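(* Let $(M,\mathcal{O})$ be a formal manifold, let $\mathcal{F}$ be a sheaf of $\mathcal{O}$-modules, and let $E$ be a quasi-complete LCS. Then the presheaf $$\mathrm{C}^{-\infty}(\mathcal{F};E):\ U\mapsto\mathrm{C}^{-\infty}(U;\mathcal{F};E)\qquad(U\subset M\text{ open})$$ is a sheaf on $M$.
   Context: Formal manifolds. For a smooth manifold $N$ and $k\in\mathbb{N}$, $N^{(k)}$ is the locally ringed space $(N,\mathcal{O}_N^{(k)})$ over $\mathrm{Spec}(\mathbb{C})$ with $\mathcal{O}_N^{(k)}(U)=\mathrm{C}^\infty(U)[[y_1,\dots,y_k]]$ (complex-valued smooth functions). A formal manifold is a locally ringed space $(M,\mathcal{O})$ over $\mathrm{Spec}(\mathbb{C})$ with $M$ paracompact Hausdorff such that every point has an open neighborhood $U$ with $(U,\mathcal{O}|_U)\cong(\mathbb{R}^n)^{(k)}$ for some $n,k\in\mathbb{N}$. For $f\in\mathcal{O}(U)$, $f(a)\in\mathbb{C}$ is the residue of the germ of $f$ at $a$. The reduction is the smooth manifold $\underline{M}=(M,\underline{\mathcal{O}})$, where $\underline{\mathcal{O}}$ is the quotient of $\mathcal{O}$ by the ideal sheaf of sections $f$ with $f(a)=0$ for all $a$. $\underline{\mathcal{D}}$ is the sheaf of complex-valued smooth densities on $\underline{M}$, an $\mathcal{O}$-module via $\mathcal{O}\to\underline{\mathcal{O}}$. LCS. An LCS is a locally convex topological vector space over $\mathbb{C}$, possibly non-Hausdorff; (quasi-)complete LCS are by convention Hausdorff. $\mathcal{L}_b(X,Y)$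 is the space of continuous linear maps with the strong topology. Inductive limits are in the category of LCS. Differential operators. For sheaves $\mathcal{F}_1,\mathcal{F}_2$ of $\mathcal{O}$-modules, a $\mathbb{C}$-linear sheaf homomorphism $D:\mathcal{F}_1\to\mathcal{F}_2$ has order $\le r$ if for every open $U$ and $f_0,\dots,f_r\in\mathcal{O}(U)$, $[\cdots[[D|_U,f_0],f_1],\dots,f_r]=0$, where $[D,f]=D\circ f-f\circ D$. It is a differential operator if it is locally of finite order; $\mathrm{supp}\,D$ is the complement of the largest open set on which $D$ is zero. $\mathrm{Diff}_c$: differential operators with compact support; $\mathrm{Diff}_{K,r}$: those of order $\le r$ supported in the compact set $K$. Compactly supported formal densities. For $U\subset M$ open, $\mathrm{D}_c^\infty(U;\mathcal{F})$ is the image of $\rho_U:\mathrm{Diff}_c(\mathcal{F}|_U,\underline{\mathcal{D}}|_U)\to\mathrm{Hom}_{\mathbb{C}}(\mathcal{F}(U),\mathbb{C})$, $\rho_U(D)(u)=\int_U D(u)$. For $K\subset U$ compact and $r\in\mathbb{N}$, $\mathrm{Diff}_{K,r}(\mathcal{F}|_U,\underline{\mathcal{D}}|_U)$ has the topology of the seminorms $|D|_{X,u}=\sup_{a\in U}|(X(D(u)))(a)|$ ($X\in\mathrm{Diff}_c(\underline{\mathcal{D}}|_U,\underline{\mathcal{O}}|_U)$, $u\in\mathcal{F}(U)$), its image $\mathrm{D}^\infty_{K,r}(U;\mathcal{F})$ under $\rho_U$ has the quotient topology, and $\mathrm{D}_c^\infty(U;\mathcal{F})=\varinjlim_{(K,r)}\mathrm{D}^\infty_{K,r}(U;\mathcal{F})$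 has the inductive limit topology. For open $V\subset U$ the extension map $\mathrm{ext}_{U,V}:\mathrm{D}_c^\infty(V;\mathcal{F})\to\mathrm{D}_c^\infty(U;\mathcal{F})$, $\eta\mapsto(u\mapsto\eta(u|_V))$, is well defined and continuous. The presheaf. $\mathrm{C}^{-\infty}(U;\mathcal{F};E)=\mathcal{L}_b(\mathrm{D}_c^\infty(U;\mathcal{F}),E)$, with restriction maps $u\mapsto u\circ\mathrm{ext}_{U,V}$. *)

theory Defs
  imports
    "HOL-Analysis.Analysis"
    "HOL-Algebra.QuotRing"
    "HOL-Algebra.Module"
    "Jordan_Normal_Form.Determinant"
begin

section \<open>Sheaves on a topological space\<close>

text \<open>
  A presheaf carries its base space. The sections over an open set form the carrier of an
  algebraic structure (of type \<open>'c\<close>); \<open>res P U V\<close> is the restriction from \<open>U\<close> to \<open>V\<close>.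
  Values at sets that are not open are irrelevant. A ringed space is represented by its
  structure sheaf.
\<close>

record ('m, 'c, 's) presheaf =
  base :: "'m topology"
  sect :: "'m set \<Rightarrow> 'c"
  res :: "'m set \<Rightarrow> 'm set \<Rightarrow> 's \<Rightarrow> 's"

type_synonym ('m, 's) ringed_space = "('m, (complex, 's) module, 's) presheaf"
type_synonym ('m, 's, 'f) module_presheaf = "('m, ('s, 'f) module, 'f) presheaf"

definition is_presheaf :: "('m, ('s, 'z) partial_object_scheme, 's) presheaf \<Rightarrow> bool" where
  "is_presheaf P \<longleftrightarrow>
     (\<forall>U V. openin (base P) U \<and> openin (base P) V \<and> V \<subseteq> U \<longrightarrow>
        res P U V \<in> carrier (sect P U) \<rightarrow> carrier (sect P V)) \<and>
     (\<forall>U. openin (base P) U \<longrightarrow> (\<forall>s \<in> carrier (sect P U). res P U U s = s)) \<and>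
     (\<forall>U V W. openin (base P) U \<and> openin (base P) V \<and> openin (base P) W \<and> W \<subseteq> V \<and> V \<subseteq> U \<longrightarrow>
        (\<forall>s \<in> carrier (sect P U). res P V W (res P U V s) = res P U W s))"

definition is_sheaf :: "('m, ('s, 'z) partial_object_scheme, 's) presheaf \<Rightarrow> bool" where
  "is_sheaf P \<longleftrightarrow> is_presheaf P \<and>
     (\<forall>\<U> s. (\<forall>U\<in>\<U>. openin (base P) U \<and> s U \<in> carrier (sect P U)) \<and>
            (\<forall>U\<in>\<U>. \<forall>V\<in>\<U>. res P U (U \<inter> V) (s U) = res P V (U \<inter> V) (s V)) \<longrightarrow>
        (\<exists>!t. t \<in> carrier (sect P (\<Union>\<U>)) \<and> (\<forall>U\<in>\<U>. res P (\<Union>\<U>) U t = s U)))"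

definition restr :: "('m, 'c, 's) presheaf \<Rightarrow> 'm set \<Rightarrow> ('m, 'c, 's) presheaf" where
  "restr P U = P\<lparr>base := subtopology (base P) U\<rparr>"

section \<open>Locally ringed spaces over Spec(C)\<close>

definition complex_ring :: "complex ring" where
  "complex_ring = \<lparr>carrier = UNIV, mult = (*), one = 1, zero = 0, add = (+)\<rparr>"

definition germ :: "('m, 's) ringed_space \<Rightarrow> 'm \<Rightarrow> 'm set \<Rightarrow> 's \<Rightarrow> ('m set \<times> 's) set" where
  "germ A a U f =
     {(V, g). openin (base A) V \<and> a \<in> V \<and> g \<in> carrier (sect A V) \<and>
        (\<exists>W. openin (base A) W \<and> a \<in> W \<and> W \<subseteq> U \<inter> V \<and> res A U W f = res A V W g)}"

definition stalk :: "('m, 's) ringed_space \<Rightarrow> 'm \<Rightarrow> ('m set \<times> 's) set ring" where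
  "stalk A a =
     \<lparr>carrier = {germ A a U f | U f. openin (base A) U \<and> a \<in> U \<and> f \<in> carrier (sect A U)},
      mult = (\<lambda>x y. \<Union>(U, f)\<in>x. \<Union>(V, g)\<in>y.
        germ A a (U \<inter> V) (res A U (U \<inter> V) f \<otimes>\<^bsub>sect A (U \<inter> V)\<^esub> res A V (U \<inter> V) g)),
      one = germ A a (topspace (base A)) \<one>\<^bsub>sect A (topspace (base A))\<^esub>,
      zero = germ A a (topspace (base A)) \<zero>\<^bsub>sect A (topspace (base A))\<^esub>,
      add = (\<lambda>x y. \<Union>(U, f)\<in>x. \<Union>(V, g)\<in>y.
        germ A a (U \<inter> V) (res A U (U \<inter> V) f \<oplus>\<^bsub>sect A (U \<inter> V)\<^esub> res A V (U \<inter> V) g))\<rparr>"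

definition local_ring :: "('a, 'z) ring_scheme \<Rightarrow> bool" where
  "local_ring R \<longleftrightarrow> cring R \<and> (\<exists>!I. maximalideal I R)"

definition max_ideal :: "('a, 'z) ring_scheme \<Rightarrow> 'a set" where
  "max_ideal R = (THE I. maximalideal I R)"

text \<open>A morphism to Spec(C) is the same as a structure of sheaf of C-algebras.\<close>

definition locally_ringed_space :: "('m, 's) ringed_space \<Rightarrow> bool" where
  "locally_ringed_space A \<longleftrightarrow> is_sheaf A \<and>
     (\<forall>U. openin (base A) U \<longrightarrow> Module.algebra complex_ring (sect A U)) \<and>
     (\<forall>U V. openin (base A) U \<and> openin (base A) V \<and> V \<subseteq> U \<longrightarrow>
        res A U V \<in> Ring.ring_hom (sect A U) (sect A V) \<and>
        (\<forall>c. \<forall>f \<in> carrier (sect A U).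
           res A U V (c \<odot>\<^bsub>sect A U\<^esub> f) = c \<odot>\<^bsub>sect A V\<^esub> res A U V f)) \<and>
     (\<forall>a \<in> topspace (base A). local_ring (stalk A a))"

text \<open>Locality of the maps on stalks is automatic for isomorphisms.\<close>

definition lrs_isomorphic :: "('m, 's) ringed_space \<Rightarrow> ('n, 't) ringed_space \<Rightarrow> bool" where
  "lrs_isomorphic A B \<longleftrightarrow>
     (\<exists>\<phi> \<theta>. homeomorphic_map (base A) (base B) \<phi> \<and>
        (\<forall>V. openin (base B) V \<longrightarrow>
           (let U = {a \<in> topspace (base A). \<phi> a \<in> V} in
              \<theta> V \<in> ring_iso (sect B V) (sect A U) \<and>
              (\<forall>c. \<forall>f \<in> carrier (sect B V).
                 \<theta> V (c \<odot>\<^bsub>sect B V\<^esub> f) = c \<odot>\<^bsub>sect A U\<^esub> \<theta> V f))) \<and>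
        (\<forall>V W. openin (base B) V \<and> openin (base B) W \<and> W \<subseteq> V \<longrightarrow>
           (\<forall>f \<in> carrier (sect B V).
              \<theta> W (res B V W f) =
              res A {a \<in> topspace (base A). \<phi> a \<in> V} {a \<in> topspace (base A). \<phi> a \<in> W} (\<theta> V f))))"

text \<open>
  \<open>val A U f a\<close> is the residue \<open>f(a)\<close>: the complex number \<open>c\<close> whose image in the residue field of
  the stalk at \<open>a\<close> is the class of the germ of \<open>f\<close>. On a formal manifold the residue fields are C.
\<close>

definition val :: "('m, 's) ringed_space \<Rightarrow> 'm set \<Rightarrow> 's \<Rightarrow> 'm \<Rightarrow> complex" where
  "val A U f a =
     (THE c. germ A a U (f \<ominus>\<^bsub>sect A U\<^esub> (c \<odot>\<^bsub>sect A U\<^esub> \<one>\<^bsub>sect A U\<^esub>)) \<in> max_ideal (stalk A a))"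

section \<open>Formal manifolds\<close>

text \<open>Smooth functions on open subsets of \<open>Euclidean_space n\<close>, by iterated partial derivatives.\<close>

definition partial_d :: "nat \<Rightarrow> ((nat \<Rightarrow> real) \<Rightarrow> 'a::real_normed_vector) \<Rightarrow> (nat \<Rightarrow> real) \<Rightarrow> 'a" where
  "partial_d i f x = vector_derivative (\<lambda>t. f (x(i := t))) (at (x i))"

primrec Ck_on :: "nat \<Rightarrow> nat \<Rightarrow> (nat \<Rightarrow> real) set \<Rightarrow> ((nat \<Rightarrow> real) \<Rightarrow> complex) \<Rightarrow> bool" where
  "Ck_on n 0 S f \<longleftrightarrow> continuous_map (subtopology (Euclidean_space n) S) euclidean f"
| "Ck_on n (Suc k) S f \<longleftrightarrow>
     continuous_map (subtopology (Euclidean_space n) S) euclidean f \<and>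
     (\<forall>i<n. (\<forall>x\<in>S. (\<lambda>t. f (x(i := t))) differentiable (at (x i))) \<and>
            Ck_on n k S (partial_d i f))"

definition smooth_on :: "nat \<Rightarrow> (nat \<Rightarrow> real) set \<Rightarrow> ((nat \<Rightarrow> real) \<Rightarrow> complex) \<Rightarrow> bool" where
  "smooth_on n S f \<longleftrightarrow> (\<forall>k. Ck_on n k S f)"

text \<open>
  The space \<open>(R\<^sup>n)\<^sup>(\<^sup>k\<^sup>)\<close>. The power series \<open>\<Sum>\<alpha>. f\<^sub>\<alpha> y\<^sup>\<alpha>\<close> over \<open>U\<close> in \<open>y\<^sub>0, \<dots>, y\<^sub>k\<^sub>-\<^sub>1\<close> is the function
  \<open>\<lambda>\<alpha> x. f\<^sub>\<alpha> x\<close>, extended by 0 to points outside \<open>U\<close> and to exponents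
  \<open>\<alpha> :: nat \<Rightarrow> nat\<close> not supported in \<open>{..<k}\<close>.
\<close>

definition formal_functions ::
  "nat \<Rightarrow> nat \<Rightarrow> (nat \<Rightarrow> real) set \<Rightarrow> (complex, (nat \<Rightarrow> nat) \<Rightarrow> (nat \<Rightarrow> real) \<Rightarrow> complex) module" where
  "formal_functions n k U =
     \<lparr>carrier = {f. (\<forall>\<alpha>. smooth_on n U (f \<alpha>)) \<and>
                    (\<forall>\<alpha> x. x \<notin> U \<or> (\<exists>i\<ge>k. \<alpha> i \<noteq> 0) \<longrightarrow> f \<alpha> x = 0)},
      mult = (\<lambda>f g \<alpha> x. \<Sum>\<beta> | \<forall>i. \<beta> i \<le> \<alpha> i. f \<beta> x * g (\<lambda>i. \<alpha> i - \<beta> i) x),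
      one = (\<lambda>\<alpha> x. if x \<in> U \<and> \<alpha> = (\<lambda>_. 0) then 1 else 0),
      zero = (\<lambda>\<alpha> x. 0),
      add = (\<lambda>f g \<alpha> x. f \<alpha> x + g \<alpha> x),
      smult = (\<lambda>c f \<alpha> x. c * f \<alpha> x)\<rparr>"

definition formal_Euclidean_space ::
  "nat \<Rightarrow> nat \<Rightarrow> (nat \<Rightarrow> real, (nat \<Rightarrow> nat) \<Rightarrow> (nat \<Rightarrow> real) \<Rightarrow> complex) ringed_space" where
  "formal_Euclidean_space n k =
     \<lparr>base = Euclidean_space n,
      sect = formal_functions n k,
      res = (\<lambda>U V f \<alpha> x. if x \<in> V then f \<alpha> x else 0)\<rparr>"

definition paracompact_in :: "'m topology \<Rightarrow> bool" where
  "paracompact_in X \<longleftrightarrow>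
     (\<forall>\<U>. (\<forall>U\<in>\<U>. openin X U) \<and> \<Union>\<U> = topspace X \<longrightarrow>
        (\<exists>\<V>. (\<forall>V\<in>\<V>. openin X V \<and> (\<exists>U\<in>\<U>. V \<subseteq> U)) \<and> \<Union>\<V> = topspace X \<and> locally_finite_in X \<V>))"

definition formal_manifold :: "('m, 's) ringed_space \<Rightarrow> bool" where
  "formal_manifold A \<longleftrightarrow> locally_ringed_space A \<and>
     paracompact_in (base A) \<and> Hausdorff_space (base A) \<and>
     (\<forall>a \<in> topspace (base A). \<exists>U n k. openin (base A) U \<and> a \<in> U \<and>
        lrs_isomorphic (restr A U) (formal_Euclidean_space n k))"

section \<open>Sheaves of modules\<close>

text \<open>The fields \<open>mult\<close> and \<open>one\<close> of the modules of sections play no role.\<close>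

definition sheaf_of_modules :: "('m, 's) ringed_space \<Rightarrow> ('m, 's, 'f) module_presheaf \<Rightarrow> bool" where
  "sheaf_of_modules A F \<longleftrightarrow> base F = base A \<and> is_sheaf F \<and>
     (\<forall>U. openin (base A) U \<longrightarrow> Module.module (sect A U) (sect F U)) \<and>
     (\<forall>U V. openin (base A) U \<and> openin (base A) V \<and> V \<subseteq> U \<longrightarrow>
        (\<forall>s \<in> carrier (sect F U). \<forall>t \<in> carrier (sect F U).
           res F U V (s \<oplus>\<^bsub>sect F U\<^esub> t) = res F U V s \<oplus>\<^bsub>sect F V\<^esub> res F U V t) \<and>
        (\<forall>f \<in> carrier (sect A U). \<forall>s \<in> carrier (sect F U).
           res F U V (f \<odot>\<^bsub>sect F U\<^esub> s) = res A U V f \<odot>\<^bsub>sect F V\<^esub> res F U V s))"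

definition cscale ::
  "('m, 's) ringed_space \<Rightarrow> ('m, 's, 'f) module_presheaf \<Rightarrow> 'm set \<Rightarrow> complex \<Rightarrow> 'f \<Rightarrow> 'f" where
  "cscale A F U c s = (c \<odot>\<^bsub>sect A U\<^esub> \<one>\<^bsub>sect A U\<^esub>) \<odot>\<^bsub>sect F U\<^esub> s"

section \<open>The reduction and its densities\<close>

text \<open>
  Sections of the quotient of \<open>A\<close> by the ideal sheaf of the \<open>f\<close> with \<open>f(a) = 0\<close> for all \<open>a\<close>.
  This ideal sheaf is the kernel of \<open>f \<mapsto> (a \<mapsto> f(a))\<close>, so the quotient presheaf consists of the
  functions \<open>a \<mapsto> f(a)\<close>, and its sheafification of the functions that are locally of this
  form. They are extended by 0 outside \<open>U\<close>.
\<close>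

definition red_functions :: "('m, 's) ringed_space \<Rightarrow> 'm set \<Rightarrow> ('m \<Rightarrow> complex) set" where
  "red_functions A U =
     {g. (\<forall>a. a \<notin> U \<longrightarrow> g a = 0) \<and>
         (\<forall>a\<in>U. \<exists>V f. openin (base A) V \<and> a \<in> V \<and> V \<subseteq> U \<and> f \<in> carrier (sect A V) \<and>
            (\<forall>b\<in>V. g b = val A V f b))}"

definition reduction :: "('m, 's) ringed_space \<Rightarrow> ('m, 's, 'm \<Rightarrow> complex) module_presheaf" where
  "reduction A =
     \<lparr>base = base A,
      sect = (\<lambda>U. \<lparr>carrier = red_functions A U,
                   mult = (\<lambda>g h a. g a * h a),
                   one = (\<lambda>a. if a \<in> U then 1 else 0),
                   zero = (\<lambda>a. 0),
                   add = (\<lambda>g h a. g a + h a),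
                   smult = (\<lambda>f g a. if a \<in> U then val A U f a * g a else 0)\<rparr>),
      res = (\<lambda>U V g a. if a \<in> V then g a else 0)\<rparr>"

text \<open>A chart \<open>(U, n, \<phi>)\<close> of the smooth manifold underlying the reduction.\<close>

type_synonym 'm chart = "'m set \<times> nat \<times> ('m \<Rightarrow> nat \<Rightarrow> real)"

definition charts :: "('m, 's) ringed_space \<Rightarrow> 'm chart set" where
  "charts A =
     {(U, n, \<phi>). openin (base A) U \<and> openin (Euclidean_space n) (\<phi> ` U) \<and>
        homeomorphic_map (subtopology (base A) U) (subtopology (Euclidean_space n) (\<phi> ` U)) \<phi> \<and>
        (\<forall>V g. openin (base A) V \<and> V \<subseteq> U \<and> (\<forall>a. a \<notin> V \<longrightarrow> g a = 0) \<longrightarrow>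
           (g \<in> red_functions A V \<longleftrightarrow> smooth_on n (\<phi> ` V) (\<lambda>x. g (inv_into U \<phi> x))))}"

abbreviation chart_dom :: "'m chart \<Rightarrow> 'm set" where
  "chart_dom \<equiv> fst"

text \<open>The determinant at \<open>a\<close> of the Jacobian matrix of the transition map \<open>\<psi> \<circ> \<phi>\<^sup>-\<^sup>1\<close>.\<close>

fun transition_det :: "'m chart \<Rightarrow> 'm chart \<Rightarrow> 'm \<Rightarrow> real" where
  "transition_det (U, n, \<phi>) (V, m, \<psi>) a =
     Determinant.det (Matrix.mat n n (\<lambda>(i, j). partial_d j (\<lambda>x. \<psi> (inv_into U \<phi> x) i) (\<phi> a)))"

text \<open>
  A complex-valued smooth density over \<open>W\<close> is given by its coefficients \<open>\<omega> c\<close> with respect to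
  \<open>\<bar>dx\<^sub>1 \<dots> dx\<^sub>n\<bar>\<close> in all charts \<open>c\<close>. These are viewed as functions on the manifold, extended by 0
  outside \<open>chart_dom c \<inter> W\<close>.
\<close>

definition density_sections :: "('m, 's) ringed_space \<Rightarrow> 'm set \<Rightarrow> ('m chart \<Rightarrow> 'm \<Rightarrow> complex) set" where
  "density_sections A W =
     {\<omega>. (\<forall>c. c \<notin> charts A \<longrightarrow> \<omega> c = (\<lambda>a. 0)) \<and>
         (\<forall>c \<in> charts A. \<omega> c \<in> red_functions A (chart_dom c \<inter> W)) \<and>
         (\<forall>c \<in> charts A. \<forall>c' \<in> charts A. \<forall>a \<in> chart_dom c \<inter> chart_dom c' \<inter> W.
            \<omega> c a = complex_of_real \<bar>transition_det c c' a\<bar> * \<omega> c' a)}"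

definition densities ::
  "('m, 's) ringed_space \<Rightarrow> ('m, 's, 'm chart \<Rightarrow> 'm \<Rightarrow> complex) module_presheaf" where
  "densities A =
     \<lparr>base = base A,
      sect = (\<lambda>U. \<lparr>carrier = density_sections A U,
                   mult = undefined,
                   one = undefined,
                   zero = (\<lambda>c a. 0),
                   add = (\<lambda>\<omega> \<eta> c a. \<omega> c a + \<eta> c a),
                   smult = (\<lambda>f \<omega> c a. if a \<in> U then val A U f a * \<omega> c a else 0)\<rparr>),
      res = (\<lambda>U V \<omega> c a. if a \<in> V then \<omega> c a else 0)\<rparr>"

text \<open>
  Smooth partitions of unity subordinate to the charts: every function \<open>\<rho>\<close> comes with a chart
  whose domain contains its support.
\<close>

definition partition_of_unity ::
  "('m, 's) ringed_space \<Rightarrow> (('m \<Rightarrow> complex) \<times> 'm chart) set \<Rightarrow> bool" where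
  "partition_of_unity A P \<longleftrightarrow>
     (\<forall>(\<rho>, c) \<in> P. \<rho> \<in> red_functions A (topspace (base A)) \<and> c \<in> charts A \<and> range \<rho> \<subseteq> \<real>\<^sub>\<ge>\<^sub>0 \<and>
        base A closure_of {a. \<rho> a \<noteq> 0} \<subseteq> chart_dom c) \<and>
     (\<forall>a \<in> topspace (base A). \<exists>V. openin (base A) V \<and> a \<in> V \<and>
        finite {(\<rho>, c) \<in> P. \<exists>b\<in>V. \<rho> b \<noteq> 0}) \<and>
     (\<forall>a \<in> topspace (base A). (\<Sum>(\<rho>, c) | (\<rho>, c) \<in> P \<and> \<rho> a \<noteq> 0. \<rho> a) = 1)"

text \<open>
  Integral of a function \<open>g\<close> on the domain of the chart \<open>(U, n, \<phi>)\<close> with respect to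
  \<open>\<bar>dx\<^sub>1 \<dots> dx\<^sub>n\<bar>\<close>. Points of the product space \<open>\<Pi>\<^sub>M i\<in>{..<n}. lborel\<close> are \<open>undefined\<close> beyond \<open>n\<close>, points
  of \<open>Euclidean_space n\<close> are 0 there.
\<close>

fun chart_integral :: "'m chart \<Rightarrow> ('m \<Rightarrow> complex) \<Rightarrow> complex" where
  "chart_integral (U, n, \<phi>) g =
     (LINT x | (\<Pi>\<^sub>M i\<in>{..<n}. lborel).
        (let z = (\<lambda>i. if i < n then x i else 0)
         in if z \<in> \<phi> ` U then g (inv_into U \<phi> z) else 0))"

text \<open>
  The integral of a compactly supported density \<open>\<omega>\<close>, computed with some partition of unity;
  the value does not depend on the choice. Restricted to an open \<open>U\<close>, the chosen partition of
  unity is one of \<open>U\<close>. Since sections over \<open>U\<close> are extended by 0, the same formula is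
  the integral over \<open>U\<close> of a compactly supported density on \<open>U\<close>. By local finiteness
  the sum is finite.
\<close>

definition density_integral :: "('m, 's) ringed_space \<Rightarrow> ('m chart \<Rightarrow> 'm \<Rightarrow> complex) \<Rightarrow> complex" where
  "density_integral A \<omega> =
     (let P = (SOME P. partition_of_unity A P)
      in \<Sum>(\<rho>, c) | (\<rho>, c) \<in> P \<and> (\<exists>a. \<rho> a * \<omega> c a \<noteq> 0). chart_integral c (\<lambda>a. \<rho> a * \<omega> c a))"

section \<open>Differential operators\<close>

text \<open>
  C-linear sheaf homomorphisms. They are made extensional, so that equality of
  homomorphisms is equality of functions.
\<close>

definition sheaf_homs ::
  "('m, 's) ringed_space \<Rightarrow> ('m, 's, 'f) module_presheaf \<Rightarrow> ('m, 's, 'g) module_presheaf \<Rightarrow>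
   ('m set \<Rightarrow> 'f \<Rightarrow> 'g) set" where
  "sheaf_homs A F G =
     {D \<in> extensional {U. openin (base A) U}.
        (\<forall>U. openin (base A) U \<longrightarrow>
           D U \<in> carrier (sect F U) \<rightarrow>\<^sub>E carrier (sect G U) \<and>
           (\<forall>s \<in> carrier (sect F U). \<forall>t \<in> carrier (sect F U).
              D U (s \<oplus>\<^bsub>sect F U\<^esub> t) = D U s \<oplus>\<^bsub>sect G U\<^esub> D U t) \<and>
           (\<forall>c. \<forall>s \<in> carrier (sect F U). D U (cscale A F U c s) = cscale A G U c (D U s))) \<and>
        (\<forall>U V. openin (base A) U \<and> openin (base A) V \<and> V \<subseteq> U \<longrightarrow>
           (\<forall>s \<in> carrier (sect F U). D V (res F U V s) = res G U V (D U s)))}"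

text \<open>\<open>D|\<^sub>U \<mapsto> [D|\<^sub>U, f]\<close> for a section \<open>f\<close> over \<open>U\<close>; only the values at open \<open>V \<subseteq> U\<close> matter.\<close>

definition commutator ::
  "('m, 's) ringed_space \<Rightarrow> ('m, 's, 'f) module_presheaf \<Rightarrow> ('m, 's, 'g) module_presheaf \<Rightarrow>
   'm set \<Rightarrow> 's \<Rightarrow> ('m set \<Rightarrow> 'f \<Rightarrow> 'g) \<Rightarrow> ('m set \<Rightarrow> 'f \<Rightarrow> 'g)" where
  "commutator A F G U f D =
     (\<lambda>V s. D V (res A U V f \<odot>\<^bsub>sect F V\<^esub> s) \<ominus>\<^bsub>sect G V\<^esub> (res A U V f \<odot>\<^bsub>sect G V\<^esub> D V s))"

definition zero_on ::
  "('m, 's, 'f) module_presheaf \<Rightarrow> ('m, 's, 'g) module_presheaf \<Rightarrow> 'm set \<Rightarrow>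
   ('m set \<Rightarrow> 'f \<Rightarrow> 'g) \<Rightarrow> bool" where
  "zero_on F G U D \<longleftrightarrow>
     (\<forall>V. openin (base F) V \<and> V \<subseteq> U \<longrightarrow> (\<forall>s \<in> carrier (sect F V). D V s = \<zero>\<^bsub>sect G V\<^esub>))"

definition order_le ::
  "('m, 's) ringed_space \<Rightarrow> ('m, 's, 'f) module_presheaf \<Rightarrow> ('m, 's, 'g) module_presheaf \<Rightarrow>
   nat \<Rightarrow> ('m set \<Rightarrow> 'f \<Rightarrow> 'g) \<Rightarrow> bool" where
  "order_le A F G r D \<longleftrightarrow>
     (\<forall>U. openin (base A) U \<longrightarrow>
        (\<forall>fs. length fs = Suc r \<and> set fs \<subseteq> carrier (sect A U) \<longrightarrow>
           zero_on F G U (fold (commutator A F G U) fs D)))"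

definition diff_ops ::
  "('m, 's) ringed_space \<Rightarrow> ('m, 's, 'f) module_presheaf \<Rightarrow> ('m, 's, 'g) module_presheaf \<Rightarrow>
   ('m set \<Rightarrow> 'f \<Rightarrow> 'g) set" where
  "diff_ops A F G =
     {D \<in> sheaf_homs A F G. \<forall>a \<in> topspace (base A). \<exists>U r. openin (base A) U \<and> a \<in> U \<and>
        order_le (restr A U) (restr F U) (restr G U) r D}"

definition op_support ::
  "('m, 's, 'f) module_presheaf \<Rightarrow> ('m, 's, 'g) module_presheaf \<Rightarrow> ('m set \<Rightarrow> 'f \<Rightarrow> 'g) \<Rightarrow> 'm set" where
  "op_support F G D = topspace (base F) - \<Union>{U. openin (base F) U \<and> zero_on F G U D}"

definition Diff_c ::
  "('m, 's) ringed_space \<Rightarrow> ('m, 's, 'f) module_presheaf \<Rightarrow> ('m, 's, 'g) module_presheaf \<Rightarrow>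
   ('m set \<Rightarrow> 'f \<Rightarrow> 'g) set" where
  "Diff_c A F G = {D \<in> diff_ops A F G. compactin (base A) (op_support F G D)}"

definition Diff_KR ::
  "('m, 's) ringed_space \<Rightarrow> ('m, 's, 'f) module_presheaf \<Rightarrow> ('m, 's, 'g) module_presheaf \<Rightarrow>
   'm set \<Rightarrow> nat \<Rightarrow> ('m set \<Rightarrow> 'f \<Rightarrow> 'g) set" where
  "Diff_KR A F G K r = {D \<in> sheaf_homs A F G. order_le A F G r D \<and> op_support F G D \<subseteq> K}"

section \<open>Locally convex spaces\<close>

text \<open>Complex vector spaces with a topology; again \<open>mult\<close> and \<open>one\<close> play no role.\<close>

record 'v tvs = "(complex, 'v) module" +
  vtop :: "'v topology"

definition lcs :: "'v tvs \<Rightarrow> bool" where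
  "lcs V \<longleftrightarrow> Module.module complex_ring V \<and> topspace (vtop V) = carrier V \<and>
     continuous_map (prod_topology (vtop V) (vtop V)) (vtop V) (\<lambda>(x, y). x \<oplus>\<^bsub>V\<^esub> y) \<and>
     continuous_map (prod_topology euclidean (vtop V)) (vtop V) (\<lambda>(c, x). c \<odot>\<^bsub>V\<^esub> x) \<and>
     (\<forall>W. openin (vtop V) W \<and> \<zero>\<^bsub>V\<^esub> \<in> W \<longrightarrow>
        (\<exists>N C. openin (vtop V) N \<and> \<zero>\<^bsub>V\<^esub> \<in> N \<and> N \<subseteq> C \<and> C \<subseteq> W \<and>
           (\<forall>x\<in>C. \<forall>y\<in>C. \<forall>t\<in>{0..1}.
              (complex_of_real t \<odot>\<^bsub>V\<^esub> x) \<oplus>\<^bsub>V\<^esub> (complex_of_real (1 - t) \<odot>\<^bsub>V\<^esub> y) \<in> C)))"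

definition vbounded :: "'v tvs \<Rightarrow> 'v set \<Rightarrow> bool" where
  "vbounded V B \<longleftrightarrow> B \<subseteq> carrier V \<and>
     (\<forall>W. openin (vtop V) W \<and> \<zero>\<^bsub>V\<^esub> \<in> W \<longrightarrow>
        (\<exists>r>0. \<forall>c. cmod c \<ge> r \<longrightarrow> B \<subseteq> (\<lambda>w. c \<odot>\<^bsub>V\<^esub> w) ` W))"

definition vcauchy_filter :: "'v tvs \<Rightarrow> 'v filter \<Rightarrow> bool" where
  "vcauchy_filter V \<F> \<longleftrightarrow>
     (\<forall>W. openin (vtop V) W \<and> \<zero>\<^bsub>V\<^esub> \<in> W \<longrightarrow>
        (\<exists>S \<subseteq> carrier V. eventually (\<lambda>x. x \<in> S) \<F> \<and> (\<forall>x\<in>S. \<forall>y\<in>S. x \<ominus>\<^bsub>V\<^esub> y \<in> W)))"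

definition quasi_complete_lcs :: "'v tvs \<Rightarrow> bool" where
  "quasi_complete_lcs V \<longleftrightarrow> lcs V \<and> Hausdorff_space (vtop V) \<and>
     (\<forall>B. vbounded V B \<and> closedin (vtop V) B \<longrightarrow>
        (\<forall>\<F>. \<F> \<noteq> bot \<and> eventually (\<lambda>x. x \<in> B) \<F> \<and> vcauchy_filter V \<F> \<longrightarrow>
           (\<exists>l\<in>B. limitin (vtop V) (\<lambda>x. x) l \<F>)))"

definition clinear_maps :: "'v tvs \<Rightarrow> 'w tvs \<Rightarrow> ('v \<Rightarrow> 'w) set" where
  "clinear_maps V W =
     {u \<in> carrier V \<rightarrow>\<^sub>E carrier W. continuous_map (vtop V) (vtop W) u \<and>
        (\<forall>x \<in> carrier V. \<forall>y \<in> carrier V. u (x \<oplus>\<^bsub>V\<^esub> y) = u x \<oplus>\<^bsub>W\<^esub> u y) \<and>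
        (\<forall>c. \<forall>x \<in> carrier V. u (c \<odot>\<^bsub>V\<^esub> x) = c \<odot>\<^bsub>W\<^esub> u x)}"

text \<open>
  Continuous linear maps with the strong topology: the sets
  \<open>{v. \<forall>x\<in>B. v x - u x \<in> N}\<close>, with \<open>B\<close> bounded and \<open>N\<close> an open
  neighbourhood of 0, are a neighbourhood base at \<open>u\<close>.
\<close>

definition Lb :: "'v tvs \<Rightarrow> 'w tvs \<Rightarrow> ('v \<Rightarrow> 'w) tvs" where
  "Lb V W =
     \<lparr>carrier = clinear_maps V W,
      mult = undefined,
      one = undefined,
      zero = (\<lambda>x\<in>carrier V. \<zero>\<^bsub>W\<^esub>),
      add = (\<lambda>u v. \<lambda>x\<in>carrier V. u x \<oplus>\<^bsub>W\<^esub> v x),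
      smult = (\<lambda>c u. \<lambda>x\<in>carrier V. c \<odot>\<^bsub>W\<^esub> u x),
      vtop = topology (\<lambda>S. S \<subseteq> clinear_maps V W \<and>
        (\<forall>u\<in>S. \<exists>B N. vbounded V B \<and> openin (vtop W) N \<and> \<zero>\<^bsub>W\<^esub> \<in> N \<and>
           {v \<in> clinear_maps V W. \<forall>x\<in>B. v x \<ominus>\<^bsub>W\<^esub> u x \<in> N} \<subseteq> S))\<rparr>"

text \<open>
  Topology of the inductive limit in the category of LCS, for subspaces with topologies \<open>\<T>\<close>
  whose union is \<open>V\<close>: the finest locally convex topology on \<open>V\<close> for which all inclusions are
  continuous, that is, the supremum of all such topologies. The given topology of \<open>V\<close> is ignored.
\<close>

definition inductive_limit_topology :: "'v tvs \<Rightarrow> 'v topology set \<Rightarrow> 'v topology" where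
  "inductive_limit_topology V \<T> =
     topology_generated_by
       {S. \<exists>T. lcs (V\<lparr>vtop := T\<rparr>) \<and> (\<forall>Y\<in>\<T>. continuous_map Y T (\<lambda>x. x)) \<and> openin T S}"

definition quotient_topology :: "'a topology \<Rightarrow> ('a \<Rightarrow> 'b) \<Rightarrow> 'b topology" where
  "quotient_topology X f =
     topology (\<lambda>S. S \<subseteq> f ` topspace X \<and> openin X {x \<in> topspace X. f x \<in> S})"

definition presheaf_of_lcs :: "('m, 'v tvs, 'v) presheaf \<Rightarrow> bool" where
  "presheaf_of_lcs P \<longleftrightarrow> is_presheaf P \<and>
     (\<forall>U. openin (base P) U \<longrightarrow> lcs (sect P U)) \<and>
     (\<forall>U V. openin (base P) U \<and> openin (base P) V \<and> V \<subseteq> U \<longrightarrow>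
        restrict (res P U V) (carrier (sect P U)) \<in> clinear_maps (sect P U) (sect P V))"

section \<open>Compactly supported formal densities and formal generalized functions\<close>

text \<open>Elements of \<open>Hom\<^sub>C(F(U), C)\<close> are represented as extensional functions on \<open>F(U)\<close>.\<close>

definition rho ::
  "('m, 's) ringed_space \<Rightarrow> ('m, 's, 'f) module_presheaf \<Rightarrow> 'm set \<Rightarrow>
   ('m set \<Rightarrow> 'f \<Rightarrow> 'm chart \<Rightarrow> 'm \<Rightarrow> complex) \<Rightarrow> 'f \<Rightarrow> complex" where
  "rho A F U D = (\<lambda>u \<in> carrier (sect F U). density_integral A (D U u))"

text \<open>\<open>sup |(X(D(u)))(a)|\<close> over \<open>a\<close> in \<open>U\<close>; inserting 0 only matters for empty \<open>U\<close>.\<close>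

definition diff_seminorm ::
  "'m set \<Rightarrow> ('m set \<Rightarrow> ('m chart \<Rightarrow> 'm \<Rightarrow> complex) \<Rightarrow> 'm \<Rightarrow> complex) \<Rightarrow> 'f \<Rightarrow>
   ('m set \<Rightarrow> 'f \<Rightarrow> 'm chart \<Rightarrow> 'm \<Rightarrow> complex) \<Rightarrow> real" where
  "diff_seminorm U X u D = Sup (insert 0 {cmod (X U (D U u) a) | a. a \<in> U})"

definition hom_minus ::
  "('m, 's, 'g) module_presheaf \<Rightarrow> ('m set \<Rightarrow> 'f \<Rightarrow> 'g) \<Rightarrow> ('m set \<Rightarrow> 'f \<Rightarrow> 'g) \<Rightarrow>
   ('m set \<Rightarrow> 'f \<Rightarrow> 'g)" where
  "hom_minus G D D' = (\<lambda>V s. D V s \<ominus>\<^bsub>sect G V\<^esub> D' V s)"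

definition Diff_KR_topology ::
  "('m, 's) ringed_space \<Rightarrow> ('m, 's, 'f) module_presheaf \<Rightarrow> 'm set \<Rightarrow> 'm set \<Rightarrow> nat \<Rightarrow>
   ('m set \<Rightarrow> 'f \<Rightarrow> 'm chart \<Rightarrow> 'm \<Rightarrow> complex) topology" where
  "Diff_KR_topology A F U K r =
     (let \<D> = Diff_KR (restr A U) (restr F U) (restr (densities A) U) K r in
      topology_generated_by
        {{D' \<in> \<D>. diff_seminorm U X u (hom_minus (densities A) D' D) < \<epsilon>} | D X u \<epsilon>.
           D \<in> \<D> \<and> X \<in> Diff_c (restr A U) (restr (densities A) U) (restr (reduction A) U) \<and>
           u \<in> carrier (sect F U) \<and> \<epsilon> > 0})"

definition D_KR_topology ::
  "('m, 's) ringed_space \<Rightarrow> ('m, 's, 'f) module_presheaf \<Rightarrow> 'm set \<Rightarrow> 'm set \<Rightarrow> nat \<Rightarrow>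
   ('f \<Rightarrow> complex) topology" where
  "D_KR_topology A F U K r = quotient_topology (Diff_KR_topology A F U K r) (rho A F U)"

definition D_c_space ::
  "('m, 's) ringed_space \<Rightarrow> ('m, 's, 'f) module_presheaf \<Rightarrow> 'm set \<Rightarrow> ('f \<Rightarrow> complex) tvs" where
  "D_c_space A F U =
     \<lparr>carrier = rho A F U ` Diff_c (restr A U) (restr F U) (restr (densities A) U),
      mult = undefined,
      one = undefined,
      zero = (\<lambda>u\<in>carrier (sect F U). 0),
      add = (\<lambda>\<eta> \<theta>. \<lambda>u\<in>carrier (sect F U). \<eta> u + \<theta> u),
      smult = (\<lambda>c \<eta>. \<lambda>u\<in>carrier (sect F U). c * \<eta> u),
      vtop = trivial_topology\<rparr>"

definition D_c ::
  "('m, 's) ringed_space \<Rightarrow> ('m, 's, 'f) module_presheaf \<Rightarrow> 'm set \<Rightarrow> ('f \<Rightarrow> complex) tvs" where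
  "D_c A F U = (D_c_space A F U)\<lparr>vtop :=
     inductive_limit_topology (D_c_space A F U)
       {D_KR_topology A F U K r | K r. compactin (base A) K \<and> K \<subseteq> U}\<rparr>"

definition extension ::
  "('m, 's, 'f) module_presheaf \<Rightarrow> 'm set \<Rightarrow> 'm set \<Rightarrow> ('f \<Rightarrow> complex) \<Rightarrow> ('f \<Rightarrow> complex)" where
  "extension F U V \<eta> = (\<lambda>u\<in>carrier (sect F U). \<eta> (res F U V u))"

definition generalized_functions ::
  "('m, 's) ringed_space \<Rightarrow> ('m, 's, 'f) module_presheaf \<Rightarrow> 'e tvs \<Rightarrow>
   ('m, (('f \<Rightarrow> complex) \<Rightarrow> 'e) tvs, ('f \<Rightarrow> complex) \<Rightarrow> 'e) presheaf" where
  "generalized_functions A F E =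
     \<lparr>base = base A,
      sect = (\<lambda>U. Lb (D_c A F U) E),
      res = (\<lambda>U V u. \<lambda>\<eta>\<in>carrier (D_c A F V). u (extension F U V \<eta>))\<rparr>"

end

theory Submission
  imports Defs
begin

text \<open>
  A section \<open>f\<close> of \<open>\<O>(U)\<close> that vanishes off a compact subset of \<open>V \<subseteq> U\<close> lets one cut a compactly
  supported formal density \<open>\<eta>\<close> on \<open>U\<close> down to \<open>V\<close>: send \<open>v \<in> \<F>(V)\<close> to \<open>\<eta>(f v)\<close>, where \<open>f v\<close> is
  extended by zero. If \<open>\<eta>\<close> comes from the operator \<open>D\<close>, its cut comes from \<open>D \<circ> f\<close>, which has no
  larger order, and the defining seminorms show that cutting is continuous.

  Cut-off sections exist because a chart lifts bump functions into \<open>\<O>\<close>. For a cover \<open>\<U>\<close> and a compact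
  set \<open>K\<close> they yield finitely many sections \<open>g\<^sub>j\<close> supported in members \<open>V\<^sub>j\<close> of \<open>\<U>\<close> with sum \<open>1\<close> near
  \<open>K\<close>. Hence \<open>\<eta>\<close> is the sum of the extensions of its cuts by the \<open>g\<^sub>j\<close>, and a glued functional has to
  send \<open>\<eta>\<close> to the sum of the values of the given local functionals at these cuts. This gives
  uniqueness; for existence, comparing two partitions by cutting with both shows that the sum does
  not depend on the choice, and it is continuous on each step of the inductive limit since there one
  partition serves all densities.
\<close>

section \<open>Gluing in sheaves\<close>

text \<open>Residues and integrals are given by descriptions: a maximal ideal of a stalk, a
  partition of unity picked by \<open>SOME\<close>. That residues are additive and multiplicative,
  so that densities form a sheaf of modules, has to be earned by identifying the residue with the
  constant coefficient in a chart. That integrals are linear needs a smooth partition of unity to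
  exist and every chart integrand to be integrable. Residues forget the formal variables, so a
  cut-off section must equal 1 and 0 as a section on the relevant open sets, not merely in its
  residues. The topologies are never computed. Each defining seminorm of a cut or extended operator
  equals one seminorm of the original operator, for another test operator and another test section.
  A linear map out of the limit is continuous because the topology pulled back along it is one of
  those whose supremum is the limit topology. The sections used for gluing come from products of
  factors 1 - f, hence from ring operations alone; no section has to be inverted.\<close>

lemma presheaf_closed:
  "is_presheaf P \<Longrightarrow> openin (base P) U \<Longrightarrow> openin (base P) V \<Longrightarrow> V \<subseteq> U \<Longrightarrow> s \<in> carrier (sect P U) \<Longrightarrow>
    res P U V s \<in> carrier (sect P V)"
proof -
  assume a: "is_presheaf P" "openin (base P) U" "openin (base P) V" "V \<subseteq> U" "s \<in> carrier (sect P U)"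
  have "res P U V \<in> carrier (sect P U) \<rightarrow> carrier (sect P V)"
    by (rule a(1)[unfolded is_presheaf_def, THEN conjunct1, rule_format]) (use a in simp)
  then show ?thesis using a(5) by (rule funcset_mem)
qed

lemma presheaf_id: "is_presheaf P \<Longrightarrow> openin (base P) U \<Longrightarrow> s \<in> carrier (sect P U) \<Longrightarrow> res P U U s = s"
  unfolding is_presheaf_def by (elim conjE) simp

lemma presheaf_trans:
  "is_presheaf P \<Longrightarrow> openin (base P) U \<Longrightarrow> openin (base P) V \<Longrightarrow> openin (base P) W \<Longrightarrow> W \<subseteq> V \<Longrightarrow> V \<subseteq> U \<Longrightarrow>
    s \<in> carrier (sect P U) \<Longrightarrow> res P V W (res P U V s) = res P U W s"
  unfolding is_presheaf_def by (elim conjE) simp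

text \<open>Both sections glue the family of restrictions of \<open>s\<close>, so the uniqueness
  half of the gluing axiom identifies them.\<close>

lemma sheaf_sep:
  assumes P: "is_sheaf P" and op: "\<And>U. U \<in> \<U> \<Longrightarrow> openin (base P) U"
    and X: "X = \<Union>\<U>" and s: "s \<in> carrier (sect P X)" and t: "t \<in> carrier (sect P X)"
    and eq: "\<And>U. U \<in> \<U> \<Longrightarrow> res P X U s = res P X U t"
  shows "s = t"
proof -
  have pre: "is_presheaf P" using P by (simp add: is_sheaf_def)
  have opX: "openin (base P) X" using X op by blast
  have cl: "res P X U s \<in> carrier (sect P U)" if "U \<in> \<U>" for U
  proof -
    have "U \<subseteq> X" using that X by auto
    then show ?thesis using presheaf_closed[OF pre opX op[OF that] _ s] by simp
  qed
  have tr: "res P U W (res P X U s) = res P X W s" if "U \<in> \<U>" "W \<subseteq> U" "openin (base P) W" for U W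
  proof -
    have "U \<subseteq> X" using that X by auto
    then show ?thesis using presheaf_trans[OF pre opX op[OF that(1)] that(3,2) _ s] by simp
  qed
  have compat: "res P U (U \<inter> V) (res P X U s) = res P V (U \<inter> V) (res P X V s)" if "U \<in> \<U>" "V \<in> \<U>" for U V
    using tr[OF that(1), of "U \<inter> V"] tr[OF that(2), of "U \<inter> V"] openin_Int[OF op op, OF that] by simp
  have "\<exists>!t. t \<in> carrier (sect P (\<Union>\<U>)) \<and> (\<forall>U\<in>\<U>. res P (\<Union>\<U>) U t = res P X U s)"
    using P[unfolded is_sheaf_def, THEN conjunct2, rule_format, of \<U> "\<lambda>U. res P X U s"] op cl compat
    by blast
  then show ?thesis using X s t eq by metis
qed

lemma sheaf_glue:
  assumes P: "is_sheaf P" and op: "\<And>U. U \<in> \<U> \<Longrightarrow> openin (base P) U"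
    and X: "X = \<Union>\<U>" and s: "\<And>U. U \<in> \<U> \<Longrightarrow> s U \<in> carrier (sect P U)"
    and eq: "\<And>U V. U \<in> \<U> \<Longrightarrow> V \<in> \<U> \<Longrightarrow> res P U (U \<inter> V) (s U) = res P V (U \<inter> V) (s V)"
  obtains t where "t \<in> carrier (sect P X)" "\<And>U. U \<in> \<U> \<Longrightarrow> res P X U t = s U"
  using P[unfolded is_sheaf_def, THEN conjunct2, rule_format, of \<U> s] op s eq X by blast

lemma sheaf_glue2:
  assumes P: "is_sheaf P" and op: "openin (base P) V" "openin (base P) W"
    and X: "X = V \<union> W" and s: "s \<in> carrier (sect P V)" "t \<in> carrier (sect P W)"
    and eq: "res P V (V \<inter> W) s = res P W (V \<inter> W) t"
  obtains u where "u \<in> carrier (sect P X)" "res P X V u = s" "res P X W u = t"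
proof -
  note thesis_I = that
  have pre: "is_presheaf P" using P by (simp add: is_sheaf_def)
  have id: "res P U U x = x" if "openin (base P) U" "x \<in> carrier (sect P U)" for U x
    using presheaf_id[OF pre that] .
  let ?s = "\<lambda>U. if U = V then s else t"
  \<comment> \<open>The family of sections is indexed by the open sets themselves, so for
    \<open>V = W\<close> the two data compete for one index; the overlap condition then forces them
    to be equal.\<close>
  have st: "s = t" if "V = W" using eq id[OF op(1) s(1)] id[OF op(1)] s that by simp
  show thesis
  proof (rule sheaf_glue[OF P, of "{V, W}" X ?s])
    show "X = \<Union>{V, W}" using X by auto
    show "res P U1 (U1 \<inter> U2) (?s U1) = res P U2 (U1 \<inter> U2) (?s U2)"
      if "U1 \<in> {V, W}" "U2 \<in> {V, W}" for U1 U2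
      using that eq st by (auto simp: Int_commute)
    show thesis if "u \<in> carrier (sect P X)" "\<And>U. U \<in> {V, W} \<Longrightarrow> res P X U u = ?s U" for u
      using that(1) that(2)[of V] that(2)[of W] st by (intro thesis_I[of u]) (simp_all split: if_splits)
  qed (use op s in auto)
qed

section \<open>Modules over the structure sheaf\<close>

locale ringed =
  fixes A :: "('m, 's) ringed_space"
  assumes lrs: "locally_ringed_space A"
begin

abbreviation Op :: "'m set \<Rightarrow> bool" where "Op \<equiv> openin (base A)"

lemma sheafA: "is_sheaf A"
  using lrs by (simp add: locally_ringed_space_def)

lemma algA: "Op U \<Longrightarrow> Module.algebra complex_ring (sect A U)"
  using lrs by (simp add: locally_ringed_space_def)

lemma cringA: "Op U \<Longrightarrow> cring (sect A U)"
  using algA algebra.M_cring by blast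

lemma res_homA: "Op U \<Longrightarrow> Op V \<Longrightarrow> V \<subseteq> U \<Longrightarrow> res A U V \<in> Ring.ring_hom (sect A U) (sect A V)"
  using lrs by (simp add: locally_ringed_space_def)

lemma resA_closed: "Op U \<Longrightarrow> Op V \<Longrightarrow> V \<subseteq> U \<Longrightarrow> f \<in> carrier (sect A U) \<Longrightarrow> res A U V f \<in> carrier (sect A V)"
  using ring_hom_closed[OF res_homA] by blast

lemma resA_mult: "Op U \<Longrightarrow> Op V \<Longrightarrow> V \<subseteq> U \<Longrightarrow> f \<in> carrier (sect A U) \<Longrightarrow> g \<in> carrier (sect A U) \<Longrightarrow>
    res A U V (f \<otimes>\<^bsub>sect A U\<^esub> g) = res A U V f \<otimes>\<^bsub>sect A V\<^esub> res A U V g"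
  using ring_hom_mult[OF res_homA] by blast

lemma resA_add: "Op U \<Longrightarrow> Op V \<Longrightarrow> V \<subseteq> U \<Longrightarrow> f \<in> carrier (sect A U) \<Longrightarrow> g \<in> carrier (sect A U) \<Longrightarrow>
    res A U V (f \<oplus>\<^bsub>sect A U\<^esub> g) = res A U V f \<oplus>\<^bsub>sect A V\<^esub> res A U V g"
  using ring_hom_add[OF res_homA] by blast

lemma resA_one: "Op U \<Longrightarrow> Op V \<Longrightarrow> V \<subseteq> U \<Longrightarrow> res A U V \<one>\<^bsub>sect A U\<^esub> = \<one>\<^bsub>sect A V\<^esub>"
  using ring_hom_one[OF res_homA] by blast

lemma resA_hom_cring: "Op U \<Longrightarrow> Op V \<Longrightarrow> V \<subseteq> U \<Longrightarrow> ring_hom_cring (sect A U) (sect A V) (res A U V)"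
  by (intro ring_hom_cring.intro ring_hom_cring_axioms.intro cringA res_homA)

lemma resA_zero: "Op U \<Longrightarrow> Op V \<Longrightarrow> V \<subseteq> U \<Longrightarrow> res A U V \<zero>\<^bsub>sect A U\<^esub> = \<zero>\<^bsub>sect A V\<^esub>"
  by (rule ring_hom_cring.hom_zero[OF resA_hom_cring])

lemma resA_minus: "Op U \<Longrightarrow> Op V \<Longrightarrow> V \<subseteq> U \<Longrightarrow> f \<in> carrier (sect A U) \<Longrightarrow> g \<in> carrier (sect A U) \<Longrightarrow>
    res A U V (f \<ominus>\<^bsub>sect A U\<^esub> g) = res A U V f \<ominus>\<^bsub>sect A V\<^esub> res A U V g"
  unfolding a_minus_def
  by (simp add: resA_add ring_hom_cring.hom_a_inv[OF resA_hom_cring] abelian_group.a_inv_closed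
      ring.is_abelian_group cring.axioms(1) cringA)

lemma resA_smult: "Op U \<Longrightarrow> Op V \<Longrightarrow> V \<subseteq> U \<Longrightarrow> f \<in> carrier (sect A U) \<Longrightarrow>
    res A U V (c \<odot>\<^bsub>sect A U\<^esub> f) = c \<odot>\<^bsub>sect A V\<^esub> res A U V f"
  using lrs by (simp add: locally_ringed_space_def)

lemma resA_id: "Op U \<Longrightarrow> f \<in> carrier (sect A U) \<Longrightarrow> res A U U f = f"
  using sheafA by (simp add: is_sheaf_def is_presheaf_def)

lemma resA_trans: "Op U \<Longrightarrow> Op V \<Longrightarrow> Op W \<Longrightarrow> V \<subseteq> U \<Longrightarrow> W \<subseteq> V \<Longrightarrow> f \<in> carrier (sect A U) \<Longrightarrow>
    res A V W (res A U V f) = res A U W f"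
  using sheafA by (simp add: is_sheaf_def is_presheaf_def)

lemma sepA: "(\<And>U. U \<in> \<U> \<Longrightarrow> Op U) \<Longrightarrow> X = \<Union>\<U> \<Longrightarrow> s \<in> carrier (sect A X) \<Longrightarrow> t \<in> carrier (sect A X) \<Longrightarrow>
    (\<And>U. U \<in> \<U> \<Longrightarrow> res A X U s = res A X U t) \<Longrightarrow> s = t"
  by (rule sheaf_sep[OF sheafA])

text \<open>The structure map from C into the algebra of sections. Complex scaling in any sheaf of
  modules is multiplication by such a section (\<open>cscale_cst\<close>), so the module laws cover
  it.\<close>

definition cst :: "'m set \<Rightarrow> complex \<Rightarrow> 's" where
  "cst U c = c \<odot>\<^bsub>sect A U\<^esub> \<one>\<^bsub>sect A U\<^esub>"

lemma cst_closed: "Op U \<Longrightarrow> cst U c \<in> carrier (sect A U)"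
  unfolding cst_def using algA[of U] cringA[of U]
  by (intro module.smult_closed[OF algebra.module]) (auto simp: complex_ring_def cring.cring_simprules)

lemma cst_one: "Op U \<Longrightarrow> cst U 1 = \<one>\<^bsub>sect A U\<^esub>"
  unfolding cst_def using module.smult_one[OF algebra.module[OF algA]] cringA[of U]
  by (auto simp: complex_ring_def cring.cring_simprules)

lemma cst_zero: "Op U \<Longrightarrow> cst U 0 = \<zero>\<^bsub>sect A U\<^esub>"
  unfolding cst_def using module.smult_l_null[OF algebra.module[OF algA]] cringA[of U]
  by (auto simp: complex_ring_def cring.cring_simprules)

lemma res_cst: "Op U \<Longrightarrow> Op V \<Longrightarrow> V \<subseteq> U \<Longrightarrow> res A U V (cst U c) = cst V c"
  unfolding cst_def by (simp add: resA_smult resA_one cringA cring.cring_simprules)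

lemma openin_restr: "Op U \<Longrightarrow> openin (subtopology (base A) U) V \<longleftrightarrow> Op V \<and> V \<subseteq> U"
  using openin_open_subtopology by blast

lemma restr_restr: "V \<subseteq> U \<Longrightarrow> restr (restr P U) V = restr P V"
  by (simp add: restr_def subtopology_subtopology Int_absorb1)

end

text \<open>The rearrangement that makes the commutator D f - f D additive, in the section as well
  as in D.\<close>

lemma (in module) minus_smult_add:
  "f \<in> carrier R \<Longrightarrow> a \<in> carrier M \<Longrightarrow> b \<in> carrier M \<Longrightarrow> c \<in> carrier M \<Longrightarrow> d \<in> carrier M \<Longrightarrow>
   (a \<oplus>\<^bsub>M\<^esub> b) \<ominus>\<^bsub>M\<^esub> (f \<odot>\<^bsub>M\<^esub> (c \<oplus>\<^bsub>M\<^esub> d)) =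
   (a \<ominus>\<^bsub>M\<^esub> (f \<odot>\<^bsub>M\<^esub> c)) \<oplus>\<^bsub>M\<^esub> (b \<ominus>\<^bsub>M\<^esub> (f \<odot>\<^bsub>M\<^esub> d))"
  by (simp add: smult_r_distr a_minus_def M.minus_add M.a_ac)

lemma (in module) smult_commute:
  "f \<in> carrier R \<Longrightarrow> g \<in> carrier R \<Longrightarrow> a \<in> carrier M \<Longrightarrow> f \<odot>\<^bsub>M\<^esub> (g \<odot>\<^bsub>M\<^esub> a) = g \<odot>\<^bsub>M\<^esub> (f \<odot>\<^bsub>M\<^esub> a)"
  using smult_assoc1 R.m_comm by metis

lemma (in module) smult_r_minus':
  "f \<in> carrier R \<Longrightarrow> a \<in> carrier M \<Longrightarrow> b \<in> carrier M \<Longrightarrow>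
    f \<odot>\<^bsub>M\<^esub> (a \<ominus>\<^bsub>M\<^esub> b) = (f \<odot>\<^bsub>M\<^esub> a) \<ominus>\<^bsub>M\<^esub> (f \<odot>\<^bsub>M\<^esub> b)"
  by (simp add: a_minus_def smult_r_distr smult_r_minus)

section \<open>Sheaves of modules and extension of sections by zero\<close>

locale modsheaf = ringed A for A :: "('m, 's) ringed_space" +
  fixes F :: "('m, 's, 'f) module_presheaf"
  assumes sheaf_of_modules: "sheaf_of_modules A F"
begin

lemma baseF: "base F = base A" and sheafF: "is_sheaf F"
  using sheaf_of_modules by (simp_all add: sheaf_of_modules_def)

lemma modF: "Op U \<Longrightarrow> Module.module (sect A U) (sect F U)"
  using sheaf_of_modules by (simp add: sheaf_of_modules_def)

lemma abgF: "Op U \<Longrightarrow> abelian_group (sect F U)"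
  using modF module.axioms(2) by blast

lemma addF: "Op U \<Longrightarrow> s \<in> carrier (sect F U) \<Longrightarrow> t \<in> carrier (sect F U) \<Longrightarrow> s \<oplus>\<^bsub>sect F U\<^esub> t \<in> carrier (sect F U)"
  by (rule abelian_monoid.a_closed[OF abelian_group.axioms(1)[OF abgF]])

lemma zeroF: "Op U \<Longrightarrow> \<zero>\<^bsub>sect F U\<^esub> \<in> carrier (sect F U)"
  by (rule abelian_monoid.zero_closed[OF abelian_group.axioms(1)[OF abgF]])

lemma minusF: "Op U \<Longrightarrow> s \<in> carrier (sect F U) \<Longrightarrow> t \<in> carrier (sect F U) \<Longrightarrow> s \<ominus>\<^bsub>sect F U\<^esub> t \<in> carrier (sect F U)"
  by (rule abelian_group.minus_closed[OF abgF])

lemma smultF: "Op U \<Longrightarrow> f \<in> carrier (sect A U) \<Longrightarrow> s \<in> carrier (sect F U) \<Longrightarrow> f \<odot>\<^bsub>sect F U\<^esub> s \<in> carrier (sect F U)"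
  by (rule module.smult_closed[OF modF])

lemma resF_closed: "Op U \<Longrightarrow> Op V \<Longrightarrow> V \<subseteq> U \<Longrightarrow> s \<in> carrier (sect F U) \<Longrightarrow> res F U V s \<in> carrier (sect F V)"
  using sheafF by (auto simp: is_sheaf_def is_presheaf_def baseF)

lemma resF_id: "Op U \<Longrightarrow> s \<in> carrier (sect F U) \<Longrightarrow> res F U U s = s"
  using sheafF by (simp add: is_sheaf_def is_presheaf_def baseF)

lemma resF_trans: "Op U \<Longrightarrow> Op V \<Longrightarrow> Op W \<Longrightarrow> V \<subseteq> U \<Longrightarrow> W \<subseteq> V \<Longrightarrow> s \<in> carrier (sect F U) \<Longrightarrow>
    res F V W (res F U V s) = res F U W s"
  using sheafF by (simp add: is_sheaf_def is_presheaf_def baseF)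

lemma resF_add: "Op U \<Longrightarrow> Op V \<Longrightarrow> V \<subseteq> U \<Longrightarrow> s \<in> carrier (sect F U) \<Longrightarrow> t \<in> carrier (sect F U) \<Longrightarrow>
    res F U V (s \<oplus>\<^bsub>sect F U\<^esub> t) = res F U V s \<oplus>\<^bsub>sect F V\<^esub> res F U V t"
  using sheaf_of_modules by (simp add: sheaf_of_modules_def)

lemma resF_smult: "Op U \<Longrightarrow> Op V \<Longrightarrow> V \<subseteq> U \<Longrightarrow> f \<in> carrier (sect A U) \<Longrightarrow> s \<in> carrier (sect F U) \<Longrightarrow>
    res F U V (f \<odot>\<^bsub>sect F U\<^esub> s) = res A U V f \<odot>\<^bsub>sect F V\<^esub> res F U V s"
  using sheaf_of_modules by (simp add: sheaf_of_modules_def)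

lemma hom_groupF:
  assumes "Op U" "Op V" "V \<subseteq> U"
  shows "abelian_group_hom (sect F U) (sect F V) (res F U V)"
  using assms resF_add resF_closed
  by (intro abelian_group_homI abgF group_hom.intro group_hom_axioms.intro)
     (auto simp: hom_def abelian_group.a_group[OF abgF])

lemma resF_zero: "Op U \<Longrightarrow> Op V \<Longrightarrow> V \<subseteq> U \<Longrightarrow> res F U V \<zero>\<^bsub>sect F U\<^esub> = \<zero>\<^bsub>sect F V\<^esub>"
  using abelian_group_hom.hom_zero hom_groupF by blast

lemma resF_minus: "Op U \<Longrightarrow> Op V \<Longrightarrow> V \<subseteq> U \<Longrightarrow> s \<in> carrier (sect F U) \<Longrightarrow> t \<in> carrier (sect F U) \<Longrightarrow>
    res F U V (s \<ominus>\<^bsub>sect F U\<^esub> t) = res F U V s \<ominus>\<^bsub>sect F V\<^esub> res F U V t"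
  unfolding a_minus_def
  by (simp add: resF_add abelian_group.a_inv_closed[OF abgF] abelian_group_hom.hom_a_inv[OF hom_groupF])

lemma sepF: "(\<And>U. U \<in> \<U> \<Longrightarrow> Op U) \<Longrightarrow> X = \<Union>\<U> \<Longrightarrow> s \<in> carrier (sect F X) \<Longrightarrow> t \<in> carrier (sect F X) \<Longrightarrow>
    (\<And>U. U \<in> \<U> \<Longrightarrow> res F X U s = res F X U t) \<Longrightarrow> s = t"
  by (rule sheaf_sep[OF sheafF]) (auto simp: baseF)

lemma sep2F: "Op V \<Longrightarrow> Op W \<Longrightarrow> X = V \<union> W \<Longrightarrow> s \<in> carrier (sect F X) \<Longrightarrow> t \<in> carrier (sect F X) \<Longrightarrow>
    res F X V s = res F X V t \<Longrightarrow> res F X W s = res F X W t \<Longrightarrow> s = t"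
  by (rule sepF[of "{V, W}"]) auto

lemma smultF_zero: "Op U \<Longrightarrow> f \<in> carrier (sect A U) \<Longrightarrow> f \<odot>\<^bsub>sect F U\<^esub> \<zero>\<^bsub>sect F U\<^esub> = \<zero>\<^bsub>sect F U\<^esub>"
  using module.smult_r_null[OF modF] by blast

lemma smultF_l_zero: "Op U \<Longrightarrow> s \<in> carrier (sect F U) \<Longrightarrow> \<zero>\<^bsub>sect A U\<^esub> \<odot>\<^bsub>sect F U\<^esub> s = \<zero>\<^bsub>sect F U\<^esub>"
  using module.smult_l_null[OF modF] by blast

lemma smultF_one: "Op U \<Longrightarrow> s \<in> carrier (sect F U) \<Longrightarrow> \<one>\<^bsub>sect A U\<^esub> \<odot>\<^bsub>sect F U\<^esub> s = s"
  using module.smult_one[OF modF] by blast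

lemma minusF_self: "Op U \<Longrightarrow> s \<in> carrier (sect F U) \<Longrightarrow> s \<ominus>\<^bsub>sect F U\<^esub> s = \<zero>\<^bsub>sect F U\<^esub>"
  by (simp add: a_minus_def abelian_group.r_neg[OF abgF])

lemma addF_zero: "Op U \<Longrightarrow> s \<in> carrier (sect F U) \<Longrightarrow> s \<oplus>\<^bsub>sect F U\<^esub> \<zero>\<^bsub>sect F U\<^esub> = s"
  using abelian_monoid.r_zero[OF abelian_group.axioms(1)[OF abgF]] by blast

lemma cscaleF: "Op U \<Longrightarrow> s \<in> carrier (sect F U) \<Longrightarrow> cscale A F U c s \<in> carrier (sect F U)"
  unfolding cscale_def using cst_closed[unfolded cst_def] smultF by blast

lemma cscale_cst: "cscale A F U c s = cst U c \<odot>\<^bsub>sect F U\<^esub> s"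
  by (simp add: cscale_def cst_def)

lemma resF_cscale: "Op U \<Longrightarrow> Op V \<Longrightarrow> V \<subseteq> U \<Longrightarrow> s \<in> carrier (sect F U) \<Longrightarrow>
    res F U V (cscale A F U c s) = cscale A F V c (res F U V s)"
  by (simp add: cscale_cst resF_smult cst_closed res_cst)

text \<open>Extension by zero of a section over \<open>V\<close> that is supported in
  \<open>C\<close>. It exists by gluing \<open>s\<close> with 0 on \<open>W - C\<close>, which needs
  \<open>s\<close> to vanish on \<open>V - C\<close>; it is unique because \<open>V\<close> and
  \<open>W - C\<close> cover \<open>W\<close> when \<open>C\<close> lies in
  \<open>V\<close>.\<close>

definition zext :: "'m set \<Rightarrow> 'm set \<Rightarrow> 'm set \<Rightarrow> 'f \<Rightarrow> 'f" where
  "zext V W C s = (THE t. t \<in> carrier (sect F W) \<and> res F W V t = s \<and> res F W (W - C) t = \<zero>\<^bsub>sect F (W - C)\<^esub>)"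

lemma zext_eqI:
  assumes "Op V" "Op W" "V \<subseteq> W" "C \<subseteq> V" "Op (W - C)"
    and t: "t \<in> carrier (sect F W)" "res F W V t = s" "res F W (W - C) t = \<zero>\<^bsub>sect F (W - C)\<^esub>"
  shows "zext V W C s = t"
  unfolding zext_def
proof (rule the_equality)
  have W: "W = V \<union> (W - C)" using assms by auto
  show "t' = t" if "t' \<in> carrier (sect F W) \<and> res F W V t' = s \<and> res F W (W - C) t' = \<zero>\<^bsub>sect F (W - C)\<^esub>" for t'
    by (rule sep2F[OF assms(1,5) W]) (use that t in auto)
qed (use t in blast)

lemma zext:
  assumes "Op V" "Op W" "V \<subseteq> W" "C \<subseteq> V" "Op (W - C)"
    and s: "s \<in> carrier (sect F V)" "res F V (V - C) s = \<zero>\<^bsub>sect F (V - C)\<^esub>"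
  shows zext_closed: "zext V W C s \<in> carrier (sect F W)"
    and zext_res: "res F W V (zext V W C s) = s"
    and zext_res_zero: "res F W (W - C) (zext V W C s) = \<zero>\<^bsub>sect F (W - C)\<^esub>"
proof -
  have W: "W = V \<union> (W - C)" using assms by auto
  have VC: "V \<inter> (W - C) = V - C" using assms by auto
  have OVC: "Op (V - C)" using openin_Int[OF assms(1,5)] VC by simp
  obtain t where "t \<in> carrier (sect F W)" "res F W V t = s" "res F W (W - C) t = \<zero>\<^bsub>sect F (W - C)\<^esub>"
    by (rule sheaf_glue2[OF sheafF, of V "W - C" W s "\<zero>\<^bsub>sect F (W - C)\<^esub>"])
       (use assms W s zeroF OVC in \<open>auto simp: baseF VC intro!: resF_zero[symmetric]\<close>)
  moreover from this have "zext V W C s = t" by (intro zext_eqI assms)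
  ultimately show "zext V W C s \<in> carrier (sect F W)" "res F W V (zext V W C s) = s"
    "res F W (W - C) (zext V W C s) = \<zero>\<^bsub>sect F (W - C)\<^esub>" by auto
qed

end

section \<open>Sheaf homomorphisms and differential operators\<close>

locale modsheaf2 = modsheaf A F + G: modsheaf A G
  for A :: "('m, 's) ringed_space" and F :: "('m, 's, 'f) module_presheaf"
    and G :: "('m, 's, 'g) module_presheaf"
begin

text \<open>The laws of a C-linear sheaf homomorphism over the open subsets of \<open>U\<close>,
  without extensionality. Commutators, sums and composites can thus be formed as plain functions;
  \<open>mk\<close> turns the result into an element of \<open>sheaf_homs\<close>.\<close>

definition lhom :: "'m set \<Rightarrow> ('m set \<Rightarrow> 'f \<Rightarrow> 'g) \<Rightarrow> bool" where
  "lhom U D \<longleftrightarrow>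
     (\<forall>V s. Op V \<longrightarrow> V \<subseteq> U \<longrightarrow> s \<in> carrier (sect F V) \<longrightarrow> D V s \<in> carrier (sect G V)) \<and>
     (\<forall>V s t. Op V \<longrightarrow> V \<subseteq> U \<longrightarrow> s \<in> carrier (sect F V) \<longrightarrow> t \<in> carrier (sect F V) \<longrightarrow>
        D V (s \<oplus>\<^bsub>sect F V\<^esub> t) = D V s \<oplus>\<^bsub>sect G V\<^esub> D V t) \<and>
     (\<forall>V c s. Op V \<longrightarrow> V \<subseteq> U \<longrightarrow> s \<in> carrier (sect F V) \<longrightarrow> D V (cscale A F V c s) = cscale A G V c (D V s)) \<and>
     (\<forall>V W s. Op V \<longrightarrow> Op W \<longrightarrow> W \<subseteq> V \<longrightarrow> V \<subseteq> U \<longrightarrow> s \<in> carrier (sect F V) \<longrightarrow>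
        D W (res F V W s) = res G V W (D V s))"

lemma lhom_closed: "lhom U D \<Longrightarrow> Op V \<Longrightarrow> V \<subseteq> U \<Longrightarrow> s \<in> carrier (sect F V) \<Longrightarrow> D V s \<in> carrier (sect G V)"
  and lhom_add: "lhom U D \<Longrightarrow> Op V \<Longrightarrow> V \<subseteq> U \<Longrightarrow> s \<in> carrier (sect F V) \<Longrightarrow> t \<in> carrier (sect F V) \<Longrightarrow>
    D V (s \<oplus>\<^bsub>sect F V\<^esub> t) = D V s \<oplus>\<^bsub>sect G V\<^esub> D V t"
  and lhom_cscale: "lhom U D \<Longrightarrow> Op V \<Longrightarrow> V \<subseteq> U \<Longrightarrow> s \<in> carrier (sect F V) \<Longrightarrow>
    D V (cscale A F V c s) = cscale A G V c (D V s)"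
  and lhom_res: "lhom U D \<Longrightarrow> Op V \<Longrightarrow> Op W \<Longrightarrow> W \<subseteq> V \<Longrightarrow> V \<subseteq> U \<Longrightarrow> s \<in> carrier (sect F V) \<Longrightarrow>
    D W (res F V W s) = res G V W (D V s)"
  by (simp_all add: lhom_def)

lemma lhomI:
  assumes "\<And>V s. Op V \<Longrightarrow> V \<subseteq> U \<Longrightarrow> s \<in> carrier (sect F V) \<Longrightarrow> D V s \<in> carrier (sect G V)"
    and "\<And>V s t. Op V \<Longrightarrow> V \<subseteq> U \<Longrightarrow> s \<in> carrier (sect F V) \<Longrightarrow> t \<in> carrier (sect F V) \<Longrightarrow>
        D V (s \<oplus>\<^bsub>sect F V\<^esub> t) = D V s \<oplus>\<^bsub>sect G V\<^esub> D V t"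
    and "\<And>V c s. Op V \<Longrightarrow> V \<subseteq> U \<Longrightarrow> s \<in> carrier (sect F V) \<Longrightarrow> D V (cscale A F V c s) = cscale A G V c (D V s)"
    and "\<And>V W s. Op V \<Longrightarrow> Op W \<Longrightarrow> W \<subseteq> V \<Longrightarrow> V \<subseteq> U \<Longrightarrow> s \<in> carrier (sect F V) \<Longrightarrow>
        D W (res F V W s) = res G V W (D V s)"
  shows "lhom U D"
  using assms by (simp add: lhom_def)

lemma lhom_subset: "lhom U D \<Longrightarrow> V \<subseteq> U \<Longrightarrow> lhom V D"
  by (rule lhomI) (auto intro: lhom_closed lhom_add lhom_cscale lhom_res)

lemma lhom_zero:
  assumes "lhom U D" "Op V" "V \<subseteq> U"
  shows "D V \<zero>\<^bsub>sect F V\<^esub> = \<zero>\<^bsub>sect G V\<^esub>"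
proof -
  have "abelian_group_hom (sect F V) (sect G V) (D V)"
    using assms
    by (intro abelian_group_homI abgF G.abgF group_hom.intro group_hom_axioms.intro)
       (auto simp: hom_def abelian_group.a_group[OF abgF] abelian_group.a_group[OF G.abgF] lhom_closed lhom_add)
  then show ?thesis by (rule abelian_group_hom.hom_zero)
qed

lemma lhom_minus:
  assumes "lhom U D" "Op V" "V \<subseteq> U" "s \<in> carrier (sect F V)" "t \<in> carrier (sect F V)"
  shows "D V (s \<ominus>\<^bsub>sect F V\<^esub> t) = D V s \<ominus>\<^bsub>sect G V\<^esub> D V t"
proof -
  have *: "abelian_group_hom (sect F V) (sect G V) (D V)"
    using assms
    by (intro abelian_group_homI abgF G.abgF group_hom.intro group_hom_axioms.intro)
       (auto simp: hom_def abelian_group.a_group[OF abgF] abelian_group.a_group[OF G.abgF] lhom_closed lhom_add)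
  show ?thesis using assms abelian_group.a_inv_closed[OF abgF]
    by (simp add: a_minus_def lhom_add abelian_group_hom.hom_a_inv[OF *])
qed

text \<open>Equality of operators where their values mean something. Commutators are not
  extensional, so identities between them hold in this sense only, and later statements are shown to
  be invariant under it.\<close>

definition agree :: "'m set \<Rightarrow> ('m set \<Rightarrow> 'f \<Rightarrow> 'g) \<Rightarrow> ('m set \<Rightarrow> 'f \<Rightarrow> 'g) \<Rightarrow> bool" where
  "agree U D D' \<longleftrightarrow> (\<forall>V s. Op V \<longrightarrow> V \<subseteq> U \<longrightarrow> s \<in> carrier (sect F V) \<longrightarrow> D V s = D' V s)"

lemma agreeI: "(\<And>V s. Op V \<Longrightarrow> V \<subseteq> U \<Longrightarrow> s \<in> carrier (sect F V) \<Longrightarrow> D V s = D' V s) \<Longrightarrow> agree U D D'"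
  by (simp add: agree_def)

lemma agreeD: "agree U D D' \<Longrightarrow> Op V \<Longrightarrow> V \<subseteq> U \<Longrightarrow> s \<in> carrier (sect F V) \<Longrightarrow> D V s = D' V s"
  by (simp add: agree_def)

lemma agree_sym: "agree U D D' \<Longrightarrow> agree U D' D"
  by (simp add: agree_def)

lemma agree_subset: "agree U D D' \<Longrightarrow> V \<subseteq> U \<Longrightarrow> agree V D D'"
  by (auto simp: agree_def)

lemma lhom_agree:
  assumes D: "lhom U D" and D': "agree U D D'"
  shows "lhom U D'"
proof (rule lhomI)
  fix V s assume V: "Op V" "V \<subseteq> U" and s: "s \<in> carrier (sect F V)"
  note e = agreeD[OF D' V, symmetric]
  show "D' V s \<in> carrier (sect G V)" using lhom_closed[OF D V s] by (simp add: e s)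
  show "D' V (s \<oplus>\<^bsub>sect F V\<^esub> t) = D' V s \<oplus>\<^bsub>sect G V\<^esub> D' V t" if "t \<in> carrier (sect F V)" for t
    using lhom_add[OF D V s that] V s that by (simp add: e addF)
  show "D' V (cscale A F V c s) = cscale A G V c (D' V s)" for c
    using lhom_cscale[OF D V s] V s by (simp add: e cscaleF)
  show "D' W (res F V W s) = res G V W (D' V s)" if W: "Op W" "W \<subseteq> V" for W
    using lhom_res[OF D V(1) W V(2) s] agreeD[OF D' W(1) _ resF_closed[OF V(1) W s]] W(2) V(2) by (simp add: e s)
qed

section \<open>Iterated commutators\<close>

abbreviation comm :: "'m set \<Rightarrow> 's \<Rightarrow> ('m set \<Rightarrow> 'f \<Rightarrow> 'g) \<Rightarrow> 'm set \<Rightarrow> 'f \<Rightarrow> 'g" where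
  "comm \<equiv> commutator A F G"

text \<open>Constants commute with \<open>f\<close>, and the action of \<open>f\<close> is
  compatible with restriction; hence the commutator is again a sheaf homomorphism and can be formed
  repeatedly.\<close>

lemma comm_lhom:
  assumes W: "Op W" and D: "lhom W D" and f: "f \<in> carrier (sect A W)"
  shows "lhom W (comm W f D)"
proof (rule lhomI)
  fix V s assume V: "Op V" "V \<subseteq> W" and s: "s \<in> carrier (sect F V)"
  let ?f = "res A W V f"
  have f': "?f \<in> carrier (sect A V)" by (rule resA_closed[OF W V f])
  have Ds: "D V s \<in> carrier (sect G V)" using lhom_closed[OF D V] s by simp
  have Dfs: "D V (?f \<odot>\<^bsub>sect F V\<^esub> s) \<in> carrier (sect G V)" using lhom_closed[OF D V] smultF[OF V(1) f' s] by simp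
  show "comm W f D V s \<in> carrier (sect G V)"
    using V(1) f' Ds Dfs by (simp add: commutator_def G.minusF G.smultF)
  show "comm W f D V (s \<oplus>\<^bsub>sect F V\<^esub> t) = comm W f D V s \<oplus>\<^bsub>sect G V\<^esub> comm W f D V t" if t: "t \<in> carrier (sect F V)" for t
    using V f' Ds Dfs s t lhom_closed[OF D V t] lhom_closed[OF D V smultF[OF V(1) f' t]]
    by (simp add: commutator_def lhom_add[OF D V] smultF module.smult_r_distr[OF modF] module.minus_smult_add[OF G.modF])
  show "comm W f D V (cscale A F V c s) = cscale A G V c (comm W f D V s)" for c
  proof -
    have c: "cst V c \<in> carrier (sect A V)" using cst_closed V by blast
    have 1: "?f \<odot>\<^bsub>sect F V\<^esub> (cscale A F V c s) = cscale A F V c (?f \<odot>\<^bsub>sect F V\<^esub> s)"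
      using module.smult_commute[OF modF] V f' s c by (simp add: cscale_cst)
    have 2: "?f \<odot>\<^bsub>sect G V\<^esub> (cscale A G V c (D V s)) = cscale A G V c (?f \<odot>\<^bsub>sect G V\<^esub> D V s)"
      using module.smult_commute[OF G.modF] V f' Ds c by (simp add: G.cscale_cst)
    show ?thesis using V f' s Ds Dfs c
      by (simp add: commutator_def 1 lhom_cscale[OF D V] smultF 2)
         (simp add: G.cscale_cst module.smult_r_minus'[OF G.modF] G.smultF)
  qed
  show "comm W f D V' (res F V V' s) = res G V V' (comm W f D V s)" if V': "Op V'" "V' \<subseteq> V" for V'
  proof -
    have 1: "res A W V' f \<odot>\<^bsub>sect F V'\<^esub> res F V V' s = res F V V' (?f \<odot>\<^bsub>sect F V\<^esub> s)"
      using V V' W f f' s by (simp add: resF_smult resA_trans)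
    have 2: "res A W V' f \<odot>\<^bsub>sect G V'\<^esub> res G V V' (D V s) = res G V V' (?f \<odot>\<^bsub>sect G V\<^esub> D V s)"
      using V V' W f f' Ds by (simp add: G.resF_smult resA_trans)
    show ?thesis using V V' f' s Ds Dfs
      by (simp add: commutator_def 1 lhom_res[OF D V(1) V' V(2)] smultF 2 G.resF_minus G.smultF)
  qed
qed

lemma fold_comm_lhom:
  assumes W: "Op W" shows "lhom W D \<Longrightarrow> set fs \<subseteq> carrier (sect A W) \<Longrightarrow> lhom W (fold (comm W) fs D)"
  by (induction fs arbitrary: D) (simp_all add: comm_lhom W)

lemma comm_agree:
  assumes W: "Op W" "W \<subseteq> W'" "Op W'" and f: "f \<in> carrier (sect A W')" and D: "agree W D D'"
  shows "agree W (comm W' f D) (comm W (res A W' W f) D')"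
proof (rule agreeI)
  fix V s assume V: "Op V" "V \<subseteq> W" and s: "s \<in> carrier (sect F V)"
  have "res A W' V f \<in> carrier (sect A V)" using resA_closed W V f by blast
  then show "comm W' f D V s = comm W (res A W' W f) D' V s"
    unfolding commutator_def using agreeD[OF D V] V s W f by (simp add: resA_trans smultF)
qed

text \<open>Over \<open>W\<close>, iterated commutators with sections over a larger
  \<open>W'\<close> are those with the restricted sections. This makes the order of an operator a
  local notion.\<close>

lemma fold_comm_agree:
  assumes W: "Op W" "W \<subseteq> W'" "Op W'"
  shows "set fs \<subseteq> carrier (sect A W') \<Longrightarrow> agree W D D' \<Longrightarrow>
    agree W (fold (comm W') fs D) (fold (comm W) (map (res A W' W) fs) D')"
  by (induction fs arbitrary: D D') (auto simp: comm_agree W)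

lemma fold_comm_cong:
  assumes W: "Op W" and fs: "set fs \<subseteq> carrier (sect A W)" and "agree W D D'"
  shows "agree W (fold (comm W) fs D) (fold (comm W) fs D')"
proof -
  have "map (res A W W) fs = fs" using fs W by (intro map_idI) (auto simp: resA_id)
  then show ?thesis using fold_comm_agree[OF W order_refl W fs assms(3)] by simp
qed

section \<open>Sums, precomposition with a section, and the zero operator\<close>

definition hplus :: "('m set \<Rightarrow> 'f \<Rightarrow> 'g) \<Rightarrow> ('m set \<Rightarrow> 'f \<Rightarrow> 'g) \<Rightarrow> 'm set \<Rightarrow> 'f \<Rightarrow> 'g" where
  "hplus D D' = (\<lambda>V s. D V s \<oplus>\<^bsub>sect G V\<^esub> D' V s)"

definition precomp :: "'m set \<Rightarrow> 's \<Rightarrow> ('m set \<Rightarrow> 'f \<Rightarrow> 'g) \<Rightarrow> 'm set \<Rightarrow> 'f \<Rightarrow> 'g" where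
  "precomp U f D = (\<lambda>V s. D V (res A U V f \<odot>\<^bsub>sect F V\<^esub> s))"

definition hzero :: "'m set \<Rightarrow> 'f \<Rightarrow> 'g" where
  "hzero = (\<lambda>V s. \<zero>\<^bsub>sect G V\<^esub>)"

lemma hplus_lhom:
  assumes D: "lhom U D" and D': "lhom U D'"
  shows "lhom U (hplus D D')"
proof (rule lhomI)
  fix V s assume V: "Op V" "V \<subseteq> U" and s: "s \<in> carrier (sect F V)"
  note cl = lhom_closed[OF D V] lhom_closed[OF D' V]
  show "hplus D D' V s \<in> carrier (sect G V)" using V s cl by (simp add: hplus_def G.addF)
  show "hplus D D' V (s \<oplus>\<^bsub>sect F V\<^esub> t) = hplus D D' V s \<oplus>\<^bsub>sect G V\<^esub> hplus D D' V t" if "t \<in> carrier (sect F V)" for t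
  proof -
    interpret g: abelian_group "sect G V" using G.abgF V by blast
    show ?thesis using V s that cl
      by (simp add: hplus_def lhom_add[OF D V] lhom_add[OF D' V] g.a_ac)
  qed
  show "hplus D D' V (cscale A F V c s) = cscale A G V c (hplus D D' V s)" for c
    using V s cl cst_closed[OF V(1)]
    by (simp add: hplus_def lhom_cscale[OF D V] lhom_cscale[OF D' V] G.cscale_cst module.smult_r_distr[OF G.modF])
  show "hplus D D' W (res F V W s) = res G V W (hplus D D' V s)" if W: "Op W" "W \<subseteq> V" for W
    using lhom_res[OF D V(1) W V(2) s] lhom_res[OF D' V(1) W V(2) s] V W s cl by (simp add: hplus_def G.resF_add)
qed

lemma hzero_lhom: "lhom U hzero"
  by (rule lhomI) (simp_all add: hzero_def G.zeroF G.addF_zero G.cscale_cst cst_closed G.smultF_zero G.resF_zero)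

lemma precomp_lhom:
  assumes U: "Op U" and D: "lhom U D" and f: "f \<in> carrier (sect A U)"
  shows "lhom U (precomp U f D)"
proof (rule lhomI)
  fix V s assume V: "Op V" "V \<subseteq> U" and s: "s \<in> carrier (sect F V)"
  let ?f = "res A U V f"
  have f': "?f \<in> carrier (sect A V)" by (rule resA_closed[OF U V f])
  show "precomp U f D V s \<in> carrier (sect G V)" using V s f' by (simp add: precomp_def lhom_closed[OF D] smultF)
  show "precomp U f D V (s \<oplus>\<^bsub>sect F V\<^esub> t) = precomp U f D V s \<oplus>\<^bsub>sect G V\<^esub> precomp U f D V t"
    if "t \<in> carrier (sect F V)" for t
    using V s f' that by (simp add: precomp_def module.smult_r_distr[OF modF] lhom_add[OF D] smultF)
  show "precomp U f D V (cscale A F V c s) = cscale A G V c (precomp U f D V s)" for c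
  proof -
    have "?f \<odot>\<^bsub>sect F V\<^esub> (cscale A F V c s) = cscale A F V c (?f \<odot>\<^bsub>sect F V\<^esub> s)"
      using module.smult_commute[OF modF] V f' s cst_closed[OF V(1)] by (simp add: cscale_cst)
    then show ?thesis using V s f' by (simp add: precomp_def lhom_cscale[OF D] smultF)
  qed
  show "precomp U f D W (res F V W s) = res G V W (precomp U f D V s)" if W: "Op W" "W \<subseteq> V" for W
  proof -
    have 1: "res A U W f \<odot>\<^bsub>sect F W\<^esub> res F V W s = res F V W (?f \<odot>\<^bsub>sect F V\<^esub> s)"
      using V W U f f' s by (simp add: resF_smult resA_trans)
    show ?thesis using V W s f' by (simp add: precomp_def 1 lhom_res[OF D] smultF)
  qed
qed

section \<open>The order of an operator\<close>

definition ordle :: "'m set \<Rightarrow> nat \<Rightarrow> ('m set \<Rightarrow> 'f \<Rightarrow> 'g) \<Rightarrow> bool" where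
  "ordle U r D \<longleftrightarrow> (\<forall>W fs. Op W \<longrightarrow> W \<subseteq> U \<longrightarrow> length fs = Suc r \<longrightarrow> set fs \<subseteq> carrier (sect A W) \<longrightarrow>
     agree W (fold (comm W) fs D) hzero)"

lemma ordleI: "(\<And>W fs. Op W \<Longrightarrow> W \<subseteq> U \<Longrightarrow> length fs = Suc r \<Longrightarrow> set fs \<subseteq> carrier (sect A W) \<Longrightarrow>
     agree W (fold (comm W) fs D) hzero) \<Longrightarrow> ordle U r D"
  by (simp add: ordle_def)

lemma ordleD: "ordle U r D \<Longrightarrow> Op W \<Longrightarrow> W \<subseteq> U \<Longrightarrow> length fs = Suc r \<Longrightarrow> set fs \<subseteq> carrier (sect A W) \<Longrightarrow>
     agree W (fold (comm W) fs D) hzero"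
  by (simp add: ordle_def)

lemma ordle_subset: "ordle U r D \<Longrightarrow> V \<subseteq> U \<Longrightarrow> ordle V r D"
  by (auto simp: ordle_def)

lemma agree_trans: "agree U D D' \<Longrightarrow> agree U D' D'' \<Longrightarrow> agree U D D''"
  by (simp add: agree_def)

lemma ordle_agree: "ordle U r D \<Longrightarrow> agree U D D' \<Longrightarrow> ordle U r D'"
  by (rule ordleI, rule agree_trans[OF fold_comm_cong[OF _ _ agree_sym[OF agree_subset]] ordleD])

lemma comm_hzero:
  assumes W: "Op W" and f: "f \<in> carrier (sect A W)"
  shows "agree W (comm W f hzero) hzero"
proof (rule agreeI)
  fix V s assume V: "Op V" "V \<subseteq> W"
  then show "comm W f hzero V s = hzero V s"
    using resA_closed[OF W V f] by (simp add: commutator_def hzero_def G.smultF_zero G.minusF_self G.zeroF)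
qed

lemma fold_comm_hzero:
  assumes W: "Op W" shows "set fs \<subseteq> carrier (sect A W) \<Longrightarrow> agree W (fold (comm W) fs hzero) hzero"
proof (induction fs)
  case (Cons f fs)
  then have "agree W (fold (comm W) fs (comm W f hzero)) (fold (comm W) fs hzero)"
    by (intro fold_comm_cong W comm_hzero) auto
  from agree_trans[OF this Cons.IH] Cons.prems show ?case by simp
qed (simp add: agree_def)

lemma ordle_hzero: "agree U D hzero \<Longrightarrow> ordle U r D"
  by (rule ordleI, rule agree_trans[OF fold_comm_cong[OF _ _ agree_subset] fold_comm_hzero])

lemma ordle_mono:
  assumes "ordle U r D" "r \<le> r'"
  shows "ordle U r' D"
  using assms(2)
proof (induction rule: dec_induct)
  case (step n)
  show ?case
  proof (rule ordleI)
    fix W fs assume W: "Op W" "W \<subseteq> U" and fs: "length fs = Suc (Suc n)" "set fs \<subseteq> carrier (sect A W)"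
    \<comment> \<open>\<open>fold\<close> treats the list from left to right, so the last commutator
      is taken with an operator that already vanishes.\<close>
    obtain gs g where g: "fs = gs @ [g]" "length gs = Suc n" using fs(1) by (metis length_Suc_conv_rev)
    have "agree W (fold (comm W) gs D) hzero" by (rule ordleD[OF step(3)]) (use W fs g in auto)
    then have "agree W (fold (comm W) [g] (fold (comm W) gs D)) (fold (comm W) [g] hzero)"
      by (intro fold_comm_cong W) (use fs g in auto)
    moreover have "agree W (fold (comm W) [g] hzero) hzero" by (intro fold_comm_hzero W) (use fs g in auto)
    ultimately have "agree W (fold (comm W) [g] (fold (comm W) gs D)) hzero" by (rule agree_trans)
    then show "agree W (fold (comm W) fs D) hzero" by (simp add: g)
  qed
qed (rule assms(1))

text \<open>The iterated commutator is a sheaf homomorphism, so its value vanishes as soon as it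
  vanishes on a cover. On a member of the cover it is the commutator with restricted sections, where
  the assumed order applies.\<close>

lemma ordle_local:
  assumes op: "\<And>V. V \<in> \<U> \<Longrightarrow> Op V" and U: "Op U" "U \<subseteq> \<Union>\<U>" and D: "lhom U D"
    and ord: "\<And>V. V \<in> \<U> \<Longrightarrow> ordle V r D"
  shows "ordle U r D"
proof (intro ordleI agreeI)
  fix W fs V s assume W: "Op W" "W \<subseteq> U" and fs: "length fs = Suc r" "set fs \<subseteq> carrier (sect A W)"
    and V: "Op V" "V \<subseteq> W" and s: "s \<in> carrier (sect F V)"
  let ?E = "fold (comm W) fs D"
  have E: "lhom W ?E" by (intro fold_comm_lhom W fs lhom_subset[OF D])
  show "?E V s = hzero V s"
  proof (rule G.sepF[of "(\<inter>) V ` \<U>"])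
    show "?E V s \<in> carrier (sect G V)" by (rule lhom_closed[OF E V s])
    show "V = \<Union> ((\<inter>) V ` \<U>)" using U V W by auto
    fix V' assume "V' \<in> (\<inter>) V ` \<U>"
    then obtain T where T: "T \<in> \<U>" "V' = V \<inter> T" by blast
    have oT: "Op (W \<inter> T)" and oV': "Op V'" using op T W V by auto
    have V': "V' \<subseteq> V" "V' \<subseteq> W \<inter> T" using T V by auto
    have rs: "res F V V' s \<in> carrier (sect F V')" by (rule resF_closed[OF V(1) oV' V'(1) s])
    have "res G V V' (?E V s) = ?E V' (res F V V' s)"
      using lhom_res[OF E V(1) oV' V'(1) V(2) s] by simp
    also have "\<dots> = fold (comm (W \<inter> T)) (map (res A W (W \<inter> T)) fs) D V' (res F V V' s)"
      by (rule agreeD[OF fold_comm_agree[OF oT _ W(1) fs(2)] oV' V'(2) rs]) (auto simp: agree_def)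
    also have "\<dots> = \<zero>\<^bsub>sect G V'\<^esub>"
    proof -
      have "agree (W \<inter> T) (fold (comm (W \<inter> T)) (map (res A W (W \<inter> T)) fs) D) hzero"
        by (rule ordleD[OF ord[OF T(1)] oT]) (use fs W oT in \<open>auto intro: resA_closed\<close>)
      from agreeD[OF this oV' V'(2) rs] show ?thesis by (simp add: hzero_def)
    qed
    finally show "res G V V' (?E V s) = res G V V' (hzero V s)"
      using V V' oV' by (simp add: hzero_def G.resF_zero)
  qed (use op V in \<open>auto simp: hzero_def G.zeroF\<close>)
qed

lemma fold_comm_hplus:
  assumes W: "Op W"
  shows "set fs \<subseteq> carrier (sect A W) \<Longrightarrow> lhom W D \<Longrightarrow> lhom W D' \<Longrightarrow>
    agree W (fold (comm W) fs (hplus D D')) (hplus (fold (comm W) fs D) (fold (comm W) fs D'))"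
proof (induction fs arbitrary: D D')
  case (Cons f fs)
  have f: "f \<in> carrier (sect A W)" using Cons by auto
  have "agree W (comm W f (hplus D D')) (hplus (comm W f D) (comm W f D'))"
  proof (rule agreeI)
    fix V s assume V: "Op V" "V \<subseteq> W" and s: "s \<in> carrier (sect F V)"
    note cl = lhom_closed[OF Cons(3) V] lhom_closed[OF Cons(4) V] smultF[OF V(1) resA_closed[OF W V f] s] resA_closed[OF W V f]
    show "comm W f (hplus D D') V s = hplus (comm W f D) (comm W f D') V s"
      using cl s by (simp add: commutator_def hplus_def module.minus_smult_add[OF G.modF] V)
  qed
  then have "agree W (fold (comm W) fs (comm W f (hplus D D'))) (fold (comm W) fs (hplus (comm W f D) (comm W f D')))"
    by (intro fold_comm_cong W) (use Cons in auto)
  moreover have "agree W (fold (comm W) fs (hplus (comm W f D) (comm W f D')))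
     (hplus (fold (comm W) fs (comm W f D)) (fold (comm W) fs (comm W f D')))"
    by (rule Cons.IH) (use Cons f W in \<open>auto intro: comm_lhom\<close>)
  ultimately show ?case unfolding fold.simps o_apply by (rule agree_trans)
qed (simp add: agree_def)

lemma ordle_hplus:
  assumes "ordle U r D" "ordle U r D'" "lhom U D" "lhom U D'"
  shows "ordle U r (hplus D D')"
proof (rule ordleI)
  fix W fs assume W: "Op W" "W \<subseteq> U" and fs: "length fs = Suc r" "set fs \<subseteq> carrier (sect A W)"
  have 1: "agree W (fold (comm W) fs (hplus D D')) (hplus (fold (comm W) fs D) (fold (comm W) fs D'))"
    by (intro fold_comm_hplus W fs lhom_subset[OF assms(3)] lhom_subset[OF assms(4)])
  have "agree W (hplus (fold (comm W) fs D) (fold (comm W) fs D')) hzero"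
    using ordleD[OF assms(1) W fs] ordleD[OF assms(2) W fs]
    by (simp add: agree_def hplus_def hzero_def G.addF_zero G.zeroF)
  with 1 show "agree W (fold (comm W) fs (hplus D D')) hzero" by (rule agree_trans)
qed

text \<open>Sections act commutatively, so D g f - f D g = (D f - f D) g. Precomposition passes out
  of every commutator and therefore cannot raise the order.\<close>

lemma fold_comm_precomp:
  assumes W: "Op W" and U: "Op U" "W \<subseteq> U" and g: "g \<in> carrier (sect A U)"
  shows "set fs \<subseteq> carrier (sect A W) \<Longrightarrow> lhom W D \<Longrightarrow>
    agree W (fold (comm W) fs (precomp U g D)) (precomp U g (fold (comm W) fs D))"
proof (induction fs arbitrary: D)
  case (Cons f fs)
  have f: "f \<in> carrier (sect A W)" using Cons by auto
  have "agree W (comm W f (precomp U g D)) (precomp U g (comm W f D))"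
  proof (rule agreeI)
    fix V s assume V: "Op V" "V \<subseteq> W" and s: "s \<in> carrier (sect F V)"
    have gV: "res A U V g \<in> carrier (sect A V)" using resA_closed U V g by blast
    have fV: "res A W V f \<in> carrier (sect A V)" by (rule resA_closed[OF W V f])
    show "comm W f (precomp U g D) V s = precomp U g (comm W f D) V s"
      by (simp add: commutator_def precomp_def module.smult_commute[OF modF[OF V(1)] gV fV s])
  qed
  then have "agree W (fold (comm W) fs (comm W f (precomp U g D))) (fold (comm W) fs (precomp U g (comm W f D)))"
    by (intro fold_comm_cong W) (use Cons in auto)
  moreover have "agree W (fold (comm W) fs (precomp U g (comm W f D))) (precomp U g (fold (comm W) fs (comm W f D)))"
    by (rule Cons.IH) (use Cons f W in \<open>auto intro: comm_lhom\<close>)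
  ultimately show ?case unfolding fold.simps o_apply by (rule agree_trans)
qed (simp add: agree_def)

lemma ordle_precomp:
  assumes U: "Op U" and D: "ordle U r D" "lhom U D" and g: "g \<in> carrier (sect A U)"
  shows "ordle U r (precomp U g D)"
proof (rule ordleI)
  fix W fs assume W: "Op W" "W \<subseteq> U" and fs: "length fs = Suc r" "set fs \<subseteq> carrier (sect A W)"
  have 1: "agree W (fold (comm W) fs (precomp U g D)) (precomp U g (fold (comm W) fs D))"
    by (intro fold_comm_precomp W fs U g lhom_subset[OF D(2)])
  have "agree W (precomp U g (fold (comm W) fs D)) hzero"
  proof (rule agreeI)
    fix V s assume V: "Op V" "V \<subseteq> W" and s: "s \<in> carrier (sect F V)"
    have "res A U V g \<odot>\<^bsub>sect F V\<^esub> s \<in> carrier (sect F V)"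
      by (rule smultF[OF V(1) resA_closed[OF U V(1) _ g] s]) (use V W in auto)
    then show "precomp U g (fold (comm W) fs D) V s = hzero V s"
      using agreeD[OF ordleD[OF D(1) W fs] V] by (simp add: precomp_def hzero_def)
  qed
  with 1 show "agree W (fold (comm W) fs (precomp U g D)) hzero" by (rule agree_trans)
qed

text \<open>The operator behind the extension map for densities: \<open>extension_rho\<close> shows
  that its functional is the extension of the functional of \<open>D\<close>. It is meaningful when
  \<open>D\<close> vanishes on \<open>V - C\<close>.\<close>

definition extop :: "'m set \<Rightarrow> 'm set \<Rightarrow> ('m set \<Rightarrow> 'f \<Rightarrow> 'g) \<Rightarrow> 'm set \<Rightarrow> 'f \<Rightarrow> 'g" where
  "extop V C D = (\<lambda>W s. G.zext (W \<inter> V) W (W \<inter> C) (D (W \<inter> V) (res F W (W \<inter> V) s)))"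

context
  fixes U V C D
  assumes U: "Op U" and V: "Op V" "V \<subseteq> U" and C: "C \<subseteq> V" "Op (U - C)"
    and D: "lhom V D" "agree (V - C) D hzero"
begin

lemma extop_char:
  assumes W: "Op W" "W \<subseteq> U" and s: "s \<in> carrier (sect F W)"
  shows extop_closed: "extop V C D W s \<in> carrier (sect G W)"
    and extop_res: "res G W (W \<inter> V) (extop V C D W s) = D (W \<inter> V) (res F W (W \<inter> V) s)"
    and extop_res_zero: "res G W (W - C) (extop V C D W s) = \<zero>\<^bsub>sect G (W - C)\<^esub>"
proof -
  have WC: "W - W \<inter> C = W - C" "W \<inter> V - W \<inter> C = W \<inter> V - C" by auto
  have oWC: "Op (W - C)" using openin_Int[OF W(1) C(2)] W(2) by (simp add: Diff_eq Int_absorb2 Int_assoc[symmetric])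
  have oWV: "Op (W \<inter> V)" using W V by blast
  have oWVC: "Op (W \<inter> V - C)" using openin_Int[OF oWV oWC] by (simp add: Int_Diff[symmetric] Int_absorb2 Int_commute)
     (metis Diff_eq Int_assoc Int_absorb1 Int_commute inf.left_idem)
  have rs: "res F W (W \<inter> V) s \<in> carrier (sect F (W \<inter> V))" using resF_closed[OF W(1) oWV _ s] by auto
  have 1: "D (W \<inter> V) (res F W (W \<inter> V) s) \<in> carrier (sect G (W \<inter> V))"
    by (rule lhom_closed[OF D(1) oWV _ rs]) auto
  have 2: "res G (W \<inter> V) (W \<inter> V - C) (D (W \<inter> V) (res F W (W \<inter> V) s)) = \<zero>\<^bsub>sect G (W \<inter> V - C)\<^esub>"
  proof -
    have "res G (W \<inter> V) (W \<inter> V - C) (D (W \<inter> V) (res F W (W \<inter> V) s)) =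
      D (W \<inter> V - C) (res F (W \<inter> V) (W \<inter> V - C) (res F W (W \<inter> V) s))"
      by (rule lhom_res[OF D(1) oWV oWVC _ _ rs, symmetric]) auto
    also have "\<dots> = hzero (W \<inter> V - C) (res F (W \<inter> V) (W \<inter> V - C) (res F W (W \<inter> V) s))"
      by (rule agreeD[OF D(2) oWVC]) (use resF_closed[OF oWV oWVC _ rs] in auto)
    finally show ?thesis by (simp add: hzero_def)
  qed
  show "extop V C D W s \<in> carrier (sect G W)"
     "res G W (W \<inter> V) (extop V C D W s) = D (W \<inter> V) (res F W (W \<inter> V) s)"
     "res G W (W - C) (extop V C D W s) = \<zero>\<^bsub>sect G (W - C)\<^esub>"
    using G.zext[OF oWV W(1), of "W \<inter> C" "D (W \<inter> V) (res F W (W \<inter> V) s)"] 1 2 oWC C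
    by (auto simp: extop_def WC)
qed

text \<open>\<open>W \<inter> V\<close> and \<open>W - C\<close> cover \<open>W\<close>, so a
  section is determined by its restrictions to them. The laws of a sheaf homomorphism for
  \<open>extop\<close> are all checked through this criterion.\<close>

lemma extop_eqI:
  assumes W: "Op W" "W \<subseteq> U" and s: "s \<in> carrier (sect F W)" and t: "t \<in> carrier (sect G W)"
    and 1: "res G W (W \<inter> V) t = D (W \<inter> V) (res F W (W \<inter> V) s)"
    and 2: "res G W (W - C) t = \<zero>\<^bsub>sect G (W - C)\<^esub>"
  shows "extop V C D W s = t"
proof (rule G.sep2F[of "W \<inter> V" "W - C"])
  show "Op (W - C)" using openin_Int[OF W(1) C(2)] W(2) by (simp add: Diff_eq Int_absorb2 Int_assoc[symmetric])
qed (use W V C t 1 2 extop_char[OF W s] in auto)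

lemma extop_lhom: "lhom U (extop V C D)"
proof (rule lhomI)
  fix W s assume W: "Op W" "W \<subseteq> U" and s: "s \<in> carrier (sect F W)"
  have oWC: "Op (W - C)" using openin_Int[OF W(1) C(2)] W(2) by (simp add: Diff_eq Int_absorb2 Int_assoc[symmetric])
  have oWV: "Op (W \<inter> V)" using W V by blast
  have sub: "W \<inter> V \<subseteq> W" "W - C \<subseteq> W" "W \<inter> V \<subseteq> V" by auto
  note E = extop_char[OF W]
  note rF = resF_closed[OF W(1) oWV sub(1)]
  show "extop V C D W s \<in> carrier (sect G W)" using E s by blast
  show "extop V C D W (s \<oplus>\<^bsub>sect F W\<^esub> t) = extop V C D W s \<oplus>\<^bsub>sect G W\<^esub> extop V C D W t" if t: "t \<in> carrier (sect F W)" for t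
    using E[OF s] E[OF t] s t W oWC oWV sub rF
    by (intro extop_eqI) (simp_all add: addF G.addF G.resF_add resF_add lhom_add[OF D(1)] G.addF_zero G.zeroF)
  show "extop V C D W (cscale A F W c s) = cscale A G W c (extop V C D W s)" for c
    using E[OF s] s W oWC oWV sub rF
    by (intro extop_eqI) (simp_all add: cscaleF G.cscaleF G.resF_cscale resF_cscale lhom_cscale[OF D(1)],
        simp add: G.cscale_cst cst_closed G.smultF_zero)
  show "extop V C D W' (res F W W' s) = res G W W' (extop V C D W s)" if W': "Op W'" "W' \<subseteq> W" for W'
  proof (rule extop_eqI)
    have oWC': "Op (W' - C)" using openin_Int[OF W'(1) oWC] W'(2) by (simp add: Diff_eq Int_absorb2 Int_assoc[symmetric])
    have oWV': "Op (W' \<inter> V)" using W' V by blast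
    have s': "W' \<inter> V \<subseteq> W \<inter> V" "W' - C \<subseteq> W - C" using W' by auto
    have "res G W' (W' \<inter> V) (res G W W' (extop V C D W s)) = res G (W \<inter> V) (W' \<inter> V) (res G W (W \<inter> V) (extop V C D W s))"
      using G.resF_trans[OF W(1) oWV oWV' sub(1) s'(1)] G.resF_trans[OF W(1) W'(1) oWV' W'(2)] E(1)[OF s] by simp
    also have "\<dots> = D (W' \<inter> V) (res F (W \<inter> V) (W' \<inter> V) (res F W (W \<inter> V) s))"
      using lhom_res[OF D(1) oWV oWV' s'(1) sub(3)] rF[OF s] E[OF s] by simp
    also have "\<dots> = D (W' \<inter> V) (res F W' (W' \<inter> V) (res F W W' s))"
      using resF_trans[OF W(1) oWV oWV' sub(1) s'(1) s] resF_trans[OF W(1) W'(1) oWV' W'(2) _ s] by simp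
    finally show "res G W' (W' \<inter> V) (res G W W' (extop V C D W s)) = D (W' \<inter> V) (res F W' (W' \<inter> V) (res F W W' s))" .
    have "res G W' (W' - C) (res G W W' (extop V C D W s)) = res G (W - C) (W' - C) (res G W (W - C) (extop V C D W s))"
      using G.resF_trans[OF W(1) oWC oWC' sub(2) s'(2)] G.resF_trans[OF W(1) W'(1) oWC' W'(2)] E(1)[OF s] by auto
    then show "res G W' (W' - C) (res G W W' (extop V C D W s)) = \<zero>\<^bsub>sect G (W' - C)\<^esub>"
      using E[OF s] G.resF_zero[OF oWC oWC' s'(2)] by simp
  qed (use W W' s E[OF s] in \<open>auto intro: resF_closed G.resF_closed\<close>)
qed

lemma extop_agree: "agree V (extop V C D) D"
proof (rule agreeI)
  fix W s assume W: "Op W" "W \<subseteq> V" and s: "s \<in> carrier (sect F W)"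
  have WV: "W \<inter> V = W" and WU: "W \<subseteq> U" using W V by auto
  have "extop V C D W s \<in> carrier (sect G W)" "res G W W (extop V C D W s) = D W (res F W W s)"
    using extop_char[OF W(1) WU s] WV by auto
  then show "extop V C D W s = D W s" using W s by (simp add: resF_id G.resF_id)
qed

lemma extop_agree_zero: "agree (U - C) (extop V C D) hzero"
proof (rule agreeI)
  fix W s assume W: "Op W" "W \<subseteq> U - C" and s: "s \<in> carrier (sect F W)"
  have WV: "W - C = W" and WU: "W \<subseteq> U" using W V by auto
  have "extop V C D W s \<in> carrier (sect G W)" "res G W W (extop V C D W s) = \<zero>\<^bsub>sect G W\<^esub>"
    using extop_char[OF W(1) WU s] WV by auto
  then show "extop V C D W s = hzero W s" using W s by (simp add: hzero_def G.resF_id)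
qed

text \<open>Order is local: the extension is \<open>D\<close> on \<open>V\<close> and 0 on
  \<open>U - C\<close>, and these two sets cover \<open>U\<close>.\<close>

lemma extop_ordle: "ordle V r D \<Longrightarrow> ordle U r (extop V C D)"
  by (rule ordle_local[of "{V, U - C}"])
     (use U V C in \<open>auto intro: extop_lhom ordle_agree[OF _ agree_sym[OF extop_agree]] ordle_hzero extop_agree_zero\<close>)

end

text \<open>The extensional representative of an operator over \<open>U\<close>. By
  \<open>homs_iff\<close>, the elements of \<open>sheaf_homs\<close> are exactly the operators that
  satisfy the laws and are their own representative.\<close>

definition mk :: "'m set \<Rightarrow> ('m set \<Rightarrow> 'f \<Rightarrow> 'g) \<Rightarrow> 'm set \<Rightarrow> 'f \<Rightarrow> 'g" where
  "mk U D = (\<lambda>V\<in>{V. Op V \<and> V \<subseteq> U}. \<lambda>s\<in>carrier (sect F V). D V s)"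

lemma mk_apply: "Op V \<Longrightarrow> V \<subseteq> U \<Longrightarrow> s \<in> carrier (sect F V) \<Longrightarrow> mk U D V s = D V s"
  by (simp add: mk_def)

lemma mk_agree: "agree U (mk U D) D"
  by (rule agreeI) (simp add: mk_apply)

definition homs :: "'m set \<Rightarrow> ('m set \<Rightarrow> 'f \<Rightarrow> 'g) set" where
  "homs U = sheaf_homs (restr A U) (restr F U) (restr G U)"

lemma homs_iff:
  assumes "Op U"
  shows "D \<in> homs U \<longleftrightarrow> mk U D = D \<and> lhom U D"
proof
  assume D: "D \<in> homs U"
  note D' = D[unfolded homs_def sheaf_homs_def, simplified restr_def, simplified, unfolded openin_restr[OF assms]]
  \<comment> \<open>Scaling reads the modules of sections only, so replacing the base space leaves
    it unchanged.\<close>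
  have c: "cscale (A\<lparr>base := subtopology (base A) U\<rparr>) (F\<lparr>base := subtopology (base F) U\<rparr>) = cscale A F"
     "cscale (A\<lparr>base := subtopology (base A) U\<rparr>) (G\<lparr>base := subtopology (base G) U\<rparr>) = cscale A G"
    by (auto intro!: ext simp: cscale_def)
  have ext: "D V \<in> carrier (sect F V) \<rightarrow>\<^sub>E carrier (sect G V)" if "Op V" "V \<subseteq> U" for V
    using D' that by simp
  have 1: "lhom U D"
  proof (rule lhomI)
    show "D V s \<in> carrier (sect G V)" if "Op V" "V \<subseteq> U" "s \<in> carrier (sect F V)" for V s
      using ext[OF that(1,2)] that(3) by (rule PiE_mem)
  qed (use D' in \<open>simp_all add: c\<close>)
  have "mk U D V = D V" for V
  proof (cases "Op V \<and> V \<subseteq> U")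
    case True
    then have "D V \<in> extensional (carrier (sect F V))" using ext[of V] by (simp add: PiE_def)
    then show ?thesis using True extensional_restrict by (simp add: mk_def)
  next
    case False
    then have "D V = undefined" using D' by (auto simp: extensional_def)
    then show ?thesis using False by (auto simp: mk_def)
  qed
  then show "mk U D = D \<and> lhom U D" using 1 by blast
next
  assume D: "mk U D = D \<and> lhom U D"
  then have D1: "D = mk U D" and D2: "lhom U D" by auto
  have c: "cscale (A\<lparr>base := subtopology (base A) U\<rparr>) (F\<lparr>base := subtopology (base F) U\<rparr>) = cscale A F"
     "cscale (A\<lparr>base := subtopology (base A) U\<rparr>) (G\<lparr>base := subtopology (base G) U\<rparr>) = cscale A G"
    by (auto intro!: ext simp: cscale_def)
  have 1: "D \<in> extensional {V. Op V \<and> V \<subseteq> U}" by (subst D1) (simp add: mk_def)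
  have 2: "D V \<in> carrier (sect F V) \<rightarrow>\<^sub>E carrier (sect G V)" if "Op V" "V \<subseteq> U" for V
  proof (rule PiE_I)
    show "D V s = undefined" if "s \<notin> carrier (sect F V)" for s
      using that \<open>Op V\<close> \<open>V \<subseteq> U\<close> by (subst D1) (simp add: mk_def)
  qed (use lhom_closed[OF D2] that in blast)
  have "Collect (openin (subtopology (base A) U)) = {V. Op V \<and> V \<subseteq> U}"
    using openin_restr[OF assms] by auto
  then show "D \<in> homs U"
    unfolding homs_def sheaf_homs_def restr_def
    using 1 2 D2 by (simp add: openin_restr[OF assms] c lhom_def)
qed

lemma mk_mk: "mk U (mk U D) = mk U D"
  by (rule ext)+ (simp add: mk_def restrict_def)

lemma mk_homs: "Op U \<Longrightarrow> lhom U D \<Longrightarrow> mk U D \<in> homs U"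
  using homs_iff[of U "mk U D"] mk_mk[of U D] lhom_agree[OF _ agree_sym[OF mk_agree]] by simp

lemma homs_lhom: "Op U \<Longrightarrow> D \<in> homs U \<Longrightarrow> lhom U D"
  using homs_iff by blast

lemma order_le_restr:
  assumes "Op U"
  shows "order_le (restr A U) (restr F U) (restr G U) r D \<longleftrightarrow> ordle U r D"
proof -
  have c: "commutator (restr A U) (restr F U) (restr G U) W = comm W" for W
    by (auto intro!: ext simp: commutator_def restr_def)
  have z: "zero_on (restr F U) (restr G U) W E \<longleftrightarrow> agree W E hzero" if "Op W" "W \<subseteq> U" for W E
    using that by (auto simp: zero_on_def restr_def baseF openin_restr[OF assms] agree_def hzero_def)
  show ?thesis
    unfolding order_le_def c ordle_def using z
    by (auto simp: restr_def openin_restr[OF assms])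
qed

text \<open>A section that is 0 on a cover is 0, so the operator vanishes on the union of all open
  sets on which it vanishes. Conversely, if it vanishes on the open set \<open>U - C\<close>, this
  set is one of those removed in forming the support.\<close>

lemma support_subset_iff:
  assumes U: "Op U" and D: "lhom U D" and C: "Op (U - C)"
  shows "op_support (restr F U) (restr G U) D \<subseteq> C \<longleftrightarrow> agree (U - C) D hzero"
proof -
  have z: "zero_on (restr F U) (restr G U) W E \<longleftrightarrow> agree W E hzero" if "Op W" "W \<subseteq> U" for W E
    using that by (auto simp: zero_on_def restr_def baseF openin_restr[OF U] agree_def hzero_def)
  let ?\<U> = "{W. Op W \<and> W \<subseteq> U \<and> agree W D hzero}"
  have supp: "op_support (restr F U) (restr G U) D = U - \<Union>?\<U>"
    using z openin_subset[OF U] unfolding op_support_def restr_def by (auto simp: baseF openin_restr[OF U] topspace_subtopology)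
  show ?thesis
  proof
    assume "op_support (restr F U) (restr G U) D \<subseteq> C"
    then have sub: "U - C \<subseteq> \<Union>?\<U>" using supp by auto
    show "agree (U - C) D hzero"
    proof (rule agreeI)
      fix V s assume V: "Op V" "V \<subseteq> U - C" and s: "s \<in> carrier (sect F V)"
      have VU: "V \<subseteq> U" using V by auto
      show "D V s = hzero V s"
      proof (rule G.sepF[of "(\<inter>) V ` ?\<U>"])
        fix W assume "W \<in> (\<inter>) V ` ?\<U>"
        then obtain T where T: "Op T" "T \<subseteq> U" "agree T D hzero" "W = V \<inter> T" by auto
        then have W: "Op W" "W \<subseteq> V" "W \<subseteq> T" using V by auto
        have "res G V W (D V s) = D W (res F V W s)" using lhom_res[OF D V(1) W(1,2) VU s] by simp
        also have "\<dots> = \<zero>\<^bsub>sect G W\<^esub>" using agreeD[OF T(3) W(1,3) resF_closed[OF V(1) W(1,2) s]] by (simp add: hzero_def)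
        finally show "res G V W (D V s) = res G V W (hzero V s)" using V W by (simp add: hzero_def G.resF_zero)
      qed (use V sub lhom_closed[OF D V(1) VU s] in \<open>auto simp: hzero_def G.zeroF\<close>)
    qed
  next
    assume "agree (U - C) D hzero"
    then show "op_support (restr F U) (restr G U) D \<subseteq> C" using C supp by auto
  qed
qed

lemma op_support_closed:
  assumes U: "Op U" and D: "lhom U D"
  obtains C where "op_support (restr F U) (restr G U) D = C" "C \<subseteq> U" "Op (U - C)"
proof -
  let ?\<U> = "{W. Op W \<and> W \<subseteq> U \<and> zero_on (restr F U) (restr G U) W D}"
  have supp: "op_support (restr F U) (restr G U) D = U - \<Union>?\<U>"
    using openin_subset[OF U] unfolding op_support_def restr_def by (auto simp: baseF openin_restr[OF U] topspace_subtopology)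
  have "Op (\<Union>?\<U>)" by auto
  moreover have "U - (U - \<Union>?\<U>) = \<Union>?\<U>" by auto
  ultimately show thesis using supp by (intro that[of "U - \<Union>?\<U>"]) auto
qed

definition DKR :: "'m set \<Rightarrow> 'm set \<Rightarrow> nat \<Rightarrow> ('m set \<Rightarrow> 'f \<Rightarrow> 'g) set" where
  "DKR U K r = Diff_KR (restr A U) (restr F U) (restr G U) K r"

definition DC :: "'m set \<Rightarrow> ('m set \<Rightarrow> 'f \<Rightarrow> 'g) set" where
  "DC U = Diff_c (restr A U) (restr F U) (restr G U)"

lemma DKR_iff:
  assumes "Op U" "Op (U - K)"
  shows "D \<in> DKR U K r \<longleftrightarrow> D \<in> homs U \<and> ordle U r D \<and> agree (U - K) D hzero"
  using support_subset_iff[OF assms(1) _ assms(2)] homs_lhom[OF assms(1)]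
  by (auto simp: DKR_def Diff_KR_def homs_def[symmetric] order_le_restr[OF assms(1)])

text \<open>Compact support is replaced by vanishing off some compact \<open>K\<close> inside
  \<open>U\<close>. The support then lies in \<open>K\<close>, because \<open>K\<close> is closed in
  a Hausdorff space, and being relatively closed it is compact itself. Restricting a restricted
  sheaf collapses, which turns the local order condition into one over open subsets of
  \<open>U\<close>.\<close>

lemma DC_iff:
  assumes U: "Op U" and H: "Hausdorff_space (base A)"
  shows "D \<in> DC U \<longleftrightarrow> D \<in> homs U \<and> (\<forall>a\<in>U. \<exists>V r. Op V \<and> a \<in> V \<and> V \<subseteq> U \<and> ordle V r D) \<and>
    (\<exists>K. compactin (base A) K \<and> K \<subseteq> U \<and> agree (U - K) D hzero)"
proof -
  have cl: "Op (U - K)" if "compactin (base A) K" for K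
    using compactin_imp_closedin[OF H that] U by blast
  have base: "base (restr A U) = subtopology (base A) U" "topspace (base (restr A U)) = U"
    using openin_subset[OF U] by (auto simp: restr_def topspace_subtopology)
  have loc: "(\<exists>V r. openin (base (restr A U)) V \<and> a \<in> V \<and>
       order_le (restr (restr A U) V) (restr (restr F U) V) (restr (restr G U) V) r D) \<longleftrightarrow>
    (\<exists>V r. Op V \<and> a \<in> V \<and> V \<subseteq> U \<and> ordle V r D)" for a
  proof -
    have "order_le (restr (restr A U) V) (restr (restr F U) V) (restr (restr G U) V) r D = ordle V r D"
      if "Op V" "V \<subseteq> U" for V r
      using that order_le_restr by (simp add: restr_restr)
    then show ?thesis unfolding base openin_restr[OF U] by fast
  qed
  have comp: "compactin (base (restr A U)) (op_support (restr F U) (restr G U) D) \<longleftrightarrow>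
      (\<exists>K. compactin (base A) K \<and> K \<subseteq> U \<and> agree (U - K) D hzero)" if D: "lhom U D"
  proof -
    obtain C where C: "op_support (restr F U) (restr G U) D = C" "C \<subseteq> U" "Op (U - C)"
      using op_support_closed[OF U D] .
    have iff: "compactin (base (restr A U)) C \<longleftrightarrow> compactin (base A) C"
      using C(2) by (simp add: base compactin_subtopology)
    have 1: "agree (U - C) D hzero" using support_subset_iff[OF U D C(3)] C(1) by simp
    have "compactin (base A) C" if K: "compactin (base A) K" "K \<subseteq> U" "agree (U - K) D hzero" for K
    proof -
      have CK: "C \<subseteq> K" using support_subset_iff[OF U D cl[OF K(1)]] K(3) C(1) by simp
      have "closedin (subtopology (base A) K) C"
      proof -
        have "C = K - (U - C)" using CK C K by auto
        moreover have "K - (U - C) = K \<inter> (topspace (base A) - (U - C))"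
          using compactin_subset_topspace[OF K(1)] by auto
        moreover have "closedin (base A) (topspace (base A) - (U - C))" using C(3) by blast
        ultimately show ?thesis by (metis closedin_subtopology Int_commute)
      qed
      then show ?thesis
        using closed_compactin K(1) CK
        by (metis closedin_compact_space compact_space_subtopology compactin_subtopology)
    qed
    then show ?thesis unfolding C(1) iff using 1 C(2) by blast
  qed
  show ?thesis
    unfolding DC_def Diff_c_def diff_ops_def mem_Collect_eq homs_def[symmetric] loc base(2)
    using comp homs_lhom[OF U] by blast
qed

end

section \<open>Calculus of smooth functions\<close>

text \<open>\<open>Euclidean_space n\<close> is a subspace of the function type with its product
  topology; this gives access to \<open>continuous_on\<close> and the calculus stated for
  types.\<close>

lemma Euclidean_space_eq: "Euclidean_space n = top_of_set (topspace (Euclidean_space n))"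
  by (simp add: Euclidean_space_def euclidean_product_topology)

lemma subtopology_Euclidean_space:
  "S \<subseteq> topspace (Euclidean_space n) \<Longrightarrow> subtopology (Euclidean_space n) S = top_of_set S"
  by (subst Euclidean_space_eq) (simp add: subtopology_subtopology Int_absorb1)

lemma Ck_on_0: "openin (Euclidean_space n) S \<Longrightarrow> Ck_on n 0 S f \<longleftrightarrow> continuous_on S f"
  by (simp add: subtopology_Euclidean_space openin_subset)

lemma Ck_on_Suc: "openin (Euclidean_space n) S \<Longrightarrow> Ck_on n (Suc k) S f \<longleftrightarrow> continuous_on S f \<and>
     (\<forall>i<n. (\<forall>x\<in>S. (\<lambda>t. f (x(i := t))) differentiable (at (x i))) \<and> Ck_on n k S (partial_d i f))"
  by (simp add: subtopology_Euclidean_space openin_subset)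

lemmas [simp del] = Ck_on.simps

text \<open>Changing a coordinate below \<open>n\<close> stays among the sequences that vanish from
  \<open>n\<close> on, so a relatively open set contains a short piece of each coordinate line
  through its points.\<close>

lemma eventually_line:
  assumes S: "openin (Euclidean_space n) S" and x: "x \<in> S" and i: "i < n"
  shows "eventually (\<lambda>t. x(i := t) \<in> S) (nhds (x i))"
proof -
  obtain T where T: "open T" "S = topspace (Euclidean_space n) \<inter> T"
    using S by (subst (asm) Euclidean_space_eq) (auto simp: openin_open)
  have "continuous_on UNIV (\<lambda>t. x(i := t))"
  proof (rule continuous_on_coordinatewise_then_product)
    show "continuous_on UNIV (\<lambda>t. (x(i := t)) j)" for j by (cases "j = i") simp_all
  qed
  then have "open ((\<lambda>t. x(i := t)) -` T)" using T(1) by (simp add: continuous_on_open_vimage)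
  moreover have "x i \<in> (\<lambda>t. x(i := t)) -` T" using x T by simp
  ultimately have "eventually (\<lambda>t. t \<in> (\<lambda>t. x(i := t)) -` T) (nhds (x i))"
    using eventually_nhds by blast
  then show ?thesis
    by eventually_elim (use x T i in \<open>auto simp: topspace_Euclidean_space\<close>)
qed

lemma partial_d_cong:
  assumes S: "openin (Euclidean_space n) S" and eq: "\<And>x. x \<in> S \<Longrightarrow> f x = g x" and x: "x \<in> S" and i: "i < n"
  shows "partial_d i f x = partial_d i g x"
    and "(\<lambda>t. f (x(i := t))) differentiable (at (x i)) \<longleftrightarrow> (\<lambda>t. g (x(i := t))) differentiable (at (x i))"
proof -
  have ev: "eventually (\<lambda>t. f (x(i := t)) = g (x(i := t))) (nhds (x i))"
    using eventually_line[OF S x i] by eventually_elim (rule eq)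
  show "partial_d i f x = partial_d i g x"
    unfolding partial_d_def by (rule vector_derivative_cong_eq) (use ev in \<open>auto elim: eventually_mono\<close>)
  have "((\<lambda>t. f (x(i := t))) has_vector_derivative D) (at (x i)) \<longleftrightarrow> ((\<lambda>t. g (x(i := t))) has_vector_derivative D) (at (x i))" for D
    by (rule has_vector_derivative_cong_ev) (use ev eventually_nhds_x_imp_x[OF ev] in \<open>auto elim: eventually_mono\<close>)
  then show "(\<lambda>t. f (x(i := t))) differentiable (at (x i)) \<longleftrightarrow> (\<lambda>t. g (x(i := t))) differentiable (at (x i))"
    using vector_derivative_works differentiableI_vector by metis
qed

text \<open>Functions are total, but only values on \<open>S\<close> matter: difference quotients at
  a point of the open set \<open>S\<close> eventually use points of \<open>S\<close> alone.\<close>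

lemma Ck_on_cong:
  assumes S: "openin (Euclidean_space n) S"
  shows "(\<And>x. x \<in> S \<Longrightarrow> f x = g x) \<Longrightarrow> Ck_on n k S f \<longleftrightarrow> Ck_on n k S g"
proof (induction k arbitrary: f g)
  case 0
  then show ?case using continuous_on_cong[of S S f g] by (simp add: Ck_on_0 S)
next
  case (Suc k)
  have "Ck_on n k S (partial_d i f) \<longleftrightarrow> Ck_on n k S (partial_d i g)" if "i < n" for i
    by (rule Suc.IH) (rule partial_d_cong(1)[OF S Suc.prems _ that])
  moreover have "(\<lambda>t. f (x(i := t))) differentiable (at (x i)) \<longleftrightarrow> (\<lambda>t. g (x(i := t))) differentiable (at (x i))"
    if "x \<in> S" "i < n" for x i
    by (rule partial_d_cong(2)[OF S Suc.prems that])
  moreover have "continuous_on S f \<longleftrightarrow> continuous_on S g" using continuous_on_cong[of S S f g] Suc.prems by simp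
  ultimately show ?case by (simp add: Ck_on_Suc S)
qed

lemma Ck_on_SucD: "openin (Euclidean_space n) S \<Longrightarrow> Ck_on n (Suc k) S f \<Longrightarrow> Ck_on n k S f"
  by (induction k arbitrary: f) (simp_all add: Ck_on_0 Ck_on_Suc)

lemma Ck_on_continuous: "openin (Euclidean_space n) S \<Longrightarrow> Ck_on n k S f \<Longrightarrow> continuous_on S f"
  by (cases k) (simp_all add: Ck_on_0 Ck_on_Suc)

lemma Ck_on_subset:
  assumes S: "openin (Euclidean_space n) S" and T: "openin (Euclidean_space n) T" "T \<subseteq> S"
  shows "Ck_on n k S f \<Longrightarrow> Ck_on n k T f"
proof (induction k arbitrary: f)
  case 0
  then show ?case using continuous_on_subset T S by (auto simp: Ck_on_0)
next
  case (Suc k)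
  then show ?case using continuous_on_subset T S by (auto simp: Ck_on_Suc)
qed

text \<open>Serves functions known only piecewise: residue functions, represented by sections on
  small sets, and functions extended by zero.\<close>

lemma Ck_on_local:
  assumes S: "openin (Euclidean_space n) S"
    and loc: "\<And>x. x \<in> S \<Longrightarrow> \<exists>T. openin (Euclidean_space n) T \<and> x \<in> T \<and> T \<subseteq> S \<and> Ck_on n k T f"
  shows "Ck_on n k S f"
proof -
  have cont: "continuous_on S f"
    if loc: "\<And>x. x \<in> S \<Longrightarrow> \<exists>T. openin (Euclidean_space n) T \<and> x \<in> T \<and> T \<subseteq> S \<and> continuous_on T f" for f :: "(nat \<Rightarrow> real) \<Rightarrow> complex"
  proof -
    obtain T where T: "\<And>x. x \<in> S \<Longrightarrow> openin (Euclidean_space n) (T x) \<and> x \<in> T x \<and> T x \<subseteq> S \<and> continuous_on (T x) f"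
      using loc by metis
    have "continuous (at x within S) f" if x: "x \<in> S" for x
    proof -
      have "openin (subtopology (Euclidean_space n) S) (T x)" using T[OF that] S by (simp add: openin_open_subtopology)
      then have "openin (top_of_set S) (T x)" using S by (simp add: subtopology_Euclidean_space openin_subset)
      then obtain V where V: "open V" "T x = S \<inter> V" by (auto simp: openin_open)
      have "x \<in> V" using T[OF x] V by auto
      then have "at x within S = at x within T x" using V by (intro at_within_nhd[of x V]) auto
      moreover have "continuous (at x within T x) f" using T[OF x] by (simp add: continuous_on_eq_continuous_within)
      ultimately show ?thesis by simp
    qed
    then show ?thesis by (simp add: continuous_on_eq_continuous_within)
  qed
  show ?thesis using loc
  proof (induction k arbitrary: f)
    case 0
    then show ?case using cont[of f] Ck_on_0 S by metis
  next
    case (Suc k)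
    have d: "\<exists>T. openin (Euclidean_space n) T \<and> x \<in> T \<and> T \<subseteq> S \<and> continuous_on T f \<and>
       (\<forall>i<n. (\<forall>x\<in>T. (\<lambda>t. f (x(i := t))) differentiable (at (x i))) \<and> Ck_on n k T (partial_d i f))" if "x \<in> S" for x
      using Suc.prems[OF that] Ck_on_Suc by metis
    have "continuous_on S f" using cont[of f] d by metis
    moreover have "Ck_on n k S (partial_d i f)" if "i < n" for i
      by (rule Suc.IH) (use d that in metis)
    moreover have "(\<lambda>t. f (x(i := t))) differentiable (at (x i))" if "i < n" "x \<in> S" for i x
      using d[OF that(2)] that(1) by blast
    ultimately show ?case by (simp add: Ck_on_Suc S)
  qed
qed

lemma Ck_on_const: "openin (Euclidean_space n) S \<Longrightarrow> Ck_on n k S (\<lambda>x. c)"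
proof (induction k arbitrary: c)
  case (Suc k)
  have "partial_d i (\<lambda>x. c) = (\<lambda>x. 0)" for i
    by (rule HOL.ext) (simp add: partial_d_def)
  then show ?case using Suc by (simp add: Ck_on_Suc)
qed (simp add: Ck_on_0)

lemma partial_d_has_derivative:
  "(\<lambda>t. f (x(i := t))) differentiable (at (x i)) \<Longrightarrow>
    ((\<lambda>t. f (x(i := t))) has_vector_derivative partial_d i f x) (at (x i))"
  by (simp add: partial_d_def vector_derivative_works)

text \<open>It suffices to exhibit the partial derivatives by formulas \<open>g i\<close>;
  \<open>partial_d i f\<close> agrees with them on \<open>S\<close>, which is enough by
  \<open>Ck_on_cong\<close>.\<close>

lemma Ck_on_SucI:
  assumes S: "openin (Euclidean_space n) S" and c: "continuous_on S f"
    and d: "\<And>i x. i < n \<Longrightarrow> x \<in> S \<Longrightarrow> ((\<lambda>t. f (x(i := t))) has_vector_derivative g i x) (at (x i))"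
    and g: "\<And>i. i < n \<Longrightarrow> Ck_on n k S (g i)"
  shows "Ck_on n (Suc k) S f"
proof -
  have "Ck_on n k S (partial_d i f)" if "i < n" for i
  proof -
    have "partial_d i f x = g i x" if "x \<in> S" for x
      using d[OF \<open>i < n\<close> that] by (simp add: partial_d_def vector_derivative_at)
    then show ?thesis using Ck_on_cong[OF S, of "partial_d i f" "g i"] g[OF that] by simp
  qed
  then show ?thesis using c d differentiableI_vector by (simp add: Ck_on_Suc S) blast
qed

lemma Ck_on_add:
  assumes S: "openin (Euclidean_space n) S"
  shows "Ck_on n k S f \<Longrightarrow> Ck_on n k S g \<Longrightarrow> Ck_on n k S (\<lambda>x. f x + g x)"
proof (induction k arbitrary: f g)
  case (Suc k)
  show ?case
  proof (rule Ck_on_SucI[OF S, where g = "\<lambda>i x. partial_d i f x + partial_d i g x"])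
    fix i x assume "i < n" "x \<in> S"
    then show "((\<lambda>t. f (x(i := t)) + g (x(i := t))) has_vector_derivative partial_d i f x + partial_d i g x) (at (x i))"
      using Suc.prems S by (intro has_vector_derivative_add partial_d_has_derivative) (simp_all add: Ck_on_Suc)
  qed (use Suc S in \<open>simp_all add: Ck_on_Suc continuous_on_add\<close>)
qed (simp add: Ck_on_0 S continuous_on_add)

lemma Ck_on_mult:
  assumes S: "openin (Euclidean_space n) S"
  shows "Ck_on n k S f \<Longrightarrow> Ck_on n k S g \<Longrightarrow> Ck_on n k S (\<lambda>x. f x * g x)"
proof (induction k arbitrary: f g)
  case (Suc k)
  show ?case
  proof (rule Ck_on_SucI[OF S, where g = "\<lambda>i x. f x * partial_d i g x + partial_d i f x * g x"])
    fix i x assume "i < n" "x \<in> S"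
    then show "((\<lambda>t. f (x(i := t)) * g (x(i := t))) has_vector_derivative f x * partial_d i g x + partial_d i f x * g x) (at (x i))"
      using has_vector_derivative_mult[OF partial_d_has_derivative[of f x i] partial_d_has_derivative[of g x i]] Suc.prems S
      by (simp add: Ck_on_Suc)
  next
    show "Ck_on n k S (\<lambda>x. f x * partial_d i g x + partial_d i f x * g x)" if "i < n" for i
      using Suc.prems that Ck_on_SucD[OF S Suc.prems(1)] Ck_on_SucD[OF S Suc.prems(2)]
      by (intro Ck_on_add Suc.IH S) (simp_all add: Ck_on_Suc S)
  qed (use Suc S in \<open>simp add: Ck_on_Suc continuous_on_mult\<close>)
qed (simp add: Ck_on_0 S continuous_on_mult)

lemma Ck_on_inverse:
  assumes S: "openin (Euclidean_space n) S" and nz: "\<And>x. x \<in> S \<Longrightarrow> f x \<noteq> 0"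
  shows "Ck_on n k S f \<Longrightarrow> Ck_on n k S (\<lambda>x. inverse (f x))"
proof (induction k)
  case (Suc k)
  note IH = Suc.IH[OF Ck_on_SucD[OF S Suc.prems]]
  show ?case
  proof (rule Ck_on_SucI[OF S, where g = "\<lambda>i x. (- 1) * (partial_d i f x * (inverse (f x) * inverse (f x)))"])
    fix i x assume i: "i < n" "x \<in> S"
    have 1: "((\<lambda>t. f (x(i := t))) has_vector_derivative partial_d i f x) (at (x i))"
      using Suc.prems S i by (intro partial_d_has_derivative) (simp_all add: Ck_on_Suc)
    have 2: "(inverse has_field_derivative - (inverse (f x) * inverse (f x))) (at (f (x(i := x i))))"
      using DERIV_inverse'[OF DERIV_ident, of "f x" UNIV] nz[OF i(2)] by simp
    from field_vector_diff_chain_at[OF 1 2, unfolded o_def]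
    show "((\<lambda>t. inverse (f (x(i := t)))) has_vector_derivative (- 1) * (partial_d i f x * (inverse (f x) * inverse (f x)))) (at (x i))"
      by (simp del: fun_upd_apply)
  next
    show "Ck_on n k S (\<lambda>x. (- 1) * (partial_d i f x * (inverse (f x) * inverse (f x))))" if "i < n" for i
      using Suc.prems that IH by (intro Ck_on_mult S Ck_on_const) (simp_all add: Ck_on_Suc S)
  qed (use Suc S nz in \<open>simp add: Ck_on_Suc continuous_on_inverse\<close>)
qed (use nz in \<open>simp add: Ck_on_0 S continuous_on_inverse\<close>)

lemma Ck_on_sum:
  assumes S: "openin (Euclidean_space n) S"
  shows "(\<And>j. j \<in> J \<Longrightarrow> Ck_on n k S (f j)) \<Longrightarrow> Ck_on n k S (\<lambda>x. \<Sum>j\<in>J. f j x)"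
  by (induction J rule: infinite_finite_induct) (simp_all add: Ck_on_const Ck_on_add S)

lemma Ck_on_prod:
  assumes S: "openin (Euclidean_space n) S"
  shows "(\<And>j. j \<in> J \<Longrightarrow> Ck_on n k S (f j)) \<Longrightarrow> Ck_on n k S (\<lambda>x. \<Prod>j\<in>J. f j x)"
  by (induction J rule: infinite_finite_induct) (simp_all add: Ck_on_const Ck_on_mult S)

text \<open>\<open>H\<close> lists a function of one real variable together with its successive
  derivatives; keeping \<open>m\<close> arbitrary lets the induction on \<open>k\<close> move along
  the list.\<close>

lemma Ck_on_coordinate:
  assumes S: "openin (Euclidean_space n) S" and j: "j < n"
    and H: "\<And>m t. (H m has_real_derivative H (Suc m) t) (at t)"
  shows "Ck_on n k S (\<lambda>x. complex_of_real (H m (x j)))"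
proof (induction k arbitrary: m)
  case 0
  have "continuous_on UNIV (H m)" using H DERIV_isCont continuous_at_imp_continuous_on by blast
  then have "continuous_on S (\<lambda>x. H m (x j))"
    by (rule continuous_on_compose2) (auto intro: continuous_on_product_coordinates continuous_on_subset)
  then show ?case by (simp add: Ck_on_0 S continuous_on_of_real)
next
  case (Suc k)
  show ?case
  proof (rule Ck_on_SucI[OF S, where g = "\<lambda>i x. if i = j then complex_of_real (H (Suc m) (x j)) else 0"])
    show "continuous_on S (\<lambda>x. complex_of_real (H m (x j)))" using Suc.IH Ck_on_continuous S by blast
    show "Ck_on n k S (\<lambda>x. if i = j then complex_of_real (H (Suc m) (x j)) else 0)" for i
      by (cases "i = j") (simp_all add: Ck_on_const S Suc.IH)
    show "((\<lambda>t. complex_of_real (H m ((x(i := t)) j))) has_vector_derivative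
        (if i = j then complex_of_real (H (Suc m) (x j)) else 0)) (at (x i))" for i x
    proof (cases "i = j")
      case True
      have "((\<lambda>t. complex_of_real (H m t)) has_vector_derivative complex_of_real (H (Suc m) (x j))) (at (x j))"
        using H[of m "x j"] has_vector_derivative_of_real has_real_derivative_iff_has_vector_derivative by blast
      then show ?thesis using True by simp
    qed simp
  qed
qed

lemma smooth_on_Ck: "smooth_on n S f \<Longrightarrow> Ck_on n k S f"
  by (simp add: smooth_on_def)

subsection \<open>Bump functions\<close>

text \<open>With y = 1/x, the derivative of p(y) exp(-y) with respect to x is y^2 (p - p')(y)
  exp(-y), whence the recursion. Started at 1, it produces the polynomial factor in the
  \<open>m\<close>-th derivative of exp(-1/x).\<close>

definition flat_poly :: "nat \<Rightarrow> real poly" where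
  "flat_poly m = ((\<lambda>p. [:0, 0, 1:] * (p - pderiv p)) ^^ m) 1"

definition flat :: "nat \<Rightarrow> real \<Rightarrow> real" where
  "flat m x = (if x > 0 then poly (flat_poly m) (1 / x) * exp (- (1 / x)) else 0)"

lemma poly_exp_tendsto_0: "((\<lambda>y. poly p y * exp (- y)) \<longlongrightarrow> 0) at_top" for p :: "real poly"
proof -
  have "((\<lambda>y. \<Sum>i\<le>degree p. coeff p i * (y ^ i / exp y)) \<longlongrightarrow> (\<Sum>i\<le>degree p. coeff p i * 0)) at_top"
    by (intro tendsto_sum tendsto_mult tendsto_const tendsto_power_div_exp_0)
  moreover have "(\<lambda>y. \<Sum>i\<le>degree p. coeff p i * (y ^ i / exp y)) = (\<lambda>y. poly p y * exp (- y))"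
    by (simp add: poly_altdef sum_distrib_right exp_minus divide_inverse mult.assoc)
  ultimately show ?thesis by simp
qed

lemma flat_derivative: "(flat m has_real_derivative flat (Suc m) x) (at x)"
proof -
  consider "x > 0" | "x < 0" | "x = 0" by linarith
  then show ?thesis
  proof cases
    case 1
    have "((\<lambda>x. poly (flat_poly m) (1 / x) * exp (- (1 / x))) has_real_derivative flat (Suc m) x) (at x)"
      using 1 by (auto intro!: derivative_eq_intros simp: flat_def flat_poly_def power2_eq_square algebra_simps)
    moreover have "eventually (\<lambda>y. y > 0) (nhds x)" using eventually_nhds_in_open[OF open_greaterThan, of x 0] 1 by simp
    then have "eventually (\<lambda>y. flat m y = poly (flat_poly m) (1 / y) * exp (- (1 / y))) (nhds x)"
      by eventually_elim (simp add: flat_def)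
    from DERIV_cong_ev[OF refl this refl] calculation show ?thesis by simp
  next
    case 2
    have "eventually (\<lambda>y. y < 0) (nhds x)" using eventually_nhds_in_open[OF open_lessThan, of x 0] 2 by simp
    then have "eventually (\<lambda>y. flat m y = 0) (nhds x)" by eventually_elim (simp add: flat_def)
    moreover have "flat (Suc m) x = 0" using 2 by (simp add: flat_def)
    ultimately show ?thesis using DERIV_cong_ev[OF refl _ refl, of "flat m" "\<lambda>y. 0" x] by simp
  next
    case 3
    have "((\<lambda>h. flat m h / h) \<longlongrightarrow> 0) (at_right 0)"
    proof -
      have "filterlim (\<lambda>h::real. 1 / h) at_top (at_right 0)"
        using filterlim_inverse_at_top_right by (simp add: inverse_eq_divide)
      \<comment> \<open>Dividing by \<open>h\<close> multiplies a polynomial in 1/h by its variable,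
        which is the factor \<open>[:0, 1:]\<close>.\<close>
      from filterlim_compose[OF poly_exp_tendsto_0[of "[:0, 1:] * flat_poly m"] this]
      have "((\<lambda>h. poly ([:0, 1:] * flat_poly m) (1 / h) * exp (- (1 / h))) \<longlongrightarrow> 0) (at_right 0)" by simp
      moreover have "eventually (\<lambda>h. poly ([:0, 1:] * flat_poly m) (1 / h) * exp (- (1 / h)) = flat m h / h) (at_right 0)"
        unfolding eventually_at_right_field by (rule exI[of _ 1]) (simp add: flat_def)
      ultimately show ?thesis by (rule Lim_transform_eventually)
    qed
    moreover have "((\<lambda>h. flat m h / h) \<longlongrightarrow> 0) (at_left 0)"
    proof -
      have "eventually (\<lambda>h. 0 = flat m h / h) (at_left 0)"
        unfolding eventually_at_left_field by (rule exI[of _ "-1"]) (simp add: flat_def)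
      then show ?thesis by (rule Lim_transform_eventually[OF tendsto_const])
    qed
    ultimately have "((\<lambda>h. flat m h / h) \<longlongrightarrow> 0) (at 0)" by (simp add: filterlim_split_at)
    then show ?thesis using 3 by (simp add: DERIV_def flat_def)
  qed
qed

text \<open>A smooth transition from 0 (for t \<le> 0) to 1 (for t \<ge> 1). The denominator is
  positive, since t and 1 - t cannot both be nonpositive.\<close>

definition flat_step :: "real \<Rightarrow> real" where
  "flat_step t = flat 0 t / (flat 0 t + flat 0 (1 - t))"

lemma flat_0: "flat 0 x = (if x > 0 then exp (- (1 / x)) else 0)"
  by (simp add: flat_def flat_poly_def)

lemma flat_step_denominator: "flat 0 t + flat 0 (1 - t) > 0"
  by (auto simp: flat_0 intro: add_pos_nonneg)

lemma flat_step: "0 \<le> flat_step t" "flat_step t \<le> 1" "t \<ge> 1 \<Longrightarrow> flat_step t = 1" "t \<le> 0 \<Longrightarrow> flat_step t = 0"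
  using flat_step_denominator[of t] by (auto simp: flat_step_def flat_0 divide_simps split: if_splits)

lemma Ck_on_flat_step:
  assumes S: "openin (Euclidean_space n) S" and j: "j < n"
  shows "Ck_on n k S (\<lambda>x. complex_of_real (flat_step (a * x j + b)))"
proof -
  \<comment> \<open>Each derivative of a function of c t + d contributes a factor c; the powers make
    this a list of successive derivatives as \<open>Ck_on_coordinate\<close> expects.\<close>
  have d: "((\<lambda>t. c ^ m * flat m (c * t + d)) has_real_derivative c ^ Suc m * flat (Suc m) (c * t + d)) (at t)" for c d m t
  proof -
    have "((\<lambda>t. flat m (c * t + d)) has_real_derivative flat (Suc m) (c * t + d) * c) (at t)"
      by (rule DERIV_chain2[where g = "\<lambda>t. c * t + d", OF flat_derivative]) (auto intro!: derivative_eq_intros)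
    from DERIV_cmult[OF this, of "c ^ m"] show ?thesis by (simp add: algebra_simps)
  qed
  have 1: "Ck_on n k S (\<lambda>x. complex_of_real (flat 0 (c * x j + d)))" for c d
    using Ck_on_coordinate[OF S j, of "\<lambda>m t. c ^ m * flat m (c * t + d)" k 0, OF d] by simp
  have 2: "Ck_on n k S (\<lambda>x. complex_of_real (flat 0 (1 - (a * x j + b))))"
    using 1[of "- a" "1 - b"] by (simp add: algebra_simps)
  have nz: "complex_of_real (flat 0 (a * x j + b)) + complex_of_real (flat 0 (1 - (a * x j + b))) \<noteq> 0" for x
    using flat_step_denominator[of "a * x j + b"] by (metis less_irrefl of_real_0 of_real_add of_real_eq_iff)
  have "Ck_on n k S (\<lambda>x. complex_of_real (flat 0 (a * x j + b)) *
      inverse (complex_of_real (flat 0 (a * x j + b)) + complex_of_real (flat 0 (1 - (a * x j + b)))))"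
    by (intro Ck_on_mult Ck_on_inverse Ck_on_add S 1 2 nz)
  then show ?thesis by (simp add: flat_step_def divide_inverse)
qed

text \<open>In the scaled coordinate y = (x - c) / \<delta> the factor
  \<open>flat_step (2 + y) * flat_step (2 - y)\<close> is 1 for |y| \<le> 1 and 0 for |y| \<ge> 2.
  The bump is the product of these factors over the coordinates below \<open>n\<close>.\<close>

lemma bump_exists:
  fixes c :: "nat \<Rightarrow> real"
  assumes \<delta>: "\<delta> > 0"
  obtains b :: "(nat \<Rightarrow> real) \<Rightarrow> real" where
    "\<And>S. openin (Euclidean_space n) S \<Longrightarrow> smooth_on n S (\<lambda>x. complex_of_real (b x))"
    "\<And>x. 0 \<le> b x" "\<And>x. b x \<le> 1"
    "\<And>x. (\<And>j. j < n \<Longrightarrow> \<bar>x j - c j\<bar> \<le> \<delta>) \<Longrightarrow> b x = 1"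
    "\<And>x j. j < n \<Longrightarrow> \<bar>x j - c j\<bar> \<ge> 2 * \<delta> \<Longrightarrow> b x = 0"
proof -
  define y where "y = (\<lambda>j (x :: nat \<Rightarrow> real). (x j - c j) / \<delta>)"
  define b where "b = (\<lambda>x. \<Prod>j<n. flat_step (2 + y j x) * flat_step (2 - y j x))"
  show thesis
  proof (rule that[of b])
    show "smooth_on n S (\<lambda>x. complex_of_real (b x))" if S: "openin (Euclidean_space n) S" for S
    proof -
      have "Ck_on n k S (\<lambda>x. complex_of_real (flat_step (2 + y j x)))" if "j < n" for k j
        using Ck_on_flat_step[OF S that, of k "1 / \<delta>" "2 - c j / \<delta>"] by (simp add: y_def diff_divide_distrib algebra_simps)
      moreover have "Ck_on n k S (\<lambda>x. complex_of_real (flat_step (2 - y j x)))" if "j < n" for k j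
        using Ck_on_flat_step[OF S that, of k "- 1 / \<delta>" "2 + c j / \<delta>"] by (simp add: y_def diff_divide_distrib algebra_simps)
      ultimately show ?thesis
        unfolding smooth_on_def b_def of_real_prod of_real_mult by (auto intro!: Ck_on_prod Ck_on_mult S)
    qed
    show "0 \<le> b x" "b x \<le> 1" for x
      unfolding b_def by (auto intro!: prod_nonneg prod_le_1 flat_step mult_nonneg_nonneg mult_le_one)
    show "b x = 1" if "\<And>j. j < n \<Longrightarrow> \<bar>x j - c j\<bar> \<le> \<delta>" for x
    proof -
      have "\<bar>y j x\<bar> \<le> 1" if "j < n" for j
        using \<open>\<And>j. j < n \<Longrightarrow> \<bar>x j - c j\<bar> \<le> \<delta>\<close>[OF that] \<delta> by (simp add: y_def abs_divide)
      then show ?thesis unfolding b_def by (intro prod.neutral) (force simp: flat_step abs_le_iff)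
    qed
    show "b x = 0" if "j < n" "\<bar>x j - c j\<bar> \<ge> 2 * \<delta>" for x j
    proof -
      have "\<bar>y j x\<bar> \<ge> 2" using that \<delta> by (simp add: y_def abs_divide pos_le_divide_eq)
      then have "flat_step (2 + y j x) * flat_step (2 - y j x) = 0" using flat_step(4) by (auto simp: abs_if split: if_splits)
      then show ?thesis unfolding b_def using that(1) by (intro prod_zero) auto
    qed
  qed
qed

section \<open>Boxes as neighbourhoods and as compact sets\<close>

lemma Euclidean_space_box:
  assumes S: "openin (Euclidean_space n) S" and c: "c \<in> S"
  obtains \<delta> where "\<delta> > 0" "\<And>x. x \<in> topspace (Euclidean_space n) \<Longrightarrow> (\<And>j. j < n \<Longrightarrow> \<bar>x j - c j\<bar> \<le> 2 * \<delta>) \<Longrightarrow> x \<in> S"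
proof -
  obtain T where T: "openin (powertop_real UNIV) T" "S = T \<inter> {x. \<forall>i\<ge>n. x i = 0}"
    using S by (auto simp: Euclidean_space_def openin_subtopology)
  obtain U where U: "\<And>i. open (U i)" "c \<in> (\<Pi>\<^sub>E i\<in>UNIV. U i)" "(\<Pi>\<^sub>E i\<in>UNIV. U i) \<subseteq> T"
  proof -
    have "c \<in> T" using T c by auto
    with T(1)[unfolded openin_product_topology_alt]
    obtain U where "\<forall>i\<in>UNIV. openin euclideanreal (U i)" "c \<in> Pi\<^sub>E UNIV U" "Pi\<^sub>E UNIV U \<subseteq> T" by meson
    then show thesis by (intro that[of U]) simp_all
  qed
  have "\<exists>e>0. \<forall>t. \<bar>t - c i\<bar> \<le> 2 * e \<longrightarrow> t \<in> U i" for i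
  proof -
    have "c i \<in> U i" using U(2) by auto
    then obtain e where e: "e > 0" "\<And>t. dist t (c i) < e \<Longrightarrow> t \<in> U i" using U(1)[of i] by (auto simp: open_dist)
    \<comment> \<open>A third of the radius leaves room for the closed interval of radius
      \<open>2 * e\<close>.\<close>
    then show ?thesis by (intro exI[of _ "e / 3"]) (auto simp: dist_real_def)
  qed
  then obtain e where e: "\<And>i. e i > 0" "\<And>i t. \<bar>t - c i\<bar> \<le> 2 * e i \<Longrightarrow> t \<in> U i" by metis
  \<comment> \<open>Only the coordinates below \<open>n\<close> restrict anything, as the others are
    0 throughout; the inserted 1 gives the minimum a meaning for \<open>n = 0\<close>.\<close>
  define \<delta> where "\<delta> = Min (insert 1 (e ` {..<n}))"
  show thesis
  proof (rule that[of \<delta>])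
    show "\<delta> > 0" using e(1) by (auto simp: \<delta>_def)
    fix x assume x: "x \<in> topspace (Euclidean_space n)" "\<And>j. j < n \<Longrightarrow> \<bar>x j - c j\<bar> \<le> 2 * \<delta>"
    have "x i \<in> U i" for i
    proof (cases "i < n")
      case True
      then have "\<delta> \<le> e i" by (simp add: \<delta>_def)
      then show ?thesis using x(2)[OF True] e(2)[of "x i" i] by linarith
    next
      case False
      then have "x i = c i" using x(1) c T(2) by (simp add: topspace_Euclidean_space)
      then show ?thesis using U(2) by auto
    qed
    then show "x \<in> S" using U(3) T(2) x(1) by (auto simp: topspace_Euclidean_space PiE_def)
  qed
qed

text \<open>In the full product the box is a product of compact intervals and, from \<open>n\<close>
  on, of the single point 0, hence compact by Tychonoff.\<close>

lemma compactin_Euclidean_box: "compactin (Euclidean_space n) {x \<in> topspace (Euclidean_space n). \<forall>j<n. \<bar>x j - c j\<bar> \<le> r}"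
proof -
  have eq: "{x \<in> topspace (Euclidean_space n). \<forall>j<n. \<bar>x j - c j\<bar> \<le> r} =
     (\<Pi>\<^sub>E i\<in>UNIV. if i < n then {c i - r..c i + r} else {0})"
    by (auto simp: topspace_Euclidean_space PiE_iff abs_diff_le_iff not_less)
       (metis atLeastAtMost_iff not_less singletonD)+
  have "compactin (powertop_real UNIV) (\<Pi>\<^sub>E i\<in>UNIV. if i < n then {c i - r..c i + r} else {0})"
    by (subst compactin_PiE) auto
  then show ?thesis unfolding eq
    unfolding Euclidean_space_def compactin_subtopology using eq by (auto simp: topspace_Euclidean_space)
qed

lemma openin_Euclidean_box: "openin (Euclidean_space n) {x \<in> topspace (Euclidean_space n). \<forall>j<n. \<bar>x j - c j\<bar> < r}"
proof -
  have "open {x :: nat \<Rightarrow> real. \<forall>j\<in>{..<n}. \<bar>x j - c j\<bar> < r}"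
    unfolding Collect_ball_eq
    by (intro open_INT ballI finite_lessThan open_Collect_less continuous_intros continuous_on_product_coordinates)
  then have "openin (top_of_set (topspace (Euclidean_space n))) (topspace (Euclidean_space n) \<inter> {x. \<forall>j\<in>{..<n}. \<bar>x j - c j\<bar> < r})"
    by (rule openin_open_Int)
  moreover have "{x \<in> topspace (Euclidean_space n). \<forall>j<n. \<bar>x j - c j\<bar> < r} =
     topspace (Euclidean_space n) \<inter> {x. \<forall>j\<in>{..<n}. \<bar>x j - c j\<bar> < r}" by auto
  ultimately show ?thesis using Euclidean_space_eq[of n] by simp
qed

section \<open>Residues\<close>

context ringed
begin

lemma germ_self:
  assumes "Op W" "b \<in> W" "f \<in> carrier (sect A W)"
  shows "(W, f) \<in> germ A b W f"
  unfolding germ_def using assms by auto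

text \<open>
  A compatible family of C-algebra homomorphisms on the sections around \<open>b\<close> computes the residue:
  its kernel is a maximal ideal of the stalk, hence the only one.
\<close>

lemma val_eqI:
  assumes b: "b \<in> topspace (base A)"
    and add: "\<And>W f g. Op W \<Longrightarrow> b \<in> W \<Longrightarrow> f \<in> carrier (sect A W) \<Longrightarrow> g \<in> carrier (sect A W) \<Longrightarrow>
       e W (f \<oplus>\<^bsub>sect A W\<^esub> g) = e W f + e W g"
    and mult: "\<And>W f g. Op W \<Longrightarrow> b \<in> W \<Longrightarrow> f \<in> carrier (sect A W) \<Longrightarrow> g \<in> carrier (sect A W) \<Longrightarrow>
       e W (f \<otimes>\<^bsub>sect A W\<^esub> g) = e W f * e W g"
    and cst: "\<And>W c. Op W \<Longrightarrow> b \<in> W \<Longrightarrow> e W (cst W c) = c"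
    and res: "\<And>W W' f. Op W \<Longrightarrow> Op W' \<Longrightarrow> b \<in> W' \<Longrightarrow> W' \<subseteq> W \<Longrightarrow> f \<in> carrier (sect A W) \<Longrightarrow>
       e W' (res A W W' f) = e W f"
    and W: "Op W" "b \<in> W" and f: "f \<in> carrier (sect A W)"
  shows "val A W f b = e W f"
proof -
  let ?R = "stalk A b"
  have lr: "cring ?R" "\<exists>!I. maximalideal I ?R" using lrs b by (auto simp: locally_ringed_space_def local_ring_def)
  interpret R: cring ?R by (rule lr)
  have S: "cring complex_ring" using algA[of "topspace (base A)"] by (auto dest: algebra.R_cring)
  have carr: "x \<in> carrier ?R \<longleftrightarrow> (\<exists>W f. x = germ A b W f \<and> Op W \<and> b \<in> W \<and> f \<in> carrier (sect A W))" for x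
    by (auto simp: stalk_def)
  have germ_e: "Op W' \<and> b \<in> W' \<and> g \<in> carrier (sect A W') \<and> e W' g = e W f"
    if "(W', g) \<in> germ A b W f" "Op W" "b \<in> W" "f \<in> carrier (sect A W)" for W' g W f
  proof -
    have "\<exists>V. Op V \<and> b \<in> V \<and> V \<subseteq> W \<inter> W' \<and> res A W V f = res A W' V g"
      and g: "Op W'" "b \<in> W'" "g \<in> carrier (sect A W')"
      using that(1) by (simp_all add: germ_def)
    then obtain V where V: "Op V" "b \<in> V" "V \<subseteq> W \<inter> W'" "res A W V f = res A W' V g" by blast
    have "e W' g = e V (res A W' V g)" using res[OF g(1) V(1,2) _ g(3)] V(3) by simp
    also have "\<dots> = e W f" using res[OF that(2) V(1,2) _ that(4)] V(3,4) by simp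
    finally show ?thesis using g by simp
  qed
  \<comment> \<open>A germ is a set of pairs, so its value is read off a chosen representative;
    \<open>germ_e\<close> makes the result independent of the choice.\<close>
  define E where "E = (\<lambda>x. let p = (SOME p. p \<in> x) in e (fst p) (snd p))"
  have E: "E x = e W f \<and> Op W \<and> b \<in> W \<and> f \<in> carrier (sect A W)" if x: "x \<in> carrier ?R" "(W, f) \<in> x" for x W f
  proof -
    obtain V h where V: "x = germ A b V h" "Op V" "b \<in> V" "h \<in> carrier (sect A V)" using x carr by blast
    have "(SOME p. p \<in> x) \<in> x" using x(2) by (rule someI)
    then have "(fst (SOME p. p \<in> x), snd (SOME p. p \<in> x)) \<in> x" by simp
    from germ_e[OF this[unfolded V(1)] V(2-4)] germ_e[OF x(2)[unfolded V(1)] V(2-4)]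
    show ?thesis by (simp add: E_def V(1))
  qed
  have rep: "\<exists>W f. (W, f) \<in> x" if "x \<in> carrier ?R" for x
    using that carr germ_self by metis
  have germ_carr: "germ A b W f \<in> carrier ?R" if "Op W" "b \<in> W" "f \<in> carrier (sect A W)" for W f
    using that carr by blast
  have E_germ: "E (germ A b W f) = e W f" if "Op W" "b \<in> W" "f \<in> carrier (sect A W)" for W f
    using E[OF germ_carr germ_self] that by blast
  have ops: "E (x \<otimes>\<^bsub>?R\<^esub> y) = E x * E y \<and> E (x \<oplus>\<^bsub>?R\<^esub> y) = E x + E y" if x: "x \<in> carrier ?R" and y: "y \<in> carrier ?R" for x y
  proof -
    obtain W f where f: "(W, f) \<in> x" using rep[OF x] by blast
    obtain V g where g: "(V, g) \<in> y" using rep[OF y] by blast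
    note f' = E[OF x f] and g' = E[OF y g]
    have WV: "Op (W \<inter> V)" "b \<in> W \<inter> V" "W \<inter> V \<subseteq> W" "W \<inter> V \<subseteq> V" using f' g' by auto
    let ?f = "res A W (W \<inter> V) f" and ?g = "res A V (W \<inter> V) g"
    have fg: "?f \<in> carrier (sect A (W \<inter> V))" "?g \<in> carrier (sect A (W \<inter> V))"
      using resA_closed f' g' WV by auto
    interpret r: cring "sect A (W \<inter> V)" by (rule cringA[OF WV(1)])
    have "(W \<inter> V, ?f \<otimes>\<^bsub>sect A (W \<inter> V)\<^esub> ?g) \<in> x \<otimes>\<^bsub>?R\<^esub> y"
      using f g germ_self[OF WV(1,2), of "?f \<otimes>\<^bsub>sect A (W \<inter> V)\<^esub> ?g"] fg unfolding stalk_def by fastforce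
    from E[OF R.m_closed[OF x y] this] have "E (x \<otimes>\<^bsub>?R\<^esub> y) = e (W \<inter> V) ?f * e (W \<inter> V) ?g"
      using mult[OF WV(1,2) fg] by simp
    moreover have "(W \<inter> V, ?f \<oplus>\<^bsub>sect A (W \<inter> V)\<^esub> ?g) \<in> x \<oplus>\<^bsub>?R\<^esub> y"
      using f g germ_self[OF WV(1,2), of "?f \<oplus>\<^bsub>sect A (W \<inter> V)\<^esub> ?g"] fg unfolding stalk_def by fastforce
    from E[OF R.a_closed[OF x y] this] have "E (x \<oplus>\<^bsub>?R\<^esub> y) = e (W \<inter> V) ?f + e (W \<inter> V) ?g"
      using add[OF WV(1,2) fg] by simp
    ultimately show ?thesis using f' g' res[of W "W \<inter> V"] res[of V "W \<inter> V"] WV by simp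
  qed
  have one: "E \<one>\<^bsub>?R\<^esub> = 1"
  proof -
    have "\<one>\<^bsub>?R\<^esub> = germ A b (topspace (base A)) (cst (topspace (base A)) 1)"
      by (simp add: stalk_def cst_one)
    then show ?thesis using E_germ[OF _ b, of "cst (topspace (base A)) 1"] cst[OF _ b] cst_closed by simp
  qed
  interpret h: ring_hom_ring ?R complex_ring E
    by (rule ring_hom_ringI)
       (use ops one S in \<open>auto simp: complex_ring_def R.ring_axioms cring.axioms(1)\<close>)
  have K: "a_kernel ?R complex_ring E = {x \<in> carrier ?R. E x = 0}"
    unfolding a_kernel_def kernel_def complex_ring_def by simp
  let ?M = "{x \<in> carrier ?R. E x = 0}"
  have M: "ideal ?M ?R" using h.kernel_is_ideal K by simp
  have "maximalideal ?M ?R"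
  proof (rule maximalidealI[OF M])
    show "carrier ?R \<noteq> ?M" using one R.one_closed by force
    fix J assume J: "ideal J ?R" "?M \<subseteq> J" "J \<subseteq> carrier ?R"
    show "J = ?M \<or> J = carrier ?R"
    proof (cases "J = ?M")
      case False
      then obtain x where x: "x \<in> J" "E x \<noteq> 0" "x \<in> carrier ?R" using J by auto
      \<comment> \<open>Scaling \<open>x\<close> to value 1 gives y in J, and 1 - y has value 0, so
        it lies in the kernel and hence in J. Then 1 lies in J, which is the whole stalk.\<close>
      let ?k = "germ A b (topspace (base A)) (cst (topspace (base A)) (1 / E x))"
      have k: "?k \<in> carrier ?R" "E ?k = 1 / E x"
        using germ_carr[OF _ b cst_closed] E_germ[OF _ b cst_closed] cst[OF _ b] by auto
      let ?y = "?k \<otimes>\<^bsub>?R\<^esub> x"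
      have y: "?y \<in> J" "?y \<in> carrier ?R" "E ?y = 1" using ideal.I_l_closed[OF J(1) x(1) k(1)] ops[OF k(1) x(3)] k x by auto
      let ?z = "\<one>\<^bsub>?R\<^esub> \<ominus>\<^bsub>?R\<^esub> ?y"
      have z: "?z \<in> carrier ?R" "?z \<oplus>\<^bsub>?R\<^esub> ?y = \<one>\<^bsub>?R\<^esub>"
        using y(2) by (simp_all add: a_minus_def R.a_assoc R.l_neg)
      have "E ?z + E ?y = 1" using ops[OF z(1) y(2)] one z(2) by simp
      then have "?z \<in> J" using J(2) z(1) y(3) by auto
      then have "\<one>\<^bsub>?R\<^esub> \<in> J" using y(1) z(2) additive_subgroup.a_closed[OF ideal.axioms(1)[OF J(1)], of ?z ?y] by simp
      then show ?thesis using ideal.one_imp_carrier[OF J(1)] by blast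
    qed simp
  qed
  then have maxi: "max_ideal ?R = ?M"
    unfolding max_ideal_def using lr(2) by (rule the1_equality[rotated])
  interpret r: cring "sect A W" by (rule cringA[OF W(1)])
  have "germ A b W (f \<ominus>\<^bsub>sect A W\<^esub> cst W c) \<in> max_ideal ?R \<longleftrightarrow> c = e W f" for c
  proof -
    have c: "cst W c \<in> carrier (sect A W)" by (rule cst_closed[OF W(1)])
    have "(f \<ominus>\<^bsub>sect A W\<^esub> cst W c) \<oplus>\<^bsub>sect A W\<^esub> cst W c = f"
      using f c by (simp add: a_minus_def r.a_assoc r.l_neg)
    then have "e W f = e W (f \<ominus>\<^bsub>sect A W\<^esub> cst W c) + c"
      using add[OF W, of "f \<ominus>\<^bsub>sect A W\<^esub> cst W c" "cst W c"] f c cst[OF W] by simp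
    then show ?thesis using maxi germ_carr[OF W] E_germ[OF W] f c by auto
  qed
  then show ?thesis unfolding val_def cst_def by auto
qed

end

section \<open>Charts\<close>

text \<open>Only \<beta> = 0 lies below the exponent 0, so taking the constant coefficient is
  multiplicative. This is what makes \<open>ev\<close> multiplicative.\<close>

lemma formal_functions_mult_0: "mult (formal_functions n k V) f g (\<lambda>_. 0) x = f (\<lambda>_. 0) x * g (\<lambda>_. 0) x"
proof -
  have "{\<beta> :: nat \<Rightarrow> nat. \<forall>i. \<beta> i = 0} = {\<lambda>_. 0}" by auto
  then show ?thesis by (simp add: formal_functions_def)
qed

lemma formal_functions_closed:
  assumes V: "openin (Euclidean_space n) V"
  shows "f \<in> carrier (formal_functions n k V) \<Longrightarrow> g \<in> carrier (formal_functions n k V) \<Longrightarrow>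
      f \<oplus>\<^bsub>formal_functions n k V\<^esub> g \<in> carrier (formal_functions n k V)"
    and "f \<in> carrier (formal_functions n k V) \<Longrightarrow> g \<in> carrier (formal_functions n k V) \<Longrightarrow>
      f \<otimes>\<^bsub>formal_functions n k V\<^esub> g \<in> carrier (formal_functions n k V)"
    and "c \<odot>\<^bsub>formal_functions n k V\<^esub> \<one>\<^bsub>formal_functions n k V\<^esub> \<in> carrier (formal_functions n k V)"
    and "\<one>\<^bsub>formal_functions n k V\<^esub> \<in> carrier (formal_functions n k V)"
    and "\<zero>\<^bsub>formal_functions n k V\<^esub> \<in> carrier (formal_functions n k V)"
proof -
  show "f \<oplus>\<^bsub>formal_functions n k V\<^esub> g \<in> carrier (formal_functions n k V)"
    if "f \<in> carrier (formal_functions n k V)" "g \<in> carrier (formal_functions n k V)"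
    using that by (auto simp: formal_functions_def smooth_on_def intro!: Ck_on_add V)
  show "f \<otimes>\<^bsub>formal_functions n k V\<^esub> g \<in> carrier (formal_functions n k V)"
    if f: "f \<in> carrier (formal_functions n k V)" and g: "g \<in> carrier (formal_functions n k V)"
  proof -
    \<comment> \<open>A nonzero entry of \<alpha> at a place beyond the \<open>k\<close> variables
      is inherited by \<beta> or by \<alpha> - \<beta>, so one of the two coefficients
      vanishes.\<close>
    have fz: "f \<beta> x * g (\<lambda>i. \<alpha> i - \<beta> i) x = 0" if "x \<notin> V \<or> (\<exists>i\<ge>k. \<alpha> i \<noteq> 0)" "\<forall>i. \<beta> i \<le> \<alpha> i" for \<alpha> \<beta> x
      using that(1)
    proof
      assume "\<exists>i\<ge>k. \<alpha> i \<noteq> 0"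
      then obtain i where i: "i \<ge> k" "\<alpha> i \<noteq> 0" by blast
      show ?thesis
      proof (cases "\<beta> i = 0")
        case True
        then have nz: "\<exists>i\<ge>k. (\<lambda>i. \<alpha> i - \<beta> i) i \<noteq> 0" using i by auto
        have "\<forall>\<alpha> x. x \<notin> V \<or> (\<exists>i\<ge>k. \<alpha> i \<noteq> 0) \<longrightarrow> g \<alpha> x = 0"
          using g unfolding formal_functions_def partial_object.simps mem_Collect_eq by (rule conjunct2)
        from this[rule_format, OF disjI2[OF nz]] have "g (\<lambda>i. \<alpha> i - \<beta> i) x = 0" .
        then show ?thesis by simp
      next
        case False
        then show ?thesis using f i by (auto simp: formal_functions_def)
      qed
    qed (use f in \<open>simp add: formal_functions_def\<close>)
    have "(\<Sum>\<beta> | \<forall>i. \<beta> i \<le> \<alpha> i. f \<beta> x * g (\<lambda>i. \<alpha> i - \<beta> i) x) = 0" if "x \<notin> V \<or> (\<exists>i\<ge>k. \<alpha> i \<noteq> 0)" for \<alpha> x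
      by (rule sum.neutral, rule ballI, rule fz[OF that], simp)
    moreover have "smooth_on n V (\<lambda>x. \<Sum>\<beta> | \<forall>i. \<beta> i \<le> \<alpha> i. f \<beta> x * g (\<lambda>i. \<alpha> i - \<beta> i) x)" for \<alpha>
      using f g by (auto simp: formal_functions_def smooth_on_def intro!: Ck_on_sum Ck_on_mult V)
    ultimately show ?thesis by (simp add: formal_functions_def)
  qed
  have c: "smooth_on n V (\<lambda>x. if x \<in> V \<and> P then c else 0)" for P and c :: complex
    using Ck_on_cong[OF V, of "\<lambda>x. if x \<in> V \<and> P then c else 0" "\<lambda>x. if P then c else 0"] Ck_on_const[OF V]
    by (cases P) (simp_all add: smooth_on_def)
  show "c \<odot>\<^bsub>formal_functions n k V\<^esub> \<one>\<^bsub>formal_functions n k V\<^esub> \<in> carrier (formal_functions n k V)"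
    using c[of _ c] by (auto simp: formal_functions_def if_distrib cong: if_cong)
  show "\<one>\<^bsub>formal_functions n k V\<^esub> \<in> carrier (formal_functions n k V)"
    using c[of _ 1] by (auto simp: formal_functions_def)
  show "\<zero>\<^bsub>formal_functions n k V\<^esub> \<in> carrier (formal_functions n k V)"
    using c[of False 0] by (auto simp: formal_functions_def)
qed

locale formal_mfd =
  fixes A :: "('m, 's) ringed_space"
  assumes mfd: "formal_manifold A"

sublocale formal_mfd \<subseteq> ringed
  using mfd by unfold_locales (simp add: formal_manifold_def)

text \<open>The data of one isomorphism with a formal Euclidean space, unpacked: \<phi> acts on
  points, and \<theta> in the opposite direction on sections, from power series over
  \<open>V\<close> to sections of \<open>A\<close> over the preimage of \<open>V\<close>.\<close>

locale formal_chart = formal_mfd A for A :: "('m, 's) ringed_space" +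
  fixes U :: "'m set" and n k :: nat and \<phi> :: "'m \<Rightarrow> nat \<Rightarrow> real"
    and \<theta> :: "(nat \<Rightarrow> real) set \<Rightarrow> ((nat \<Rightarrow> nat) \<Rightarrow> (nat \<Rightarrow> real) \<Rightarrow> complex) \<Rightarrow> 's"
  assumes U: "Op U"
    and homeo: "homeomorphic_map (subtopology (base A) U) (Euclidean_space n) \<phi>"
    and iso: "openin (Euclidean_space n) V \<Longrightarrow> \<theta> V \<in> ring_iso (formal_functions n k V) (sect A {a \<in> U. \<phi> a \<in> V})"
    and smult: "openin (Euclidean_space n) V \<Longrightarrow> f \<in> carrier (formal_functions n k V) \<Longrightarrow>
       \<theta> V (c \<odot>\<^bsub>formal_functions n k V\<^esub> f) = c \<odot>\<^bsub>sect A {a \<in> U. \<phi> a \<in> V}\<^esub> \<theta> V f"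
    and natural: "openin (Euclidean_space n) V \<Longrightarrow> openin (Euclidean_space n) W \<Longrightarrow> W \<subseteq> V \<Longrightarrow>
       f \<in> carrier (formal_functions n k V) \<Longrightarrow>
       \<theta> W (\<lambda>\<alpha> x. if x \<in> W then f \<alpha> x else 0) = res A {a \<in> U. \<phi> a \<in> V} {a \<in> U. \<phi> a \<in> W} (\<theta> V f)"

lemma (in formal_mfd) formal_chart_exists:
  assumes "a \<in> topspace (base A)"
  obtains U n k \<phi> \<theta> where "formal_chart A U n k \<phi> \<theta>" "a \<in> U"
proof -
  obtain U n k where U: "Op U" "a \<in> U" "lrs_isomorphic (restr A U) (formal_Euclidean_space n k)"
    using mfd assms by (auto simp: formal_manifold_def)
  then obtain \<phi> \<theta> where h: "homeomorphic_map (subtopology (base A) U) (Euclidean_space n) \<phi>"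
    and i: "\<forall>V. openin (Euclidean_space n) V \<longrightarrow> (let T = {a \<in> topspace (base (restr A U)). \<phi> a \<in> V} in
        \<theta> V \<in> ring_iso (formal_functions n k V) (sect A T) \<and> (\<forall>c. \<forall>f \<in> carrier (formal_functions n k V).
        \<theta> V (c \<odot>\<^bsub>formal_functions n k V\<^esub> f) = c \<odot>\<^bsub>sect A T\<^esub> \<theta> V f))"
    and n: "\<forall>V W. openin (Euclidean_space n) V \<and> openin (Euclidean_space n) W \<and> W \<subseteq> V \<longrightarrow>
           (\<forall>f \<in> carrier (formal_functions n k V). \<theta> W (\<lambda>\<alpha> x. if x \<in> W then f \<alpha> x else 0) =
              res A {a \<in> topspace (base (restr A U)). \<phi> a \<in> V} {a \<in> topspace (base (restr A U)). \<phi> a \<in> W} (\<theta> V f))"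
    unfolding lrs_isomorphic_def by (auto simp: restr_def formal_Euclidean_space_def)
  have t: "topspace (base (restr A U)) = U" using openin_subset[OF U(1)] by (auto simp: restr_def topspace_subtopology)
  have "formal_chart A U n k \<phi> \<theta>"
    by unfold_locales (use U h i n in \<open>simp_all add: t Let_def\<close>)
  then show thesis using U(2) that by blast
qed

context formal_chart
begin

lemma phi_inj: "inj_on \<phi> U"
  using homeomorphic_imp_injective_map[OF homeo] openin_subset[OF U] by (simp add: topspace_subtopology Int_absorb1)

lemma phi_image: "\<phi> ` U = topspace (Euclidean_space n)"
  using homeomorphic_imp_surjective_map[OF homeo] openin_subset[OF U] by (simp add: topspace_subtopology Int_absorb1)

lemma openin_phi: "Op W \<Longrightarrow> W \<subseteq> U \<Longrightarrow> openin (Euclidean_space n) (\<phi> ` W)"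
  using homeomorphic_imp_open_map[OF homeo] openin_restr[OF U] by (simp add: open_map_def)

lemma preimage_phi: "W \<subseteq> U \<Longrightarrow> {a \<in> U. \<phi> a \<in> \<phi> ` W} = W"
  using phi_inj by (auto simp: inj_on_def)

lemma openin_preimage: "openin (Euclidean_space n) V \<Longrightarrow> Op {a \<in> U. \<phi> a \<in> V}"
proof -
  assume V: "openin (Euclidean_space n) V"
  have "openin (subtopology (base A) U) {a \<in> topspace (subtopology (base A) U). \<phi> a \<in> V}"
    by (rule openin_continuous_map_preimage[OF homeomorphic_imp_continuous_map[OF homeo] V])
  then show ?thesis using openin_subset[OF U] openin_restr[OF U] by (simp add: topspace_subtopology Int_absorb1)
qed

definition \<psi> :: "'m set \<Rightarrow> 's \<Rightarrow> (nat \<Rightarrow> nat) \<Rightarrow> (nat \<Rightarrow> real) \<Rightarrow> complex" where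
  "\<psi> W f = inv_into (carrier (formal_functions n k (\<phi> ` W))) (\<theta> (\<phi> ` W)) f"

text \<open>The constant coefficient of the coordinate expression at the image of the point. It is
  the candidate for the residue, and \<open>val_ev_Int\<close> confirms it.\<close>

definition ev :: "'m set \<Rightarrow> 's \<Rightarrow> 'm \<Rightarrow> complex" where
  "ev W f b = \<psi> W f (\<lambda>_. 0) (\<phi> b)"

context
  fixes W assumes W: "Op W" "W \<subseteq> U"
begin

lemma theta_iso: "\<theta> (\<phi> ` W) \<in> ring_iso (formal_functions n k (\<phi> ` W)) (sect A W)"
  using iso[OF openin_phi[OF W]] preimage_phi[OF W(2)] by simp

lemma theta_bij: "bij_betw (\<theta> (\<phi> ` W)) (carrier (formal_functions n k (\<phi> ` W))) (carrier (sect A W))"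
  using theta_iso by (simp add: ring_iso_def)

lemma theta_hom: "\<theta> (\<phi> ` W) \<in> Ring.ring_hom (formal_functions n k (\<phi> ` W)) (sect A W)"
  using theta_iso by (simp add: ring_iso_def)

lemma psi_closed: "f \<in> carrier (sect A W) \<Longrightarrow> \<psi> W f \<in> carrier (formal_functions n k (\<phi> ` W))"
  using theta_bij inv_into_into unfolding \<psi>_def bij_betw_def by metis

lemma theta_psi: "f \<in> carrier (sect A W) \<Longrightarrow> \<theta> (\<phi> ` W) (\<psi> W f) = f"
  using theta_bij f_inv_into_f unfolding \<psi>_def bij_betw_def by metis

lemma theta_closed: "g \<in> carrier (formal_functions n k (\<phi> ` W)) \<Longrightarrow> \<theta> (\<phi> ` W) g \<in> carrier (sect A W)"
  using theta_bij by (rule bij_betwE[THEN bspec])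

lemma psi_eqI: "g \<in> carrier (formal_functions n k (\<phi> ` W)) \<Longrightarrow> \<theta> (\<phi> ` W) g = f \<Longrightarrow> \<psi> W f = g"
  unfolding \<psi>_def using theta_bij by (auto simp: bij_betw_def)

text \<open>Membership in \<open>ring_hom\<close> speaks of sums, products and the unit. Zero is
  recovered from z + z = z by cancellation in the ring of sections.\<close>

lemma theta_zero: "\<theta> (\<phi> ` W) \<zero>\<^bsub>formal_functions n k (\<phi> ` W)\<^esub> = \<zero>\<^bsub>sect A W\<^esub>"
proof -
  interpret r: cring "sect A W" by (rule cringA[OF W(1)])
  let ?z = "\<zero>\<^bsub>formal_functions n k (\<phi> ` W)\<^esub>"
  have z: "?z \<in> carrier (formal_functions n k (\<phi> ` W))" "?z \<oplus>\<^bsub>formal_functions n k (\<phi> ` W)\<^esub> ?z = ?z"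
    using formal_functions_closed(5)[OF openin_phi[OF W]] by (auto simp: formal_functions_def)
  have "\<theta> (\<phi> ` W) ?z \<oplus>\<^bsub>sect A W\<^esub> \<theta> (\<phi> ` W) ?z = \<theta> (\<phi> ` W) ?z"
    using ring_hom_add[OF theta_hom z(1) z(1)] z(2) by simp
  then show ?thesis using theta_closed[OF z(1)] r.add.l_cancel_one by blast
qed

lemma ev_add: "f \<in> carrier (sect A W) \<Longrightarrow> g \<in> carrier (sect A W) \<Longrightarrow> ev W (f \<oplus>\<^bsub>sect A W\<^esub> g) b = ev W f b + ev W g b"
proof -
  assume f: "f \<in> carrier (sect A W)" and g: "g \<in> carrier (sect A W)"
  have "\<psi> W (f \<oplus>\<^bsub>sect A W\<^esub> g) = \<psi> W f \<oplus>\<^bsub>formal_functions n k (\<phi> ` W)\<^esub> \<psi> W g"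
    using f g by (intro psi_eqI formal_functions_closed openin_phi W psi_closed)
      (simp_all add: ring_hom_add[OF theta_hom] psi_closed theta_psi)
  then show ?thesis by (simp add: ev_def) (simp add: formal_functions_def)
qed

lemma ev_mult: "f \<in> carrier (sect A W) \<Longrightarrow> g \<in> carrier (sect A W) \<Longrightarrow> ev W (f \<otimes>\<^bsub>sect A W\<^esub> g) b = ev W f b * ev W g b"
proof -
  assume f: "f \<in> carrier (sect A W)" and g: "g \<in> carrier (sect A W)"
  have "\<psi> W (f \<otimes>\<^bsub>sect A W\<^esub> g) = \<psi> W f \<otimes>\<^bsub>formal_functions n k (\<phi> ` W)\<^esub> \<psi> W g"
    using f g by (intro psi_eqI formal_functions_closed openin_phi W psi_closed)
      (simp_all add: ring_hom_mult[OF theta_hom] psi_closed theta_psi)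
  then show ?thesis by (simp add: ev_def formal_functions_mult_0)
qed

lemma ev_cst: "b \<in> W \<Longrightarrow> ev W (cst W c) b = c"
proof -
  assume b: "b \<in> W"
  let ?B = "formal_functions n k (\<phi> ` W)"
  have "\<psi> W (cst W c) = c \<odot>\<^bsub>?B\<^esub> \<one>\<^bsub>?B\<^esub>"
    using smult[OF openin_phi[OF W] formal_functions_closed(4)[OF openin_phi[OF W]], of c] preimage_phi[OF W(2)]
    by (intro psi_eqI formal_functions_closed openin_phi W) (simp add: cst_def ring_hom_one[OF theta_hom])
  then show ?thesis using b by (simp add: ev_def) (simp add: formal_functions_def)
qed

end

lemma ev_res:
  assumes W: "Op W" "W \<subseteq> U" and W': "Op W'" "W' \<subseteq> W" and b: "b \<in> W'" and f: "f \<in> carrier (sect A W)"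
  shows "ev W' (res A W W' f) b = ev W f b"
proof -
  have WU: "W' \<subseteq> U" using W W' by auto
  let ?g = "\<lambda>\<alpha> x. if x \<in> \<phi> ` W' then \<psi> W f \<alpha> x else 0"
  have g: "?g \<in> carrier (formal_functions n k (\<phi> ` W'))"
  proof -
    have "smooth_on n (\<phi> ` W') (?g \<alpha>)" for \<alpha>
      using Ck_on_cong[OF openin_phi[OF W'(1) WU], of "?g \<alpha>" "\<psi> W f \<alpha>"] psi_closed[OF W f]
        Ck_on_subset[OF openin_phi[OF W] openin_phi[OF W'(1) WU] image_mono[OF W'(2)]]
      by (auto simp: smooth_on_def formal_functions_def)
    then show ?thesis using psi_closed[OF W f] by (auto simp: formal_functions_def)
  qed
  have "\<theta> (\<phi> ` W') ?g = res A W W' f"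
    using natural[OF openin_phi[OF W] openin_phi[OF W'(1) WU] image_mono[OF W'(2)] psi_closed[OF W f]]
    by (simp add: preimage_phi[OF W(2)] preimage_phi[OF WU] theta_psi[OF W f])
  then have "\<psi> W' (res A W W' f) = ?g" by (rule psi_eqI[OF W'(1) WU g])
  then show ?thesis using b by (simp add: ev_def)
qed

text \<open>\<open>val_eqI\<close> asks for values on all open neighbourhoods of \<open>b\<close>,
  including those that leave the chart; hence the restriction to \<open>W \<inter> U\<close> before
  evaluation.\<close>

lemma val_ev_Int:
  assumes W: "Op W" and b: "b \<in> W" "b \<in> U" and f: "f \<in> carrier (sect A W)"
  shows "val A W f b = ev (W \<inter> U) (res A W (W \<inter> U) f) b"
proof (rule val_eqI[where e = "\<lambda>W f. ev (W \<inter> U) (res A W (W \<inter> U) f) b"])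
  show "b \<in> topspace (base A)" using b openin_subset[OF W] by auto
  fix T f assume T: "Op T" "b \<in> T"
  have TU: "Op (T \<inter> U)" "T \<inter> U \<subseteq> U" "T \<inter> U \<subseteq> T" "b \<in> T \<inter> U" using T U b W by auto
  note rc = resA_closed[OF T(1) TU(1,3)]
  show "ev (T \<inter> U) (res A T (T \<inter> U) (cst T c)) b = c" for c
    using TU T by (simp add: res_cst ev_cst)
  assume f: "f \<in> carrier (sect A T)"
  show "ev (T \<inter> U) (res A T (T \<inter> U) (f \<oplus>\<^bsub>sect A T\<^esub> g)) b =
      ev (T \<inter> U) (res A T (T \<inter> U) f) b + ev (T \<inter> U) (res A T (T \<inter> U) g) b" if g: "g \<in> carrier (sect A T)" for g
    using TU T f g rc by (simp add: resA_add ev_add)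
  show "ev (T \<inter> U) (res A T (T \<inter> U) (f \<otimes>\<^bsub>sect A T\<^esub> g)) b =
      ev (T \<inter> U) (res A T (T \<inter> U) f) b * ev (T \<inter> U) (res A T (T \<inter> U) g) b" if g: "g \<in> carrier (sect A T)" for g
    using TU T f g rc by (simp add: resA_mult ev_mult)
next
  fix T T' f assume T: "Op T" "Op T'" "b \<in> T'" "T' \<subseteq> T" and f: "f \<in> carrier (sect A T)"
  have TU: "Op (T \<inter> U)" "Op (T' \<inter> U)" "T' \<inter> U \<subseteq> T \<inter> U" "b \<in> T' \<inter> U" using T U b W by auto
  have "ev (T \<inter> U) (res A T (T \<inter> U) f) b = ev (T' \<inter> U) (res A (T \<inter> U) (T' \<inter> U) (res A T (T \<inter> U) f)) b"
    by (rule ev_res[symmetric]) (use TU resA_closed[OF T(1) TU(1) _ f] in auto)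
  then show "ev (T' \<inter> U) (res A T' (T' \<inter> U) (res A T T' f)) b = ev (T \<inter> U) (res A T (T \<inter> U) f) b"
    using T TU f by (simp add: resA_trans)
qed (use W b f in auto)

lemma val_ev:
  assumes W: "Op W" "W \<subseteq> U" and b: "b \<in> W" and f: "f \<in> carrier (sect A W)"
  shows "val A W f b = ev W f b"
  using val_ev_Int[OF W(1) b _ f] W b f by (auto simp: Int_absorb2 resA_id)

text \<open>A smooth function is lifted to the power series whose only coefficient is the constant
  one. The explicit form of the lift is exported because cut-offs need its restrictions as sections,
  which the residues do not determine.\<close>

lemma section_exists:
  assumes W: "Op W" "W \<subseteq> U" and g: "smooth_on n (\<phi> ` W) g"
  obtains f where "f \<in> carrier (sect A W)" "\<And>b. b \<in> W \<Longrightarrow> val A W f b = g (\<phi> b)"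
    "f = \<theta> (\<phi> ` W) (\<lambda>\<alpha> x. if \<alpha> = (\<lambda>_. 0) \<and> x \<in> \<phi> ` W then g x else 0)"
    "(\<lambda>\<alpha> x. if \<alpha> = (\<lambda>_. 0) \<and> x \<in> \<phi> ` W then g x else 0) \<in> carrier (formal_functions n k (\<phi> ` W))"
proof -
  let ?h = "\<lambda>\<alpha> x. if \<alpha> = (\<lambda>_. 0) \<and> x \<in> \<phi> ` W then g x else 0"
  have h: "?h \<in> carrier (formal_functions n k (\<phi> ` W))"
  proof -
    have "smooth_on n (\<phi> ` W) (?h \<alpha>)" for \<alpha> :: "nat \<Rightarrow> nat"
      using Ck_on_cong[OF openin_phi[OF W], of "?h \<alpha>" "if \<alpha> = (\<lambda>_. 0) then g else (\<lambda>_. 0)"] g Ck_on_const[OF openin_phi[OF W]]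
      by (simp add: smooth_on_def)
    then show ?thesis by (auto simp: formal_functions_def)
  qed
  have f: "\<theta> (\<phi> ` W) ?h \<in> carrier (sect A W)" by (rule theta_closed[OF W h])
  have "val A W (\<theta> (\<phi> ` W) ?h) b = g (\<phi> b)" if "b \<in> W" for b
    using val_ev[OF W that f] psi_eqI[OF W h refl] that by (simp add: ev_def)
  then show thesis using that f h by blast
qed

end

context formal_mfd
begin

lemma val_res:
  assumes W: "Op W" "Op W'" "W' \<subseteq> W" and b: "b \<in> W'" and f: "f \<in> carrier (sect A W)"
  shows "val A W' (res A W W' f) b = val A W f b"
proof -
  have "b \<in> topspace (base A)" using b openin_subset[OF W(2)] by auto
  then obtain U n k \<phi> \<theta> where c: "formal_chart A U n k \<phi> \<theta>" "b \<in> U" using formal_chart_exists by blast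
  interpret c: formal_chart A U n k \<phi> \<theta> by (rule c)
  have bW: "b \<in> W" using b W by auto
  have WU: "Op (W \<inter> U)" "W \<inter> U \<subseteq> W" "Op (W' \<inter> U)" "W' \<inter> U \<subseteq> W \<inter> U" "b \<in> W' \<inter> U" "W \<inter> U \<subseteq> U" using W c.U b c by auto
  have "val A W' (res A W W' f) b = c.ev (W' \<inter> U) (res A W' (W' \<inter> U) (res A W W' f)) b"
    using c.val_ev_Int[OF W(2) b c(2) resA_closed[OF W f]] .
  also have "res A W' (W' \<inter> U) (res A W W' f) = res A (W \<inter> U) (W' \<inter> U) (res A W (W \<inter> U) f)"
    using W WU f by (simp add: resA_trans)
  also have "c.ev (W' \<inter> U) \<dots> b = c.ev (W \<inter> U) (res A W (W \<inter> U) f) b"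
    by (rule c.ev_res[OF WU(1,6,3,4,5) resA_closed[OF W(1) WU(1,2) f]])
  also have "\<dots> = val A W f b"
    using c.val_ev_Int[OF W(1) bW c(2) f] by simp
  finally show ?thesis .
qed

lemma
  assumes W: "Op W" and b: "b \<in> W"
  shows val_add: "f \<in> carrier (sect A W) \<Longrightarrow> g \<in> carrier (sect A W) \<Longrightarrow> val A W (f \<oplus>\<^bsub>sect A W\<^esub> g) b = val A W f b + val A W g b"
    and val_mult: "f \<in> carrier (sect A W) \<Longrightarrow> g \<in> carrier (sect A W) \<Longrightarrow> val A W (f \<otimes>\<^bsub>sect A W\<^esub> g) b = val A W f b * val A W g b"
    and val_cst: "val A W (cst W c) b = c"
proof -
  have "b \<in> topspace (base A)" using b openin_subset[OF W] by auto
  then obtain U n k \<phi> \<theta> where c: "formal_chart A U n k \<phi> \<theta>" "b \<in> U" using formal_chart_exists by blast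
  interpret c: formal_chart A U n k \<phi> \<theta> by (rule c)
  interpret r: cring "sect A W" by (rule cringA[OF W])
  have WU: "Op (W \<inter> U)" "W \<inter> U \<subseteq> W" "W \<inter> U \<subseteq> U" "b \<in> W \<inter> U" using W c.U b c by auto
  note e = c.val_ev_Int[OF W b c(2)]
  note rc = resA_closed[OF W WU(1,2)]
  show "val A W (f \<oplus>\<^bsub>sect A W\<^esub> g) b = val A W f b + val A W g b" if "f \<in> carrier (sect A W)" "g \<in> carrier (sect A W)"
    using that W WU rc by (simp add: e resA_add c.ev_add)
  show "val A W (f \<otimes>\<^bsub>sect A W\<^esub> g) b = val A W f b * val A W g b" if "f \<in> carrier (sect A W)" "g \<in> carrier (sect A W)"
    using that W WU rc by (simp add: e resA_mult c.ev_mult)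
  show "val A W (cst W c) b = c"
    using W WU by (simp add: e cst_closed res_cst c.ev_cst)
qed

lemma val_zero: "Op W \<Longrightarrow> b \<in> W \<Longrightarrow> val A W \<zero>\<^bsub>sect A W\<^esub> b = 0"
  using val_cst[of W b 0] by (simp add: cst_zero)

lemma val_one: "Op W \<Longrightarrow> b \<in> W \<Longrightarrow> val A W \<one>\<^bsub>sect A W\<^esub> b = 1"
  using val_cst[of W b 1] by (simp add: cst_one)

lemma val_minus:
  assumes W: "Op W" and b: "b \<in> W" and f: "f \<in> carrier (sect A W)" and g: "g \<in> carrier (sect A W)"
  shows "val A W (f \<ominus>\<^bsub>sect A W\<^esub> g) b = val A W f b - val A W g b"
proof -
  interpret r: cring "sect A W" by (rule cringA[OF W])
  have "(f \<ominus>\<^bsub>sect A W\<^esub> g) \<oplus>\<^bsub>sect A W\<^esub> g = f" using f g by (simp add: a_minus_def r.a_assoc r.l_neg)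
  then show ?thesis using val_add[OF W b r.minus_closed[OF f g] g] by (simp add: algebra_simps)
qed

end

section \<open>Functions on the reduction\<close>

context formal_mfd
begin

abbreviation "M \<equiv> topspace (base A)"

lemma hausdorff: "Hausdorff_space (base A)"
  using mfd by (simp add: formal_manifold_def)

lemma openin_Diff_compactin: "Op U \<Longrightarrow> compactin (base A) K \<Longrightarrow> Op (U - K)"
  using compactin_imp_closedin[OF hausdorff] by blast

lemma red_off: "g \<in> red_functions A W \<Longrightarrow> a \<notin> W \<Longrightarrow> g a = 0"
  by (simp add: red_functions_def)

lemma red_val:
  assumes "Op W" "f \<in> carrier (sect A W)"
  shows "(\<lambda>b. if b \<in> W then val A W f b else 0) \<in> red_functions A W"
  using assms by (auto simp: red_functions_def)

lemma red_rep:
  assumes "g \<in> red_functions A W" "a \<in> W"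
  obtains V f where "Op V" "a \<in> V" "V \<subseteq> W" "f \<in> carrier (sect A V)" "\<And>b. b \<in> V \<Longrightarrow> g b = val A V f b"
proof -
  have "\<forall>a\<in>W. \<exists>V f. Op V \<and> a \<in> V \<and> V \<subseteq> W \<and> f \<in> carrier (sect A V) \<and> (\<forall>b\<in>V. g b = val A V f b)"
    using assms(1) by (simp add: red_functions_def)
  from this[rule_format, OF assms(2)] show thesis using that by blast
qed

lemma red_local:
  assumes 0: "\<And>a. a \<notin> W \<Longrightarrow> g a = 0"
    and loc: "\<And>a. a \<in> W \<Longrightarrow> \<exists>V h. Op V \<and> a \<in> V \<and> V \<subseteq> W \<and> h \<in> red_functions A V \<and> (\<forall>b\<in>V. g b = h b)"
  shows "g \<in> red_functions A W"
proof -
  have "\<exists>V f. Op V \<and> a \<in> V \<and> V \<subseteq> W \<and> f \<in> carrier (sect A V) \<and> (\<forall>b\<in>V. g b = val A V f b)" if a: "a \<in> W" for a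
  proof -
    obtain V h where V: "Op V" "a \<in> V" "V \<subseteq> W" "h \<in> red_functions A V" "\<forall>b\<in>V. g b = h b" using loc[OF a] by blast
    obtain T f where T: "Op T" "a \<in> T" "T \<subseteq> V" "f \<in> carrier (sect A T)" "\<And>b. b \<in> T \<Longrightarrow> h b = val A T f b"
      using red_rep[OF V(4,2)] by blast
    show ?thesis using V T by (intro exI[of _ T] exI[of _ f]) auto
  qed
  then show ?thesis using 0 by (simp add: red_functions_def)
qed

lemma red_res:
  assumes g: "g \<in> red_functions A W" and V: "Op V" "V \<subseteq> W"
  shows "(\<lambda>a. if a \<in> V then g a else 0) \<in> red_functions A V"
proof (rule red_local)
  fix a assume a: "a \<in> V"
  obtain T f where T: "Op T" "a \<in> T" "T \<subseteq> W" "f \<in> carrier (sect A T)" "\<And>b. b \<in> T \<Longrightarrow> g b = val A T f b"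
    using red_rep[OF g] a V by blast
  have TV: "Op (T \<inter> V)" "T \<inter> V \<subseteq> T" using T V by auto
  have f: "res A T (T \<inter> V) f \<in> carrier (sect A (T \<inter> V))" by (rule resA_closed[OF T(1) TV T(4)])
  show "\<exists>T h. Op T \<and> a \<in> T \<and> T \<subseteq> V \<and> h \<in> red_functions A T \<and> (\<forall>b\<in>T. (if b \<in> V then g b else 0) = h b)"
    using red_val[OF TV(1) f] TV T a val_res[OF T(1) TV _ T(4)]
    by (intro exI[of _ "T \<inter> V"] exI[of _ "\<lambda>b. if b \<in> T \<inter> V then val A (T \<inter> V) (res A T (T \<inter> V) f) b else 0"]) auto
qed simp

lemma
  assumes g: "g \<in> red_functions A W" and h: "h \<in> red_functions A W"
  shows red_add: "(\<lambda>a. g a + h a) \<in> red_functions A W"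
    and red_mult: "(\<lambda>a. g a * h a) \<in> red_functions A W"
proof -
  have *: "\<exists>T f f'. Op T \<and> a \<in> T \<and> T \<subseteq> W \<and> f \<in> carrier (sect A T) \<and> f' \<in> carrier (sect A T) \<and>
      (\<forall>b\<in>T. g b = val A T f b \<and> h b = val A T f' b)" if a: "a \<in> W" for a
  proof -
    obtain T f where T: "Op T" "a \<in> T" "T \<subseteq> W" "f \<in> carrier (sect A T)" "\<And>b. b \<in> T \<Longrightarrow> g b = val A T f b"
      using red_rep[OF g a] by blast
    obtain V f' where V: "Op V" "a \<in> V" "V \<subseteq> W" "f' \<in> carrier (sect A V)" "\<And>b. b \<in> V \<Longrightarrow> h b = val A V f' b"
      using red_rep[OF h a] by blast
    have TV: "Op (T \<inter> V)" "T \<inter> V \<subseteq> T" "T \<inter> V \<subseteq> V" using T V by auto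
    show ?thesis using T V TV resA_closed[OF T(1) TV(1,2) T(4)] resA_closed[OF V(1) TV(1,3) V(4)]
        val_res[OF T(1) TV(1,2) _ T(4)] val_res[OF V(1) TV(1,3) _ V(4)]
      by (intro exI[of _ "T \<inter> V"] exI[of _ "res A T (T \<inter> V) f"] exI[of _ "res A V (T \<inter> V) f'"]) auto
  qed
  show "(\<lambda>a. g a + h a) \<in> red_functions A W"
  proof (rule red_local)
    fix a assume "a \<in> W"
    then obtain T f f' where T: "Op T" "a \<in> T" "T \<subseteq> W" "f \<in> carrier (sect A T)" "f' \<in> carrier (sect A T)"
      "\<forall>b\<in>T. g b = val A T f b \<and> h b = val A T f' b" using *[OF \<open>a \<in> W\<close>] by auto
    have s: "f \<oplus>\<^bsub>sect A T\<^esub> f' \<in> carrier (sect A T)" using T cringA[OF T(1)] by (simp add: cring.cring_simprules)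
    show "\<exists>V k. Op V \<and> a \<in> V \<and> V \<subseteq> W \<and> k \<in> red_functions A V \<and> (\<forall>b\<in>V. g b + h b = k b)"
      using T red_val[OF T(1) s] val_add[OF T(1) _ T(4,5)]
      by (intro exI[of _ T] exI[of _ "\<lambda>b. if b \<in> T then val A T (f \<oplus>\<^bsub>sect A T\<^esub> f') b else 0"]) auto
  qed (use red_off[OF g] red_off[OF h] in auto)
  show "(\<lambda>a. g a * h a) \<in> red_functions A W"
  proof (rule red_local)
    fix a assume "a \<in> W"
    then obtain T f f' where T: "Op T" "a \<in> T" "T \<subseteq> W" "f \<in> carrier (sect A T)" "f' \<in> carrier (sect A T)"
      "\<forall>b\<in>T. g b = val A T f b \<and> h b = val A T f' b" using *[OF \<open>a \<in> W\<close>] by auto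
    have s: "f \<otimes>\<^bsub>sect A T\<^esub> f' \<in> carrier (sect A T)" using T cringA[OF T(1)] by (simp add: cring.cring_simprules)
    show "\<exists>V k. Op V \<and> a \<in> V \<and> V \<subseteq> W \<and> k \<in> red_functions A V \<and> (\<forall>b\<in>V. g b * h b = k b)"
      using T red_val[OF T(1) s] val_mult[OF T(1) _ T(4,5)]
      by (intro exI[of _ T] exI[of _ "\<lambda>b. if b \<in> T then val A T (f \<otimes>\<^bsub>sect A T\<^esub> f') b else 0"]) auto
  qed (use red_off[OF g] red_off[OF h] in auto)
qed

lemma red_const: "Op W \<Longrightarrow> (\<lambda>a. if a \<in> W then c else 0) \<in> red_functions A W"
proof -
  assume W: "Op W"
  have "(\<lambda>a. if a \<in> W then c else 0) = (\<lambda>a. if a \<in> W then val A W (cst W c) a else 0)"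
    using val_cst[OF W] by auto
  then show ?thesis using red_val[OF W cst_closed[OF W]] by simp
qed

lemma red_zero: "Op W \<Longrightarrow> (\<lambda>a. 0) \<in> red_functions A W"
  using red_const[of W 0] by simp

lemma red_cmult: "Op W \<Longrightarrow> g \<in> red_functions A W \<Longrightarrow> (\<lambda>a. c * g a) \<in> red_functions A W"
proof -
  assume W: "Op W" and g: "g \<in> red_functions A W"
  have "(\<lambda>a. c * g a) = (\<lambda>a. (if a \<in> W then c else 0) * g a)" using red_off[OF g] by auto
  then show ?thesis using red_mult[OF red_const[OF W] g] by simp
qed

lemma red_sum: "Op W \<Longrightarrow> (\<And>i. i \<in> I \<Longrightarrow> g i \<in> red_functions A W) \<Longrightarrow> (\<lambda>a. \<Sum>i\<in>I. g i a) \<in> red_functions A W"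
  by (induction I rule: infinite_finite_induct) (simp_all add: red_zero red_add)

end

context formal_chart
begin

lemma smooth_on_psi:
  assumes W: "Op W" "W \<subseteq> U" and f: "f \<in> carrier (sect A W)"
  shows "smooth_on n (\<phi> ` W) (\<psi> W f \<alpha>)"
  using psi_closed[OF W f] by (simp add: formal_functions_def)

text \<open>In the chart, residues of a section are its constant coefficients, which are smooth, and
  smoothness is local. Conversely \<open>section_exists\<close> lifts a smooth function to one
  section over all of \<open>V\<close>.\<close>

lemma red_smooth_iff:
  assumes V: "Op V" "V \<subseteq> U" and 0: "\<And>a. a \<notin> V \<Longrightarrow> g a = 0"
  shows "g \<in> red_functions A V \<longleftrightarrow> smooth_on n (\<phi> ` V) (\<lambda>x. g (inv_into U \<phi> x))"
proof
  have inv: "inv_into U \<phi> (\<phi> a) = a" if "a \<in> U" for a using phi_inj that by simp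
  assume g: "g \<in> red_functions A V"
  show "smooth_on n (\<phi> ` V) (\<lambda>x. g (inv_into U \<phi> x))"
    unfolding smooth_on_def
  proof
    fix m show "Ck_on n m (\<phi> ` V) (\<lambda>x. g (inv_into U \<phi> x))"
    proof (rule Ck_on_local[OF openin_phi[OF V]])
      fix x assume "x \<in> \<phi> ` V"
      then obtain a where a: "a \<in> V" "x = \<phi> a" by blast
      obtain T f where T: "Op T" "a \<in> T" "T \<subseteq> V" "f \<in> carrier (sect A T)" "\<And>b. b \<in> T \<Longrightarrow> g b = val A T f b"
        using red_rep[OF g a(1)] by blast
      have TU: "T \<subseteq> U" using T V by auto
      have "g (inv_into U \<phi> y) = \<psi> T f (\<lambda>_. 0) y" if "y \<in> \<phi> ` T" for y
        using that TU T(5) val_ev[OF T(1) TU _ T(4)] inv by (auto simp: ev_def)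
      then have "Ck_on n m (\<phi> ` T) (\<lambda>x. g (inv_into U \<phi> x))"
        using Ck_on_cong[OF openin_phi[OF T(1) TU], of "\<lambda>x. g (inv_into U \<phi> x)" "\<psi> T f (\<lambda>_. 0)"]
          smooth_on_Ck[OF smooth_on_psi[OF T(1) TU T(4)]] by simp
      then show "\<exists>T. openin (Euclidean_space n) T \<and> x \<in> T \<and> T \<subseteq> \<phi> ` V \<and> Ck_on n m T (\<lambda>x. g (inv_into U \<phi> x))"
        using T a openin_phi[OF T(1) TU] by (intro exI[of _ "\<phi> ` T"]) auto
    qed
  qed
next
  have inv: "inv_into U \<phi> (\<phi> a) = a" if "a \<in> U" for a using phi_inj that by simp
  assume g: "smooth_on n (\<phi> ` V) (\<lambda>x. g (inv_into U \<phi> x))"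
  obtain f where f: "f \<in> carrier (sect A V)" "\<And>b. b \<in> V \<Longrightarrow> val A V f b = g (inv_into U \<phi> (\<phi> b))"
    using section_exists[OF V g] by blast
  then have "g = (\<lambda>b. if b \<in> V then val A V f b else 0)" using 0 inv V by force
  then show "g \<in> red_functions A V" using red_val[OF V(1) f(1)] by simp
qed

lemma chart: "(U, n, \<phi>) \<in> charts A"
proof -
  have "homeomorphic_map (subtopology (base A) U) (subtopology (Euclidean_space n) (\<phi> ` U)) \<phi>"
    using homeo by (simp add: phi_image subtopology_topspace)
  moreover have "openin (Euclidean_space n) (\<phi> ` U)" using openin_phi[OF U] by simp
  ultimately show ?thesis using U red_smooth_iff by (auto simp: charts_def)
qed

end

context formal_mfd
begin

lemma chart_exists: "a \<in> M \<Longrightarrow> \<exists>c\<in>charts A. a \<in> chart_dom c"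
proof -
  assume "a \<in> M"
  then obtain U n k \<phi> \<theta> where c: "formal_chart A U n k \<phi> \<theta>" "a \<in> U" using formal_chart_exists by blast
  then show ?thesis using formal_chart.chart[OF c(1)] by force
qed

lemma chart_open: "c \<in> charts A \<Longrightarrow> Op (chart_dom c)"
  by (auto simp: charts_def)

text \<open>In a formal chart this is smoothness of the reciprocal; it is what allows a partition of
  unity to be normalized.\<close>

lemma red_inverse:
  assumes W: "Op W" and g: "g \<in> red_functions A W" and nz: "\<And>a. a \<in> W \<Longrightarrow> g a \<noteq> 0"
  shows "(\<lambda>a. inverse (g a)) \<in> red_functions A W"
proof (rule red_local)
  fix a assume a: "a \<in> W"
  then obtain U n k \<phi> \<theta> where c: "formal_chart A U n k \<phi> \<theta>" "a \<in> U"
    using formal_chart_exists openin_subset[OF W] by (metis subsetD)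
  interpret c: formal_chart A U n k \<phi> \<theta> by (rule c)
  let ?V = "W \<inter> U" let ?g = "\<lambda>b. if b \<in> W \<inter> U then g b else 0"
  have V: "Op ?V" "?V \<subseteq> U" using W c.U by auto
  have inv: "inv_into U \<phi> (\<phi> a) = a" if "a \<in> U" for a using c.phi_inj that by simp
  have "?g \<in> red_functions A ?V" using red_res[OF g V(1)] by simp
  then have "smooth_on n (\<phi> ` ?V) (\<lambda>x. ?g (inv_into U \<phi> x))" by - (rule iffD1[OF c.red_smooth_iff[OF V, of ?g]], auto)
  then have "smooth_on n (\<phi> ` ?V) (\<lambda>x. inverse (?g (inv_into U \<phi> x)))"
    unfolding smooth_on_def using nz inv by (auto intro!: Ck_on_inverse c.openin_phi V)
  then have "(\<lambda>b. inverse (?g b)) \<in> red_functions A ?V" by - (rule iffD2[OF c.red_smooth_iff[OF V, of "\<lambda>b. inverse (?g b)"]], auto)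
  then show "\<exists>V h. Op V \<and> a \<in> V \<and> V \<subseteq> W \<and> h \<in> red_functions A V \<and> (\<forall>b\<in>V. inverse (g b) = h b)"
    using V a c by (intro exI[of _ ?V] exI[of _ "\<lambda>b. inverse (?g b)"]) auto
qed (use red_off[OF g] in auto)

text \<open>Continuity bounds these functions on compact sets, so that the suprema in the seminorms
  are suprema of bounded sets.\<close>

lemma red_continuous:
  assumes W: "Op W" and g: "g \<in> red_functions A W"
  shows "continuous_map (subtopology (base A) W) euclidean g"
proof -
  have "Op {a \<in> W. g a \<in> T}" if T: "open T" for T
  proof (subst openin_subopen, intro ballI)
    fix a assume "a \<in> {a \<in> W. g a \<in> T}"
    then have a: "a \<in> W" "g a \<in> T" by auto
    then obtain U n k \<phi> \<theta> where c: "formal_chart A U n k \<phi> \<theta>" "a \<in> U"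
      using formal_chart_exists openin_subset[OF W] by (metis subsetD)
    interpret c: formal_chart A U n k \<phi> \<theta> by (rule c)
    let ?V = "W \<inter> U" let ?g = "\<lambda>b. if b \<in> W \<inter> U then g b else 0"
    have V: "Op ?V" "?V \<subseteq> U" using W c.U by auto
    have inv: "inv_into U \<phi> (\<phi> a) = a" if "a \<in> U" for a using c.phi_inj that by simp
    have "?g \<in> red_functions A ?V" using red_res[OF g V(1)] by simp
    then have "smooth_on n (\<phi> ` ?V) (\<lambda>x. ?g (inv_into U \<phi> x))" by - (rule iffD1[OF c.red_smooth_iff[OF V, of ?g]], auto)
    then have "continuous_on (\<phi> ` ?V) (\<lambda>x. ?g (inv_into U \<phi> x))"
      using smooth_on_Ck Ck_on_continuous c.openin_phi[OF V] by blast
    then have "openin (top_of_set (\<phi> ` ?V)) (\<phi> ` ?V \<inter> (\<lambda>x. ?g (inv_into U \<phi> x)) -` T)"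
      using continuous_openin_preimage_gen[OF _ T] by blast
    then have "openin (Euclidean_space n) (\<phi> ` ?V \<inter> (\<lambda>x. ?g (inv_into U \<phi> x)) -` T)"
      using openin_open_subtopology[OF c.openin_phi[OF V]] subtopology_Euclidean_space[OF openin_subset[OF c.openin_phi[OF V]]] by simp
    from c.openin_preimage[OF this]
    have "Op {b \<in> U. \<phi> b \<in> \<phi> ` ?V \<inter> (\<lambda>x. ?g (inv_into U \<phi> x)) -` T}" .
    moreover have "{b \<in> U. \<phi> b \<in> \<phi> ` ?V \<inter> (\<lambda>x. ?g (inv_into U \<phi> x)) -` T} = {b \<in> ?V. g b \<in> T}"
    proof -
      have "\<phi> b \<in> \<phi> ` ?V \<longleftrightarrow> b \<in> ?V" if "b \<in> U" for b using c.preimage_phi[OF V(2)] that by blast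
      then show ?thesis by (auto simp: inv cong: conj_cong)
    qed
    ultimately show "\<exists>T'. Op T' \<and> a \<in> T' \<and> T' \<subseteq> {a \<in> W. g a \<in> T}"
      using a c by (intro exI[of _ "{b \<in> ?V. g b \<in> T}"]) auto
  qed
  then show ?thesis
    using openin_subset[OF W] openin_restr[OF W] by (auto simp: continuous_map topspace_subtopology Int_absorb1)
qed

section \<open>Cut-off functions\<close>

text \<open>The values 1 on \<open>N\<close> and 0 off \<open>C\<close> are taken as sections,
  formal variables included: multiplication by \<open>f\<close> must be the identity, respectively
  0, on sections of an arbitrary module. Residues in [0, 1] provide the nonnegative functions for
  partitions of unity on the reduction.\<close>

definition cutoff :: "'m set \<Rightarrow> 'm set \<Rightarrow> 's \<Rightarrow> 'm set \<Rightarrow> bool" where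
  "cutoff V N f C \<longleftrightarrow> f \<in> carrier (sect A M) \<and> compactin (base A) C \<and> C \<subseteq> V \<and> Op N \<and>
     res A M N f = \<one>\<^bsub>sect A N\<^esub> \<and> res A M (M - C) f = \<zero>\<^bsub>sect A (M - C)\<^esub> \<and>
     (\<forall>b\<in>M. \<exists>t. 0 \<le> t \<and> t \<le> 1 \<and> val A M f b = complex_of_real t)"

lemma cutoff_point:
  assumes V: "Op V" and a: "a \<in> V"
  obtains N f C where "cutoff V N f C" "a \<in> N" "N \<subseteq> C"
proof -
  obtain U n k \<phi> \<theta> where c: "formal_chart A U n k \<phi> \<theta>" "a \<in> U"
    using formal_chart_exists openin_subset[OF V] a by (metis subsetD)
  interpret c: formal_chart A U n k \<phi> \<theta> by (rule c)
  let ?E = "Euclidean_space n" and ?W = "V \<inter> U"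
  have W: "Op ?W" "?W \<subseteq> U" "?W \<subseteq> M" using V c.U openin_subset[OF V] by auto
  note opW = c.openin_phi[OF W(1,2)]
  obtain \<delta> where \<delta>: "\<delta> > 0" "\<And>x. x \<in> topspace ?E \<Longrightarrow> (\<And>j. j < n \<Longrightarrow> \<bar>x j - \<phi> a j\<bar> \<le> 2 * \<delta>) \<Longrightarrow> x \<in> \<phi> ` ?W"
    using Euclidean_space_box[OF opW, of "\<phi> a"] a c(2) by blast
  obtain b :: "(nat \<Rightarrow> real) \<Rightarrow> real" where b: "\<And>S. openin ?E S \<Longrightarrow> smooth_on n S (\<lambda>x. complex_of_real (b x))"
    "\<And>x. 0 \<le> b x" "\<And>x. b x \<le> 1" "\<And>x. (\<And>j. j < n \<Longrightarrow> \<bar>x j - \<phi> a j\<bar> \<le> \<delta>) \<Longrightarrow> b x = 1"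
    "\<And>x j. j < n \<Longrightarrow> \<bar>x j - \<phi> a j\<bar> \<ge> 2 * \<delta> \<Longrightarrow> b x = 0"
    using bump_exists[OF \<delta>(1), of n "\<phi> a"] by blast
  let ?h = "\<lambda>(\<alpha> :: nat \<Rightarrow> nat) x. if \<alpha> = (\<lambda>_. 0) \<and> x \<in> \<phi> ` ?W then complex_of_real (b x) else 0"
  obtain f where f: "f \<in> carrier (sect A ?W)" "\<And>x. x \<in> ?W \<Longrightarrow> val A ?W f x = complex_of_real (b (\<phi> x))"
    "f = \<theta> (\<phi> ` ?W) ?h" "?h \<in> carrier (formal_functions n k (\<phi> ` ?W))"
    using c.section_exists[OF W(1,2) b(1)[OF opW]] by blast
  let ?B = "{x \<in> topspace ?E. \<forall>j<n. \<bar>x j - \<phi> a j\<bar> \<le> 2 * \<delta>}" and ?B' = "{x \<in> topspace ?E. \<forall>j<n. \<bar>x j - \<phi> a j\<bar> < \<delta>}"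
  \<comment> \<open>\<open>C\<close> is the closed box of radius 2\<delta>, which stays inside
    \<open>?W\<close> by the choice of \<delta>; \<open>N\<close> is the open box of radius
    \<delta>, on which the bump is 1.\<close>
  define C where "C = {x \<in> U. \<phi> x \<in> ?B}"
  define N where "N = {x \<in> U. \<phi> x \<in> ?B'}"
  have CW: "C \<subseteq> ?W" using \<delta>(2) c.preimage_phi[OF W(2)] unfolding C_def by blast
  have NC: "N \<subseteq> C" using \<delta>(1) unfolding N_def C_def by fastforce
  have Nop: "Op N" unfolding N_def by (rule c.openin_preimage[OF openin_Euclidean_box])
  have aN: "a \<in> N" using c(2) \<delta>(1) c.phi_image unfolding N_def by auto
  have Ccomp: "compactin (base A) C"
  proof -
    obtain g where g: "homeomorphic_maps (subtopology (base A) U) ?E \<phi> g"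
      using c.homeo homeomorphic_map_maps by blast
    have gi: "g (\<phi> x) = x" if "x \<in> U" for x
      using g that openin_subset[OF c.U] by (auto simp: homeomorphic_maps_def topspace_subtopology)
    have "compactin (subtopology (base A) U) (g ` ?B)"
      using image_compactin[OF compactin_Euclidean_box] g unfolding homeomorphic_maps_def by blast
    moreover have "g ` ?B = C"
    proof -
      have "g x \<in> U \<and> \<phi> (g x) = x" if "x \<in> topspace ?E" for x
        using g that openin_subset[OF c.U] by (auto simp: homeomorphic_maps_def topspace_subtopology continuous_map_def)
      then show ?thesis unfolding C_def using gi by (auto simp: image_iff) metis
    qed
    ultimately show ?thesis by (simp add: compactin_subtopology)
  qed
  have opWC: "Op (?W - C)" "Op (M - C)" using W Ccomp openin_Diff_compactin by auto
  have 0: "res A ?W (?W - C) f = \<zero>\<^bsub>sect A (?W - C)\<^esub>"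
  proof -
    have sub: "?W - C \<subseteq> U" "\<phi> ` (?W - C) \<subseteq> \<phi> ` ?W" using W by auto
    \<comment> \<open>Outside the closed box the whole power series is 0, since the bump is its only
      coefficient; naturality of \<theta> turns this into vanishing of the section.\<close>
    have "(\<lambda>\<alpha> x. if x \<in> \<phi> ` (?W - C) then ?h \<alpha> x else 0) = (\<lambda>\<alpha> x. 0)"
    proof (intro HOL.ext)
      fix \<alpha> :: "nat \<Rightarrow> nat" and x :: "nat \<Rightarrow> real"
      have "b x = 0" if x: "x \<in> \<phi> ` (?W - C)"
      proof -
        have "x \<in> topspace ?E" "x \<notin> ?B" using x sub(1) c.phi_image unfolding C_def by auto
        then obtain j where "j < n" "\<bar>x j - \<phi> a j\<bar> \<ge> 2 * \<delta>" by force
        then show ?thesis using b(5) by blast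
      qed
      then show "(if x \<in> \<phi> ` (?W - C) then ?h \<alpha> x else 0) = 0" by auto
    qed
    then show ?thesis
      using c.natural[OF opW c.openin_phi[OF opWC(1) sub(1)] sub(2) f(4)] c.theta_zero[OF opWC(1) sub(1)]
      by (simp add: c.preimage_phi[OF W(2)] c.preimage_phi[OF sub(1)] f(3)[symmetric]) (simp add: formal_functions_def)
  qed
  have 1: "res A ?W N f = \<one>\<^bsub>sect A N\<^esub>"
  proof -
    have NW: "N \<subseteq> ?W" using NC CW by blast
    have sub: "N \<subseteq> U" "\<phi> ` N \<subseteq> \<phi> ` ?W" using NW image_mono[OF NW] by auto
    have "(\<lambda>\<alpha> x. if x \<in> \<phi> ` N then ?h \<alpha> x else 0) = \<one>\<^bsub>formal_functions n k (\<phi> ` N)\<^esub>"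
    proof (intro HOL.ext)
      fix \<alpha> :: "nat \<Rightarrow> nat" and x :: "nat \<Rightarrow> real"
      have "b x = 1" if x: "x \<in> \<phi> ` N"
        by (rule b(4)) (use x in \<open>auto simp: N_def intro: less_imp_le\<close>)
      then show "(if x \<in> \<phi> ` N then ?h \<alpha> x else 0) = \<one>\<^bsub>formal_functions n k (\<phi> ` N)\<^esub> \<alpha> x"
        using sub(2) by (auto simp: formal_functions_def)
    qed
    then show ?thesis
      using c.natural[OF opW c.openin_phi[OF Nop sub(1)] sub(2) f(4)] ring_hom_one[OF c.theta_hom[OF Nop sub(1)]]
      by (simp add: c.preimage_phi[OF W(2)] c.preimage_phi[OF sub(1)] f(3)[symmetric])
  qed
  have M: "M = ?W \<union> (M - C)" using CW W by auto
  have WI: "?W \<inter> (M - C) = ?W - C" using W by auto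
  obtain F where F: "F \<in> carrier (sect A M)" "res A M ?W F = f" "res A M (M - C) F = \<zero>\<^bsub>sect A (M - C)\<^esub>"
    by (rule sheaf_glue2[OF sheafA W(1) opWC(2) M f(1), of "\<zero>\<^bsub>sect A (M - C)\<^esub>"])
       (use 0 WI opWC W cringA[OF opWC(2)] in \<open>auto simp: cring.cring_simprules intro: resA_zero[symmetric]\<close>)
  have resN: "res A M N F = \<one>\<^bsub>sect A N\<^esub>"
  proof -
    have NW: "N \<subseteq> ?W" using NC CW by auto
    have "res A M N F = res A ?W N (res A M ?W F)" using resA_trans[OF _ W(1) Nop W(3) NW F(1)] by simp
    then show ?thesis using F(2) 1 by simp
  qed
  have "\<exists>t. 0 \<le> t \<and> t \<le> 1 \<and> val A M F x = complex_of_real t" if x: "x \<in> M" for x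
  proof (cases "x \<in> ?W")
    case True
    have "val A M F x = val A ?W f x" using val_res[OF _ W(1,3) True F(1)] F(2) by simp
    then show ?thesis using f(2)[OF True] b(2,3) by (intro exI[of _ "b (\<phi> x)"]) simp
  next
    case False
    then have xC: "x \<in> M - C" using x CW by auto
    have "val A M F x = 0" using val_res[OF _ opWC(2) _ xC F(1)] F(3) val_zero[OF opWC(2) xC] by simp
    then show ?thesis by (intro exI[of _ 0]) simp
  qed
  then have "cutoff V N F C" using F Ccomp CW Nop resN by (auto simp: cutoff_def)
  then show thesis using that aN NC by blast
qed

text \<open>Over the empty set 0 = 1, by separation for the empty cover. This starts the finite
  induction in \<open>cutoff_exists\<close>.\<close>

lemma cutoff_empty: "cutoff V {} \<zero>\<^bsub>sect A M\<^esub> {}"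
proof -
  have oe: "Op {}" by simp
  note e = cring.cring_simprules(2)[OF cringA[OF oe]] cring.cring_simprules(6)[OF cringA[OF oe]]
  have e: "res A M {} \<zero>\<^bsub>sect A M\<^esub> = \<one>\<^bsub>sect A {}\<^esub>"
    unfolding resA_zero[OF openin_topspace oe empty_subsetI] by (rule sepA[of "{}"]) (use e in simp_all)
  show ?thesis unfolding cutoff_def using e
    by (auto simp: resA_id resA_zero cring.cring_simprules[OF cringA] val_zero intro!: exI[of _ 0])
qed

text \<open>The section is 1 - (1 - f)(1 - g) in expanded form: it is 1 where one of the two is 1,
  it is 0 where both are 0, and its residues stay in [0, 1].\<close>

lemma cutoff_Un:
  assumes f: "cutoff V N f C" and g: "cutoff V N' g C'"
  shows "\<exists>h. cutoff V (N \<union> N') h (C \<union> C')"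
proof -
  note f = f[unfolded cutoff_def] and g = g[unfolded cutoff_def]
  have fM: "f \<in> carrier (sect A M)" and gM: "g \<in> carrier (sect A M)" and N: "Op N" "Op N'"
    and C: "compactin (base A) C" "compactin (base A) C'" using f g by auto
  have NM: "N \<subseteq> M" "N' \<subseteq> M" using N openin_subset by auto
  have oC: "Op (M - C)" "Op (M - C')" "Op (M - (C \<union> C'))" using openin_Diff_compactin[of M] C compactin_Un[OF C] by simp_all
  have oM: "Op M" by simp
  interpret r: cring "sect A M" by (rule cringA) simp
  let ?h = "f \<oplus>\<^bsub>sect A M\<^esub> (g \<ominus>\<^bsub>sect A M\<^esub> (f \<otimes>\<^bsub>sect A M\<^esub> g))"
  have h: "?h \<in> carrier (sect A M)" using fM gM by simp
  have resh: "res A M T ?h = res A M T f \<oplus>\<^bsub>sect A T\<^esub> (res A M T g \<ominus>\<^bsub>sect A T\<^esub> (res A M T f \<otimes>\<^bsub>sect A T\<^esub> res A M T g))"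
    if T: "Op T" for T
    using T openin_subset[OF T] fM gM by (simp add: resA_add resA_minus resA_mult)
  have "res A M (N \<union> N') ?h = \<one>\<^bsub>sect A (N \<union> N')\<^esub>"
  proof (rule sepA[of "{N, N'}"])
    have oNN: "Op (N \<union> N')" "N \<union> N' \<subseteq> M" using N NM by auto
    show "res A M (N \<union> N') ?h \<in> carrier (sect A (N \<union> N'))" using resA_closed[OF oM oNN h] .
    show "\<one>\<^bsub>sect A (N \<union> N')\<^esub> \<in> carrier (sect A (N \<union> N'))" using cringA[OF oNN(1)] by (simp add: cring.cring_simprules)
    fix T assume "T \<in> {N, N'}"
    then consider "T = N" | "T = N'" by blast
    then have "Op T \<and> res A M T ?h = \<one>\<^bsub>sect A T\<^esub>"
    proof cases
      case 1
      interpret t: cring "sect A N" by (rule cringA[OF N(1)])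
      have "res A M N g \<in> carrier (sect A N)" by (rule resA_closed[OF oM N(1) NM(1) gM])
      then show ?thesis using resh[OF N(1)] f 1 by (simp add: a_minus_def t.r_neg)
    next
      case 2
      interpret t: cring "sect A N'" by (rule cringA[OF N(2)])
      have "res A M N' f \<in> carrier (sect A N')" by (rule resA_closed[OF oM N(2) NM(2) fM])
      then show ?thesis using resh[OF N(2)] g 2 by (simp add: a_minus_def t.r_neg t.a_ac)
    qed
    then show "res A (N \<union> N') T (res A M (N \<union> N') ?h) = res A (N \<union> N') T \<one>\<^bsub>sect A (N \<union> N')\<^esub>"
      using \<open>T \<in> {N, N'}\<close> oNN h by (auto simp: resA_trans resA_one)
  qed (use N in auto)
  moreover have "res A M (M - (C \<union> C')) ?h = \<zero>\<^bsub>sect A (M - (C \<union> C'))\<^esub>"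
  proof -
    have sub: "M - (C \<union> C') \<subseteq> M - C" "M - (C \<union> C') \<subseteq> M - C'" "M - C \<subseteq> M" "M - C' \<subseteq> M" by auto
    interpret t: cring "sect A (M - (C \<union> C'))" by (rule cringA[OF oC(3)])
    have "res A M (M - (C \<union> C')) f = \<zero>\<^bsub>sect A (M - (C \<union> C'))\<^esub>"
      using resA_trans[OF oM oC(1,3) sub(3,1) fM] f resA_zero[OF oC(1,3) sub(1)] by simp
    moreover have "res A M (M - (C \<union> C')) g = \<zero>\<^bsub>sect A (M - (C \<union> C'))\<^esub>"
      using resA_trans[OF oM oC(2,3) sub(4,2) gM] g resA_zero[OF oC(2,3) sub(2)] by simp
    ultimately show ?thesis using resh[OF oC(3)] by (simp add: a_minus_def)
  qed
  moreover have "\<exists>t. 0 \<le> t \<and> t \<le> 1 \<and> val A M ?h b = complex_of_real t" if b: "b \<in> M" for b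
  proof -
    obtain s t where s: "0 \<le> s" "s \<le> 1" "val A M f b = complex_of_real s" and t: "0 \<le> t" "t \<le> 1" "val A M g b = complex_of_real t"
      using f g b by blast
    have "val A M ?h b = complex_of_real (s + (t - s * t))"
      using fM gM b s t by (simp add: val_add val_minus val_mult)
    moreover have "0 \<le> s + (t - s * t)" using s t mult_left_le[of t s] mult_left_le[of s t] by (simp add: algebra_simps)
    moreover have "s + (t - s * t) \<le> 1"
    proof -
      have "0 \<le> (1 - s) * (1 - t)" using s t by simp
      then show ?thesis by (simp add: algebra_simps)
    qed
    ultimately show ?thesis by blast
  qed
  ultimately have "cutoff V (N \<union> N') ?h (C \<union> C')"
    using h C N f g compactin_Un[OF C] unfolding cutoff_def by auto
  then show ?thesis by blast
qed

lemma cutoff_exists: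
  assumes V: "Op V" and K: "compactin (base A) K" "K \<subseteq> V"
  obtains N f C where "cutoff V N f C" "K \<subseteq> N"
proof -
  let ?\<N> = "{N. \<exists>f C. cutoff V N f C}"
  have "\<forall>N\<in>?\<N>. Op N" by (auto simp: cutoff_def)
  moreover have "K \<subseteq> \<Union>?\<N>"
  proof
    fix a assume "a \<in> K"
    then have "a \<in> V" using K(2) by auto
    then obtain N f C where "cutoff V N f C" "a \<in> N" using cutoff_point[OF V] by metis
    then show "a \<in> \<Union>?\<N>" by blast
  qed
  ultimately obtain \<F> where \<F>: "finite \<F>" "\<F> \<subseteq> ?\<N>" "K \<subseteq> \<Union>\<F>"
    using K(1) unfolding compactin_def by meson
  from \<F>(1,2) have "\<exists>f C. cutoff V (\<Union>\<F>) f C"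
  proof (induction \<F>)
    case empty then show ?case using cutoff_empty by auto
  next
    case (insert N \<F>)
    then obtain f C f' C' where "cutoff V N f C" "cutoff V (\<Union>\<F>) f' C'" by auto
    from cutoff_Un[OF this] show ?case by auto
  qed
  then show thesis using that \<F>(3) by blast
qed

section \<open>The reduction and its densities as sheaves of modules\<close>

lemma reduction_simps:
  "base (reduction A) = base A" "carrier (sect (reduction A) U) = red_functions A U"
  "(g \<oplus>\<^bsub>sect (reduction A) U\<^esub> h) = (\<lambda>a. g a + h a)" "\<zero>\<^bsub>sect (reduction A) U\<^esub> = (\<lambda>a. 0)"
  "(f \<odot>\<^bsub>sect (reduction A) U\<^esub> g) = (\<lambda>a. if a \<in> U then val A U f a * g a else 0)"
  "res (reduction A) U V g = (\<lambda>a. if a \<in> V then g a else 0)"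
  by (simp_all add: reduction_def)

lemma densities_simps:
  "base (densities A) = base A" "carrier (sect (densities A) U) = density_sections A U"
  "(\<omega> \<oplus>\<^bsub>sect (densities A) U\<^esub> \<eta>) = (\<lambda>c a. \<omega> c a + \<eta> c a)" "\<zero>\<^bsub>sect (densities A) U\<^esub> = (\<lambda>c a. 0)"
  "(f \<odot>\<^bsub>sect (densities A) U\<^esub> \<omega>) = (\<lambda>c a. if a \<in> U then val A U f a * \<omega> c a else 0)"
  "res (densities A) U V \<omega> = (\<lambda>c a. if a \<in> V then \<omega> c a else 0)"
  by (simp_all add: densities_def)

lemma dens_red: "\<omega> \<in> density_sections A W \<Longrightarrow> c \<in> charts A \<Longrightarrow> \<omega> c \<in> red_functions A (chart_dom c \<inter> W)"
  by (simp add: density_sections_def)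

lemma dens_no_chart: "\<omega> \<in> density_sections A W \<Longrightarrow> c \<notin> charts A \<Longrightarrow> \<omega> c a = 0"
  by (simp add: density_sections_def del: split_paired_All)

lemma dens_off: "\<omega> \<in> density_sections A W \<Longrightarrow> a \<notin> W \<Longrightarrow> \<omega> c a = 0"
  by (cases "c \<in> charts A") (simp_all add: dens_no_chart red_off[OF dens_red])

lemma dens_chart_off: "\<omega> \<in> density_sections A W \<Longrightarrow> c \<in> charts A \<Longrightarrow> a \<notin> chart_dom c \<Longrightarrow> \<omega> c a = 0"
  by (rule red_off[OF dens_red]) simp_all

lemma dens_trans:
  assumes "\<omega> \<in> density_sections A W" "c \<in> charts A" "c' \<in> charts A" "a \<in> chart_dom c" "a \<in> chart_dom c'" "a \<in> W"
  shows "\<omega> c a = complex_of_real \<bar>transition_det c c' a\<bar> * \<omega> c' a"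
proof -
  have "\<forall>c \<in> charts A. \<forall>c' \<in> charts A. \<forall>a \<in> chart_dom c \<inter> chart_dom c' \<inter> W.
            \<omega> c a = complex_of_real \<bar>transition_det c c' a\<bar> * \<omega> c' a"
    using assms(1) unfolding density_sections_def by (elim CollectE conjE)
  from this[rule_format, OF assms(2,3), of a] show ?thesis using assms(4-6) by blast
qed

lemma densI:
  assumes "\<And>c a. c \<notin> charts A \<Longrightarrow> \<omega> c a = 0"
    and "\<And>c. c \<in> charts A \<Longrightarrow> \<omega> c \<in> red_functions A (chart_dom c \<inter> W)"
    and "\<And>c c' a. c \<in> charts A \<Longrightarrow> c' \<in> charts A \<Longrightarrow> a \<in> chart_dom c \<Longrightarrow> a \<in> chart_dom c' \<Longrightarrow> a \<in> W \<Longrightarrow>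
       \<omega> c a = complex_of_real \<bar>transition_det c c' a\<bar> * \<omega> c' a"
  shows "\<omega> \<in> density_sections A W"
  unfolding density_sections_def mem_Collect_eq
proof (intro conjI allI impI ballI)
  show "\<omega> c = (\<lambda>a. 0)" if "c \<notin> charts A" for c by (rule HOL.ext) (rule assms(1)[OF that])
  show "\<omega> c a = complex_of_real \<bar>transition_det c c' a\<bar> * \<omega> c' a"
    if "c \<in> charts A" "c' \<in> charts A" "a \<in> chart_dom c \<inter> chart_dom c' \<inter> W" for c c' a
    using that(3) by (intro assms(3)[OF that(1,2)]) blast+
qed (rule assms(2))

lemma dens_add:
  assumes W: "Op W" and \<omega>: "\<omega> \<in> density_sections A W" and \<eta>: "\<eta> \<in> density_sections A W"
  shows "(\<lambda>c a. \<omega> c a + \<eta> c a) \<in> density_sections A W"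
proof (rule densI)
  fix c c' a assume c: "c \<in> charts A" "c' \<in> charts A" "a \<in> chart_dom c" "a \<in> chart_dom c'" "a \<in> W"
  show "\<omega> c a + \<eta> c a = complex_of_real \<bar>transition_det c c' a\<bar> * (\<omega> c' a + \<eta> c' a)"
    using dens_trans[OF \<omega> c] dens_trans[OF \<eta> c] by (simp add: distrib_left)
qed (use \<omega> \<eta> in \<open>auto intro: red_add dens_red simp: dens_no_chart\<close>)

lemma dens_mult:
  assumes W: "Op W" and \<omega>: "\<omega> \<in> density_sections A W" and g: "g \<in> red_functions A W"
  shows "(\<lambda>c a. g a * \<omega> c a) \<in> density_sections A W"
proof (rule densI)
  fix c c' a assume c: "c \<in> charts A" "c' \<in> charts A" "a \<in> chart_dom c" "a \<in> chart_dom c'" "a \<in> W"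
  show "g a * \<omega> c a = complex_of_real \<bar>transition_det c c' a\<bar> * (g a * \<omega> c' a)"
    using dens_trans[OF \<omega> c] by simp
next
  fix c assume c: "c \<in> charts A"
  have o: "Op (chart_dom c \<inter> W)" using chart_open[OF c] W by blast
  have "(\<lambda>a. g a * \<omega> c a) = (\<lambda>a. (if a \<in> chart_dom c \<inter> W then g a else 0) * \<omega> c a)"
    using red_off[OF dens_red[OF \<omega> c]] by auto
  then show "(\<lambda>a. g a * \<omega> c a) \<in> red_functions A (chart_dom c \<inter> W)"
    using red_mult[OF red_res[OF g o] dens_red[OF \<omega> c]] by simp
qed (use \<omega> in \<open>auto simp: dens_no_chart\<close>)

lemma dens_cmult:
  assumes W: "Op W" and \<omega>: "\<omega> \<in> density_sections A W"
  shows "(\<lambda>c a. k * \<omega> c a) \<in> density_sections A W"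
proof -
  have "(\<lambda>c a. k * \<omega> c a) = (\<lambda>c a. (if a \<in> W then k else 0) * \<omega> c a)" using dens_off[OF \<omega>] by (intro HOL.ext) auto
  then show ?thesis using dens_mult[OF W \<omega> red_const[OF W]] by simp
qed

lemma dens_zero: "Op W \<Longrightarrow> (\<lambda>c a. 0) \<in> density_sections A W"
  by (rule densI) (simp_all add: red_zero chart_open openin_Int)

lemma dens_res:
  assumes \<omega>: "\<omega> \<in> density_sections A W" and V: "Op V" "V \<subseteq> W"
  shows "(\<lambda>c a. if a \<in> V then \<omega> c a else 0) \<in> density_sections A V"
proof (rule densI)
  fix c assume c: "c \<in> charts A"
  have o: "Op (chart_dom c \<inter> V)" "chart_dom c \<inter> V \<subseteq> chart_dom c \<inter> W" using chart_open[OF c] V by auto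
  have "(\<lambda>a. if a \<in> V then \<omega> c a else 0) = (\<lambda>a. if a \<in> chart_dom c \<inter> V then \<omega> c a else 0)"
    using dens_chart_off[OF \<omega> c] by auto
  then show "(\<lambda>a. if a \<in> V then \<omega> c a else 0) \<in> red_functions A (chart_dom c \<inter> V)"
    using red_res[OF dens_red[OF \<omega> c] o] by simp
next
  fix c c' a assume c: "c \<in> charts A" "c' \<in> charts A" "a \<in> chart_dom c" "a \<in> chart_dom c'" "a \<in> V"
  then show "(if a \<in> V then \<omega> c a else 0) = complex_of_real \<bar>transition_det c c' a\<bar> * (if a \<in> V then \<omega> c' a else 0)"
    using dens_trans[OF \<omega> c(1-4)] V by auto
qed (use \<omega> in \<open>auto simp: dens_no_chart\<close>)

lemma red_glue:
  assumes op: "\<And>U. U \<in> \<U> \<Longrightarrow> Op U" and s: "\<And>U. U \<in> \<U> \<Longrightarrow> s U \<in> red_functions A U"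
    and eq: "\<And>U V a. U \<in> \<U> \<Longrightarrow> V \<in> \<U> \<Longrightarrow> a \<in> U \<Longrightarrow> a \<in> V \<Longrightarrow> s U a = s V a"
  shows "\<exists>t\<in>red_functions A (\<Union>\<U>). \<forall>U\<in>\<U>. \<forall>a\<in>U. t a = s U a"
proof -
  define t where "t = (\<lambda>a. if a \<in> \<Union>\<U> then s (SOME U. U \<in> \<U> \<and> a \<in> U) a else 0)"
  have t: "t a = s U a" if "U \<in> \<U>" "a \<in> U" for U a
  proof -
    have s: "(SOME U. U \<in> \<U> \<and> a \<in> U) \<in> \<U> \<and> a \<in> (SOME U. U \<in> \<U> \<and> a \<in> U)"
      by (rule someI[of "\<lambda>U. U \<in> \<U> \<and> a \<in> U" U]) (use that in simp)
    have "a \<in> \<Union>\<U>" using that by blast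
    then show ?thesis unfolding t_def by (simp only: if_True eq[OF conjunct1[OF s] that(1) conjunct2[OF s] that(2)])
  qed
  have "t \<in> red_functions A (\<Union>\<U>)"
  proof (rule red_local)
    fix a assume "a \<in> \<Union>\<U>"
    then obtain U where U: "U \<in> \<U>" "a \<in> U" by blast
    then show "\<exists>V h. Op V \<and> a \<in> V \<and> V \<subseteq> \<Union>\<U> \<and> h \<in> red_functions A V \<and> (\<forall>b\<in>V. t b = h b)"
      using op s t by (intro exI[of _ U] exI[of _ "s U"]) auto
  qed (simp add: t_def)
  then show ?thesis using t by blast
qed

lemma dens_glue:
  assumes op: "\<And>U. U \<in> \<U> \<Longrightarrow> Op U" and s: "\<And>U. U \<in> \<U> \<Longrightarrow> s U \<in> density_sections A U"
    and eq: "\<And>U V c a. U \<in> \<U> \<Longrightarrow> V \<in> \<U> \<Longrightarrow> a \<in> U \<Longrightarrow> a \<in> V \<Longrightarrow> s U c a = s V c a"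
  shows "\<exists>t\<in>density_sections A (\<Union>\<U>). \<forall>U\<in>\<U>. \<forall>c. \<forall>a\<in>U. t c a = s U c a"
proof -
  define t where "t = (\<lambda>c a. if a \<in> \<Union>\<U> then s (SOME U. U \<in> \<U> \<and> a \<in> U) c a else 0)"
  have t: "t c a = s U c a" if "U \<in> \<U>" "a \<in> U" for U a c
  proof -
    have s: "(SOME U. U \<in> \<U> \<and> a \<in> U) \<in> \<U> \<and> a \<in> (SOME U. U \<in> \<U> \<and> a \<in> U)"
      by (rule someI[of "\<lambda>U. U \<in> \<U> \<and> a \<in> U" U]) (use that in simp)
    have "a \<in> \<Union>\<U>" using that by blast
    then show ?thesis unfolding t_def by (simp only: if_True eq[OF conjunct1[OF s] that(1) conjunct2[OF s] that(2)])
  qed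
  have "t \<in> density_sections A (\<Union>\<U>)"
  proof (rule densI)
    fix c a assume c: "c \<notin> charts A"
    show "t c a = 0"
    proof (cases "a \<in> \<Union>\<U>")
      case True
      then obtain U where U: "U \<in> \<U>" "a \<in> U" by blast
      show ?thesis unfolding t[OF U] by (rule dens_no_chart[OF s[OF U(1)] c])
    qed (simp add: t_def)
  next
    fix c assume c: "c \<in> charts A"
    show "t c \<in> red_functions A (chart_dom c \<inter> \<Union>\<U>)"
    proof (rule red_local)
      fix a assume a: "a \<notin> chart_dom c \<inter> \<Union>\<U>"
      show "t c a = 0"
      proof (cases "a \<in> \<Union>\<U>")
        case True
        then obtain U where U: "U \<in> \<U>" "a \<in> U" by blast
        show ?thesis unfolding t[OF U] by (rule dens_chart_off[OF s[OF U(1)] c]) (use a True in blast)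
      qed (simp add: t_def)
    next
      fix a assume "a \<in> chart_dom c \<inter> \<Union>\<U>"
      then obtain U where U: "U \<in> \<U>" "a \<in> U" "a \<in> chart_dom c" by blast
      then show "\<exists>V h. Op V \<and> a \<in> V \<and> V \<subseteq> chart_dom c \<inter> \<Union>\<U> \<and> h \<in> red_functions A V \<and> (\<forall>b\<in>V. t c b = h b)"
        using op[OF U(1)] dens_red[OF s[OF U(1)] c] t chart_open[OF c]
        by (intro exI[of _ "chart_dom c \<inter> U"] exI[of _ "s U c"]) auto
    qed
  next
    fix c c' a assume c: "c \<in> charts A" "c' \<in> charts A" "a \<in> chart_dom c" "a \<in> chart_dom c'" "a \<in> \<Union>\<U>"
    then obtain U where U: "U \<in> \<U>" "a \<in> U" by blast
    show "t c a = complex_of_real \<bar>transition_det c c' a\<bar> * t c' a"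
      using dens_trans[OF s[OF U(1)] c(1-4) U(2)] t[OF U] by simp
  qed
  then show ?thesis using t by blast
qed

text \<open>\<open>A\<close> acts through residues, so the module laws reduce to
  \<open>val_add\<close>, \<open>val_mult\<close> and \<open>val_one\<close>. Sections are
  functions, hence glue pointwise, and membership of the result is a local condition.\<close>

lemma reduction_sheaf: "sheaf_of_modules A (reduction A)"
proof -
  have pre: "is_presheaf (reduction A)"
    unfolding is_presheaf_def reduction_simps by (auto intro: red_res simp: red_off fun_eq_iff)
  have sheaf: "is_sheaf (reduction A)"
    unfolding is_sheaf_def reduction_simps
  proof (intro conjI pre allI impI)
    fix \<U> and s :: "'m set \<Rightarrow> 'm \<Rightarrow> complex"
    assume as: "(\<forall>U\<in>\<U>. Op U \<and> s U \<in> red_functions A U) \<and>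
       (\<forall>U\<in>\<U>. \<forall>V\<in>\<U>. (\<lambda>a. if a \<in> U \<inter> V then s U a else 0) = (\<lambda>a. if a \<in> U \<inter> V then s V a else 0))"
    have eq: "s U a = s V a" if "U \<in> \<U>" "V \<in> \<U>" "a \<in> U" "a \<in> V" for U V a
      using fun_cong[OF as[THEN conjunct2, rule_format, OF that(1,2)], of a] that(3,4) by simp
    obtain t where t: "t \<in> red_functions A (\<Union>\<U>)" "\<And>U a. U \<in> \<U> \<Longrightarrow> a \<in> U \<Longrightarrow> t a = s U a"
    proof -
      have "\<exists>t\<in>red_functions A (\<Union>\<U>). \<forall>U\<in>\<U>. \<forall>a\<in>U. t a = s U a"
        by (rule red_glue) (use as in simp, use as in simp, rule eq)
      then obtain t where t: "t \<in> red_functions A (\<Union>\<U>)" "\<forall>U\<in>\<U>. \<forall>a\<in>U. t a = s U a" ..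
      show thesis by (rule that[OF t(1)]) (use t(2) in blast)
    qed
    show "\<exists>!t. t \<in> red_functions A (\<Union>\<U>) \<and> (\<forall>U\<in>\<U>. (\<lambda>a. if a \<in> U then t a else 0) = s U)"
    proof (intro ex1I conjI ballI)
      show "(\<lambda>a. if a \<in> U then t a else 0) = s U" if "U \<in> \<U>" for U
        using t(2)[OF that] as that red_off[of "s U" U] by auto
      show "t' = t" if t': "t' \<in> red_functions A (\<Union>\<U>) \<and> (\<forall>U\<in>\<U>. (\<lambda>a. if a \<in> U then t' a else 0) = s U)" for t'
      proof
        fix a show "t' a = t a"
        proof (cases "a \<in> \<Union>\<U>")
          case True
          then obtain U where U: "U \<in> \<U>" "a \<in> U" by blast
          then have "(\<lambda>a. if a \<in> U then t' a else 0) a = s U a"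
            by (intro fun_cong[OF t'[THEN conjunct2, rule_format]])
          then show ?thesis using t(2)[OF U] U by simp
        next
          case False
          then show ?thesis using t' t(1) red_off by metis
        qed
      qed
    qed (rule t)
  qed
  have "module (sect A U) (sect (reduction A) U)" if U: "Op U" for U
  proof (rule moduleI)
    show "cring (sect A U)" by (rule cringA[OF U])
    show "abelian_group (sect (reduction A) U)"
    proof (rule abelian_groupI)
      show "\<exists>y\<in>carrier (sect (reduction A) U). y \<oplus>\<^bsub>sect (reduction A) U\<^esub> x = \<zero>\<^bsub>sect (reduction A) U\<^esub>"
        if "x \<in> carrier (sect (reduction A) U)" for x
        using that red_cmult[OF U, of x "-1"] unfolding reduction_simps by (intro bexI[of _ "\<lambda>a. - 1 * x a"]) simp_all
    qed (auto simp: reduction_simps red_add red_zero U algebra_simps)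
  qed (use U cringA[OF U] in \<open>auto simp: reduction_simps val_add val_mult val_one red_off fun_eq_iff algebra_simps cring.cring_simprules
        intro!: red_mult[OF red_val, of U, simplified if_distrib[of "\<lambda>x. x * _"] if_distribR mult_zero_left]\<close>)
  then show ?thesis
    unfolding sheaf_of_modules_def using sheaf
    by (auto simp: reduction_simps val_res fun_eq_iff)
qed

lemma densities_sheaf: "sheaf_of_modules A (densities A)"
proof -
  have pre: "is_presheaf (densities A)"
    unfolding is_presheaf_def densities_simps by (auto intro: dens_res simp: dens_off fun_eq_iff)
  have sheaf: "is_sheaf (densities A)"
    unfolding is_sheaf_def densities_simps
  proof (intro conjI pre allI impI)
    fix \<U> and s :: "'m set \<Rightarrow> 'm chart \<Rightarrow> 'm \<Rightarrow> complex"
    assume as: "(\<forall>U\<in>\<U>. Op U \<and> s U \<in> density_sections A U) \<and>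
       (\<forall>U\<in>\<U>. \<forall>V\<in>\<U>. (\<lambda>c a. if a \<in> U \<inter> V then s U c a else 0) = (\<lambda>c a. if a \<in> U \<inter> V then s V c a else 0))"
    have eq: "s U c a = s V c a" if "U \<in> \<U>" "V \<in> \<U>" "a \<in> U" "a \<in> V" for U V c a
    proof -
      have "(\<lambda>c a. if a \<in> U \<inter> V then s U c a else 0) c a = (\<lambda>c a. if a \<in> U \<inter> V then s V c a else 0) c a"
        by (rule fun_cong[OF fun_cong[OF as[THEN conjunct2, rule_format, OF that(1,2)]]])
      then show ?thesis using that by simp
    qed
    obtain t where t: "t \<in> density_sections A (\<Union>\<U>)" "\<And>U c a. U \<in> \<U> \<Longrightarrow> a \<in> U \<Longrightarrow> t c a = s U c a"
    proof -
      have "\<exists>t\<in>density_sections A (\<Union>\<U>). \<forall>U\<in>\<U>. \<forall>c. \<forall>a\<in>U. t c a = s U c a"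
        by (rule dens_glue) (use as in simp, use as in simp, rule eq)
      then obtain t where t: "t \<in> density_sections A (\<Union>\<U>)" "\<forall>U\<in>\<U>. \<forall>c. \<forall>a\<in>U. t c a = s U c a" ..
      show thesis by (rule that[OF t(1)]) (use t(2) in blast)
    qed
    show "\<exists>!t. t \<in> density_sections A (\<Union>\<U>) \<and> (\<forall>U\<in>\<U>. (\<lambda>c a. if a \<in> U then t c a else 0) = s U)"
    proof (intro ex1I conjI ballI)
      show "(\<lambda>c a. if a \<in> U then t c a else 0) = s U" if "U \<in> \<U>" for U
        using t(2)[OF that] as that dens_off[of "s U" U] by (auto simp: fun_eq_iff)
      show "t' = t" if t': "t' \<in> density_sections A (\<Union>\<U>) \<and> (\<forall>U\<in>\<U>. (\<lambda>c a. if a \<in> U then t' c a else 0) = s U)" for t'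
      proof (intro HOL.ext)
        fix c a show "t' c a = t c a"
        proof (cases "a \<in> \<Union>\<U>")
          case True
          then obtain U where U: "U \<in> \<U>" "a \<in> U" by blast
          then have "(\<lambda>c a. if a \<in> U then t' c a else 0) c a = s U c a"
            by (intro fun_cong[OF fun_cong[OF t'[THEN conjunct2, rule_format]]])
          then show ?thesis using t(2)[OF U] U by simp
        next
          case False
          then show ?thesis using t' t(1) dens_off by metis
        qed
      qed
    qed (rule t)
  qed
  have smult: "(\<lambda>c a. if a \<in> U then val A U f a * \<omega> c a else 0) \<in> density_sections A U"
    if "Op U" "f \<in> carrier (sect A U)" "\<omega> \<in> density_sections A U" for U f \<omega>
  proof -
    have "(\<lambda>c a. if a \<in> U then val A U f a * \<omega> c a else 0) = (\<lambda>c a. (if a \<in> U then val A U f a else 0) * \<omega> c a)"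
      by (auto simp: fun_eq_iff)
    then show ?thesis using dens_mult[OF that(1,3) red_val[OF that(1,2)]] by simp
  qed
  have "module (sect A U) (sect (densities A) U)" if U: "Op U" for U
  proof (rule moduleI)
    show "cring (sect A U)" by (rule cringA[OF U])
    show "abelian_group (sect (densities A) U)"
    proof (rule abelian_groupI)
      show "\<exists>y\<in>carrier (sect (densities A) U). y \<oplus>\<^bsub>sect (densities A) U\<^esub> x = \<zero>\<^bsub>sect (densities A) U\<^esub>"
        if "x \<in> carrier (sect (densities A) U)" for x
        using that dens_cmult[OF U, of x "-1"] unfolding densities_simps by (intro bexI[of _ "\<lambda>c a. - 1 * x c a"]) simp_all
    qed (auto simp: densities_simps dens_add dens_zero U algebra_simps)
  qed (use U cringA[OF U] smult in \<open>auto simp: densities_simps val_add val_mult val_one dens_off fun_eq_iff algebra_simps cring.cring_simprules\<close>)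
  then show ?thesis
    unfolding sheaf_of_modules_def using sheaf
    by (auto simp: densities_simps val_res fun_eq_iff)
qed

end

section \<open>Partitions of unity\<close>

lemma locally_finite_compactin:
  assumes \<U>: "locally_finite_in X \<U>" and K: "compactin X K"
  shows "finite {U \<in> \<U>. U \<inter> K \<noteq> {}}"
proof -
  let ?\<N> = "{N. openin X N \<and> finite {U \<in> \<U>. U \<inter> N \<noteq> {}}}"
  have "K \<subseteq> \<Union>?\<N>"
  proof
    fix a assume "a \<in> K"
    then have a: "a \<in> topspace X" using compactin_subset_topspace[OF K] by auto
    have "\<forall>x \<in> topspace X. \<exists>V. openin X V \<and> x \<in> V \<and> finite {U \<in> \<U>. U \<inter> V \<noteq> {}}"
      using \<U> by (simp add: locally_finite_in_def)
    from bspec[OF this a] show "a \<in> \<Union>?\<N>" by auto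
  qed
  moreover have "\<forall>N\<in>?\<N>. openin X N" by simp
  ultimately obtain \<F> where \<F>: "finite \<F>" "\<F> \<subseteq> ?\<N>" "K \<subseteq> \<Union>\<F>"
    using K unfolding compactin_def by meson
  have "{U \<in> \<U>. U \<inter> K \<noteq> {}} \<subseteq> (\<Union>N\<in>\<F>. {U \<in> \<U>. U \<inter> N \<noteq> {}})" using \<F>(3) by blast
  then show ?thesis using \<F>(1,2) by (elim finite_subset) auto
qed

lemma Collect_pair_fst: "{(x, y) \<in> X. P x} = {q \<in> X. P (fst q)}"
  by auto

lemma sum_nonneg_Reals: "(\<And>i. i \<in> I \<Longrightarrow> f i \<in> \<real>\<^sub>\<ge>\<^sub>0) \<Longrightarrow> (\<Sum>i\<in>I. f i) \<in> \<real>\<^sub>\<ge>\<^sub>0"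
  by (induction I rule: infinite_finite_induct) (auto intro: nonneg_Reals_add_I)

context formal_mfd
begin

lemma cutoff_red:
  assumes "cutoff V N f C"
  obtains \<psi> where "\<psi> \<in> red_functions A M" "range \<psi> \<subseteq> \<real>\<^sub>\<ge>\<^sub>0" "\<And>a. a \<in> N \<Longrightarrow> \<psi> a = 1" "\<And>a. a \<notin> C \<Longrightarrow> \<psi> a = 0"
proof -
  note f = assms[unfolded cutoff_def]
  let ?\<psi> = "\<lambda>b. if b \<in> M then val A M f b else 0"
  have N: "Op N" "N \<subseteq> M" and C: "Op (M - C)" using f openin_subset openin_Diff_compactin by auto
  show thesis
  proof (rule that[of ?\<psi>])
    show "?\<psi> \<in> red_functions A M" using red_val f by simp
    show "range ?\<psi> \<subseteq> \<real>\<^sub>\<ge>\<^sub>0"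
    proof
      fix z assume "z \<in> range ?\<psi>"
      then obtain b where b: "z = ?\<psi> b" by blast
      show "z \<in> \<real>\<^sub>\<ge>\<^sub>0"
      proof (cases "b \<in> M")
        case True
        then obtain t where "0 \<le> t" "val A M f b = complex_of_real t" using f by blast
        then show ?thesis using b True by simp
      qed (simp add: b)
    qed
    show "?\<psi> a = 1" if "a \<in> N" for a
      using val_res[OF openin_topspace N(1,2) that, where f = f] f val_one[OF N(1) that] that N by auto
    show "?\<psi> a = 0" if "a \<notin> C" for a
      using val_res[OF openin_topspace C Diff_subset, where f = f and b = a] f val_zero[OF C, of a] that by auto
  qed
qed

text \<open>Every function is divided by the locally finite sum \<tau>, which has no zero on
  \<open>M\<close>. Since a partition is a set of pairs, the normalizing map has to be injective for
  sums over its image to be sums over \<open>Q\<close>.\<close>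

lemma normalize_partition:
  fixes Q :: "(('m \<Rightarrow> complex) \<times> 'm chart) set"
  assumes red: "\<And>\<psi> c. (\<psi>, c) \<in> Q \<Longrightarrow> \<psi> \<in> red_functions A M"
    and nonneg: "\<And>\<psi> c. (\<psi>, c) \<in> Q \<Longrightarrow> range \<psi> \<subseteq> \<real>\<^sub>\<ge>\<^sub>0"
    and supp: "\<And>\<psi> c. (\<psi>, c) \<in> Q \<Longrightarrow> c \<in> charts A \<and> base A closure_of {a. \<psi> a \<noteq> 0} \<subseteq> chart_dom c"
    and fin: "\<And>a. a \<in> M \<Longrightarrow> \<exists>V. Op V \<and> a \<in> V \<and> finite {p \<in> Q. \<exists>b\<in>V. fst p b \<noteq> 0}"
    and pos: "\<And>a. a \<in> M \<Longrightarrow> \<exists>p\<in>Q. fst p a \<noteq> 0"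
  shows "\<exists>P. partition_of_unity A P"
proof -
  define S where "S = (\<lambda>a. {p \<in> Q. fst p a \<noteq> 0})"
  define \<tau> where "\<tau> = (\<lambda>a. \<Sum>p\<in>S a. fst p a)"
  have fin_S: "finite (S a)" if a: "a \<in> M" for a
  proof -
    obtain V where "a \<in> V" "finite {p \<in> Q. \<exists>b\<in>V. fst p b \<noteq> 0}" using fin[OF a] by blast
    then show ?thesis by (elim finite_subset[rotated]) (auto simp: S_def)
  qed
  have Q: "fst p \<in> red_functions A M" "fst p b \<in> \<real>\<^sub>\<ge>\<^sub>0" if "p \<in> Q" for p b
    using red[of "fst p" "snd p"] nonneg[of "fst p" "snd p"] that by auto
  have off: "fst p a = 0" if "p \<in> Q" "a \<notin> M" for p a
    using red_off[OF Q(1)[OF that(1)] that(2)] .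
  have \<tau>_nonneg: "\<tau> a \<in> \<real>\<^sub>\<ge>\<^sub>0" for a
    unfolding \<tau>_def by (rule sum_nonneg_Reals) (simp add: S_def Q)
  have \<tau>_nz: "\<tau> a \<noteq> 0" if a: "a \<in> M" for a
  proof
    assume "\<tau> a = 0"
    \<comment> \<open>Nonnegative reals with sum 0 are all 0, against \<open>pos\<close>; the
      argument runs on real parts because the values are complex.\<close>
    then have "(\<Sum>p\<in>S a. Re (fst p a)) = 0" unfolding \<tau>_def Re_sum[symmetric] by simp
    then have z: "\<forall>p\<in>S a. Re (fst p a) = 0"
      using fin_S[OF a] Q(2) by (subst (asm) sum_nonneg_eq_0_iff) (auto simp: S_def complex_nonneg_Reals_iff)
    obtain p where p: "p \<in> Q" "fst p a \<noteq> 0" using pos[OF a] by blast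
    then have "p \<in> S a" by (simp add: S_def)
    then have "Re (fst p a) = 0" by (rule bspec[OF z])
    moreover have "Im (fst p a) = 0" using Q(2)[OF p(1), of a] unfolding complex_nonneg_Reals_iff by simp
    ultimately show False using p(2) by (simp add: complex_eq_iff)
  qed
  have \<tau>_off: "\<tau> a = 0" if "a \<notin> M" for a
    unfolding \<tau>_def S_def using off that by (intro sum.neutral) auto
  have \<tau>_red: "\<tau> \<in> red_functions A M"
  proof (rule red_local)
    fix a assume "a \<in> M"
    then obtain V where V: "Op V" "a \<in> V" "finite {p \<in> Q. \<exists>b\<in>V. fst p b \<noteq> 0}" using fin by blast
    let ?T = "{p \<in> Q. \<exists>b\<in>V. fst p b \<noteq> 0}"
    have VM: "V \<subseteq> M" using openin_subset[OF V(1)] .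
    have "(\<lambda>b. \<Sum>p\<in>?T. fst p b) \<in> red_functions A M" by (rule red_sum) (auto intro: Q)
    from red_res[OF this V(1) VM] have 1: "(\<lambda>b. if b \<in> V then \<Sum>p\<in>?T. fst p b else 0) \<in> red_functions A V" .
    have "\<tau> b = (\<Sum>p\<in>?T. fst p b)" if "b \<in> V" for b
      unfolding \<tau>_def using V(3) that by (intro sum.mono_neutral_left) (auto simp: S_def)
    then show "\<exists>V h. Op V \<and> a \<in> V \<and> V \<subseteq> M \<and> h \<in> red_functions A V \<and> (\<forall>b\<in>V. \<tau> b = h b)"
      using 1 V VM by (intro exI[of _ V] exI[of _ "\<lambda>b. if b \<in> V then \<Sum>p\<in>?T. fst p b else 0"]) simp
  qed (rule \<tau>_off)
  define G where "G = (\<lambda>p :: ('m \<Rightarrow> complex) \<times> 'm chart. ((\<lambda>a. fst p a * inverse (\<tau> a)), snd p))"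
  have G_inj: "inj_on G Q"
  proof (rule inj_onI)
    fix p q assume pq: "p \<in> Q" "q \<in> Q" "G p = G q"
    have "fst p a = fst q a" for a
    proof (cases "a \<in> M")
      case True
      have "(\<lambda>a. fst p a * inverse (\<tau> a)) = (\<lambda>a. fst q a * inverse (\<tau> a))" using pq(3) by (simp add: G_def)
      from fun_cong[OF this, of a] show ?thesis using \<tau>_nz[OF True] by simp
    qed (simp add: off pq)
    then have "fst p = fst q" by (rule HOL.ext)
    moreover have "snd p = snd q" using pq(3) by (simp add: G_def)
    ultimately show "p = q" by (rule prod_eqI)
  qed
  have nz: "fst (G p) a \<noteq> 0 \<longleftrightarrow> fst p a \<noteq> 0" if "p \<in> Q" for p a
    using \<tau>_nz[of a] off[OF that, of a] by (cases "a \<in> M") (auto simp: G_def)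
  have "partition_of_unity A (G ` Q)"
    unfolding partition_of_unity_def
  proof (intro conjI ballI)
    fix q assume "q \<in> G ` Q"
    then obtain p where p: "p \<in> Q" "q = G p" by blast
    have 1: "fst q \<in> red_functions A M"
      unfolding p(2) G_def fst_conv by (rule red_mult[OF Q(1)[OF p(1)] red_inverse[OF _ \<tau>_red \<tau>_nz]]) simp_all
    have 2: "range (fst q) \<subseteq> \<real>\<^sub>\<ge>\<^sub>0"
      unfolding p(2) G_def fst_conv using Q(2)[OF p(1)] \<tau>_nonneg by (auto intro!: nonneg_Reals_mult_I nonneg_Reals_inverse_I)
    have "{a. fst q a \<noteq> 0} = {a. fst p a \<noteq> 0}" using nz[OF p(1)] p(2) by auto
    then have 3: "snd q \<in> charts A \<and> base A closure_of {a. fst q a \<noteq> 0} \<subseteq> chart_dom (snd q)"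
      using supp[of "fst p" "snd p"] p by (simp add: G_def)
    show "case q of (\<rho>, c) \<Rightarrow> \<rho> \<in> red_functions A M \<and> c \<in> charts A \<and> range \<rho> \<subseteq> \<real>\<^sub>\<ge>\<^sub>0 \<and>
        base A closure_of {a. \<rho> a \<noteq> 0} \<subseteq> chart_dom c"
      using 1 2 3 by (simp add: case_prod_beta)
  next
    fix a assume "a \<in> M"
    then obtain V where V: "Op V" "a \<in> V" "finite {p \<in> Q. \<exists>b\<in>V. fst p b \<noteq> 0}" using fin by blast
    have "{(\<rho>, c) \<in> G ` Q. \<exists>b\<in>V. \<rho> b \<noteq> 0} = {q \<in> G ` Q. \<exists>b\<in>V. fst q b \<noteq> 0}" by (rule Collect_pair_fst)
    also have "\<dots> = G ` {p \<in> Q. \<exists>b\<in>V. fst (G p) b \<noteq> 0}" by blast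
    also have "\<dots> \<subseteq> G ` {p \<in> Q. \<exists>b\<in>V. fst p b \<noteq> 0}" using nz by (simp cong: conj_cong)
    finally have sub: "{(\<rho>, c) \<in> G ` Q. \<exists>b\<in>V. \<rho> b \<noteq> 0} \<subseteq> G ` {p \<in> Q. \<exists>b\<in>V. fst p b \<noteq> 0}" .
    then show "\<exists>V. Op V \<and> a \<in> V \<and> finite {(\<rho>, c) \<in> G ` Q. \<exists>b\<in>V. \<rho> b \<noteq> 0}"
      using V(1,2) finite_subset[OF sub finite_imageI[OF V(3)]] by blast
  next
    fix a assume a: "a \<in> M"
    have "{(\<rho>, c). (\<rho>, c) \<in> G ` Q \<and> \<rho> a \<noteq> 0} = {q \<in> G ` Q. fst q a \<noteq> 0}" by (rule Collect_pair_fst)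
    also have "\<dots> = G ` {p \<in> Q. fst (G p) a \<noteq> 0}" by blast
    also have "\<dots> = G ` S a" unfolding S_def using nz by (simp cong: conj_cong)
    finally have "{(\<rho>, c). (\<rho>, c) \<in> G ` Q \<and> \<rho> a \<noteq> 0} = G ` S a" .
    then have "(\<Sum>(\<rho>, c) | (\<rho>, c) \<in> G ` Q \<and> \<rho> a \<noteq> 0. \<rho> a) = (\<Sum>q\<in>G ` S a. fst q a)"
      by (simp add: case_prod_beta)
    also have "\<dots> = (\<Sum>p\<in>S a. fst (G p) a)"
      using inj_on_subset[OF G_inj, of "S a"] by (subst sum.reindex) (auto simp: S_def)
    also have "\<dots> = \<tau> a * inverse (\<tau> a)" by (simp add: G_def \<tau>_def sum_distrib_right)
    also have "\<dots> = 1" using \<tau>_nz[OF a] by simp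
    finally show "(\<Sum>(\<rho>, c) | (\<rho>, c) \<in> G ` Q \<and> \<rho> a \<noteq> 0. \<rho> a) = 1" .
  qed
  then show ?thesis by blast
qed

lemma paracompact_refine:
  assumes "\<And>U. U \<in> \<U> \<Longrightarrow> Op U" "\<Union>\<U> = M"
  obtains \<V> where "\<And>V. V \<in> \<V> \<Longrightarrow> Op V" "\<And>V. V \<in> \<V> \<Longrightarrow> \<exists>U\<in>\<U>. V \<subseteq> U" "\<Union>\<V> = M" "locally_finite_in (base A) \<V>"
proof -
  have "paracompact_in (base A)" using mfd by (simp add: formal_manifold_def)
  from this[unfolded paracompact_in_def, rule_format, of \<U>] assms
  have "\<exists>\<V>. (\<forall>V\<in>\<V>. Op V \<and> (\<exists>U\<in>\<U>. V \<subseteq> U)) \<and> \<Union>\<V> = M \<and> locally_finite_in (base A) \<V>" by simp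
  then obtain \<V> where \<V>: "\<forall>V\<in>\<V>. Op V \<and> (\<exists>U\<in>\<U>. V \<subseteq> U)" "\<Union>\<V> = M" "locally_finite_in (base A) \<V>" by (elim exE conjE)
  show thesis by (rule that[OF _ _ \<V>(2,3)]) (use \<V>(1) in simp_all)
qed

text \<open>Two locally finite refinements stand in for a shrinking lemma. Members of \<V> lie in
  compact subsets of chart domains, members of \<W> in compact subsets of members of \<V>. For each
  member of \<W> a cut-off equal to 1 on it is supported in a member of \<V>. Near a point only
  finitely many members of \<V> occur, and the compact set around each of them meets only finitely
  many members of \<W>.\<close>

lemma partition_of_unity_exists: "\<exists>P. partition_of_unity A P"
proof -
  let ?\<U> = "{V. Op V \<and> (\<exists>C. \<exists>c\<in>charts A. compactin (base A) C \<and> V \<subseteq> C \<and> C \<subseteq> chart_dom c)}"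
  have cov: "\<Union>?\<U> = M"
  proof
    show "\<Union>?\<U> \<subseteq> M" using openin_subset by blast
    show "M \<subseteq> \<Union>?\<U>"
    proof
      fix a assume "a \<in> M"
      then obtain c where c: "c \<in> charts A" "a \<in> chart_dom c" using chart_exists by blast
      obtain N f C where N: "cutoff (chart_dom c) N f C" "a \<in> N" "N \<subseteq> C" using cutoff_point[OF chart_open[OF c(1)] c(2)] .
      then have "N \<in> ?\<U>" using c unfolding cutoff_def by blast
      then show "a \<in> \<Union>?\<U>" using N(2) by blast
    qed
  qed
  obtain \<V> where \<V>: "\<And>V. V \<in> \<V> \<Longrightarrow> Op V" "\<And>V. V \<in> \<V> \<Longrightarrow> \<exists>U\<in>?\<U>. V \<subseteq> U" "\<Union>\<V> = M" "locally_finite_in (base A) \<V>"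
    by (rule paracompact_refine[of ?\<U>, OF _ cov]) blast+
  have "\<exists>C c. c \<in> charts A \<and> compactin (base A) C \<and> V \<subseteq> C \<and> C \<subseteq> chart_dom c" if "V \<in> \<V>" for V
    using \<V>(2)[OF that] by fast
  then obtain CV ch where CV: "\<And>V. V \<in> \<V> \<Longrightarrow> ch V \<in> charts A \<and> compactin (base A) (CV V) \<and> V \<subseteq> CV V \<and> CV V \<subseteq> chart_dom (ch V)"
    by metis
  let ?\<U>' = "{W. Op W \<and> (\<exists>C. \<exists>V\<in>\<V>. compactin (base A) C \<and> W \<subseteq> C \<and> C \<subseteq> V)}"
  have cov': "\<Union>?\<U>' = M"
  proof
    show "\<Union>?\<U>' \<subseteq> M" using openin_subset by blast
    show "M \<subseteq> \<Union>?\<U>'"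
    proof
      fix a assume "a \<in> M"
      then obtain V where V: "V \<in> \<V>" "a \<in> V" using \<V>(3) by blast
      obtain N f C where N: "cutoff V N f C" "a \<in> N" "N \<subseteq> C" using cutoff_point[OF \<V>(1)[OF V(1)] V(2)] .
      then have "N \<in> ?\<U>'" using V unfolding cutoff_def by blast
      then show "a \<in> \<Union>?\<U>'" using N(2) by blast
    qed
  qed
  obtain \<W> where \<W>: "\<And>W. W \<in> \<W> \<Longrightarrow> Op W" "\<And>W. W \<in> \<W> \<Longrightarrow> \<exists>U\<in>?\<U>'. W \<subseteq> U" "\<Union>\<W> = M" "locally_finite_in (base A) \<W>"
    by (rule paracompact_refine[of ?\<U>', OF _ cov']) blast+
  have "\<exists>V \<psi> D. V \<in> \<V> \<and> W \<subseteq> V \<and> compactin (base A) D \<and> D \<subseteq> V \<and> \<psi> \<in> red_functions A M \<and> range \<psi> \<subseteq> \<real>\<^sub>\<ge>\<^sub>0 \<and>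
      (\<forall>a\<in>W. \<psi> a = 1) \<and> (\<forall>a. a \<notin> D \<longrightarrow> \<psi> a = 0)" if W: "W \<in> \<W>" for W
  proof -
    obtain C V where C: "V \<in> \<V>" "compactin (base A) C" "W \<subseteq> C" "C \<subseteq> V" using \<W>(2)[OF W] by fast
    obtain N f D where f: "cutoff V N f D" "C \<subseteq> N" using cutoff_exists[OF \<V>(1)[OF C(1)] C(2,4)] .
    obtain \<psi> where \<psi>: "\<psi> \<in> red_functions A M" "range \<psi> \<subseteq> \<real>\<^sub>\<ge>\<^sub>0" "\<And>a. a \<in> N \<Longrightarrow> \<psi> a = 1" "\<And>a. a \<notin> D \<Longrightarrow> \<psi> a = 0"
      using cutoff_red[OF f(1)] by blast
    have "compactin (base A) D" "D \<subseteq> V" using f(1) by (auto simp: cutoff_def)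
    then show ?thesis using \<psi> C f(2) by (intro exI[of _ V] exI[of _ \<psi>] exI[of _ D]) auto
  qed
  then obtain v \<psi> D where v: "\<And>W. W \<in> \<W> \<Longrightarrow> v W \<in> \<V> \<and> W \<subseteq> v W \<and> compactin (base A) (D W) \<and> D W \<subseteq> v W \<and>
      \<psi> W \<in> red_functions A M \<and> range (\<psi> W) \<subseteq> \<real>\<^sub>\<ge>\<^sub>0 \<and> (\<forall>a\<in>W. \<psi> W a = 1) \<and> (\<forall>a. a \<notin> D W \<longrightarrow> \<psi> W a = 0)"
    by metis
  let ?g = "\<lambda>W. (\<psi> W, ch (v W))"
  show ?thesis
  proof (rule normalize_partition[of "?g ` \<W>"])
    fix \<psi>' c assume "(\<psi>', c) \<in> ?g ` \<W>"
    then obtain W where W: "W \<in> \<W>" "\<psi>' = \<psi> W" "c = ch (v W)" by auto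
    show "\<psi>' \<in> red_functions A M" "range \<psi>' \<subseteq> \<real>\<^sub>\<ge>\<^sub>0" using v[OF W(1)] W by auto
    have "{a. \<psi>' a \<noteq> 0} \<subseteq> D W" using v[OF W(1)] W by auto
    then have "base A closure_of {a. \<psi>' a \<noteq> 0} \<subseteq> D W"
      using compactin_imp_closedin[OF hausdorff] v[OF W(1)] by (intro closure_of_minimal) auto
    then show "c \<in> charts A \<and> base A closure_of {a. \<psi>' a \<noteq> 0} \<subseteq> chart_dom c"
      using v[OF W(1)] CV[of "v W"] W by blast
  next
    fix a assume a: "a \<in> M"
    obtain N where N: "Op N" "a \<in> N" "finite {V \<in> \<V>. V \<inter> N \<noteq> {}}" using \<V>(4) a unfolding locally_finite_in_def by blast
    \<comment> \<open>The empty set may belong to \<W> while meeting no compact set, so it is added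
      to the finite index set by hand.\<close>
    let ?F = "{V \<in> \<V>. V \<inter> N \<noteq> {}}" let ?H = "insert {} (\<Union>V\<in>?F. {W \<in> \<W>. W \<inter> CV V \<noteq> {}})"
    have fin: "finite ?H"
      using N(3) locally_finite_compactin[OF \<W>(4)] CV by auto
    have "{p \<in> ?g ` \<W>. \<exists>b\<in>N. fst p b \<noteq> 0} \<subseteq> ?g ` ?H"
    proof
      fix p assume "p \<in> {p \<in> ?g ` \<W>. \<exists>b\<in>N. fst p b \<noteq> 0}"
      then obtain W b where W: "W \<in> \<W>" "p = ?g W" "b \<in> N" "\<psi> W b \<noteq> 0" by auto
      have "b \<in> v W" using v[OF W(1)] W(4) by blast
      then have "v W \<in> ?F" using v[OF W(1)] W(3) by blast
      moreover have "W \<inter> CV (v W) = W" using v[OF W(1)] CV[of "v W"] by blast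
      ultimately have "W \<in> ?H" using W(1) by (cases "W = {}") auto
      then show "p \<in> ?g ` ?H" using W(2) by blast
    qed
    then show "\<exists>V. Op V \<and> a \<in> V \<and> finite {p \<in> ?g ` \<W>. \<exists>b\<in>V. fst p b \<noteq> 0}"
      using N fin by (meson finite_imageI finite_subset)
    obtain W where W: "W \<in> \<W>" "a \<in> W" using \<W>(3) a by blast
    then show "\<exists>p\<in>?g ` \<W>. fst p a \<noteq> 0" using v[OF W(1)] by (intro bexI[of _ "?g W"]) auto
  qed
qed

section \<open>Integration of compactly supported densities\<close>

text \<open>Extended by 0, the coordinate expression is continuous on the whole Euclidean space: it
  is continuous on \<phi>(U) and it is 0 off the compact set \<phi>(K). It is bounded and vanishes
  outside a box of finite measure.\<close>

lemma chart_integrable: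
  assumes c: "(U, n, \<phi>) \<in> charts A" and g: "g \<in> red_functions A U"
    and K: "compactin (base A) K" "K \<subseteq> U" "\<And>a. a \<notin> K \<Longrightarrow> g a = 0"
  shows "integrable (\<Pi>\<^sub>M i\<in>{..<n}. lborel)
     (\<lambda>x. let z = (\<lambda>i. if i < n then x i else 0) in if z \<in> \<phi> ` U then g (inv_into U \<phi> z) else 0)"
proof -
  let ?E = "topspace (Euclidean_space n)" and ?\<pi> = "\<lambda>x i. if i < n then x i else (0::real)"
  define H where "H = (\<lambda>z. if z \<in> \<phi> ` U then g (inv_into U \<phi> z) else 0)"
  have U: "Op U" "openin (Euclidean_space n) (\<phi> ` U)"
    "homeomorphic_map (subtopology (base A) U) (subtopology (Euclidean_space n) (\<phi> ` U)) \<phi>"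
    and sm: "\<And>V g. Op V \<Longrightarrow> V \<subseteq> U \<Longrightarrow> (\<And>a. a \<notin> V \<Longrightarrow> g a = 0) \<Longrightarrow>
        g \<in> red_functions A V \<longleftrightarrow> smooth_on n (\<phi> ` V) (\<lambda>x. g (inv_into U \<phi> x))"
    using c unfolding charts_def by auto
  have inj: "inj_on \<phi> U"
    using homeomorphic_imp_injective_map[OF U(3)] openin_subset[OF U(1)] by (simp add: topspace_subtopology Int_absorb1)
  have smU: "Ck_on n 0 (\<phi> ` U) (\<lambda>x. g (inv_into U \<phi> x))"
  proof -
    have "smooth_on n (\<phi> ` U) (\<lambda>x. g (inv_into U \<phi> x))"
      by (rule iffD1[OF sm[OF U(1) order_refl, of g]]) (use red_off[OF g] g in auto)
    then show ?thesis by (rule smooth_on_Ck)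
  qed
  have KE: "compactin (Euclidean_space n) (\<phi> ` K)"
  proof -
    have "compactin (subtopology (base A) U) K" using K by (simp add: compactin_subtopology)
    then have "compactin (subtopology (Euclidean_space n) (\<phi> ` U)) (\<phi> ` K)"
      using image_compactin homeomorphic_imp_continuous_map[OF U(3)] by blast
    then show ?thesis by (simp add: compactin_subtopology)
  qed
  have Kc: "compact (\<phi> ` K)" "\<phi> ` K \<subseteq> ?E"
  proof -
    have "compactin (top_of_set ?E) (\<phi> ` K)" using KE Euclidean_space_eq[of n] by simp
    then show "compact (\<phi> ` K)" by (simp add: compactin_subtopology)
    show "\<phi> ` K \<subseteq> ?E" by (rule compactin_subset_topspace[OF KE])
  qed
  have H0: "H z = 0" if "z \<notin> \<phi> ` K" for z
    using that K(3) f_inv_into_f[of z \<phi> U] unfolding H_def by (metis image_eqI)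
  have openK: "openin (Euclidean_space n) (?E - \<phi> ` K)"
  proof -
    have "openin (top_of_set ?E) (?E - \<phi> ` K)" 
      by (rule openin_diff[OF openin_subtopology_self closed_subset[OF Kc(2) compact_imp_closed[OF Kc(1)]]])
    then show ?thesis using Euclidean_space_eq[of n] by simp
  qed
  have "Ck_on n 0 ?E H"
  proof (rule Ck_on_local)
    fix x assume x: "x \<in> ?E"
    show "\<exists>T. openin (Euclidean_space n) T \<and> x \<in> T \<and> T \<subseteq> ?E \<and> Ck_on n 0 T H"
    proof (cases "x \<in> \<phi> ` U")
      case True
      have "Ck_on n 0 (\<phi> ` U) H" using Ck_on_cong[OF U(2), of H "\<lambda>x. g (inv_into U \<phi> x)"] smU by (simp add: H_def)
      then show ?thesis using U(2) True openin_subset[OF U(2)] by blast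
    next
      case False
      have "Ck_on n 0 (?E - \<phi> ` K) H" using Ck_on_cong[OF openK, of H "\<lambda>_. 0"] Ck_on_const[OF openK] H0 by simp
      moreover have "x \<in> ?E - \<phi> ` K" using False x K(2) by blast
      ultimately show ?thesis using openK by blast
    qed
  qed simp
  then have Hcont: "continuous_on ?E H" by (simp add: Ck_on_0)
  have pc: "continuous_on UNIV ?\<pi>"
  proof (rule continuous_on_coordinatewise_then_product)
    show "continuous_on UNIV (\<lambda>x. ?\<pi> x i)" for i :: nat
      by (cases "i < n") (simp_all add: continuous_on_product_coordinates)
  qed
  have "continuous_on UNIV (\<lambda>x. H (?\<pi> x))"
    by (rule continuous_on_compose2[OF Hcont pc]) (auto simp: topspace_Euclidean_space)
  then have Hm: "(\<lambda>x. H (?\<pi> x)) \<in> borel_measurable borel" by (rule borel_measurable_continuous_onI)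
  \<comment> \<open>The integrand is a continuous function on sequences, composed with the map that
    pads \<open>n\<close> coordinates by 0. The product sigma-algebra on sequences is the Borel one,
    so both are measurable.\<close>
  have "?\<pi> \<in> measurable (\<Pi>\<^sub>M i\<in>{..<n}. lborel) (\<Pi>\<^sub>M i\<in>UNIV. borel)"
  proof (rule measurable_PiM_single')
    show "(\<lambda>x. ?\<pi> x i) \<in> measurable (\<Pi>\<^sub>M i\<in>{..<n}. lborel) borel" for i :: nat
      by (cases "i < n") simp_all
  qed (auto simp: PiE_def)
  then have "?\<pi> \<in> measurable (\<Pi>\<^sub>M i\<in>{..<n}. lborel) borel"
    using measurable_cong_sets[OF refl sets_PiM_equal_borel] by blast
  from measurable_compose[OF this Hm] have meas: "(\<lambda>x. H (?\<pi> x)) \<in> borel_measurable (\<Pi>\<^sub>M i\<in>{..<n}. lborel)"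
    by (simp cong: if_cong)
  have "bounded (H ` (\<phi> ` K))"
    using compact_continuous_image[OF continuous_on_subset[OF Hcont Kc(2)] Kc(1)] by (rule compact_imp_bounded)
  then obtain B where B: "\<And>z. z \<in> \<phi> ` K \<Longrightarrow> norm (H z) \<le> B" by (auto simp: bounded_iff)
  have "\<exists>R. \<forall>z\<in>\<phi> ` K. \<bar>z i\<bar> \<le> R" for i
  proof -
    have "bounded ((\<lambda>z. z i) ` (\<phi> ` K))"
      using compact_continuous_image[OF continuous_on_subset[OF continuous_on_product_coordinates subset_UNIV] Kc(1)]
      by (rule compact_imp_bounded)
    then show ?thesis by (auto simp: bounded_iff)
  qed
  then obtain R where R: "\<And>i z. z \<in> \<phi> ` K \<Longrightarrow> \<bar>z i\<bar> \<le> R i" by metis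
  let ?box = "\<Pi>\<^sub>E i\<in>{..<n}. {- R i..R i}"
  interpret product_sigma_finite "\<lambda>_ :: nat. lborel :: real measure" ..
  have "emeasure (\<Pi>\<^sub>M i\<in>{..<n}. lborel) ?box = (\<Prod>i<n. emeasure lborel {- R i..R i})"
    by (rule emeasure_PiM) auto
  also have "\<dots> < \<infinity>" by (auto simp: emeasure_lborel_Icc_eq less_top[symmetric] ennreal_prod_eq_top)
  finally have fin: "emeasure (\<Pi>\<^sub>M i\<in>{..<n}. lborel) ?box < \<infinity>" .
  have bound: "norm (H z) \<le> max B 0" for z
  proof (cases "z \<in> \<phi> ` K")
    case True
    from B[OF this] show ?thesis by simp
  qed (simp add: H0)
  have "integrable (\<Pi>\<^sub>M i\<in>{..<n}. lborel) (\<lambda>x. H (?\<pi> x))"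
  proof (rule integrableI_bounded_set[OF _ meas fin])
    show "?box \<in> sets (\<Pi>\<^sub>M i\<in>{..<n}. lborel)" by (rule sets_PiM_I_finite) auto
    show "AE x in (\<Pi>\<^sub>M i\<in>{..<n}. lborel). x \<in> ?box \<longrightarrow> norm (H (?\<pi> x)) \<le> max B 0"
    proof (rule AE_I2)
      fix x show "x \<in> ?box \<longrightarrow> norm (H (?\<pi> x)) \<le> max B 0"
        by (rule impI, rule bound)
    qed
    show "AE x in (\<Pi>\<^sub>M i\<in>{..<n}. lborel). x \<notin> ?box \<longrightarrow> H (?\<pi> x) = 0"
    proof (rule AE_I2)
      fix x assume x: "x \<in> space (\<Pi>\<^sub>M i\<in>{..<n}. lborel :: real measure)"
      show "x \<notin> ?box \<longrightarrow> H (?\<pi> x) = 0"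
      proof (rule impI, rule H0, rule notI)
        assume "x \<notin> ?box" "?\<pi> x \<in> \<phi> ` K"
        moreover have "- R i \<le> x i \<and> x i \<le> R i" if "i < n" for i
          using R[OF \<open>?\<pi> x \<in> \<phi> ` K\<close>, of i] that by auto
        ultimately show False using x by (auto simp: space_PiM PiE_iff)
      qed
    qed
  qed
  then show ?thesis by (simp add: H_def Let_def)
qed

definition chart_fun :: "'m set \<Rightarrow> nat \<Rightarrow> ('m \<Rightarrow> nat \<Rightarrow> real) \<Rightarrow> ('m \<Rightarrow> complex) \<Rightarrow> (nat \<Rightarrow> real) \<Rightarrow> complex" where
  "chart_fun U n \<phi> g = (\<lambda>x. let z = (\<lambda>i. if i < n then x i else 0) in if z \<in> \<phi> ` U then g (inv_into U \<phi> z) else 0)"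

lemma chart_integral_fun: "chart_integral (U, n, \<phi>) g = (LINT x | (\<Pi>\<^sub>M i\<in>{..<n}. lborel). chart_fun U n \<phi> g x)"
  by (simp add: chart_fun_def)

definition cdens :: "'m set \<Rightarrow> ('m chart \<Rightarrow> 'm \<Rightarrow> complex) \<Rightarrow> bool" where
  "cdens K \<omega> \<longleftrightarrow> compactin (base A) K \<and> \<omega> \<in> density_sections A M \<and> (\<forall>c a. a \<notin> K \<longrightarrow> \<omega> c a = 0)"

text \<open>A section over \<open>U\<close> is extended by 0 as a function, and that function
  already is a global density: gluing the section with 0 on \<open>M - K\<close> returns it.\<close>

lemma cdensI:
  assumes U: "Op U" and \<omega>: "\<omega> \<in> density_sections A U" and K: "compactin (base A) K" "K \<subseteq> U"
    and 0: "\<And>c a. a \<notin> K \<Longrightarrow> \<omega> c a = 0"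
  shows "cdens K \<omega>"
proof -
  let ?s = "\<lambda>V. if V = U then \<omega> else (\<lambda>c a. 0)"
  have "\<exists>t\<in>density_sections A (\<Union>{U, M - K}). \<forall>V\<in>{U, M - K}. \<forall>c. \<forall>a\<in>V. t c a = ?s V c a"
  proof (rule dens_glue)
    show "Op V" if "V \<in> {U, M - K}" for V using that U openin_Diff_compactin[OF _ K(1), of M] by auto
    then show "?s V \<in> density_sections A V" if "V \<in> {U, M - K}" for V using that \<omega> dens_zero by auto
    show "?s V c a = ?s W c a" if "V \<in> {U, M - K}" "W \<in> {U, M - K}" "a \<in> V" "a \<in> W" for V W c a
    proof (cases "V = W")
      case False
      then have "a \<notin> K" using that by auto
      then show ?thesis by (simp add: 0)
    qed simp
  qed
  then obtain t where t: "t \<in> density_sections A (\<Union>{U, M - K})" "\<forall>V\<in>{U, M - K}. \<forall>c. \<forall>a\<in>V. t c a = ?s V c a" ..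
  have UM: "\<Union>{U, M - K} = M" using K openin_subset[OF U] by auto
  have "t = \<omega>"
  proof (intro HOL.ext)
    fix c a
    have tV: "t c a = ?s V c a" if "V \<in> {U, M - K}" "a \<in> V" for V using t(2) that by blast
    consider "a \<in> U" | "a \<notin> U" "a \<in> M - K" | "a \<notin> M" using UM by auto
    then show "t c a = \<omega> c a"
    proof cases
      case 1 then show ?thesis using tV[of U] by simp
    next
      case 2
      then have "M - K \<noteq> U" by auto
      then show ?thesis using tV[of "M - K"] 2 by (simp add: 0)
    next
      case 3
      then show ?thesis using dens_off[OF t(1), of a c] dens_off[OF \<omega>, of a c] UM openin_subset[OF U] by auto
    qed
  qed
  then show ?thesis using t(1) UM K(1) 0 by (simp add: cdens_def)
qed

lemma cdens_mono: "cdens K \<omega> \<Longrightarrow> K \<subseteq> L \<Longrightarrow> compactin (base A) L \<Longrightarrow> cdens L \<omega>"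
  unfolding cdens_def by blast

lemma cdens_add: "cdens K \<omega> \<Longrightarrow> cdens K \<eta> \<Longrightarrow> cdens K (\<lambda>c a. \<omega> c a + \<eta> c a)"
  unfolding cdens_def using dens_add[of M \<omega> \<eta>] by simp

lemma cdens_cmult: "cdens K \<omega> \<Longrightarrow> cdens K (\<lambda>c a. k * \<omega> c a)"
  unfolding cdens_def using dens_cmult[of M \<omega> k] by simp

definition some_pou :: "(('m \<Rightarrow> complex) \<times> 'm chart) set" where
  "some_pou = (SOME P. partition_of_unity A P)"

lemma some_pou: "partition_of_unity A some_pou"
  unfolding some_pou_def using partition_of_unity_exists by (rule someI_ex)

lemma some_pou_red: "p \<in> some_pou \<Longrightarrow> fst p \<in> red_functions A M"
  and some_pou_chart: "p \<in> some_pou \<Longrightarrow> snd p \<in> charts A"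
  and some_pou_support: "p \<in> some_pou \<Longrightarrow> base A closure_of {a. fst p a \<noteq> 0} \<subseteq> chart_dom (snd p)"
proof -
  have "\<forall>p\<in>some_pou. fst p \<in> red_functions A M \<and> snd p \<in> charts A \<and> base A closure_of {a. fst p a \<noteq> 0} \<subseteq> chart_dom (snd p)"
    using some_pou by (simp add: partition_of_unity_def case_prod_beta)
  then show "p \<in> some_pou \<Longrightarrow> fst p \<in> red_functions A M" "p \<in> some_pou \<Longrightarrow> snd p \<in> charts A"
    "p \<in> some_pou \<Longrightarrow> base A closure_of {a. fst p a \<noteq> 0} \<subseteq> chart_dom (snd p)" by simp_all
qed

lemma some_pou_locally_finite:
  assumes "a \<in> M"
  shows "\<exists>V. Op V \<and> a \<in> V \<and> finite {p \<in> some_pou. \<exists>b\<in>V. fst p b \<noteq> 0}"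
proof -
  have e: "{(\<rho>, c) \<in> some_pou. \<exists>b\<in>V. \<rho> b \<noteq> 0} = {p \<in> some_pou. \<exists>b\<in>V. fst p b \<noteq> 0}" for V by auto
  have "\<forall>a\<in>M. \<exists>V. Op V \<and> a \<in> V \<and> finite {(\<rho>, c) \<in> some_pou. \<exists>b\<in>V. \<rho> b \<noteq> 0}"
    using some_pou unfolding partition_of_unity_def by (elim conjE)
  from bspec[OF this assms] show ?thesis unfolding e .
qed

definition pou_over :: "'m set \<Rightarrow> (('m \<Rightarrow> complex) \<times> 'm chart) set" where
  "pou_over K = {p \<in> some_pou. \<exists>a\<in>K. fst p a \<noteq> 0}"

lemma finite_pou_over:
  assumes K: "compactin (base A) K"
  shows "finite (pou_over K)"
proof -
  let ?\<N> = "{N. Op N \<and> finite {p \<in> some_pou. \<exists>b\<in>N. fst p b \<noteq> 0}}"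
  have "K \<subseteq> \<Union>?\<N>"
  proof
    fix a assume "a \<in> K"
    then have "a \<in> M" using compactin_subset_topspace[OF K] by auto
    from some_pou_locally_finite[OF this] show "a \<in> \<Union>?\<N>" by auto
  qed
  moreover have "\<forall>N\<in>?\<N>. Op N" by blast
  ultimately obtain \<F> where \<F>: "finite \<F>" "\<F> \<subseteq> ?\<N>" "K \<subseteq> \<Union>\<F>"
    using K unfolding compactin_def by meson
  have "pou_over K \<subseteq> (\<Union>N\<in>\<F>. {p \<in> some_pou. \<exists>b\<in>N. fst p b \<noteq> 0})" using \<F>(3) unfolding pou_over_def by blast
  then show ?thesis using \<F>(1,2) by (elim finite_subset) auto
qed

text \<open>The defining sum runs over an index set that depends on \<omega>. Here it is enlarged by
  zero terms to the finite set of those partition functions that do not vanish identically on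
  \<open>K\<close>, so that integrals of different densities become comparable.\<close>

lemma density_integral_eq:
  assumes "cdens K \<omega>"
  shows "density_integral A \<omega> = (\<Sum>p\<in>pou_over K. chart_integral (snd p) (\<lambda>a. fst p a * \<omega> (snd p) a))"
proof -
  have "density_integral A \<omega> = (\<Sum>p | p \<in> some_pou \<and> (\<exists>a. fst p a * \<omega> (snd p) a \<noteq> 0). chart_integral (snd p) (\<lambda>a. fst p a * \<omega> (snd p) a))"
  proof -
    have "{(\<rho>, c). (\<rho>, c) \<in> some_pou \<and> (\<exists>a. \<rho> a * \<omega> c a \<noteq> 0)} = {p. p \<in> some_pou \<and> (\<exists>a. fst p a * \<omega> (snd p) a \<noteq> 0)}"
      by auto
    then show ?thesis
      by (simp only: density_integral_def some_pou_def[symmetric] Let_def) (rule sum.cong[OF refl], simp add: case_prod_beta)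
  qed
  also have "\<dots> = (\<Sum>p\<in>pou_over K. chart_integral (snd p) (\<lambda>a. fst p a * \<omega> (snd p) a))"
  proof (rule sum.mono_neutral_left)
    show "finite (pou_over K)" using assms finite_pou_over by (simp add: cdens_def)
    show "{p. p \<in> some_pou \<and> (\<exists>a. fst p a * \<omega> (snd p) a \<noteq> 0)} \<subseteq> pou_over K"
      using assms unfolding cdens_def pou_over_def by (auto simp del: split_paired_All)
    show "\<forall>p\<in>pou_over K - {p. p \<in> some_pou \<and> (\<exists>a. fst p a * \<omega> (snd p) a \<noteq> 0)}. chart_integral (snd p) (\<lambda>a. fst p a * \<omega> (snd p) a) = 0"
    proof
      fix p assume "p \<in> pou_over K - {p. p \<in> some_pou \<and> (\<exists>a. fst p a * \<omega> (snd p) a \<noteq> 0)}"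
      then have "\<And>a. fst p a * \<omega> (snd p) a = 0" by (auto simp: pou_over_def)
      then have "(\<lambda>a. fst p a * \<omega> (snd p) a) = (\<lambda>a. 0)" by (rule HOL.ext)
      then show "chart_integral (snd p) (\<lambda>a. fst p a * \<omega> (snd p) a) = 0"
        by (cases "snd p") (simp add: Let_def)
    qed
  qed
  finally show ?thesis .
qed

lemma cdens_integrable:
  assumes \<omega>: "cdens K \<omega>" and p: "p \<in> some_pou" and c: "snd p = (U, n, \<phi>)"
  shows "integrable (\<Pi>\<^sub>M i\<in>{..<n}. lborel) (chart_fun U n \<phi> (\<lambda>a. fst p a * \<omega> (snd p) a))"
  unfolding chart_fun_def
proof (rule chart_integrable)
  have P: "fst p \<in> red_functions A M" "snd p \<in> charts A" "base A closure_of {a. fst p a \<noteq> 0} \<subseteq> U"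
    using some_pou_red[OF p] some_pou_chart[OF p] some_pou_support[OF p] c by simp_all
  show "(U, n, \<phi>) \<in> charts A" using P c by simp
  have U: "Op U" using chart_open[OF P(2)] c by simp
  have UM: "chart_dom (snd p) \<inter> M = U" using openin_subset[OF U] c by auto
  have w: "\<omega> (snd p) \<in> red_functions A U" using dens_red[of \<omega> M "snd p"] \<omega> P(2) UM by (simp add: cdens_def)
  have "(\<lambda>a. fst p a * \<omega> (snd p) a) = (\<lambda>a. (if a \<in> U then fst p a else 0) * \<omega> (snd p) a)"
    using red_off[OF w] by auto
  then show "(\<lambda>a. fst p a * \<omega> (snd p) a) \<in> red_functions A U"
    using red_mult[OF red_res[OF P(1) U openin_subset[OF U]] w] by simp
  \<comment> \<open>The closed support of the partition function lies in the chart domain; its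
    intersection with \<open>K\<close> is compact and carries the product.\<close>
  let ?L = "K \<inter> (base A closure_of {a. fst p a \<noteq> 0})"
  have K: "compactin (base A) K" using \<omega> by (simp add: cdens_def)
  show "compactin (base A) ?L" by (rule compact_Int_closedin[OF K closedin_closure_of])
  show "?L \<subseteq> U" using P(3) by blast
  show "fst p a * \<omega> (snd p) a = 0" if a: "a \<notin> ?L" for a
  proof (cases "a \<in> K")
    case True
    then have "a \<notin> {a. fst p a \<noteq> 0}"
      using a closure_of_subset[of "{a. fst p a \<noteq> 0}" "base A"] red_off[OF P(1)] by blast
    then show ?thesis by simp
  next
    case False
    then show ?thesis using \<omega> by (simp add: cdens_def del: split_paired_All)
  qed
qed

lemma density_integral_add:
  assumes "cdens K \<omega>" "cdens K \<eta>"
  shows "density_integral A (\<lambda>c a. \<omega> c a + \<eta> c a) = density_integral A \<omega> + density_integral A \<eta>"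
proof -
  have "chart_integral (snd p) (\<lambda>a. fst p a * (\<omega> (snd p) a + \<eta> (snd p) a)) =
     chart_integral (snd p) (\<lambda>a. fst p a * \<omega> (snd p) a) + chart_integral (snd p) (\<lambda>a. fst p a * \<eta> (snd p) a)"
    if "p \<in> pou_over K" for p
  proof -
    obtain U n \<phi> where c: "snd p = (U, n, \<phi>)" by (cases "snd p")
    have p: "p \<in> some_pou" using that by (simp add: pou_over_def)
    show ?thesis
      using Bochner_Integration.integral_add[OF cdens_integrable[OF assms(1) p c] cdens_integrable[OF assms(2) p c]]
      unfolding c chart_integral_fun by (simp add: chart_fun_def Let_def algebra_simps if_distrib cong: if_cong)
  qed
  then show ?thesis
    unfolding density_integral_eq[OF assms(1)] density_integral_eq[OF assms(2)] density_integral_eq[OF cdens_add[OF assms]]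
    by (simp add: sum.distrib)
qed

lemma density_integral_cmult:
  assumes "cdens K \<omega>"
  shows "density_integral A (\<lambda>c a. k * \<omega> c a) = k * density_integral A \<omega>"
proof -
  have "chart_integral (snd p) (\<lambda>a. fst p a * (k * \<omega> (snd p) a)) = k * chart_integral (snd p) (\<lambda>a. fst p a * \<omega> (snd p) a)" for p
  proof -
    obtain U n \<phi> where c: "snd p = (U, n, \<phi>)" by (cases "snd p")
    show ?thesis
      unfolding c chart_integral_fun integral_mult_right_zero[symmetric]
      by (rule Bochner_Integration.integral_cong) (simp_all add: chart_fun_def Let_def algebra_simps)
  qed
  then show ?thesis
    unfolding density_integral_eq[OF assms(1)] density_integral_eq[OF cdens_cmult[OF assms]]
    by (simp add: sum_distrib_left)
qed

end

section \<open>Locally convex spaces\<close>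

lemma complex_ring_simps:
  "carrier complex_ring = UNIV" "x \<otimes>\<^bsub>complex_ring\<^esub> y = x * y" "x \<oplus>\<^bsub>complex_ring\<^esub> y = x + y"
  "\<one>\<^bsub>complex_ring\<^esub> = 1" "\<zero>\<^bsub>complex_ring\<^esub> = 0"
  by (simp_all add: complex_ring_def)

lemma cring_complex_ring: "cring complex_ring"
proof (rule cringI)
  show "abelian_group complex_ring"
  proof (rule abelian_groupI)
    show "\<exists>y\<in>carrier complex_ring. y \<oplus>\<^bsub>complex_ring\<^esub> x = \<zero>\<^bsub>complex_ring\<^esub>" for x
      by (rule bexI[of _ "- x"]) (simp_all add: complex_ring_simps)
  qed (simp_all add: complex_ring_simps)
  show "Group.comm_monoid complex_ring" by (rule comm_monoidI) (simp_all add: complex_ring_simps)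
qed (simp_all add: complex_ring_simps algebra_simps)

lemma module_vtop:
  assumes "Module.module complex_ring V"
  shows "Module.module complex_ring (V\<lparr>vtop := T\<rparr>)"
proof -
  interpret V: module complex_ring V by (rule assms)
  show ?thesis
  proof (rule moduleI)
    show "abelian_group (V\<lparr>vtop := T\<rparr>)"
    proof (rule abelian_groupI)
      show "\<exists>y\<in>carrier (V\<lparr>vtop := T\<rparr>). y \<oplus>\<^bsub>V\<lparr>vtop := T\<rparr>\<^esub> x = \<zero>\<^bsub>V\<lparr>vtop := T\<rparr>\<^esub>" if "x \<in> carrier (V\<lparr>vtop := T\<rparr>)" for x
        using that by (intro bexI[of _ "\<ominus>\<^bsub>V\<^esub> x"]) (simp_all add: V.M.l_neg)
    qed (simp_all add: V.M.a_ac)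
  qed (use V.smult_l_distr V.smult_r_distr V.smult_assoc1 V.smult_one in \<open>simp_all add: cring_complex_ring complex_ring_simps\<close>)
qed

locale lcspace =
  fixes E :: "'e tvs"
  assumes lcs: "lcs E"

sublocale lcspace \<subseteq> module complex_ring E
  using lcs by (simp add: lcs_def)

context lcspace
begin

lemma top_E: "topspace (vtop E) = carrier E"
  using lcs by (simp add: lcs_def)

lemma smult_simps:
  "x \<in> carrier E \<Longrightarrow> c \<odot>\<^bsub>E\<^esub> x \<in> carrier E"
  "x \<in> carrier E \<Longrightarrow> (c + d) \<odot>\<^bsub>E\<^esub> x = c \<odot>\<^bsub>E\<^esub> x \<oplus>\<^bsub>E\<^esub> d \<odot>\<^bsub>E\<^esub> x"
  "x \<in> carrier E \<Longrightarrow> y \<in> carrier E \<Longrightarrow> c \<odot>\<^bsub>E\<^esub> (x \<oplus>\<^bsub>E\<^esub> y) = c \<odot>\<^bsub>E\<^esub> x \<oplus>\<^bsub>E\<^esub> c \<odot>\<^bsub>E\<^esub> y"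
  "x \<in> carrier E \<Longrightarrow> (c * d) \<odot>\<^bsub>E\<^esub> x = c \<odot>\<^bsub>E\<^esub> (d \<odot>\<^bsub>E\<^esub> x)"
  "x \<in> carrier E \<Longrightarrow> 1 \<odot>\<^bsub>E\<^esub> x = x"
  "x \<in> carrier E \<Longrightarrow> 0 \<odot>\<^bsub>E\<^esub> x = \<zero>\<^bsub>E\<^esub>"
  "c \<odot>\<^bsub>E\<^esub> \<zero>\<^bsub>E\<^esub> = \<zero>\<^bsub>E\<^esub>"
  using smult_closed smult_l_distr[of c d x] smult_r_distr[of c x y] smult_assoc1[of c d x] smult_one[of x] smult_l_null[of x] smult_r_null[of c]
  by (simp_all add: complex_ring_simps)

lemma add_cont: "continuous_map (prod_topology (vtop E) (vtop E)) (vtop E) (\<lambda>(x, y). x \<oplus>\<^bsub>E\<^esub> y)"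
  and smult_cont: "continuous_map (prod_topology euclidean (vtop E)) (vtop E) (\<lambda>(c, x). c \<odot>\<^bsub>E\<^esub> x)"
  using lcs by (simp_all add: lcs_def)

lemma continuous_add:
  assumes "continuous_map X (vtop E) f" "continuous_map X (vtop E) g"
  shows "continuous_map X (vtop E) (\<lambda>x. f x \<oplus>\<^bsub>E\<^esub> g x)"
  using continuous_map_compose[OF continuous_map_pairedI[OF assms] add_cont] by (simp add: o_def)

lemma continuous_smult:
  assumes "continuous_map X euclidean f" "continuous_map X (vtop E) g"
  shows "continuous_map X (vtop E) (\<lambda>x. f x \<odot>\<^bsub>E\<^esub> g x)"
  using continuous_map_compose[OF continuous_map_pairedI[OF assms] smult_cont] by (simp add: o_def)

lemma nbhd_half:
  assumes N: "openin (vtop E) N" "\<zero>\<^bsub>E\<^esub> \<in> N"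
  obtains N' where "openin (vtop E) N'" "\<zero>\<^bsub>E\<^esub> \<in> N'" "\<And>x y. x \<in> N' \<Longrightarrow> y \<in> N' \<Longrightarrow> x \<oplus>\<^bsub>E\<^esub> y \<in> N"
proof -
  let ?P = "{p \<in> topspace (prod_topology (vtop E) (vtop E)). (\<lambda>(x, y). x \<oplus>\<^bsub>E\<^esub> y) p \<in> N}"
  have "openin (prod_topology (vtop E) (vtop E)) ?P"
    by (rule openin_continuous_map_preimage[OF add_cont N(1)])
  moreover have "(\<zero>\<^bsub>E\<^esub>, \<zero>\<^bsub>E\<^esub>) \<in> ?P" using N(2) by (simp add: top_E)
  ultimately obtain N1 N2 where "openin (vtop E) N1" "openin (vtop E) N2" "\<zero>\<^bsub>E\<^esub> \<in> N1" "\<zero>\<^bsub>E\<^esub> \<in> N2" "N1 \<times> N2 \<subseteq> ?P"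
    unfolding openin_prod_topology_alt by meson
  then show thesis by (intro that[of "N1 \<inter> N2"]) auto
qed

lemma nbhd_smult:
  assumes N: "openin (vtop E) N" "\<zero>\<^bsub>E\<^esub> \<in> N"
  obtains e N' where "e > 0" "openin (vtop E) N'" "\<zero>\<^bsub>E\<^esub> \<in> N'" "\<And>c' x. cmod (c' - c) < e \<Longrightarrow> x \<in> N' \<Longrightarrow> c' \<odot>\<^bsub>E\<^esub> x \<in> N"
proof -
  let ?P = "{p \<in> topspace (prod_topology euclidean (vtop E)). (\<lambda>(c, x). c \<odot>\<^bsub>E\<^esub> x) p \<in> N}"
  have "openin (prod_topology euclidean (vtop E)) ?P"
    by (rule openin_continuous_map_preimage[OF smult_cont N(1)])
  moreover have "(c, \<zero>\<^bsub>E\<^esub>) \<in> ?P" using N(2) by (simp add: top_E smult_simps)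
  ultimately obtain S N' where S: "openin euclidean S" "openin (vtop E) N'" "c \<in> S" "\<zero>\<^bsub>E\<^esub> \<in> N'" "S \<times> N' \<subseteq> ?P"
    unfolding openin_prod_topology_alt by meson
  obtain e where e: "e > 0" "\<And>c'. dist c' c < e \<Longrightarrow> c' \<in> S" using S(1,3) by (auto simp: open_dist)
  show thesis
  proof (rule that[OF e(1) S(2,4)])
    show "c' \<odot>\<^bsub>E\<^esub> x \<in> N" if "cmod (c' - c) < e" "x \<in> N'" for c' x
      using S(5) e(2)[of c'] that by (auto simp: dist_norm)
  qed
qed

lemma nbhd_convex:
  assumes "openin (vtop E) W" "\<zero>\<^bsub>E\<^esub> \<in> W"
  obtains N C where "openin (vtop E) N" "\<zero>\<^bsub>E\<^esub> \<in> N" "N \<subseteq> C" "C \<subseteq> W"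
    "\<And>x y t. x \<in> C \<Longrightarrow> y \<in> C \<Longrightarrow> t \<in> {0..1} \<Longrightarrow>
       (complex_of_real t \<odot>\<^bsub>E\<^esub> x) \<oplus>\<^bsub>E\<^esub> (complex_of_real (1 - t) \<odot>\<^bsub>E\<^esub> y) \<in> C"
proof -
  have "\<forall>W. openin (vtop E) W \<and> \<zero>\<^bsub>E\<^esub> \<in> W \<longrightarrow>
        (\<exists>N C. openin (vtop E) N \<and> \<zero>\<^bsub>E\<^esub> \<in> N \<and> N \<subseteq> C \<and> C \<subseteq> W \<and>
           (\<forall>x\<in>C. \<forall>y\<in>C. \<forall>t\<in>{0..1}.
              (complex_of_real t \<odot>\<^bsub>E\<^esub> x) \<oplus>\<^bsub>E\<^esub> (complex_of_real (1 - t) \<odot>\<^bsub>E\<^esub> y) \<in> C))"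
    using lcs unfolding lcs_def by (elim conjE)
  from this[rule_format, of W] assms obtain N C where 1: "openin (vtop E) N" "\<zero>\<^bsub>E\<^esub> \<in> N" "N \<subseteq> C" "C \<subseteq> W" and
    2: "\<forall>x\<in>C. \<forall>y\<in>C. \<forall>t\<in>{0..1}. (complex_of_real t \<odot>\<^bsub>E\<^esub> x) \<oplus>\<^bsub>E\<^esub> (complex_of_real (1 - t) \<odot>\<^bsub>E\<^esub> y) \<in> C"
    by auto
  show thesis by (rule that[OF 1]) (use 2 in simp)
qed

text \<open>The initial topology of a linear map into an LCS is locally convex. It need not be
  Hausdorff, which \<open>lcs\<close> permits. This is the source of test topologies for the
  inductive limit.\<close>

lemma pullback_lcs:
  assumes V: "Module.module complex_ring V" and g: "\<And>x. x \<in> carrier V \<Longrightarrow> g x \<in> carrier E"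
    and add: "\<And>x y. x \<in> carrier V \<Longrightarrow> y \<in> carrier V \<Longrightarrow> g (x \<oplus>\<^bsub>V\<^esub> y) = g x \<oplus>\<^bsub>E\<^esub> g y"
    and smult: "\<And>c x. x \<in> carrier V \<Longrightarrow> g (c \<odot>\<^bsub>V\<^esub> x) = c \<odot>\<^bsub>E\<^esub> g x"
  shows "Defs.lcs (V\<lparr>vtop := pullback_topology (carrier V) g (vtop E)\<rparr>)"
proof -
  interpret V: module complex_ring V by (rule V)
  let ?T = "pullback_topology (carrier V) g (vtop E)"
  have top: "topspace ?T = carrier V" using g by (auto simp: topspace_pullback_topology top_E)
  have gc: "continuous_map ?T (vtop E) g" using continuous_map_pullback[OF continuous_map_id[of "vtop E"], where A = "carrier V" and f = g] by (simp add: id_def o_def)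
  have g0: "g \<zero>\<^bsub>V\<^esub> = \<zero>\<^bsub>E\<^esub>" using smult[of "\<zero>\<^bsub>V\<^esub>" 0] V.smult_l_null[of "\<zero>\<^bsub>V\<^esub>"] g[of "\<zero>\<^bsub>V\<^esub>"] by (simp add: complex_ring_simps smult_simps)
  have into: "continuous_map X ?T f" if "continuous_map X (vtop E) (\<lambda>x. g (f x))" "\<And>x. x \<in> topspace X \<Longrightarrow> f x \<in> carrier V" for X :: "'x topology" and f
    by (rule continuous_map_pullback') (use that in \<open>auto simp: o_def\<close>)
  have "continuous_map (prod_topology ?T ?T) ?T (\<lambda>(x, y). x \<oplus>\<^bsub>V\<^esub> y)"
  proof (rule into)
    have "continuous_map (prod_topology ?T ?T) (vtop E) (\<lambda>p. g (fst p) \<oplus>\<^bsub>E\<^esub> g (snd p))"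
      using continuous_map_compose[OF continuous_map_fst gc] continuous_map_compose[OF continuous_map_snd gc]
      by (intro continuous_add) (simp_all add: o_def)
    then show "continuous_map (prod_topology ?T ?T) (vtop E) (\<lambda>x. g (case x of (x, y) \<Rightarrow> x \<oplus>\<^bsub>V\<^esub> y))"
      by (rule continuous_map_eq) (auto simp: top add)
  qed (auto simp: top)
  moreover have "continuous_map (prod_topology euclidean ?T) ?T (\<lambda>(c, x). c \<odot>\<^bsub>V\<^esub> x)"
  proof (rule into)
    have "continuous_map (prod_topology euclidean ?T) (vtop E) (\<lambda>p. fst p \<odot>\<^bsub>E\<^esub> g (snd p))"
      using continuous_map_compose[OF continuous_map_snd gc]
      by (intro continuous_smult continuous_map_fst) (simp_all add: o_def)
    then show "continuous_map (prod_topology euclidean ?T) (vtop E) (\<lambda>x. g (case x of (c, x) \<Rightarrow> c \<odot>\<^bsub>V\<^esub> x))"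
      by (rule continuous_map_eq) (auto simp: top smult)
  qed (auto simp: top V.smult_closed complex_ring_simps)
  moreover have "\<exists>N C. openin ?T N \<and> \<zero>\<^bsub>V\<^esub> \<in> N \<and> N \<subseteq> C \<and> C \<subseteq> W \<and>
           (\<forall>x\<in>C. \<forall>y\<in>C. \<forall>t\<in>{0..1}. (complex_of_real t \<odot>\<^bsub>V\<^esub> x) \<oplus>\<^bsub>V\<^esub> (complex_of_real (1 - t) \<odot>\<^bsub>V\<^esub> y) \<in> C)"
    if W: "openin ?T W" "\<zero>\<^bsub>V\<^esub> \<in> W" for W
  proof -
    obtain S where S: "openin (vtop E) S" "W = g -` S \<inter> carrier V" using W(1) by (auto simp: openin_pullback_topology)
    then obtain N C where N: "openin (vtop E) N" "\<zero>\<^bsub>E\<^esub> \<in> N" "N \<subseteq> C" "C \<subseteq> S"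
      "\<And>x y t. x \<in> C \<Longrightarrow> y \<in> C \<Longrightarrow> t \<in> {0..1} \<Longrightarrow> (complex_of_real t \<odot>\<^bsub>E\<^esub> x) \<oplus>\<^bsub>E\<^esub> (complex_of_real (1 - t) \<odot>\<^bsub>E\<^esub> y) \<in> C"
      using W(2) g0 nbhd_convex[OF S(1)] by auto
    have cl: "c \<odot>\<^bsub>V\<^esub> x \<in> carrier V" if "x \<in> carrier V" for c x
      using that V.smult_closed by (simp add: complex_ring_simps)
    show ?thesis
    proof (intro exI conjI ballI)
      show "openin ?T (g -` N \<inter> carrier V)" using N(1) by (auto simp: openin_pullback_topology)
      show "complex_of_real t \<odot>\<^bsub>V\<^esub> x \<oplus>\<^bsub>V\<^esub> complex_of_real (1 - t) \<odot>\<^bsub>V\<^esub> y \<in> g -` C \<inter> carrier V"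
        if "x \<in> g -` C \<inter> carrier V" "y \<in> g -` C \<inter> carrier V" "t \<in> {0..1}" for x y t
        using N(5)[of "g x" "g y" t] that cl by (simp add: add smult)
    qed (use N W S g0 in auto)
  qed
  ultimately show ?thesis unfolding Defs.lcs_def using module_vtop[OF V] top by simp
qed

end

lemma vbounded_Un: "vbounded V B \<Longrightarrow> vbounded V B' \<Longrightarrow> vbounded V (B \<union> B')"
  unfolding vbounded_def
proof (intro conjI allI impI)
  fix W
  assume B: "B \<subseteq> carrier V \<and> (\<forall>W. openin (vtop V) W \<and> \<zero>\<^bsub>V\<^esub> \<in> W \<longrightarrow> (\<exists>r>0. \<forall>c. cmod c \<ge> r \<longrightarrow> B \<subseteq> (\<lambda>w. c \<odot>\<^bsub>V\<^esub> w) ` W))"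
    and B': "B' \<subseteq> carrier V \<and> (\<forall>W. openin (vtop V) W \<and> \<zero>\<^bsub>V\<^esub> \<in> W \<longrightarrow> (\<exists>r>0. \<forall>c. cmod c \<ge> r \<longrightarrow> B' \<subseteq> (\<lambda>w. c \<odot>\<^bsub>V\<^esub> w) ` W))"
    and W: "openin (vtop V) W \<and> \<zero>\<^bsub>V\<^esub> \<in> W"
  obtain r where r: "r > 0" "\<And>c. cmod c \<ge> r \<Longrightarrow> B \<subseteq> (\<lambda>w. c \<odot>\<^bsub>V\<^esub> w) ` W"
    using B[THEN conjunct2, rule_format, OF W] by (elim exE conjE) simp
  obtain r' where r': "r' > 0" "\<And>c. cmod c \<ge> r' \<Longrightarrow> B' \<subseteq> (\<lambda>w. c \<odot>\<^bsub>V\<^esub> w) ` W"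
    using B'[THEN conjunct2, rule_format, OF W] by (elim exE conjE) simp
  show "\<exists>r>0. \<forall>c. cmod c \<ge> r \<longrightarrow> B \<union> B' \<subseteq> (\<lambda>w. c \<odot>\<^bsub>V\<^esub> w) ` W"
    using r r' by (intro exI[of _ "max r r'"]) simp
qed auto

lemma vbounded_subset: "vbounded V B \<Longrightarrow> B \<subseteq> carrier V"
  by (simp add: vbounded_def)

lemma vbounded_empty: "vbounded V {}"
  unfolding vbounded_def by (auto intro: exI[of _ 1])

locale tvector_space = module complex_ring V for V :: "'v tvs" (structure) +
  assumes top_V: "topspace (vtop V) = carrier V"

lemma vbounded_image:
  assumes B: "vbounded V B" and g: "continuous_map (vtop V) (vtop W) g" "\<And>x. x \<in> carrier V \<Longrightarrow> g x \<in> carrier W"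
    and z: "g \<zero>\<^bsub>V\<^esub> = \<zero>\<^bsub>W\<^esub>" "\<zero>\<^bsub>V\<^esub> \<in> carrier V" and top: "topspace (vtop V) = carrier V"
    and smult: "\<And>c x. x \<in> carrier V \<Longrightarrow> g (c \<odot>\<^bsub>V\<^esub> x) = c \<odot>\<^bsub>W\<^esub> g x"
  shows "vbounded W (g ` B)"
  unfolding vbounded_def
proof (intro conjI allI impI)
  show "g ` B \<subseteq> carrier W" using vbounded_subset[OF B] g(2) by auto
  fix N assume N: "openin (vtop W) N \<and> \<zero>\<^bsub>W\<^esub> \<in> N"
  let ?N = "{x \<in> topspace (vtop V). g x \<in> N}"
  have "openin (vtop V) ?N \<and> \<zero>\<^bsub>V\<^esub> \<in> ?N" using openin_continuous_map_preimage[OF g(1)] N z top by simp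
  then obtain r where r: "r > 0" "\<forall>c. cmod c \<ge> r \<longrightarrow> B \<subseteq> (\<lambda>w. c \<odot>\<^bsub>V\<^esub> w) ` ?N"
    using B unfolding vbounded_def by meson
  have "g ` B \<subseteq> (\<lambda>w. c \<odot>\<^bsub>W\<^esub> w) ` N" if c: "cmod c \<ge> r" for c
  proof
    fix y assume "y \<in> g ` B"
    then obtain x where x: "x \<in> B" "y = g x" by blast
    then obtain w where w: "w \<in> ?N" "x = c \<odot>\<^bsub>V\<^esub> w" using r(2) c by blast
    then show "y \<in> (\<lambda>w. c \<odot>\<^bsub>W\<^esub> w) ` N" using x smult[of w c] top by auto
  qed
  then show "\<exists>r>0. \<forall>c. cmod c \<ge> r \<longrightarrow> g ` B \<subseteq> (\<lambda>w. c \<odot>\<^bsub>W\<^esub> w) ` N" using r(1) by blast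
qed

section \<open>Continuous linear maps with the strong topology\<close>

locale lin_maps = V: tvector_space V + E: lcspace E for V :: "'v tvs" and E :: "'e tvs"
begin

lemma V_smult: "x \<in> carrier V \<Longrightarrow> c \<odot>\<^bsub>V\<^esub> x \<in> carrier V"
  using V.smult_closed by (simp add: complex_ring_simps)

lemma clinear_maps_iff: "u \<in> clinear_maps V E \<longleftrightarrow> u \<in> extensional (carrier V) \<and> (\<forall>x\<in>carrier V. u x \<in> carrier E) \<and>
    continuous_map (vtop V) (vtop E) u \<and>
    (\<forall>x \<in> carrier V. \<forall>y \<in> carrier V. u (x \<oplus>\<^bsub>V\<^esub> y) = u x \<oplus>\<^bsub>E\<^esub> u y) \<and>
    (\<forall>c. \<forall>x \<in> carrier V. u (c \<odot>\<^bsub>V\<^esub> x) = c \<odot>\<^bsub>E\<^esub> u x)"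
  by (auto simp: clinear_maps_def PiE_def Pi_def)

lemma clinear_zero: "u \<in> clinear_maps V E \<Longrightarrow> u \<zero>\<^bsub>V\<^esub> = \<zero>\<^bsub>E\<^esub>"
proof -
  assume u: "u \<in> clinear_maps V E"
  have "u (0 \<odot>\<^bsub>V\<^esub> \<zero>\<^bsub>V\<^esub>) = 0 \<odot>\<^bsub>E\<^esub> u \<zero>\<^bsub>V\<^esub>" "u \<zero>\<^bsub>V\<^esub> \<in> carrier E" using u by (auto simp: clinear_maps_iff)
  then show ?thesis using V.smult_l_null[of "\<zero>\<^bsub>V\<^esub>"] by (simp add: complex_ring_simps E.smult_simps)
qed

definition nb :: "('v \<Rightarrow> 'e) \<Rightarrow> 'v set \<Rightarrow> 'e set \<Rightarrow> ('v \<Rightarrow> 'e) set" where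
  "nb u B N = {v \<in> clinear_maps V E. \<forall>x\<in>B. v x \<ominus>\<^bsub>E\<^esub> u x \<in> N}"

text \<open>\<open>topology\<close> returns the prescribed open sets only if they form a topology.
  Finite intersections work because a union of two bounded sets is bounded.\<close>

lemma openin_Lb:
  "openin (vtop (Lb V E)) S \<longleftrightarrow> S \<subseteq> clinear_maps V E \<and>
     (\<forall>u\<in>S. \<exists>B N. vbounded V B \<and> openin (vtop E) N \<and> \<zero>\<^bsub>E\<^esub> \<in> N \<and> nb u B N \<subseteq> S)"
proof -
  have "istopology (\<lambda>S. S \<subseteq> clinear_maps V E \<and>
     (\<forall>u\<in>S. \<exists>B N. vbounded V B \<and> openin (vtop E) N \<and> \<zero>\<^bsub>E\<^esub> \<in> N \<and> nb u B N \<subseteq> S))"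
    unfolding istopology_def
  proof (intro conjI allI impI ballI)
    fix S T u
    assume S: "S \<subseteq> clinear_maps V E \<and> (\<forall>u\<in>S. \<exists>B N. vbounded V B \<and> openin (vtop E) N \<and> \<zero>\<^bsub>E\<^esub> \<in> N \<and> nb u B N \<subseteq> S)"
      and T: "T \<subseteq> clinear_maps V E \<and> (\<forall>u\<in>T. \<exists>B N. vbounded V B \<and> openin (vtop E) N \<and> \<zero>\<^bsub>E\<^esub> \<in> N \<and> nb u B N \<subseteq> T)"
      and u: "u \<in> S \<inter> T"
    obtain B N where 1: "vbounded V B" "openin (vtop E) N" "\<zero>\<^bsub>E\<^esub> \<in> N" "nb u B N \<subseteq> S" using S u by (meson IntD1)
    obtain B' N' where 2: "vbounded V B'" "openin (vtop E) N'" "\<zero>\<^bsub>E\<^esub> \<in> N'" "nb u B' N' \<subseteq> T" using T u by (meson IntD2)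
    have "nb u (B \<union> B') (N \<inter> N') \<subseteq> S \<inter> T" using 1(4) 2(4) unfolding nb_def by blast
    then show "\<exists>B N. vbounded V B \<and> openin (vtop E) N \<and> \<zero>\<^bsub>E\<^esub> \<in> N \<and> nb u B N \<subseteq> S \<inter> T"
      using 1 2 vbounded_Un[OF 1(1) 2(1)] openin_Int[OF 1(2) 2(2)] by (intro exI[of _ "B \<union> B'"] exI[of _ "N \<inter> N'"]) simp
  next
    fix \<K> u
    assume \<K>: "\<forall>S\<in>\<K>. S \<subseteq> clinear_maps V E \<and> (\<forall>u\<in>S. \<exists>B N. vbounded V B \<and> openin (vtop E) N \<and> \<zero>\<^bsub>E\<^esub> \<in> N \<and> nb u B N \<subseteq> S)"
      and "u \<in> \<Union>\<K>"
    then obtain S where S: "S \<in> \<K>" "u \<in> S" by blast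
    then obtain B N where "vbounded V B" "openin (vtop E) N" "\<zero>\<^bsub>E\<^esub> \<in> N" "nb u B N \<subseteq> S" using \<K> by meson
    then show "\<exists>B N. vbounded V B \<and> openin (vtop E) N \<and> \<zero>\<^bsub>E\<^esub> \<in> N \<and> nb u B N \<subseteq> \<Union>\<K>" using S(1) by blast
  qed blast+
  from topology_inverse'[OF this] show ?thesis by (simp add: Lb_def nb_def)
qed

lemma Lb_simps:
  "carrier (Lb V E) = clinear_maps V E" "u \<oplus>\<^bsub>Lb V E\<^esub> v = (\<lambda>x\<in>carrier V. u x \<oplus>\<^bsub>E\<^esub> v x)"
  "c \<odot>\<^bsub>Lb V E\<^esub> u = (\<lambda>x\<in>carrier V. c \<odot>\<^bsub>E\<^esub> u x)" "\<zero>\<^bsub>Lb V E\<^esub> = (\<lambda>x\<in>carrier V. \<zero>\<^bsub>E\<^esub>)"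
  by (simp_all add: Lb_def)

lemma topspace_Lb: "topspace (vtop (Lb V E)) = clinear_maps V E"
proof -
  have "openin (vtop (Lb V E)) (clinear_maps V E)"
    unfolding openin_Lb using vbounded_empty[of V] openin_topspace[of "vtop E"] E.M.zero_closed
    by (auto simp: nb_def E.top_E[symmetric])
  then show ?thesis using openin_Lb by (meson openin_topspace subset_antisym openin_subset)
qed

text \<open>The defining sets \<open>nb u B N\<close> are neighbourhoods, not necessarily open. The
  points having such a set inside \<open>nb u B N\<close> form an open set: a neighbourhood
  \<open>N''\<close> with sums in \<open>N'\<close> allows the centre to move.\<close>

lemma nb_interior:
  assumes u: "u \<in> clinear_maps V E" and B: "vbounded V B" and N: "openin (vtop E) N" "\<zero>\<^bsub>E\<^esub> \<in> N"
  obtains S where "openin (vtop (Lb V E)) S" "u \<in> S" "S \<subseteq> nb u B N"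
proof -
  let ?S = "{v \<in> clinear_maps V E. \<exists>N'. openin (vtop E) N' \<and> \<zero>\<^bsub>E\<^esub> \<in> N' \<and> nb v B N' \<subseteq> nb u B N}"
  have BV: "x \<in> carrier V" if "x \<in> B" for x using vbounded_subset[OF B] that by auto
  have vE: "v x \<in> carrier E" if "v \<in> clinear_maps V E" "x \<in> B" for v x using that BV by (auto simp: clinear_maps_iff)
  have self: "v \<in> nb v B N'" if "v \<in> clinear_maps V E" "\<zero>\<^bsub>E\<^esub> \<in> N'" for v N'
    using that vE by (simp add: nb_def a_minus_def E.M.r_neg)
  show thesis
  proof (rule that[of ?S])
    show "openin (vtop (Lb V E)) ?S"
      unfolding openin_Lb
    proof (intro conjI ballI)
      fix v assume "v \<in> ?S"
      then obtain N' where v: "v \<in> clinear_maps V E" and N': "openin (vtop E) N'" "\<zero>\<^bsub>E\<^esub> \<in> N'" "nb v B N' \<subseteq> nb u B N" by auto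
      obtain N'' where N'': "openin (vtop E) N''" "\<zero>\<^bsub>E\<^esub> \<in> N''" "\<And>x y. x \<in> N'' \<Longrightarrow> y \<in> N'' \<Longrightarrow> x \<oplus>\<^bsub>E\<^esub> y \<in> N'"
        using E.nbhd_half[OF N'(1,2)] by blast
      have "nb v B N'' \<subseteq> ?S"
      proof
        fix w assume w: "w \<in> nb v B N''"
        have "nb w B N'' \<subseteq> nb v B N'"
        proof
          fix w' assume w': "w' \<in> nb w B N''"
          have "w' x \<ominus>\<^bsub>E\<^esub> v x \<in> N'" if x: "x \<in> B" for x
          proof -
            have c: "w' x \<in> carrier E" "w x \<in> carrier E" "v x \<in> carrier E" using w w' v vE x by (auto simp: nb_def)
            have "(w' x \<ominus>\<^bsub>E\<^esub> w x) \<oplus>\<^bsub>E\<^esub> (w x \<ominus>\<^bsub>E\<^esub> v x) = w' x \<ominus>\<^bsub>E\<^esub> v x"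
              using c by (simp add: a_minus_def E.M.a_assoc E.M.r_neg1)
            then show ?thesis using N''(3)[of "w' x \<ominus>\<^bsub>E\<^esub> w x" "w x \<ominus>\<^bsub>E\<^esub> v x"] w w' x by (simp add: nb_def)
          qed
          then show "w' \<in> nb v B N'" using w' by (simp add: nb_def)
        qed
        then have "nb w B N'' \<subseteq> nb u B N" using N'(3) by blast
        moreover have "w \<in> clinear_maps V E" using w by (simp add: nb_def)
        ultimately show "w \<in> ?S" using N''(1,2) by blast
      qed
      then show "\<exists>B N. vbounded V B \<and> openin (vtop E) N \<and> \<zero>\<^bsub>E\<^esub> \<in> N \<and> nb v B N \<subseteq> ?S"
        using B N''(1,2) by blast
    qed blast
    show "u \<in> ?S" using u N by blast
    show "?S \<subseteq> nb u B N"
    proof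
      fix v assume "v \<in> ?S"
      then obtain N' where "v \<in> clinear_maps V E" "\<zero>\<^bsub>E\<^esub> \<in> N'" "nb v B N' \<subseteq> nb u B N" by auto
      then show "v \<in> nb u B N" using self by blast
    qed
  qed
qed

lemma clinear_add:
  assumes u: "u \<in> clinear_maps V E" and v: "v \<in> clinear_maps V E"
  shows "(\<lambda>x\<in>carrier V. u x \<oplus>\<^bsub>E\<^esub> v x) \<in> clinear_maps V E"
proof -
  have "continuous_map (vtop V) (vtop E) (\<lambda>x. u x \<oplus>\<^bsub>E\<^esub> v x)" using u v by (intro E.continuous_add) (simp_all add: clinear_maps_iff)
  then have "continuous_map (vtop V) (vtop E) (\<lambda>x\<in>carrier V. u x \<oplus>\<^bsub>E\<^esub> v x)" by (rule continuous_map_eq) (simp add: V.top_V)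
  then show ?thesis using u v by (simp add: clinear_maps_iff V_smult E.smult_simps E.M.a_ac)
qed

lemma clinear_smult:
  assumes u: "u \<in> clinear_maps V E"
  shows "(\<lambda>x\<in>carrier V. c \<odot>\<^bsub>E\<^esub> u x) \<in> clinear_maps V E"
proof -
  have "continuous_map (vtop V) (vtop E) (\<lambda>x. c \<odot>\<^bsub>E\<^esub> u x)" using u by (intro E.continuous_smult) (simp_all add: clinear_maps_iff)
  then have "continuous_map (vtop V) (vtop E) (\<lambda>x\<in>carrier V. c \<odot>\<^bsub>E\<^esub> u x)" by (rule continuous_map_eq) (simp add: V.top_V)
  moreover have "c \<odot>\<^bsub>E\<^esub> (d \<odot>\<^bsub>E\<^esub> y) = d \<odot>\<^bsub>E\<^esub> (c \<odot>\<^bsub>E\<^esub> y)" if "y \<in> carrier E" for d y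
    using E.smult_commute[of c d y] that by (simp add: complex_ring_simps)
  ultimately show ?thesis using u by (simp add: clinear_maps_iff V_smult E.smult_simps)
qed

lemma clinear_0: "(\<lambda>x\<in>carrier V. \<zero>\<^bsub>E\<^esub>) \<in> clinear_maps V E"
proof -
  have "continuous_map (vtop V) (vtop E) (\<lambda>x. \<zero>\<^bsub>E\<^esub>)" by (simp add: E.top_E)
  then have "continuous_map (vtop V) (vtop E) (\<lambda>x\<in>carrier V. \<zero>\<^bsub>E\<^esub>)" by (rule continuous_map_eq) (simp add: V.top_V)
  then show ?thesis by (simp add: clinear_maps_iff V_smult E.smult_simps)
qed

lemma Lb_module: "Module.module complex_ring (Lb V E)"
proof -
  have E: "u x \<in> carrier E" if "u \<in> clinear_maps V E" "x \<in> carrier V" for u x using that by (simp add: clinear_maps_iff)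
  have ext: "restrict u (carrier V) = u" if "u \<in> clinear_maps V E" for u using that by (simp add: clinear_maps_iff extensional_restrict)
  show ?thesis
  proof (rule moduleI)
    show "abelian_group (Lb V E)"
    proof (rule abelian_groupI)
      fix u assume u: "u \<in> carrier (Lb V E)"
      then show "\<zero>\<^bsub>Lb V E\<^esub> \<oplus>\<^bsub>Lb V E\<^esub> u = u"
      proof -
        have "\<zero>\<^bsub>Lb V E\<^esub> \<oplus>\<^bsub>Lb V E\<^esub> u = restrict u (carrier V)"
          unfolding Lb_simps by (rule restrict_ext) (use u E in \<open>simp add: Lb_simps\<close>)
        then show ?thesis using u ext by (simp add: Lb_simps)
      qed
      have "(\<lambda>x\<in>carrier V. (- 1) \<odot>\<^bsub>E\<^esub> u x) \<oplus>\<^bsub>Lb V E\<^esub> u = \<zero>\<^bsub>Lb V E\<^esub>"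
      proof -
        have "(- 1) \<odot>\<^bsub>E\<^esub> u x \<oplus>\<^bsub>E\<^esub> u x = \<zero>\<^bsub>E\<^esub>" if "x \<in> carrier V" for x
          using E.smult_simps(2)[of "u x" "-1" 1] E[of u x] u that by (simp add: Lb_simps E.smult_simps)
        then show ?thesis by (auto simp: Lb_simps restrict_def)
      qed
      then show "\<exists>y\<in>carrier (Lb V E). y \<oplus>\<^bsub>Lb V E\<^esub> u = \<zero>\<^bsub>Lb V E\<^esub>"
        using clinear_smult[of u "-1"] u by (intro bexI) (simp_all add: Lb_simps(1))
    qed (auto simp: Lb_simps clinear_add clinear_0 E E.M.a_ac intro!: restrict_ext)
    show "\<one>\<^bsub>complex_ring\<^esub> \<odot>\<^bsub>Lb V E\<^esub> u = u" if "u \<in> carrier (Lb V E)" for u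
    proof -
      have "\<one>\<^bsub>complex_ring\<^esub> \<odot>\<^bsub>Lb V E\<^esub> u = restrict u (carrier V)"
        unfolding Lb_simps by (rule restrict_ext) (use that E E.smult_simps(5) in \<open>simp add: Lb_simps complex_ring_simps\<close>)
      then show ?thesis using that ext by (simp add: Lb_simps)
    qed
  qed (auto simp: Lb_simps clinear_smult cring_complex_ring complex_ring_simps E.smult_simps E intro!: restrict_ext)
qed

lemma Lb_lcs: "lcs (Lb V E)"
proof -
  let ?L = "vtop (Lb V E)"
  have E: "u x \<in> carrier E" if "u \<in> clinear_maps V E" "x \<in> carrier V" for u x using that by (simp add: clinear_maps_iff)
  have add: "continuous_map (prod_topology ?L ?L) ?L (\<lambda>(u, v). u \<oplus>\<^bsub>Lb V E\<^esub> v)"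
    unfolding continuous_map
  proof (intro conjI allI impI)
    show "(\<lambda>(u, v). u \<oplus>\<^bsub>Lb V E\<^esub> v) ` topspace (prod_topology ?L ?L) \<subseteq> topspace ?L"
      by (auto simp: topspace_Lb Lb_simps clinear_add)
    fix S assume S: "openin ?L S"
    show "openin (prod_topology ?L ?L) {p \<in> topspace (prod_topology ?L ?L). (\<lambda>(u, v). u \<oplus>\<^bsub>Lb V E\<^esub> v) p \<in> S}"
      unfolding openin_prod_topology_alt
    proof (intro allI impI)
      fix u v assume "(u, v) \<in> {p \<in> topspace (prod_topology ?L ?L). (\<lambda>(u, v). u \<oplus>\<^bsub>Lb V E\<^esub> v) p \<in> S}"
      then have uv: "u \<in> clinear_maps V E" "v \<in> clinear_maps V E" "u \<oplus>\<^bsub>Lb V E\<^esub> v \<in> S" by (auto simp: topspace_Lb)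
      then obtain B N where B: "vbounded V B" "openin (vtop E) N" "\<zero>\<^bsub>E\<^esub> \<in> N" "nb (u \<oplus>\<^bsub>Lb V E\<^esub> v) B N \<subseteq> S"
        using S unfolding openin_Lb by meson
      obtain N' where N': "openin (vtop E) N'" "\<zero>\<^bsub>E\<^esub> \<in> N'" "\<And>x y. x \<in> N' \<Longrightarrow> y \<in> N' \<Longrightarrow> x \<oplus>\<^bsub>E\<^esub> y \<in> N"
        using E.nbhd_half[OF B(2,3)] by blast
      obtain S1 where S1: "openin ?L S1" "u \<in> S1" "S1 \<subseteq> nb u B N'" using nb_interior[OF uv(1) B(1) N'(1,2)] .
      obtain S2 where S2: "openin ?L S2" "v \<in> S2" "S2 \<subseteq> nb v B N'" using nb_interior[OF uv(2) B(1) N'(1,2)] .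
      have "u' \<oplus>\<^bsub>Lb V E\<^esub> v' \<in> S" if u': "u' \<in> S1" and v': "v' \<in> S2" for u' v'
      proof -
        have m: "u' \<in> nb u B N'" "v' \<in> nb v B N'" using u' v' S1 S2 by auto
        have "u' \<oplus>\<^bsub>Lb V E\<^esub> v' \<in> nb (u \<oplus>\<^bsub>Lb V E\<^esub> v) B N"
        proof -
          have "(u' x \<oplus>\<^bsub>E\<^esub> v' x) \<ominus>\<^bsub>E\<^esub> (u x \<oplus>\<^bsub>E\<^esub> v x) \<in> N" if x: "x \<in> B" for x
          proof -
            have "x \<in> carrier V" using vbounded_subset[OF B(1)] x by auto
            then have c: "u' x \<in> carrier E" "v' x \<in> carrier E" "u x \<in> carrier E" "v x \<in> carrier E" using m uv E by (auto simp: nb_def)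
            have "(u' x \<ominus>\<^bsub>E\<^esub> u x) \<oplus>\<^bsub>E\<^esub> (v' x \<ominus>\<^bsub>E\<^esub> v x) = (u' x \<oplus>\<^bsub>E\<^esub> v' x) \<ominus>\<^bsub>E\<^esub> (u x \<oplus>\<^bsub>E\<^esub> v x)"
              using c by (simp add: a_minus_def E.M.minus_add E.M.a_ac)
            then show ?thesis using N'(3)[of "u' x \<ominus>\<^bsub>E\<^esub> u x" "v' x \<ominus>\<^bsub>E\<^esub> v x"] m x by (simp add: nb_def)
          qed
          moreover have "u' \<oplus>\<^bsub>Lb V E\<^esub> v' \<in> clinear_maps V E" using m clinear_add by (simp add: nb_def Lb_simps)
          ultimately show ?thesis using vbounded_subset[OF B(1)] by (simp add: nb_def Lb_simps subset_iff)
        qed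
        then show ?thesis using B(4) by blast
      qed
      then have "S1 \<times> S2 \<subseteq> {p \<in> topspace (prod_topology ?L ?L). (\<lambda>(u, v). u \<oplus>\<^bsub>Lb V E\<^esub> v) p \<in> S}"
        using openin_subset[OF S1(1)] openin_subset[OF S2(1)] by auto
      then show "\<exists>S1 S2. openin ?L S1 \<and> openin ?L S2 \<and> u \<in> S1 \<and> v \<in> S2 \<and>
          S1 \<times> S2 \<subseteq> {p \<in> topspace (prod_topology ?L ?L). (\<lambda>(u, v). u \<oplus>\<^bsub>Lb V E\<^esub> v) p \<in> S}"
        using S1 S2 by blast
    qed
  qed
  have smult: "continuous_map (prod_topology euclidean ?L) ?L (\<lambda>(c, u). c \<odot>\<^bsub>Lb V E\<^esub> u)"
    unfolding continuous_map
  proof (intro conjI allI impI)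
    show "(\<lambda>(c, u). c \<odot>\<^bsub>Lb V E\<^esub> u) ` topspace (prod_topology euclidean ?L) \<subseteq> topspace ?L"
      by (auto simp: topspace_Lb Lb_simps clinear_smult)
    fix S assume S: "openin ?L S"
    show "openin (prod_topology euclidean ?L) {p \<in> topspace (prod_topology euclidean ?L). (\<lambda>(c, u). c \<odot>\<^bsub>Lb V E\<^esub> u) p \<in> S}"
      unfolding openin_prod_topology_alt
    proof (intro allI impI)
      fix c u assume "(c, u) \<in> {p \<in> topspace (prod_topology euclidean ?L). (\<lambda>(c, u). c \<odot>\<^bsub>Lb V E\<^esub> u) p \<in> S}"
      then have cu: "u \<in> clinear_maps V E" "c \<odot>\<^bsub>Lb V E\<^esub> u \<in> S" by (auto simp: topspace_Lb)
      then obtain B N where B: "vbounded V B" "openin (vtop E) N" "\<zero>\<^bsub>E\<^esub> \<in> N" "nb (c \<odot>\<^bsub>Lb V E\<^esub> u) B N \<subseteq> S"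
        using S unfolding openin_Lb by meson
      obtain N1 where N1: "openin (vtop E) N1" "\<zero>\<^bsub>E\<^esub> \<in> N1" "\<And>x y. x \<in> N1 \<Longrightarrow> y \<in> N1 \<Longrightarrow> x \<oplus>\<^bsub>E\<^esub> y \<in> N"
        using E.nbhd_half[OF B(2,3)] by blast
      obtain e N2 where N2: "e > 0" "openin (vtop E) N2" "\<zero>\<^bsub>E\<^esub> \<in> N2" "\<And>c' x. cmod (c' - c) < e \<Longrightarrow> x \<in> N2 \<Longrightarrow> c' \<odot>\<^bsub>E\<^esub> x \<in> N1"
        using E.nbhd_smult[OF N1(1,2), of c] by blast
      obtain e' N3 where N3: "e' > 0" "openin (vtop E) N3" "\<zero>\<^bsub>E\<^esub> \<in> N3" "\<And>c' x. cmod c' < e' \<Longrightarrow> x \<in> N3 \<Longrightarrow> c' \<odot>\<^bsub>E\<^esub> x \<in> N1"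
        using E.nbhd_smult[OF N1(1,2), of 0] by auto
      \<comment> \<open>Write c' u' - c u as c' (u' - u) + (c' - c) u. The first summand is small
        for c' near c by \<open>N2\<close>. For the second, the image of \<open>B\<close> under
        \<open>u\<close> is bounded, hence contained in \<open>r\<close> times \<open>N3\<close>,
        and |c' - c| < e'/r suffices.\<close>
      have "vbounded E (u ` B)"
        using cu(1) clinear_zero[OF cu(1)] by (intro vbounded_image[OF B(1)]) (simp_all add: clinear_maps_iff V.top_V)
      then obtain r where r: "r > 0" "u ` B \<subseteq> (\<lambda>w. complex_of_real r \<odot>\<^bsub>E\<^esub> w) ` N3"
        using N3(2,3) unfolding vbounded_def by (metis abs_of_pos norm_of_real order_refl)
      obtain S2 where S2: "openin ?L S2" "u \<in> S2" "S2 \<subseteq> nb u B N2" using nb_interior[OF cu(1) B(1) N2(2,3)] .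
      let ?S1 = "ball c (min e (e' / r))"
      have "c' \<odot>\<^bsub>Lb V E\<^esub> u' \<in> S" if c': "c' \<in> ?S1" and u': "u' \<in> S2" for c' u'
      proof -
        have m: "u' \<in> nb u B N2" using u' S2 by auto
        have c1: "cmod (c' - c) < e" "cmod (c' - c) < e' / r" using c' by (auto simp: dist_norm norm_minus_commute)
        have "c' \<odot>\<^bsub>Lb V E\<^esub> u' \<in> nb (c \<odot>\<^bsub>Lb V E\<^esub> u) B N"
        proof -
          have "(c' \<odot>\<^bsub>E\<^esub> u' x) \<ominus>\<^bsub>E\<^esub> (c \<odot>\<^bsub>E\<^esub> u x) \<in> N" if x: "x \<in> B" for x
          proof -
            have xV: "x \<in> carrier V" using vbounded_subset[OF B(1)] x by auto
            then have c: "u' x \<in> carrier E" "u x \<in> carrier E" using m cu E by (auto simp: nb_def)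
            obtain w where w: "w \<in> N3" "u x = complex_of_real r \<odot>\<^bsub>E\<^esub> w" using r(2) x by blast
            have wE: "w \<in> carrier E" using w(1) openin_subset[OF N3(2)] E.top_E by auto
            have "cmod ((c' - c) * complex_of_real r) < e'" using c1(2) r(1) by (simp add: norm_mult pos_less_divide_eq)
            then have 1: "(c' - c) \<odot>\<^bsub>E\<^esub> u x \<in> N1" using N3(4)[of "(c' - c) * complex_of_real r" w] w wE by (simp add: E.smult_simps(4))
            have 2: "c' \<odot>\<^bsub>E\<^esub> (u' x \<ominus>\<^bsub>E\<^esub> u x) \<in> N1" using N2(4)[OF c1(1)] m x by (simp add: nb_def)
            have "c' \<odot>\<^bsub>E\<^esub> (u' x \<ominus>\<^bsub>E\<^esub> u x) \<oplus>\<^bsub>E\<^esub> (c' - c) \<odot>\<^bsub>E\<^esub> u x = (c' \<odot>\<^bsub>E\<^esub> u' x) \<ominus>\<^bsub>E\<^esub> (c \<odot>\<^bsub>E\<^esub> u x)"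
            proof -
              have k: "c' \<odot>\<^bsub>E\<^esub> (u' x \<ominus>\<^bsub>E\<^esub> u x) = c' \<odot>\<^bsub>E\<^esub> u' x \<ominus>\<^bsub>E\<^esub> c' \<odot>\<^bsub>E\<^esub> u x"
                using E.smult_r_minus'[of c' "u' x" "u x"] c by (simp add: complex_ring_simps)
              have "(c' - c) \<odot>\<^bsub>E\<^esub> u x \<oplus>\<^bsub>E\<^esub> c \<odot>\<^bsub>E\<^esub> u x = c' \<odot>\<^bsub>E\<^esub> u x"
                using E.smult_simps(2)[of "u x" "c' - c" c] c by simp
              then have l: "(c' - c) \<odot>\<^bsub>E\<^esub> u x = c' \<odot>\<^bsub>E\<^esub> u x \<ominus>\<^bsub>E\<^esub> c \<odot>\<^bsub>E\<^esub> u x"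
                using c by (metis E.M.a_assoc E.M.r_neg E.M.r_zero E.M.a_inv_closed E.smult_simps(1) a_minus_def)
              show ?thesis unfolding k l using c E.smult_simps(1) by (simp add: a_minus_def E.M.a_assoc E.M.r_neg1)
            qed
            then show ?thesis using N1(3)[OF 2 1] by simp
          qed
          moreover have "c' \<odot>\<^bsub>Lb V E\<^esub> u' \<in> clinear_maps V E" using m clinear_smult by (simp add: nb_def Lb_simps)
          ultimately show ?thesis using vbounded_subset[OF B(1)] by (simp add: nb_def Lb_simps subset_iff)
        qed
        then show ?thesis using B(4) by blast
      qed
      then have "?S1 \<times> S2 \<subseteq> {p \<in> topspace (prod_topology euclidean ?L). (\<lambda>(c, u). c \<odot>\<^bsub>Lb V E\<^esub> u) p \<in> S}"
        using openin_subset[OF S2(1)] by auto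
      moreover have "c \<in> ?S1" using N2(1) N3(1) r(1) by simp
      ultimately show "\<exists>S1 S2. openin euclidean S1 \<and> openin ?L S2 \<and> c \<in> S1 \<and> u \<in> S2 \<and>
          S1 \<times> S2 \<subseteq> {p \<in> topspace (prod_topology euclidean ?L). (\<lambda>(c, u). c \<odot>\<^bsub>Lb V E\<^esub> u) p \<in> S}"
        using S2 by (intro exI[of _ ?S1] exI[of _ S2]) auto
    qed
  qed
  have convex: "\<exists>N C. openin ?L N \<and> \<zero>\<^bsub>Lb V E\<^esub> \<in> N \<and> N \<subseteq> C \<and> C \<subseteq> W \<and>
       (\<forall>x\<in>C. \<forall>y\<in>C. \<forall>t\<in>{0..1}. complex_of_real t \<odot>\<^bsub>Lb V E\<^esub> x \<oplus>\<^bsub>Lb V E\<^esub> complex_of_real (1 - t) \<odot>\<^bsub>Lb V E\<^esub> y \<in> C)"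
    if W: "openin ?L W" "\<zero>\<^bsub>Lb V E\<^esub> \<in> W" for W
  proof -
    obtain B N where B: "vbounded V B" "openin (vtop E) N" "\<zero>\<^bsub>E\<^esub> \<in> N" "nb \<zero>\<^bsub>Lb V E\<^esub> B N \<subseteq> W"
      using W unfolding openin_Lb by meson
    obtain N0 C0 where N0: "openin (vtop E) N0" "\<zero>\<^bsub>E\<^esub> \<in> N0" "N0 \<subseteq> C0" "C0 \<subseteq> N"
      "\<And>x y t. x \<in> C0 \<Longrightarrow> y \<in> C0 \<Longrightarrow> t \<in> {0..1} \<Longrightarrow> (complex_of_real t \<odot>\<^bsub>E\<^esub> x) \<oplus>\<^bsub>E\<^esub> (complex_of_real (1 - t) \<odot>\<^bsub>E\<^esub> y) \<in> C0"
      using E.nbhd_convex[OF B(2,3)] by blast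
    obtain S where S: "openin ?L S" "\<zero>\<^bsub>Lb V E\<^esub> \<in> S" "S \<subseteq> nb \<zero>\<^bsub>Lb V E\<^esub> B N0"
      using nb_interior[OF _ B(1) N0(1,2), of "\<zero>\<^bsub>Lb V E\<^esub>"] clinear_0 by (auto simp: Lb_simps)
    have BV: "x \<in> carrier V" if "x \<in> B" for x using vbounded_subset[OF B(1)] that by auto
    have nb0: "nb \<zero>\<^bsub>Lb V E\<^esub> B T = {v \<in> clinear_maps V E. \<forall>x\<in>B. v x \<in> T}" for T
    proof -
      have "\<ominus>\<^bsub>E\<^esub> \<zero>\<^bsub>E\<^esub> = \<zero>\<^bsub>E\<^esub>" by (rule E.M.minus_equality) simp_all
      then have "v x \<ominus>\<^bsub>E\<^esub> \<zero>\<^bsub>Lb V E\<^esub> x = v x" if "v \<in> clinear_maps V E" "x \<in> B" for v x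
        using BV E that by (simp add: Lb_simps a_minus_def)
      then show ?thesis unfolding nb_def by (intro Collect_cong) auto
    qed
    let ?C = "{v \<in> clinear_maps V E. \<forall>x\<in>B. v x \<in> C0}"
    show ?thesis
    proof (intro exI conjI ballI)
      show "openin ?L S" "\<zero>\<^bsub>Lb V E\<^esub> \<in> S" by fact+
      show "S \<subseteq> ?C" using S(3) N0(3) unfolding nb0 by blast
      show "?C \<subseteq> W" using B(4) N0(4) unfolding nb0 by blast
      show "complex_of_real t \<odot>\<^bsub>Lb V E\<^esub> x \<oplus>\<^bsub>Lb V E\<^esub> complex_of_real (1 - t) \<odot>\<^bsub>Lb V E\<^esub> y \<in> ?C"
        if "x \<in> ?C" "y \<in> ?C" "t \<in> {0..1}" for x y t
        using that N0(5)[OF _ _ that(3)] BV clinear_add[OF clinear_smult clinear_smult, of x y "complex_of_real t" "complex_of_real (1 - t)"]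
        by (simp add: Lb_simps)
    qed
  qed
  show ?thesis unfolding lcs_def using Lb_module add smult convex topspace_Lb by (simp add: Lb_simps(1))
qed

end

text \<open>Composition with \<open>g\<close> is continuous for the strong topologies because
  \<open>g\<close> maps bounded sets to bounded sets: a condition on u \<circ> g over
  \<open>B\<close> is a condition on u over the image of \<open>B\<close>.\<close>

lemma Lb_compose:
  assumes "lin_maps V E" "lin_maps W E"
    and g: "continuous_map (vtop V) (vtop W) g" "\<And>x. x \<in> carrier V \<Longrightarrow> g x \<in> carrier W"
      "\<And>x y. x \<in> carrier V \<Longrightarrow> y \<in> carrier V \<Longrightarrow> g (x \<oplus>\<^bsub>V\<^esub> y) = g x \<oplus>\<^bsub>W\<^esub> g y"
      "\<And>c x. x \<in> carrier V \<Longrightarrow> g (c \<odot>\<^bsub>V\<^esub> x) = c \<odot>\<^bsub>W\<^esub> g x" "g \<zero>\<^bsub>V\<^esub> = \<zero>\<^bsub>W\<^esub>"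
  shows "u \<in> clinear_maps W E \<Longrightarrow> (\<lambda>x\<in>carrier V. u (g x)) \<in> clinear_maps V E"
    and "restrict (\<lambda>u. \<lambda>x\<in>carrier V. u (g x)) (carrier (Lb W E)) \<in> clinear_maps (Lb W E) (Lb V E)"
proof -
  interpret V: lin_maps V E by fact
  interpret W: lin_maps W E by fact
  let ?r = "\<lambda>u. \<lambda>x\<in>carrier V. u (g x)"
  have r: "?r u \<in> clinear_maps V E" if u: "u \<in> clinear_maps W E" for u
  proof -
    have "continuous_map (vtop V) (vtop E) (\<lambda>x. u (g x))"
      using continuous_map_compose[OF g(1)] u by (auto simp: W.clinear_maps_iff o_def)
    then have "continuous_map (vtop V) (vtop E) (?r u)" by (rule continuous_map_eq) (simp add: V.V.top_V)
    then show ?thesis using u g by (simp add: V.clinear_maps_iff W.clinear_maps_iff V.V_smult)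
  qed
  then show "u \<in> clinear_maps W E \<Longrightarrow> (\<lambda>x\<in>carrier V. u (g x)) \<in> clinear_maps V E" by simp
  have "continuous_map (vtop (Lb W E)) (vtop (Lb V E)) ?r"
    unfolding continuous_map
  proof (intro conjI allI impI)
    show "?r ` topspace (vtop (Lb W E)) \<subseteq> topspace (vtop (Lb V E))" using r by (auto simp: V.topspace_Lb W.topspace_Lb)
    fix S assume S: "openin (vtop (Lb V E)) S"
    show "openin (vtop (Lb W E)) {u \<in> topspace (vtop (Lb W E)). ?r u \<in> S}"
      unfolding W.openin_Lb W.topspace_Lb
    proof (intro conjI ballI)
      fix u assume "u \<in> {u \<in> clinear_maps W E. ?r u \<in> S}"
      then have u: "u \<in> clinear_maps W E" "?r u \<in> S" by auto
      then obtain B N where B: "vbounded V B" "openin (vtop E) N" "\<zero>\<^bsub>E\<^esub> \<in> N" "V.nb (?r u) B N \<subseteq> S"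
        using S unfolding V.openin_Lb by meson
      have "vbounded W (g ` B)" using g by (intro vbounded_image[OF B(1)]) (simp_all add: V.V.top_V)
      moreover have "W.nb u (g ` B) N \<subseteq> {u \<in> clinear_maps W E. ?r u \<in> S}"
      proof
        fix v assume v: "v \<in> W.nb u (g ` B) N"
        then have "?r v \<in> V.nb (?r u) B N"
          using r vbounded_subset[OF B(1)] by (auto simp: V.nb_def W.nb_def subset_iff)
        then show "v \<in> {u \<in> clinear_maps W E. ?r u \<in> S}" using B(4) v by (auto simp: W.nb_def)
      qed
      ultimately show "\<exists>B N. vbounded W B \<and> openin (vtop E) N \<and> \<zero>\<^bsub>E\<^esub> \<in> N \<and> W.nb u B N \<subseteq> {u \<in> clinear_maps W E. ?r u \<in> S}"
        using B(2,3) by blast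
    qed blast
  qed
  then have "continuous_map (vtop (Lb W E)) (vtop (Lb V E)) (restrict ?r (carrier (Lb W E)))"
    by (rule continuous_map_eq) (simp add: W.topspace_Lb W.Lb_simps)
  then show "restrict ?r (carrier (Lb W E)) \<in> clinear_maps (Lb W E) (Lb V E)"
    using r W.clinear_add W.clinear_smult g(2)
    by (auto simp: clinear_maps_def[of "Lb W E" "Lb V E"] V.Lb_simps W.Lb_simps intro!: restrict_ext)
qed

section \<open>Compactly supported operators\<close>

context modsheaf2
begin

context
  assumes H: "Hausdorff_space (base A)"
begin

lemma openin_Diff_compact: "Op U \<Longrightarrow> compactin (base A) K \<Longrightarrow> Op (U - K)"
  using compactin_imp_closedin[OF H] by blast

lemma DC_mkI:
  assumes U: "Op U" and D: "lhom U D"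
    and ord: "\<And>a. a \<in> U \<Longrightarrow> \<exists>V r. Op V \<and> a \<in> V \<and> V \<subseteq> U \<and> ordle V r D"
    and K: "compactin (base A) K" "K \<subseteq> U" "agree (U - K) D hzero"
  shows "mk U D \<in> DC U"
proof -
  have "\<exists>V r. Op V \<and> a \<in> V \<and> V \<subseteq> U \<and> ordle V r (mk U D)" if a: "a \<in> U" for a
  proof -
    obtain V r where V: "Op V" "a \<in> V" "V \<subseteq> U" "ordle V r D" using ord[OF a] by blast
    have "ordle V r (mk U D)" by (rule ordle_agree[OF V(4) agree_sym[OF agree_subset[OF mk_agree V(3)]]])
    then show ?thesis using V by blast
  qed
  moreover have "agree (U - K) (mk U D) hzero"
    by (rule agree_trans[OF agree_subset[OF mk_agree Diff_subset] K(3)])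
  ultimately show ?thesis unfolding DC_iff[OF U H] using mk_homs[OF U D] K by blast
qed

lemma DKR_mkI:
  assumes U: "Op U" and D: "lhom U D" "ordle U r D" and K: "compactin (base A) K" "agree (U - K) D hzero"
  shows "mk U D \<in> DKR U K r"
  unfolding DKR_iff[OF U openin_Diff_compact[OF U K(1)]]
  using mk_homs[OF U D(1)] ordle_agree[OF D(2) agree_sym[OF mk_agree]]
    agree_trans[OF agree_subset[OF mk_agree Diff_subset] K(2)] by blast

lemma DC_D:
  assumes U: "Op U" and D: "D \<in> DC U"
  obtains K where "lhom U D" "mk U D = D" "\<And>a. a \<in> U \<Longrightarrow> \<exists>V r. Op V \<and> a \<in> V \<and> V \<subseteq> U \<and> ordle V r D"
    "compactin (base A) K" "K \<subseteq> U" "agree (U - K) D hzero"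
  using D unfolding DC_iff[OF U H] homs_iff[OF U] by (elim conjE exE) simp

lemma DKR_D:
  assumes U: "Op U" and K: "compactin (base A) K" and D: "D \<in> DKR U K r"
  shows "lhom U D" "mk U D = D" "ordle U r D" "agree (U - K) D hzero"
  using D unfolding DKR_iff[OF U openin_Diff_compact[OF U K]] homs_iff[OF U] by simp_all

lemma DKR_DC:
  assumes U: "Op U" and K: "compactin (base A) K" "K \<subseteq> U" and D: "D \<in> DKR U K r"
  shows "D \<in> DC U"
  using DC_mkI[OF U DKR_D(1)[OF U K(1) D] _ K DKR_D(4)[OF U K(1) D]] DKR_D(2,3)[OF U K(1) D] U by auto

lemma DC_hplus:
  assumes U: "Op U" and D: "D \<in> DC U" and D': "D' \<in> DC U"
  shows "mk U (hplus D D') \<in> DC U"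
proof -
  obtain K where K: "lhom U D" "\<And>a. a \<in> U \<Longrightarrow> \<exists>V r. Op V \<and> a \<in> V \<and> V \<subseteq> U \<and> ordle V r D"
    "compactin (base A) K" "K \<subseteq> U" "agree (U - K) D hzero" using DC_D[OF U D] by metis
  obtain L where L: "lhom U D'" "\<And>a. a \<in> U \<Longrightarrow> \<exists>V r. Op V \<and> a \<in> V \<and> V \<subseteq> U \<and> ordle V r D'"
    "compactin (base A) L" "L \<subseteq> U" "agree (U - L) D' hzero" using DC_D[OF U D'] by metis
  show ?thesis
  proof (rule DC_mkI[OF U hplus_lhom[OF K(1) L(1)]])
    fix a assume a: "a \<in> U"
    obtain V r where V: "Op V" "a \<in> V" "V \<subseteq> U" "ordle V r D" using K(2)[OF a] by blast
    obtain W k where W: "Op W" "a \<in> W" "W \<subseteq> U" "ordle W k D'" using L(2)[OF a] by blast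
    \<comment> \<open>Orders are bounded only locally, so the two neighbourhoods are intersected and
      the larger of the two bounds is taken.\<close>
    have "ordle (V \<inter> W) (max r k) (hplus D D')"
      using ordle_mono[OF ordle_subset[OF V(4) Int_lower1] max.cobounded1] ordle_mono[OF ordle_subset[OF W(4) Int_lower2] max.cobounded2]
        lhom_subset[OF K(1) le_infI1[OF V(3)]] lhom_subset[OF L(1) le_infI1[OF V(3)]] by (intro ordle_hplus) assumption+
    then show "\<exists>V r. Op V \<and> a \<in> V \<and> V \<subseteq> U \<and> ordle V r (hplus D D')" using V W
      by (intro exI[of _ "V \<inter> W"] exI[of _ "max r k"]) auto
  next
    show "compactin (base A) (K \<union> L)" using compactin_Un[OF K(3) L(3)] .
    show "K \<union> L \<subseteq> U" using K L by auto
    show "agree (U - (K \<union> L)) (hplus D D') hzero"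
    proof (rule agreeI)
      fix V s assume V: "Op V" "V \<subseteq> U - (K \<union> L)" and s: "s \<in> carrier (sect F V)"
      have "D V s = hzero V s" using agreeD[OF K(5) V(1) _ s] V(2) by auto
      moreover have "D' V s = hzero V s" using agreeD[OF L(5) V(1) _ s] V(2) by auto
      ultimately show "hplus D D' V s = hzero V s" using V by (simp add: hplus_def hzero_def G.addF_zero G.zeroF)
    qed
  qed
qed

lemma DC_hzero: "Op U \<Longrightarrow> mk U hzero \<in> DC U"
proof (rule DC_mkI[OF _ hzero_lhom, of _ "{}"])
  fix a assume "Op U" "a \<in> U"
  then show "\<exists>V r. Op V \<and> a \<in> V \<and> V \<subseteq> U \<and> ordle V r hzero"
    using ordle_hzero[of U hzero 0] by (intro exI[of _ U] exI[of _ 0]) (simp add: agree_def)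
qed (simp_all add: agree_def)

lemma precomp_agree_zero:
  assumes U: "Op U" and f: "f \<in> carrier (sect A U)" and D: "agree V D hzero" and V: "V \<subseteq> U"
  shows "agree V (precomp U f D) hzero"
proof (rule agreeI)
  fix W s assume W: "Op W" "W \<subseteq> V" and s: "s \<in> carrier (sect F W)"
  have "res A U W f \<odot>\<^bsub>sect F W\<^esub> s \<in> carrier (sect F W)" using smultF[OF W(1) resA_closed[OF U W(1) _ f] s] W V by auto
  then show "precomp U f D W s = hzero W s" using agreeD[OF D W] by (simp add: precomp_def hzero_def)
qed

lemma precomp_agree_zero':
  assumes U: "Op U" and D: "lhom U D" and f: "f \<in> carrier (sect A U)" and C: "Op (U - C)" "res A U (U - C) f = \<zero>\<^bsub>sect A (U - C)\<^esub>"
  shows "agree (U - C) (precomp U f D) hzero"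
proof (rule agreeI)
  fix W s assume W: "Op W" "W \<subseteq> U - C" and s: "s \<in> carrier (sect F W)"
  have "res A U W f = res A (U - C) W (res A U (U - C) f)" using resA_trans[OF U C(1) W(1) Diff_subset W(2) f] by simp
  also have "\<dots> = \<zero>\<^bsub>sect A W\<^esub>" using C W by (simp add: resA_zero)
  finally show "precomp U f D W s = hzero W s"
    using s W lhom_zero[OF D W(1)] by (auto simp: precomp_def hzero_def smultF_l_zero)
qed

lemma precomp_local_order:
  assumes U: "Op U" and D: "lhom U D" and f: "f \<in> carrier (sect A U)"
    and ord: "Op V" "V \<subseteq> U" "ordle V r D"
  shows "ordle V r (precomp U f D)"
proof -
  have fV: "res A U V f \<in> carrier (sect A V)" by (rule resA_closed[OF U ord(1,2) f])
  have "ordle V r (precomp V (res A U V f) D)" by (rule ordle_precomp[OF ord(1,3) lhom_subset[OF D ord(2)] fV])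
  moreover have "agree V (precomp V (res A U V f) D) (precomp U f D)"
    using U ord f by (intro agreeI) (simp add: precomp_def resA_trans)
  ultimately show ?thesis by (rule ordle_agree)
qed

lemma DC_precomp:
  assumes U: "Op U" and D: "D \<in> DC U" and f: "f \<in> carrier (sect A U)"
  shows "mk U (precomp U f D) \<in> DC U"
proof -
  obtain K where K: "lhom U D" "\<And>a. a \<in> U \<Longrightarrow> \<exists>V r. Op V \<and> a \<in> V \<and> V \<subseteq> U \<and> ordle V r D"
    "compactin (base A) K" "K \<subseteq> U" "agree (U - K) D hzero" using DC_D[OF U D] by metis
  show ?thesis
  proof (rule DC_mkI[OF U precomp_lhom[OF U K(1) f] _ K(3,4) precomp_agree_zero[OF U f K(5) Diff_subset]])
    fix a assume "a \<in> U"
    from K(2)[OF this] obtain V r where V: "Op V" "a \<in> V" "V \<subseteq> U" "ordle V r D" by blast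
    from precomp_local_order[OF U K(1) f V(1,3,4)] V show "\<exists>V r. Op V \<and> a \<in> V \<and> V \<subseteq> U \<and> ordle V r (precomp U f D)" by blast
  qed
qed

text \<open>After precomposition with \<open>f\<close> the operator is supported in
  \<open>C\<close>, wherever \<open>D\<close> itself was supported. This is how a support is brought
  inside \<open>V\<close>.\<close>

lemma cut_support:
  assumes U: "Op U" and V: "Op V" "V \<subseteq> U" and C: "compactin (base A) C" and D: "lhom U D"
    and f: "f \<in> carrier (sect A U)" "res A U (U - C) f = \<zero>\<^bsub>sect A (U - C)\<^esub>"
  shows "agree (V - C) (precomp U f D) hzero"
  by (rule agree_subset[OF precomp_agree_zero'[OF U D f(1) openin_Diff_compact[OF U C] f(2)]]) (use V in auto)

lemma DC_cut:
  assumes U: "Op U" and V: "Op V" "V \<subseteq> U" and C: "compactin (base A) C" "C \<subseteq> V" and D: "D \<in> DC U"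
    and f: "f \<in> carrier (sect A U)" "res A U (U - C) f = \<zero>\<^bsub>sect A (U - C)\<^esub>"
  shows "mk V (precomp U f D) \<in> DC V"
proof -
  obtain K where K: "lhom U D" "\<And>a. a \<in> U \<Longrightarrow> \<exists>V r. Op V \<and> a \<in> V \<and> V \<subseteq> U \<and> ordle V r D" using DC_D[OF U D] by metis
  show ?thesis
  proof (rule DC_mkI[OF V(1) lhom_subset[OF precomp_lhom[OF U K(1) f(1)] V(2)] _ C cut_support[OF U V C(1) K(1) f]])
    fix a assume a: "a \<in> V"
    then have "a \<in> U" using V by auto
    from K(2)[OF this] obtain W r where W: "Op W" "a \<in> W" "W \<subseteq> U" "ordle W r D" by blast
    have o: "Op (W \<inter> V)" "W \<inter> V \<subseteq> U" using W V by auto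
    have "ordle (W \<inter> V) r (precomp U f D)" by (rule precomp_local_order[OF U K(1) f(1) o ordle_subset[OF W(4) Int_lower1]])
    then show "\<exists>W r. Op W \<and> a \<in> W \<and> W \<subseteq> V \<and> ordle W r (precomp U f D)"
      using o W a by (intro exI[of _ "W \<inter> V"] exI[of _ r]) auto
  qed
qed

lemma DKR_cut:
  assumes U: "Op U" and V: "Op V" "V \<subseteq> U" and C: "compactin (base A) C" "C \<subseteq> V" and K: "compactin (base A) K" and D: "D \<in> DKR U K r"
    and f: "f \<in> carrier (sect A U)" "res A U (U - C) f = \<zero>\<^bsub>sect A (U - C)\<^esub>"
  shows "mk V (precomp U f D) \<in> DKR V C r"
  by (rule DKR_mkI[OF V(1) lhom_subset[OF precomp_lhom[OF U DKR_D(1)[OF U K D] f(1)] V(2)] _ C(1) cut_support[OF U V C(1) DKR_D(1)[OF U K D] f]])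
     (rule precomp_local_order[OF U DKR_D(1)[OF U K D] f(1) V ordle_subset[OF DKR_D(3)[OF U K D] V(2)]])

context
  fixes U V C D
  assumes UVC: "Op U" "Op V" "V \<subseteq> U" "compactin (base A) C" "C \<subseteq> V" and D: "lhom V D" "agree (V - C) D hzero"
begin

lemmas extop_prems = UVC(1-3,5) openin_Diff_compact[OF UVC(1,4)] D

lemma DC_ext:
  assumes ord: "\<And>a. a \<in> V \<Longrightarrow> \<exists>W r. Op W \<and> a \<in> W \<and> W \<subseteq> V \<and> ordle W r D"
  shows "mk U (extop V C D) \<in> DC U"
proof (rule DC_mkI[OF UVC(1) extop_lhom[OF extop_prems] _ UVC(4) _ extop_agree_zero[OF extop_prems]])
  show "C \<subseteq> U" using UVC by auto
  fix a assume "a \<in> U"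
  then consider "a \<in> V" | "a \<in> U - C" using UVC by auto
  then show "\<exists>W r. Op W \<and> a \<in> W \<and> W \<subseteq> U \<and> ordle W r (extop V C D)"
  proof cases
    case 1
    then obtain W r where W: "Op W" "a \<in> W" "W \<subseteq> V" "ordle W r D" using ord by blast
    have "ordle W r (extop V C D)" by (rule ordle_agree[OF W(4) agree_sym[OF agree_subset[OF extop_agree[OF extop_prems] W(3)]]])
    then show ?thesis using W UVC by blast
  next
    case 2
    have "ordle (U - C) 0 (extop V C D)" by (rule ordle_hzero[OF extop_agree_zero[OF extop_prems]])
    then show ?thesis using 2 openin_Diff_compact[OF UVC(1,4)] by blast
  qed
qed

lemma DKR_ext: "ordle V r D \<Longrightarrow> mk U (extop V C D) \<in> DKR U C r"
  by (rule DKR_mkI[OF UVC(1) extop_lhom[OF extop_prems] extop_ordle[OF extop_prems] UVC(4) extop_agree_zero[OF extop_prems]])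

end

end

end

section \<open>Compactly supported formal densities\<close>

sublocale formal_mfd \<subseteq> DR: modsheaf2 A "densities A" "reduction A"
  by unfold_locales (rule densities_sheaf, rule reduction_sheaf)

locale mfd_module = formal_mfd A for A :: "('m, 's) ringed_space" +
  fixes F :: "('m, 's, 'f) module_presheaf"
  assumes F: "sheaf_of_modules A F"

sublocale mfd_module \<subseteq> FD: modsheaf2 A F "densities A"
  by unfold_locales (rule F, rule densities_sheaf)

context formal_mfd
begin

lemma dens_minus:
  assumes U: "Op U" and \<omega>: "\<omega> \<in> density_sections A U" and \<eta>: "\<eta> \<in> density_sections A U"
  shows "\<omega> \<ominus>\<^bsub>sect (densities A) U\<^esub> \<eta> = (\<lambda>c a. \<omega> c a - \<eta> c a)"
proof -
  interpret abelian_group "sect (densities A) U" by (rule DR.abgF[OF U])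
  have "\<ominus>\<^bsub>sect (densities A) U\<^esub> \<eta> = (\<lambda>c a. - 1 * \<eta> c a)"
    by (rule minus_equality) (use \<eta> dens_cmult[OF U \<eta>, of "-1"] in \<open>simp_all add: densities_simps\<close>)
  then show ?thesis by (simp add: a_minus_def densities_simps)
qed

lemma red_bounded:
  assumes U: "Op U" and g: "g \<in> red_functions A U" and K: "compactin (base A) K" "K \<subseteq> U" "\<And>a. a \<notin> K \<Longrightarrow> g a = 0"
  obtains B where "\<And>a. cmod (g a) \<le> B"
proof -
  have "compactin (subtopology (base A) U) K" using K by (simp add: compactin_subtopology)
  then have "compactin euclidean (g ` K)" using image_compactin red_continuous[OF U g] by blast
  then have "bounded (g ` K)" by (simp add: compact_imp_bounded)
  then obtain B where B: "\<And>a. a \<in> K \<Longrightarrow> cmod (g a) \<le> B" by (auto simp: bounded_iff)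
  have "cmod (g a) \<le> max B 0" for a using B[of a] K(3)[of a] by (cases "a \<in> K") auto
  then show thesis using that by blast
qed

lemma DR_support:
  assumes U: "Op U" and X: "X \<in> DR.DC U" and \<omega>: "\<omega> \<in> density_sections A U"
  obtains K where "compactin (base A) K" "K \<subseteq> U" "\<And>a. a \<notin> K \<Longrightarrow> X U \<omega> a = 0"
proof -
  obtain K where K: "DR.lhom U X" "compactin (base A) K" "K \<subseteq> U" "DR.agree (U - K) X DR.hzero"
    using DR.DC_D[OF hausdorff U X] by metis
  have o: "Op (U - K)" using openin_Diff_compactin[OF U K(2)] .
  have c: "\<omega> \<in> carrier (sect (densities A) U)" using \<omega> by (simp add: densities_simps)
  have 1: "res (reduction A) U (U - K) (X U \<omega>) = (\<lambda>a. 0)"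
    using DR.lhom_res[OF K(1) U o Diff_subset order_refl c] DR.agreeD[OF K(4) o order_refl DR.resF_closed[OF U o Diff_subset c]]
    by (simp add: DR.hzero_def reduction_simps)
  have 2: "X U \<omega> \<in> red_functions A U" using DR.lhom_closed[OF K(1) U order_refl c] by (simp add: reduction_simps)
  show thesis
  proof (rule that[OF K(2,3)])
    fix a assume "a \<notin> K"
    then show "X U \<omega> a = 0" using fun_cong[OF 1, of a] red_off[OF 2, of a] by (auto simp: reduction_simps split: if_splits)
  qed
qed

text \<open>A supremum of reals is informative only for bounded sets. The functions in question
  vanish off a compact set, because the test operator does, and they are continuous; hence they are
  bounded.\<close>

lemma diff_seminorm_triangle:
  assumes U: "Op U" and X: "X \<in> DR.DC U"
    and D: "D U u \<in> density_sections A U" "D' U u \<in> density_sections A U" "D'' U u \<in> density_sections A U"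
  shows "diff_seminorm U X u (hom_minus (densities A) D D'') \<le>
     diff_seminorm U X u (hom_minus (densities A) D D') + diff_seminorm U X u (hom_minus (densities A) D' D'')"
proof -
  have lX: "DR.lhom U X" using DR.DC_D[OF hausdorff U X] by metis
  let ?m = "\<lambda>D D'. hom_minus (densities A) D D' U u"
  have m: "?m E E' \<in> density_sections A U" if "E U u \<in> density_sections A U" "E' U u \<in> density_sections A U" for E E'
    using DR.minusF[OF U] that by (simp add: hom_minus_def densities_simps)
  have bdd: "bdd_above (insert 0 {cmod (X U (?m E E') a) | a. a \<in> U})"
    if E: "E U u \<in> density_sections A U" "E' U u \<in> density_sections A U" for E E'
  proof -
    obtain K where K: "compactin (base A) K" "K \<subseteq> U" "\<And>a. a \<notin> K \<Longrightarrow> X U (?m E E') a = 0" by (rule DR_support[OF U X m[of E E', OF E]]) (rule that)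
    have r: "X U (?m E E') \<in> red_functions A U" using DR.lhom_closed[OF lX U order_refl] m[of E E', OF E] by (simp add: densities_simps reduction_simps)
    obtain B where B: "\<And>a. cmod (X U (?m E E') a) \<le> B" by (rule red_bounded[OF U r K(1,2)]) (erule K(3), rule that)
    have "0 \<le> B" using norm_ge_zero B order_trans by blast
    then show ?thesis using B by (intro bdd_aboveI[of _ B]) auto
  qed
  have sum: "X U (?m D D'') = (\<lambda>a. X U (?m D D') a + X U (?m D' D'') a)"
  proof -
    have "?m D D'' = (\<lambda>c a. ?m D D' c a + ?m D' D'' c a)"
      using D by (simp add: hom_minus_def dens_minus[OF U])
    then have "?m D D'' = ?m D D' \<oplus>\<^bsub>sect (densities A) U\<^esub> ?m D' D''" by (simp add: densities_simps)
    then show ?thesis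
      using DR.lhom_add[OF lX U order_refl, of "?m D D'" "?m D' D''"] m D by (simp add: densities_simps reduction_simps)
  qed
  have le: "cmod (X U (?m E E') a) \<le> diff_seminorm U X u (hom_minus (densities A) E E')"
    if "E U u \<in> density_sections A U" "E' U u \<in> density_sections A U" "a \<in> U" for E E' a
    unfolding diff_seminorm_def by (rule cSup_upper[OF _ bdd[of E E', OF that(1,2)]]) (use that(3) in blast)
  have nn: "0 \<le> diff_seminorm U X u (hom_minus (densities A) E E')"
    if "E U u \<in> density_sections A U" "E' U u \<in> density_sections A U" for E E'
    unfolding diff_seminorm_def by (rule cSup_upper[OF _ bdd[of E E', OF that(1,2)]]) blast
  show ?thesis
    unfolding diff_seminorm_def[of U X u "hom_minus (densities A) D D''"]
  proof (rule cSup_least)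
    fix x assume "x \<in> insert 0 {cmod (X U (?m D D'') a) | a. a \<in> U}"
    then consider "x = 0" | a where "a \<in> U" "x = cmod (X U (?m D D'') a)" by blast
    then show "x \<le> diff_seminorm U X u (hom_minus (densities A) D D') + diff_seminorm U X u (hom_minus (densities A) D' D'')"
    proof cases
      case 1 then show ?thesis using nn[of D D', OF D(1,2)] nn[of D' D'', OF D(2,3)] by simp
    next
      case 2
      have "x \<le> cmod (X U (?m D D') a) + cmod (X U (?m D' D'') a)" unfolding 2(2) sum by (rule norm_triangle_ineq)
      also have "\<dots> \<le> diff_seminorm U X u (hom_minus (densities A) D D') + diff_seminorm U X u (hom_minus (densities A) D' D'')"
        by (intro add_mono le D 2(1))
      finally show ?thesis .
    qed
  qed blast
qed

text \<open>Points of \<open>U - V\<close> contribute only the value 0, which both suprema contain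
  anyway.\<close>

lemma seminorm_transfer:
  assumes "V \<subseteq> U" "\<And>a. a \<in> V \<Longrightarrow> P a = p a" "\<And>a. a \<in> U - V \<Longrightarrow> P a = 0"
  shows "Sup (insert 0 {cmod (P a) | a. a \<in> U}) = (Sup (insert 0 {cmod (p a) | a. a \<in> V}) :: real)"
proof -
  have "insert 0 {cmod (P a) | a. a \<in> U} = insert 0 {cmod (p a) | a. a \<in> V}"
  proof (intro equalityI subsetI)
    fix x assume "x \<in> insert 0 {cmod (P a) | a. a \<in> U}"
    then consider "x = 0" | a where "a \<in> U" "x = cmod (P a)" by blast
    then show "x \<in> insert 0 {cmod (p a) | a. a \<in> V}"
    proof cases
      case 2
      then show ?thesis using assms(2)[of a] assms(3)[of a] by (cases "a \<in> V") auto
    qed simp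
  next
    fix x assume "x \<in> insert 0 {cmod (p a) | a. a \<in> V}"
    then consider "x = 0" | a where "a \<in> V" "x = cmod (p a)" by blast
    then show "x \<in> insert 0 {cmod (P a) | a. a \<in> U}"
    proof cases
      case 2
      then have "a \<in> U" "x = cmod (P a)" using assms(1,2) by auto
      then show ?thesis by blast
    qed simp
  qed
  then show ?thesis by simp
qed

end

context mfd_module
begin

lemma FD_dens: "FD.lhom U D \<Longrightarrow> Op U \<Longrightarrow> u \<in> carrier (sect F U) \<Longrightarrow> D U u \<in> density_sections A U"
  using FD.lhom_closed[of U D U u] by (simp add: densities_simps)

lemma FD_off:
  assumes U: "Op U" and D: "FD.lhom U D" and K: "Op (U - K)" "FD.agree (U - K) D FD.hzero" and u: "u \<in> carrier (sect F U)" and a: "a \<notin> K"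
  shows "D U u c a = 0"
proof -
  have 1: "res (densities A) U (U - K) (D U u) = (\<lambda>c a. 0)"
    using FD.lhom_res[OF D U K(1) Diff_subset order_refl u] FD.agreeD[OF K(2,1) order_refl FD.resF_closed[OF U K(1) Diff_subset u]]
    by (simp add: FD.hzero_def densities_simps)
  from fun_cong[OF fun_cong[OF 1], of c a] have "(if a \<in> U - K then D U u c a else 0) = 0" by (simp add: densities_simps)
  then show ?thesis using a dens_off[OF FD_dens[OF D U u], of a c] by (auto split: if_splits)
qed

lemma hom_cdens:
  assumes U: "Op U" and D: "FD.lhom U D" and K: "compactin (base A) K" "K \<subseteq> U" "FD.agree (U - K) D FD.hzero" and u: "u \<in> carrier (sect F U)"
  shows "cdens K (D U u)"
  by (rule cdensI[OF U FD_dens[OF D U u] K(1,2)]) (rule FD_off[OF U D openin_Diff_compactin[OF U K(1)] K(3) u])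

lemma rho_apply: "u \<in> carrier (sect F U) \<Longrightarrow> rho A F U D u = density_integral A (D U u)"
  by (simp add: rho_def)

section \<open>The functionals of operators form a vector space\<close>

lemma rho_add:
  assumes U: "Op U" and D: "D \<in> FD.DC U" "D' \<in> FD.DC U"
  shows "rho A F U (FD.mk U (FD.hplus D D')) = (\<lambda>u\<in>carrier (sect F U). rho A F U D u + rho A F U D' u)"
proof -
  obtain K where K: "FD.lhom U D" "compactin (base A) K" "K \<subseteq> U" "FD.agree (U - K) D FD.hzero" using FD.DC_D[OF hausdorff U D(1)] by metis
  obtain L where L: "FD.lhom U D'" "compactin (base A) L" "L \<subseteq> U" "FD.agree (U - L) D' FD.hzero" using FD.DC_D[OF hausdorff U D(2)] by metis
  have "density_integral A (FD.mk U (FD.hplus D D') U u) = rho A F U D u + rho A F U D' u" if u: "u \<in> carrier (sect F U)" for u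
  proof -
    have KL: "compactin (base A) (K \<union> L)" using compactin_Un[OF K(2) L(2)] .
    have "cdens (K \<union> L) (D U u)" "cdens (K \<union> L) (D' U u)"
      using cdens_mono[OF hom_cdens[OF U K u] _ KL] cdens_mono[OF hom_cdens[OF U L u] _ KL] by auto
    from density_integral_add[OF this] show ?thesis
      using u U by (simp add: rho_apply FD.mk_apply FD.hplus_def densities_simps)
  qed
  then show ?thesis unfolding rho_def[of A F U "FD.mk U (FD.hplus D D')"] by (intro restrict_ext)
qed

text \<open>Scaling is realized on operators as precomposition with a constant section, for which
  support and local order are already controlled by \<open>DC_precomp\<close>.\<close>

lemma rho_smult:
  assumes U: "Op U" and D: "D \<in> FD.DC U"
  shows "rho A F U (FD.mk U (FD.precomp U (cst U k) D)) = (\<lambda>u\<in>carrier (sect F U). k * rho A F U D u)"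
proof -
  obtain K where K: "FD.lhom U D" "compactin (base A) K" "K \<subseteq> U" "FD.agree (U - K) D FD.hzero" using FD.DC_D[OF hausdorff U D] by metis
  have "density_integral A (FD.mk U (FD.precomp U (cst U k) D) U u) = k * rho A F U D u" if u: "u \<in> carrier (sect F U)" for u
  proof -
    have "FD.mk U (FD.precomp U (cst U k) D) U u = cscale A (densities A) U k (D U u)"
      using FD.lhom_cscale[OF K(1) U order_refl u, of k] U u
      by (simp add: FD.mk_apply FD.precomp_def FD.cscale_cst res_cst)
    also have "\<dots> = (\<lambda>c a. k * D U u c a)"
      using val_cst[OF U] dens_off[OF FD_dens[OF K(1) U u]] by (auto simp: DR.cscale_cst densities_simps fun_eq_iff)
    finally show ?thesis using density_integral_cmult[OF hom_cdens[OF U K u], of k] u by (simp add: rho_apply)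
  qed
  then show ?thesis unfolding rho_def[of A F U "FD.mk U (FD.precomp U (cst U k) D)"] by (intro restrict_ext)
qed

lemma rho_zero: "Op U \<Longrightarrow> rho A F U (FD.mk U FD.hzero) = (\<lambda>u\<in>carrier (sect F U). 0)"
proof -
  assume U: "Op U"
  have "cdens {} (\<lambda>c a. 0)" unfolding cdens_def using dens_zero by simp
  from density_integral_cmult[OF this, of 0] have 0: "density_integral A (\<lambda>c a. 0) = 0" by simp
  show ?thesis unfolding rho_def by (rule restrict_ext) (simp add: FD.mk_apply U FD.hzero_def densities_simps 0)
qed

lemma rho_minus:
  assumes U: "Op U" and D: "D \<in> FD.DC U" and u: "u \<in> carrier (sect F U)" "v \<in> carrier (sect F U)"
  shows "rho A F U D (u \<ominus>\<^bsub>sect F U\<^esub> v) = rho A F U D u - rho A F U D v"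
proof -
  obtain K where K: "FD.lhom U D" "compactin (base A) K" "K \<subseteq> U" "FD.agree (U - K) D FD.hzero" using FD.DC_D[OF hausdorff U D] by metis
  have m: "u \<ominus>\<^bsub>sect F U\<^esub> v \<in> carrier (sect F U)" using FD.minusF[OF U u] .
  have "D U u = (\<lambda>c a. D U (u \<ominus>\<^bsub>sect F U\<^esub> v) c a + D U v c a)"
    using FD.lhom_minus[OF K(1) U order_refl u] dens_minus[OF U FD_dens[OF K(1) U u(1)] FD_dens[OF K(1) U u(2)]] by simp
  then show ?thesis
    using density_integral_add[OF hom_cdens[OF U K m] hom_cdens[OF U K u(2)]] u m by (simp add: rho_apply)
qed

lemma D_c_simps:
  "carrier (D_c A F U) = rho A F U ` FD.DC U" "carrier (D_c_space A F U) = rho A F U ` FD.DC U"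
  "\<zero>\<^bsub>D_c A F U\<^esub> = (\<lambda>u\<in>carrier (sect F U). 0)" "\<zero>\<^bsub>D_c_space A F U\<^esub> = (\<lambda>u\<in>carrier (sect F U). 0)"
  "\<eta> \<oplus>\<^bsub>D_c A F U\<^esub> \<theta> = (\<lambda>u\<in>carrier (sect F U). \<eta> u + \<theta> u)" "\<eta> \<oplus>\<^bsub>D_c_space A F U\<^esub> \<theta> = (\<lambda>u\<in>carrier (sect F U). \<eta> u + \<theta> u)"
  "c \<odot>\<^bsub>D_c A F U\<^esub> \<eta> = (\<lambda>u\<in>carrier (sect F U). c * \<eta> u)" "c \<odot>\<^bsub>D_c_space A F U\<^esub> \<eta> = (\<lambda>u\<in>carrier (sect F U). c * \<eta> u)"
  by (simp_all add: D_c_def D_c_space_def FD.DC_def)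

lemma D_c_ext: "\<eta> \<in> rho A F U ` FD.DC U \<Longrightarrow> restrict \<eta> (carrier (sect F U)) = \<eta>"
  by (auto simp: rho_def)

lemma D_c_module:
  assumes U: "Op U"
  shows "Module.module complex_ring (D_c_space A F U)"
proof -
  let ?V = "D_c_space A F U"
  have add: "\<eta> \<oplus>\<^bsub>?V\<^esub> \<theta> \<in> carrier ?V" if "\<eta> \<in> carrier ?V" "\<theta> \<in> carrier ?V" for \<eta> \<theta>
  proof -
    obtain D D' where D: "D \<in> FD.DC U" "D' \<in> FD.DC U" "\<eta> = rho A F U D" "\<theta> = rho A F U D'" using \<open>\<eta> \<in> carrier ?V\<close> \<open>\<theta> \<in> carrier ?V\<close> by (auto simp: D_c_simps)
    have "rho A F U (FD.mk U (FD.hplus D D')) \<in> carrier ?V" using FD.DC_hplus[OF hausdorff U D(1,2)] by (simp add: D_c_simps)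
    then show ?thesis unfolding rho_add[OF U D(1,2)] D(3,4) by (simp add: D_c_simps)
  qed
  have smult: "k \<odot>\<^bsub>?V\<^esub> \<eta> \<in> carrier ?V" if h: "\<eta> \<in> carrier ?V" for k \<eta>
  proof -
    obtain D where D: "D \<in> FD.DC U" "\<eta> = rho A F U D" using h by (auto simp: D_c_simps)
    have "rho A F U (FD.mk U (FD.precomp U (cst U k) D)) \<in> carrier ?V"
      using FD.DC_precomp[OF hausdorff U D(1) cst_closed[OF U]] by (simp add: D_c_simps)
    then show ?thesis unfolding rho_smult[OF U D(1)] D(2) by (simp add: D_c_simps)
  qed
  have zero: "\<zero>\<^bsub>?V\<^esub> \<in> carrier ?V" using FD.DC_hzero[OF hausdorff U] rho_zero[OF U] by (force simp: D_c_simps)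
  have ext: "restrict \<eta> (carrier (sect F U)) = \<eta>" if "\<eta> \<in> carrier ?V" for \<eta>
    using that D_c_ext by (simp add: D_c_simps)
  show ?thesis
  proof (rule moduleI)
    show "abelian_group ?V"
    proof (rule abelian_groupI)
      fix \<eta> assume \<eta>: "\<eta> \<in> carrier ?V"
      have "\<zero>\<^bsub>?V\<^esub> \<oplus>\<^bsub>?V\<^esub> \<eta> = restrict \<eta> (carrier (sect F U))" unfolding D_c_simps by (rule restrict_ext) simp
      then show "\<zero>\<^bsub>?V\<^esub> \<oplus>\<^bsub>?V\<^esub> \<eta> = \<eta>" using ext[OF \<eta>] by simp
      have "(- 1 \<odot>\<^bsub>?V\<^esub> \<eta>) \<oplus>\<^bsub>?V\<^esub> \<eta> = \<zero>\<^bsub>?V\<^esub>" unfolding D_c_simps by (rule restrict_ext) simp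
      then show "\<exists>y\<in>carrier ?V. y \<oplus>\<^bsub>?V\<^esub> \<eta> = \<zero>\<^bsub>?V\<^esub>" using smult[OF \<eta>] by blast
    qed (use add zero in \<open>auto simp: D_c_simps(4,6,8) algebra_simps intro!: restrict_ext\<close>)
    show "\<one>\<^bsub>complex_ring\<^esub> \<odot>\<^bsub>?V\<^esub> \<eta> = \<eta>" if "\<eta> \<in> carrier ?V" for \<eta>
      using ext[OF that] by (simp add: D_c_simps complex_ring_simps)
  qed (use smult in \<open>auto simp: D_c_simps cring_complex_ring complex_ring_simps algebra_simps intro!: restrict_ext\<close>)
qed

section \<open>The topology of the space of compactly supported formal densities\<close>

lemma openin_Diff_KR:
  assumes "D \<in> FD.DKR U K r" "X \<in> DR.DC U" "u \<in> carrier (sect F U)" "\<epsilon> > 0"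
  shows "openin (Diff_KR_topology A F U K r) {D' \<in> FD.DKR U K r. diff_seminorm U X u (hom_minus (densities A) D' D) < \<epsilon>}"
  unfolding Diff_KR_topology_def Let_def FD.DKR_def[symmetric] DR.DC_def[symmetric]
  by (rule topology_generated_by_Basis) (use assms in blast)

lemma topspace_Diff_KR:
  assumes U: "Op U" and K: "compactin (base A) K"
  shows "topspace (Diff_KR_topology A F U K r) = FD.DKR U K r"
proof
  show "topspace (Diff_KR_topology A F U K r) \<subseteq> FD.DKR U K r"
    unfolding Diff_KR_topology_def Let_def FD.DKR_def[symmetric] topology_generated_by_topspace by blast
  show "FD.DKR U K r \<subseteq> topspace (Diff_KR_topology A F U K r)"
  proof
    fix D assume D: "D \<in> FD.DKR U K r"
    \<comment> \<open>The zero operator and the zero section always exist and give a ball that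
      contains \<open>D\<close>, so the generated topology covers all operators.\<close>
    let ?X = "DR.mk U DR.hzero" and ?u = "\<zero>\<^bsub>sect F U\<^esub>"
    have X: "?X \<in> DR.DC U" by (rule DR.DC_hzero[OF hausdorff U])
    have u: "?u \<in> carrier (sect F U)" using FD.zeroF[OF U] .
    have "hom_minus (densities A) D D U ?u \<in> carrier (sect (densities A) U)"
      using FD.lhom_closed[OF FD.DKR_D(1)[OF hausdorff U K D] U order_refl u] DR.minusF[OF U] by (simp add: hom_minus_def)
    then have "?X U (hom_minus (densities A) D D U ?u) = (\<lambda>a. 0)" using U by (simp add: DR.mk_apply DR.hzero_def reduction_simps)
    then have S: "insert 0 {cmod (?X U (hom_minus (densities A) D D U ?u) a) | a. a \<in> U} = {0}" by auto
    have "diff_seminorm U ?X ?u (hom_minus (densities A) D D) = 0" unfolding diff_seminorm_def S by simp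
    then have "D \<in> {D' \<in> FD.DKR U K r. diff_seminorm U ?X ?u (hom_minus (densities A) D' D) < 1}" using D by simp
    then show "D \<in> topspace (Diff_KR_topology A F U K r)"
      using openin_subset[OF openin_Diff_KR[OF D X u, of 1]] by auto
  qed
qed

text \<open>A criterion in terms of seminorms: every seminorm of the images is one seminorm of the
  arguments. Since the generating sets are balls about arbitrary centres, the triangle inequality is
  needed to fit a ball about a given point into a preimage.\<close>

lemma Diff_KR_continuous:
  assumes U: "Op U" and V: "Op V" and K: "compactin (base A) K" and L: "compactin (base A) L"
    and maps: "\<And>D. D \<in> FD.DKR U K r \<Longrightarrow> \<Phi> D \<in> FD.DKR V L k"
    and semi: "\<And>X v. X \<in> DR.DC V \<Longrightarrow> v \<in> carrier (sect F V) \<Longrightarrow> \<exists>X'\<in>DR.DC U. \<exists>w\<in>carrier (sect F U).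
        \<forall>D\<in>FD.DKR U K r. \<forall>D'\<in>FD.DKR U K r. diff_seminorm V X v (hom_minus (densities A) (\<Phi> D) (\<Phi> D')) =
          diff_seminorm U X' w (hom_minus (densities A) D D')"
  shows "continuous_map (Diff_KR_topology A F U K r) (Diff_KR_topology A F V L k) \<Phi>"
  unfolding Diff_KR_topology_def[of A F V] Let_def FD.DKR_def[symmetric] DR.DC_def[symmetric]
proof (rule continuous_on_generated_topo)
  fix S assume "S \<in> {{D' \<in> FD.DKR V L k. diff_seminorm V X v (hom_minus (densities A) D' D) < \<epsilon>} | D X v \<epsilon>.
      D \<in> FD.DKR V L k \<and> X \<in> DR.DC V \<and> v \<in> carrier (sect F V) \<and> \<epsilon> > 0}"
  then obtain D0 X v \<epsilon> where S: "S = {D' \<in> FD.DKR V L k. diff_seminorm V X v (hom_minus (densities A) D' D0) < \<epsilon>}"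
    and D0: "D0 \<in> FD.DKR V L k" and X: "X \<in> DR.DC V" and v: "v \<in> carrier (sect F V)" and \<epsilon>: "\<epsilon> > 0" by blast
  obtain X' w where X': "X' \<in> DR.DC U" "w \<in> carrier (sect F U)"
    and eq: "\<And>D D'. D \<in> FD.DKR U K r \<Longrightarrow> D' \<in> FD.DKR U K r \<Longrightarrow>
        diff_seminorm V X v (hom_minus (densities A) (\<Phi> D) (\<Phi> D')) = diff_seminorm U X' w (hom_minus (densities A) D D')"
    using semi[OF X v] by blast
  have dens: "D V v \<in> density_sections A V" if "D \<in> FD.DKR V L k" for D
    by (rule FD_dens[OF FD.DKR_D(1)[OF hausdorff V L that] V v])
  show "openin (Diff_KR_topology A F U K r) (\<Phi> -` S \<inter> topspace (Diff_KR_topology A F U K r))"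
  proof (subst openin_subopen, intro ballI)
    fix D assume "D \<in> \<Phi> -` S \<inter> topspace (Diff_KR_topology A F U K r)"
    then have D: "D \<in> FD.DKR U K r" "diff_seminorm V X v (hom_minus (densities A) (\<Phi> D) D0) < \<epsilon>"
      using topspace_Diff_KR[OF U K] by (auto simp: S)
    \<comment> \<open>The radius that remains after the distance to the centre \<open>D0\<close> is
      spent.\<close>
    let ?\<delta> = "\<epsilon> - diff_seminorm V X v (hom_minus (densities A) (\<Phi> D) D0)"
    let ?T = "{D' \<in> FD.DKR U K r. diff_seminorm U X' w (hom_minus (densities A) D' D) < ?\<delta>}"
    have "?T \<subseteq> \<Phi> -` S \<inter> topspace (Diff_KR_topology A F U K r)"
    proof
      fix D' assume D': "D' \<in> ?T"
      have "diff_seminorm V X v (hom_minus (densities A) (\<Phi> D') D0) \<le>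
         diff_seminorm V X v (hom_minus (densities A) (\<Phi> D') (\<Phi> D)) + diff_seminorm V X v (hom_minus (densities A) (\<Phi> D) D0)"
        by (rule diff_seminorm_triangle[OF V X]) (use dens maps D D' D0 in auto)
      also have "\<dots> < \<epsilon>" using eq[of D' D] D D' by simp
      finally show "D' \<in> \<Phi> -` S \<inter> topspace (Diff_KR_topology A F U K r)"
        using D' maps topspace_Diff_KR[OF U K] by (simp add: S)
    qed
    moreover have "openin (Diff_KR_topology A F U K r) ?T" by (rule openin_Diff_KR[OF D(1) X']) (use D(2) in simp)
    moreover have "D \<in> ?T"
    proof -
      have "hom_minus (densities A) D D U w = \<zero>\<^bsub>sect (densities A) U\<^esub>"
        using FD.lhom_closed[OF FD.DKR_D(1)[OF hausdorff U K D(1)] U order_refl X'(2)] DR.minusF_self[OF U] by (simp add: hom_minus_def)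
      moreover have "X' U \<zero>\<^bsub>sect (densities A) U\<^esub> = (\<lambda>a. 0)"
      proof -
        have "DR.lhom U X'" using DR.DC_D[OF hausdorff U X'(1)] by metis
        from DR.lhom_zero[OF this U order_refl] show ?thesis by (simp add: reduction_simps)
      qed
      ultimately have S: "insert 0 {cmod (X' U (hom_minus (densities A) D D U w) a) | a. a \<in> U} = {0}" by auto
      have "diff_seminorm U X' w (hom_minus (densities A) D D) = 0" unfolding diff_seminorm_def S by simp
      then show ?thesis using D by simp
    qed
    ultimately show "\<exists>T. openin (Diff_KR_topology A F U K r) T \<and> D \<in> T \<and> T \<subseteq> \<Phi> -` S \<inter> topspace (Diff_KR_topology A F U K r)"
      by blast
  qed
next
  have "\<Union>{{D' \<in> FD.DKR V L k. diff_seminorm V X v (hom_minus (densities A) D' D) < \<epsilon>} | D X v \<epsilon>.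
      D \<in> FD.DKR V L k \<and> X \<in> DR.DC V \<and> v \<in> carrier (sect F V) \<and> \<epsilon> > 0} = FD.DKR V L k"
    using topspace_Diff_KR[OF V L, of k]
    unfolding Diff_KR_topology_def[of A F V] Let_def FD.DKR_def[symmetric] DR.DC_def[symmetric] topology_generated_by_topspace .
  then show "\<Phi> ` topspace (Diff_KR_topology A F U K r) \<subseteq> \<Union>{{D' \<in> FD.DKR V L k. diff_seminorm V X v (hom_minus (densities A) D' D) < \<epsilon>} | D X v \<epsilon>.
      D \<in> FD.DKR V L k \<and> X \<in> DR.DC V \<and> v \<in> carrier (sect F V) \<and> \<epsilon> > 0}"
    using maps topspace_Diff_KR[OF U K] by auto
qed

end

section \<open>Quotient topologies\<close>

lemma openin_quotient_topology:
  "openin (quotient_topology X f) S \<longleftrightarrow> S \<subseteq> f ` topspace X \<and> openin X {x \<in> topspace X. f x \<in> S}"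
proof -
  have "istopology (\<lambda>S. S \<subseteq> f ` topspace X \<and> openin X {x \<in> topspace X. f x \<in> S})"
    unfolding istopology_def
  proof (intro conjI allI impI)
    fix S T assume S: "S \<subseteq> f ` topspace X \<and> openin X {x \<in> topspace X. f x \<in> S}"
      and T: "T \<subseteq> f ` topspace X \<and> openin X {x \<in> topspace X. f x \<in> T}"
    have "{x \<in> topspace X. f x \<in> S \<inter> T} = {x \<in> topspace X. f x \<in> S} \<inter> {x \<in> topspace X. f x \<in> T}" by auto
    then show "openin X {x \<in> topspace X. f x \<in> S \<inter> T}" using openin_Int[OF conjunct2[OF S] conjunct2[OF T]] by (rule ssubst)
    show "S \<inter> T \<subseteq> f ` topspace X" using S by blast
  next
    fix \<K> assume K: "\<forall>S\<in>\<K>. S \<subseteq> f ` topspace X \<and> openin X {x \<in> topspace X. f x \<in> S}"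
    have "{x \<in> topspace X. f x \<in> \<Union>\<K>} = (\<Union>S\<in>\<K>. {x \<in> topspace X. f x \<in> S})" by auto
    then show "openin X {x \<in> topspace X. f x \<in> \<Union>\<K>}" using K by auto
    show "\<Union>\<K> \<subseteq> f ` topspace X" using K by blast
  qed
  from topology_inverse'[OF this] show ?thesis by (simp add: quotient_topology_def)
qed

lemma topspace_quotient_topology: "topspace (quotient_topology X f) = f ` topspace X"
proof
  show "topspace (quotient_topology X f) \<subseteq> f ` topspace X"
    using openin_quotient_topology[of X f "topspace (quotient_topology X f)"] openin_topspace by blast
  have "{x \<in> topspace X. f x \<in> f ` topspace X} = topspace X" by auto
  then have "openin (quotient_topology X f) (f ` topspace X)" by (simp add: openin_quotient_topology)
  then show "f ` topspace X \<subseteq> topspace (quotient_topology X f)" by (rule openin_subset)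
qed

lemma continuous_map_to_quotient: "continuous_map X (quotient_topology X f) f"
  by (simp add: continuous_map openin_quotient_topology topspace_quotient_topology)

lemma continuous_map_from_quotient:
  assumes "continuous_map X Y (\<lambda>x. g (f x))"
  shows "continuous_map (quotient_topology X f) Y g"
  unfolding continuous_map
proof (intro conjI allI impI)
  show "g ` topspace (quotient_topology X f) \<subseteq> topspace Y"
    using assms unfolding topspace_quotient_topology by (auto simp: continuous_map_def)
  fix S assume S: "openin Y S"
  have "{x \<in> topspace X. f x \<in> {y \<in> f ` topspace X. g y \<in> S}} = {x \<in> topspace X. g (f x) \<in> S}" by auto
  then show "openin (quotient_topology X f) {y \<in> topspace (quotient_topology X f). g y \<in> S}"
    unfolding openin_quotient_topology topspace_quotient_topology
    using openin_continuous_map_preimage[OF assms S] by auto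
qed

context formal_mfd
begin

text \<open>Densities over \<open>U\<close> and over \<open>V\<close> are functions of the same
  type, 0 outside. Extension by zero therefore does not change the function, and integrals over
  \<open>U\<close> and \<open>V\<close> coincide without further argument.\<close>

lemma dens_ext_eq:
  assumes t: "t \<in> density_sections A U" and s: "s \<in> density_sections A V" and V: "V \<subseteq> U" "C \<subseteq> V"
    and 1: "res (densities A) U V t = s" and 2: "res (densities A) U (U - C) t = (\<lambda>c a. 0)"
  shows "t = s"
proof (intro HOL.ext)
  fix c a
  have 1: "(if a \<in> V then t c a else 0) = s c a" using fun_cong[OF fun_cong[OF 1], of c a] by (simp add: densities_simps)
  have 2: "(if a \<in> U - C then t c a else 0) = 0" using fun_cong[OF fun_cong[OF 2], of c a] by (simp add: densities_simps)
  show "t c a = s c a"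
  proof (cases "a \<in> V")
    case False
    then have "a \<notin> C" using V by auto
    then show ?thesis using False 2 dens_off[OF t, of a c] dens_off[OF s, of a c] by (cases "a \<in> U") auto
  qed (use 1 in simp)
qed

end

context mfd_module
begin

section \<open>Extending and cutting compactly supported densities\<close>

lemma extop_dens:
  assumes U: "Op U" "Op V" "V \<subseteq> U" and C: "compactin (base A) C" "C \<subseteq> V"
    and D: "FD.lhom V D" "FD.agree (V - C) D FD.hzero" and u: "u \<in> carrier (sect F U)"
  shows "FD.extop V C D U u = D V (res F U V u)"
proof -
  note pr = U C(2) openin_Diff_compactin[OF U(1) C(1)] D
  note E = FD.extop_char[OF pr U(1) order_refl u]
  have UV: "U \<inter> V = V" using U by auto
  show ?thesis
    by (rule dens_ext_eq[of _ U _ V C])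
       (use E UV U C FD_dens[OF D(1) U(2) FD.resF_closed[OF U u]] in \<open>simp_all add: densities_simps\<close>)
qed

lemma extension_rho:
  assumes U: "Op U" "Op V" "V \<subseteq> U" and C: "compactin (base A) C" "C \<subseteq> V"
    and D: "FD.lhom V D" "FD.agree (V - C) D FD.hzero"
  shows "extension F U V (rho A F V D) = rho A F U (FD.mk U (FD.extop V C D))"
  unfolding extension_def rho_def[of A F U]
  by (rule restrict_ext) (use U extop_dens[OF U C D] FD.resF_closed[OF U] in \<open>simp add: rho_apply FD.mk_apply\<close>)

lemma extension_closed:
  assumes U: "Op U" "Op V" "V \<subseteq> U" and \<eta>: "\<eta> \<in> carrier (D_c A F V)"
  shows "extension F U V \<eta> \<in> carrier (D_c A F U)"
proof -
  obtain D where D: "D \<in> FD.DC V" "\<eta> = rho A F V D" using \<eta> by (auto simp: D_c_simps)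
  obtain C where C: "FD.lhom V D" "\<And>a. a \<in> V \<Longrightarrow> \<exists>W r. Op W \<and> a \<in> W \<and> W \<subseteq> V \<and> FD.ordle W r D"
    "compactin (base A) C" "C \<subseteq> V" "FD.agree (V - C) D FD.hzero" using FD.DC_D[OF hausdorff U(2) D(1)] by metis
  show ?thesis unfolding D(2) extension_rho[OF U C(3,4,1,5)] D_c_simps
    by (rule imageI) (rule FD.DC_ext[OF hausdorff U C(3,4,1,5,2)])
qed

text \<open>Stated on functionals, so that it does not depend on an operator representing \<eta>;
  \<open>cut_rho\<close> shows that D \<circ> f represents the cut when D represents \<eta>.\<close>

definition cut :: "'m set \<Rightarrow> 'm set \<Rightarrow> 's \<Rightarrow> 'm set \<Rightarrow> ('f \<Rightarrow> complex) \<Rightarrow> 'f \<Rightarrow> complex" where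
  "cut U V f C \<eta> = (\<lambda>v\<in>carrier (sect F V). \<eta> (FD.zext V U C (res A U V f \<odot>\<^bsub>sect F V\<^esub> v)))"

context
  fixes U V f C
  assumes U: "Op U" "Op V" "V \<subseteq> U" and C: "compactin (base A) C" "C \<subseteq> V"
    and f: "f \<in> carrier (sect A U)" "res A U (U - C) f = \<zero>\<^bsub>sect A (U - C)\<^esub>"
begin

lemma cut_zext:
  assumes v: "v \<in> carrier (sect F V)"
  shows cut_zext_closed: "FD.zext V U C (res A U V f \<odot>\<^bsub>sect F V\<^esub> v) \<in> carrier (sect F U)"
    and cut_zext_res: "res F U V (FD.zext V U C (res A U V f \<odot>\<^bsub>sect F V\<^esub> v)) = res A U V f \<odot>\<^bsub>sect F V\<^esub> v"
    and cut_zext_zero: "res F U (U - C) (FD.zext V U C (res A U V f \<odot>\<^bsub>sect F V\<^esub> v)) = \<zero>\<^bsub>sect F (U - C)\<^esub>"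
proof -
  have oC: "Op (U - C)" "Op (V - C)" using U C openin_Diff_compactin by auto
  have fV: "res A U V f \<in> carrier (sect A V)" by (rule resA_closed[OF U f(1)])
  have sub: "V - C \<subseteq> V" "V - C \<subseteq> U - C" "U - C \<subseteq> U" using U by auto
  have "res A V (V - C) (res A U V f) = res A (U - C) (V - C) (res A U (U - C) f)"
    using resA_trans[OF U(1,2) oC(2) U(3) sub(1) f(1)] resA_trans[OF U(1) oC(1,2) sub(3,2) f(1)] by simp
  also have "\<dots> = \<zero>\<^bsub>sect A (V - C)\<^esub>" using f(2) resA_zero[OF oC sub(2)] by simp
  finally have "res F V (V - C) (res A U V f \<odot>\<^bsub>sect F V\<^esub> v) = \<zero>\<^bsub>sect F (V - C)\<^esub>"
    using FD.resF_smult[OF U(2) oC(2) sub(1) fV v] FD.smultF_l_zero[OF oC(2) FD.resF_closed[OF U(2) oC(2) sub(1) v]] by simp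
  note z = FD.zext[OF U(2,1,3) C(2) oC(1) FD.smultF[OF U(2) fV v] this]
  show "FD.zext V U C (res A U V f \<odot>\<^bsub>sect F V\<^esub> v) \<in> carrier (sect F U)"
    "res F U V (FD.zext V U C (res A U V f \<odot>\<^bsub>sect F V\<^esub> v)) = res A U V f \<odot>\<^bsub>sect F V\<^esub> v"
    "res F U (U - C) (FD.zext V U C (res A U V f \<odot>\<^bsub>sect F V\<^esub> v)) = \<zero>\<^bsub>sect F (U - C)\<^esub>" using z by auto
qed

text \<open>A sheaf homomorphism does not enlarge supports: applied over \<open>U\<close> to an
  extension by zero, it gives the same density as over \<open>V\<close>.\<close>

lemma hom_zext:
  assumes D: "FD.lhom U D" and v: "v \<in> carrier (sect F V)"
  shows "D U (FD.zext V U C (res A U V f \<odot>\<^bsub>sect F V\<^esub> v)) = D V (res A U V f \<odot>\<^bsub>sect F V\<^esub> v)"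
proof -
  let ?w = "FD.zext V U C (res A U V f \<odot>\<^bsub>sect F V\<^esub> v)"
  have oC: "Op (U - C)" using U C openin_Diff_compactin by auto
  note w = cut_zext[OF v]
  show ?thesis
  proof (rule dens_ext_eq[OF FD_dens[OF D U(1) w(1)] _ U(3) C(2)])
    show "D V (res A U V f \<odot>\<^bsub>sect F V\<^esub> v) \<in> density_sections A V"
      by (rule FD_dens[OF FD.lhom_subset[OF D U(3)] U(2) FD.smultF[OF U(2) resA_closed[OF U f(1)] v]])
    show "res (densities A) U V (D U ?w) = D V (res A U V f \<odot>\<^bsub>sect F V\<^esub> v)"
      using FD.lhom_res[OF D U order_refl w(1)] w(2) by simp
    show "res (densities A) U (U - C) (D U ?w) = (\<lambda>c a. 0)"
      using FD.lhom_res[OF D U(1) oC Diff_subset order_refl w(1)] w(3) FD.lhom_zero[OF D oC Diff_subset] by (simp add: densities_simps)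
  qed
qed

lemma cut_rho:
  assumes D: "FD.lhom U D"
  shows "cut U V f C (rho A F U D) = rho A F V (FD.mk V (FD.precomp U f D))"
  unfolding cut_def rho_def[of A F V]
  by (rule restrict_ext) (simp add: rho_apply cut_zext hom_zext[OF D] FD.mk_apply FD.precomp_def U)

lemma cut_closed:
  assumes \<eta>: "\<eta> \<in> carrier (D_c A F U)"
  shows "cut U V f C \<eta> \<in> carrier (D_c A F V)"
proof -
  obtain D where D: "D \<in> FD.DC U" "\<eta> = rho A F U D" using \<eta> by (auto simp: D_c_simps)
  have "FD.lhom U D" using FD.DC_D[OF hausdorff U(1) D(1)] by metis
  from cut_rho[OF this] show ?thesis
    using FD.DC_cut[OF hausdorff U C D(1) f] by (simp add: D D_c_simps)
qed

text \<open>The content is that cutting \<eta> and extending the cut back to \<open>U\<close> yields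
  the functional u \<mapsto> \<eta>(f u).\<close>

lemma zext_res_eq:
  assumes u: "u \<in> carrier (sect F U)"
  shows "FD.zext V U C (res A U V f \<odot>\<^bsub>sect F V\<^esub> res F U V u) = f \<odot>\<^bsub>sect F U\<^esub> u"
proof -
  have oC: "Op (U - C)" using U C openin_Diff_compactin by auto
  show ?thesis
  proof (rule FD.zext_eqI[OF U(2,1,3) C(2) oC])
    show "f \<odot>\<^bsub>sect F U\<^esub> u \<in> carrier (sect F U)" using FD.smultF[OF U(1) f(1) u] .
    show "res F U V (f \<odot>\<^bsub>sect F U\<^esub> u) = res A U V f \<odot>\<^bsub>sect F V\<^esub> res F U V u" using FD.resF_smult[OF U f(1) u] .
    show "res F U (U - C) (f \<odot>\<^bsub>sect F U\<^esub> u) = \<zero>\<^bsub>sect F (U - C)\<^esub>"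
      using FD.resF_smult[OF U(1) oC Diff_subset f(1) u] f(2) FD.smultF_l_zero[OF oC FD.resF_closed[OF U(1) oC Diff_subset u]] by simp
  qed
qed

text \<open>The seminorm of D \<circ> f for a test operator X and a section v over \<open>V\<close>
  is the seminorm of D for X extended by zero to \<open>U\<close> and for f v extended by zero. Both
  extensions vanish off compact subsets of \<open>V\<close>.\<close>

lemma cut_continuous:
  assumes K: "compactin (base A) K"
  shows "continuous_map (Diff_KR_topology A F U K r) (Diff_KR_topology A F V C r) (\<lambda>D. FD.mk V (FD.precomp U f D))"
proof (rule Diff_KR_continuous[OF U(1,2) K C(1)])
  show "FD.mk V (FD.precomp U f D) \<in> FD.DKR V C r" if "D \<in> FD.DKR U K r" for D
    by (rule FD.DKR_cut[OF hausdorff U C K that f])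
  fix X v assume X: "X \<in> DR.DC V" and v: "v \<in> carrier (sect F V)"
  obtain L where L: "DR.lhom V X" "\<And>a. a \<in> V \<Longrightarrow> \<exists>W r. Op W \<and> a \<in> W \<and> W \<subseteq> V \<and> DR.ordle W r X"
    "compactin (base A) L" "L \<subseteq> V" "DR.agree (V - L) X DR.hzero" using DR.DC_D[OF hausdorff U(2) X] by metis
  let ?X = "DR.mk U (DR.extop V L X)" and ?w = "FD.zext V U C (res A U V f \<odot>\<^bsub>sect F V\<^esub> v)"
  have X': "?X \<in> DR.DC U" by (rule DR.DC_ext[OF hausdorff U L(3,4,1,5,2)])
  note pr = U L(4) openin_Diff_compactin[OF U(1) L(3)] L(1,5)
  have "diff_seminorm V X v (hom_minus (densities A) (FD.mk V (FD.precomp U f D)) (FD.mk V (FD.precomp U f D'))) =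
      diff_seminorm U ?X ?w (hom_minus (densities A) D D')" if D: "D \<in> FD.DKR U K r" "D' \<in> FD.DKR U K r" for D D'
  proof -
    note lD = FD.DKR_D(1)[OF hausdorff U(1) K D(1)] and lD' = FD.DKR_D(1)[OF hausdorff U(1) K D(2)]
    note w = cut_zext[OF v]
    have fv: "res A U V f \<odot>\<^bsub>sect F V\<^esub> v \<in> carrier (sect F V)" by (rule FD.smultF[OF U(2) resA_closed[OF U f(1)] v])
    let ?\<Omega> = "hom_minus (densities A) D D' U ?w"
    let ?\<omega> = "hom_minus (densities A) (FD.mk V (FD.precomp U f D)) (FD.mk V (FD.precomp U f D')) V v"
    have \<Omega>: "?\<Omega> \<in> carrier (sect (densities A) U)"
      using DR.minusF[OF U(1) FD.lhom_closed[OF lD U(1) order_refl w(1)] FD.lhom_closed[OF lD' U(1) order_refl w(1)]] by (simp add: hom_minus_def)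
    have res\<Omega>: "res (densities A) U V ?\<Omega> = ?\<omega>"
      using DR.resF_minus[OF U FD.lhom_closed[OF lD U(1) order_refl w(1)] FD.lhom_closed[OF lD' U(1) order_refl w(1)]]
        FD.lhom_res[OF lD U order_refl w(1)] FD.lhom_res[OF lD' U order_refl w(1)] w(2) U v
      by (simp add: hom_minus_def FD.mk_apply FD.precomp_def)
    note E = DR.extop_char[OF pr U(1) order_refl \<Omega>]
    have UV: "U \<inter> V = V" using U by auto
    have e: "?X U ?\<Omega> = DR.extop V L X U ?\<Omega>" using DR.mk_apply[OF U(1) order_refl \<Omega>] .
    show ?thesis
      unfolding diff_seminorm_def
    proof (rule seminorm_transfer[OF U(3), symmetric])
      fix a assume "a \<in> V"
      then show "?X U ?\<Omega> a = X V ?\<omega> a" using fun_cong[OF E(2), of a] by (simp add: e UV res\<Omega> reduction_simps)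
    next
      fix a assume "a \<in> U - V"
      then have "a \<in> U - L" using L(4) by auto
      then show "?X U ?\<Omega> a = 0" using fun_cong[OF E(3), of a] by (simp add: e reduction_simps)
    qed
  qed
  then show "\<exists>X'\<in>DR.DC U. \<exists>w\<in>carrier (sect F U). \<forall>D\<in>FD.DKR U K r. \<forall>D'\<in>FD.DKR U K r.
      diff_seminorm V X v (hom_minus (densities A) (FD.mk V (FD.precomp U f D)) (FD.mk V (FD.precomp U f D'))) =
      diff_seminorm U X' w (hom_minus (densities A) D D')"
    using X' cut_zext(1)[OF v] by blast
qed

end

text \<open>A test operator X over \<open>U\<close> need not have compact support in
  \<open>V\<close>. Replacing X by X \<circ> f, with f a cut-off for \<open>V\<close> equal to 1
  near \<open>K\<close>, gives it such a support and leaves its values on densities supported in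
  \<open>K\<close> unchanged. The section u is replaced by its restriction.\<close>

lemma ext_continuous:
  assumes U: "Op U" "Op V" "V \<subseteq> U" and K: "compactin (base A) K" "K \<subseteq> V"
  shows "continuous_map (Diff_KR_topology A F V K r) (Diff_KR_topology A F U K r) (\<lambda>D. FD.mk U (FD.extop V K D))"
proof (rule Diff_KR_continuous[OF U(2,1) K(1,1)])
  note dk = FD.DKR_D[OF hausdorff U(2) K(1)]
  show "FD.mk U (FD.extop V K D) \<in> FD.DKR U K r" if "D \<in> FD.DKR V K r" for D
    by (rule FD.DKR_ext[OF hausdorff U K dk(1)[OF that] dk(4)[OF that] dk(3)[OF that]])
  fix X u assume X: "X \<in> DR.DC U" and u: "u \<in> carrier (sect F U)"
  have lX: "DR.lhom U X" using DR.DC_D[OF hausdorff U(1) X] by metis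
  obtain N f C where f: "cutoff V N f C" "K \<subseteq> N" using cutoff_exists[OF U(2) K] .
  note f' = f(1)[unfolded cutoff_def]
  have UM: "U \<subseteq> M" "V \<subseteq> M" using U openin_subset by auto
  let ?f = "res A M U f"
  have fU: "?f \<in> carrier (sect A U)" using resA_closed[OF openin_topspace U(1) UM(1)] f' by blast
  have C: "compactin (base A) C" "C \<subseteq> V" using f' by auto
  have oC: "Op (U - C)" "Op (M - C)" using openin_Diff_compactin C U by auto
  have f0: "res A U (U - C) ?f = \<zero>\<^bsub>sect A (U - C)\<^esub>"
  proof -
    have sub: "U - C \<subseteq> M - C" using UM by auto
    have "res A U (U - C) ?f = res A (M - C) (U - C) (res A M (M - C) f)"
    proof -
      have fM: "f \<in> carrier (sect A M)" using f' by blast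
      show ?thesis
        using resA_trans[OF openin_topspace U(1) oC(1) UM(1) Diff_subset fM] resA_trans[OF openin_topspace oC(2,1) Diff_subset sub fM] by simp
    qed
    then show ?thesis using f' resA_zero[OF oC(2,1) sub] by simp
  qed
  let ?X = "DR.mk V (DR.precomp U ?f X)" and ?w = "res F U V u"
  have X': "?X \<in> DR.DC V" by (rule DR.DC_cut[OF hausdorff U C X fU f0])
  have w: "?w \<in> carrier (sect F V)" by (rule FD.resF_closed[OF U u])
  have "diff_seminorm U X u (hom_minus (densities A) (FD.mk U (FD.extop V K D)) (FD.mk U (FD.extop V K D'))) =
      diff_seminorm V ?X ?w (hom_minus (densities A) D D')" if D: "D \<in> FD.DKR V K r" "D' \<in> FD.DKR V K r" for D D'
  proof -
    let ?\<omega> = "hom_minus (densities A) D D' V ?w"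
    let ?\<Omega> = "hom_minus (densities A) (FD.mk U (FD.extop V K D)) (FD.mk U (FD.extop V K D')) U u"
    have cl: "D V ?w \<in> density_sections A V" "D' V ?w \<in> density_sections A V"
      using FD_dens[OF dk(1)[OF D(1)] U(2) w] FD_dens[OF dk(1)[OF D(2)] U(2) w] .
    have e: "FD.mk U (FD.extop V K E) U u = E V ?w" "E V ?w \<in> density_sections A U" if E: "E \<in> FD.DKR V K r" for E
    proof -
      have l: "FD.lhom U (FD.extop V K E)"
        by (rule FD.extop_lhom[OF U K(2) openin_Diff_compactin[OF U(1) K(1)] dk(1)[OF E] dk(4)[OF E]])
      show 1: "FD.mk U (FD.extop V K E) U u = E V ?w"
        using extop_dens[OF U K dk(1)[OF E] dk(4)[OF E] u] U u by (simp add: FD.mk_apply)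
      then show "E V ?w \<in> density_sections A U" using FD_dens[OF l U(1) u] U u by (simp add: FD.mk_apply)
    qed
    have \<omega>: "?\<omega> = (\<lambda>c a. D V ?w c a - D' V ?w c a)" using dens_minus[OF U(2) cl] by (simp add: hom_minus_def)
    have \<Omega>: "?\<Omega> = ?\<omega>" unfolding \<omega> using dens_minus[OF U(1) e(2)[OF D(1)] e(2)[OF D(2)]] by (simp add: hom_minus_def e(1) D)
    have \<Omega>c: "?\<Omega> \<in> carrier (sect (densities A) U)"
      using DR.minusF[OF U(1)] e[OF D(1)] e[OF D(2)] by (simp add: hom_minus_def densities_simps)
    have off: "?\<omega> c a = 0" if "a \<notin> K" for c a
      using FD_off[OF U(2) dk(1)[OF D(1)] openin_Diff_compactin[OF U(2) K(1)] dk(4)[OF D(1)] w that]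
        FD_off[OF U(2) dk(1)[OF D(2)] openin_Diff_compactin[OF U(2) K(1)] dk(4)[OF D(2)] w that] by (simp add: \<omega>)
    have \<omega>c: "?\<omega> \<in> carrier (sect (densities A) V)"
      using DR.minusF[OF U(2)] cl by (simp add: hom_minus_def densities_simps)
    have fV: "res A U V ?f = res A M V f" using resA_trans[OF openin_topspace U(1,2) UM(1) U(3)] f' by simp
    \<comment> \<open>The residue of the cut-off is 1 on \<open>K\<close>, and the density is 0 off
      \<open>K\<close>. Residues decide here because densities are acted on through them.\<close>
    have "res A U V ?f \<odot>\<^bsub>sect (densities A) V\<^esub> ?\<omega> = ?\<omega>"
    proof (intro HOL.ext)
      fix c a
      have "val A V (res A M V f) a = 1" if a: "a \<in> V" "a \<in> K"
      proof -
        have N: "Op N" "N \<subseteq> M" "a \<in> N" using f f' a openin_subset by auto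
        have "val A V (res A M V f) a = val A M f a" by (rule val_res[OF openin_topspace U(2) UM(2) a(1)]) (use f' in blast)
        also have "\<dots> = val A N (res A M N f) a" by (rule val_res[OF openin_topspace N, symmetric]) (use f' in blast)
        also have "\<dots> = 1" using f' val_one[OF N(1,3)] by simp
        finally show ?thesis .
      qed
      then show "(res A U V ?f \<odot>\<^bsub>sect (densities A) V\<^esub> ?\<omega>) c a = ?\<omega> c a"
        using off[of a c] K(2) by (cases "a \<in> K") (auto simp: densities_simps fV)
    qed
    then have Xw: "?X V ?\<omega> = X V ?\<omega>" using DR.mk_apply[OF U(2) order_refl \<omega>c] by (simp add: DR.precomp_def)
    have "res (densities A) U V ?\<Omega> = ?\<omega>"
      unfolding \<Omega> using dens_off[of ?\<omega> V] \<omega>c by (auto simp: densities_simps fun_eq_iff)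
    then have resX: "res (reduction A) U V (X U ?\<Omega>) = X V ?\<omega>" using DR.lhom_res[OF lX U order_refl \<Omega>c] by simp
    have oK: "Op (U - K)" using openin_Diff_compactin[OF U(1) K(1)] .
    have "res (densities A) U (U - K) ?\<Omega> = \<zero>\<^bsub>sect (densities A) (U - K)\<^esub>"
      unfolding \<Omega> using off by (auto simp: densities_simps fun_eq_iff)
    then have resX0: "res (reduction A) U (U - K) (X U ?\<Omega>) = (\<lambda>a. 0)"
      using DR.lhom_res[OF lX U(1) oK Diff_subset order_refl \<Omega>c] DR.lhom_zero[OF lX oK Diff_subset] by (simp add: reduction_simps)
    show ?thesis
      unfolding diff_seminorm_def
    proof (rule seminorm_transfer[OF U(3)])
      fix a assume "a \<in> V"
      then show "X U ?\<Omega> a = ?X V ?\<omega> a" using fun_cong[OF resX, of a] by (simp add: Xw reduction_simps)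
    next
      fix a assume "a \<in> U - V"
      then have "a \<in> U - K" using K(2) by auto
      then show "X U ?\<Omega> a = 0" using fun_cong[OF resX0, of a] by (simp add: reduction_simps)
    qed
  qed
  then show "\<exists>X'\<in>DR.DC V. \<exists>w\<in>carrier (sect F V). \<forall>D\<in>FD.DKR V K r. \<forall>D'\<in>FD.DKR V K r.
      diff_seminorm U X u (hom_minus (densities A) (FD.mk U (FD.extop V K D)) (FD.mk U (FD.extop V K D'))) =
      diff_seminorm V X' w (hom_minus (densities A) D D')"
    using X' w by blast
qed

section \<open>Continuity from and into the inductive limit\<close>

lemma openin_D_c:
  assumes "lcs ((D_c_space A F U)\<lparr>vtop := T\<rparr>)"
    and "\<And>K r. compactin (base A) K \<Longrightarrow> K \<subseteq> U \<Longrightarrow> continuous_map (D_KR_topology A F U K r) T (\<lambda>x. x)" and "openin T S"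
  shows "openin (vtop (D_c A F U)) S"
proof -
  have "openin (inductive_limit_topology (D_c_space A F U) {D_KR_topology A F U K r | K r. compactin (base A) K \<and> K \<subseteq> U}) S"
    unfolding inductive_limit_topology_def by (rule topology_generated_by_Basis) (use assms in blast)
  then show ?thesis by (simp add: D_c_def)
qed

lemma DKR_rho:
  assumes U: "Op U" and K: "compactin (base A) K" "K \<subseteq> U" and D: "D \<in> topspace (Diff_KR_topology A F U K r)"
  shows "rho A F U D \<in> carrier (D_c A F U)"
  using D FD.DKR_DC[OF hausdorff U K] by (auto simp: topspace_Diff_KR[OF U K(1)] D_c_simps)

text \<open>The universal property of the limit. The topology pulled back along \<open>g\<close> is
  locally convex and makes the inclusions of the steps continuous, so it is one of the topologies
  whose supremum is the limit topology.\<close>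

lemma limit_openin:
  assumes U: "Op U" and E: "lcspace E"
    and g: "\<And>x. x \<in> carrier (D_c A F U) \<Longrightarrow> g x \<in> carrier E"
      "\<And>x y. x \<in> carrier (D_c A F U) \<Longrightarrow> y \<in> carrier (D_c A F U) \<Longrightarrow> g (x \<oplus>\<^bsub>D_c A F U\<^esub> y) = g x \<oplus>\<^bsub>E\<^esub> g y"
      "\<And>c x. x \<in> carrier (D_c A F U) \<Longrightarrow> g (c \<odot>\<^bsub>D_c A F U\<^esub> x) = c \<odot>\<^bsub>E\<^esub> g x"
    and cont: "\<And>K r. compactin (base A) K \<Longrightarrow> K \<subseteq> U \<Longrightarrow>
       continuous_map (Diff_KR_topology A F U K r) (vtop E) (\<lambda>D. g (rho A F U D))"
    and S: "openin (vtop E) S"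
  shows "openin (vtop (D_c A F U)) {x \<in> carrier (D_c A F U). g x \<in> S}"
proof -
  interpret E: lcspace E by (rule E)
  let ?T = "pullback_topology (carrier (D_c_space A F U)) g (vtop E)"
  have cc: "carrier (D_c A F U) = carrier (D_c_space A F U)" by (simp add: D_c_simps)
  show ?thesis
  proof (rule openin_D_c[where T = ?T])
    show "lcs ((D_c_space A F U)\<lparr>vtop := ?T\<rparr>)"
      by (rule E.pullback_lcs[OF D_c_module[OF U]]) (use g in \<open>auto simp: D_c_simps\<close>)
    show "continuous_map (D_KR_topology A F U K r) ?T (\<lambda>x. x)" if K: "compactin (base A) K" "K \<subseteq> U" for K r
      unfolding D_KR_topology_def
    proof (rule continuous_map_from_quotient, rule continuous_map_pullback')
      show "continuous_map (Diff_KR_topology A F U K r) (vtop E) (g \<circ> (\<lambda>D. rho A F U D))" using cont[OF K] by (simp add: o_def)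
      show "topspace (Diff_KR_topology A F U K r) \<subseteq> (\<lambda>D. rho A F U D) -` carrier (D_c_space A F U)"
        using DKR_rho[OF U K] cc by auto
    qed
    show "openin ?T {x \<in> carrier (D_c A F U). g x \<in> S}" using S unfolding openin_pullback_topology cc by blast
  qed
qed

text \<open>Each competing topology lives on the carrier, but at least one has to exist. The zero
  map into \<open>E\<close> provides it: the pullback along it is the indiscrete topology.\<close>

lemma D_c_top:
  assumes U: "Op U" and E: "lcspace (E :: 'e tvs)"
  shows "topspace (vtop (D_c A F U)) = carrier (D_c A F U)"
proof
  interpret E: lcspace E by (rule E)
  have "openin (vtop (D_c A F U)) {x \<in> carrier (D_c A F U). \<zero>\<^bsub>E\<^esub> \<in> carrier E}"
    by (rule limit_openin[OF U E, of "\<lambda>_. \<zero>\<^bsub>E\<^esub>"]) (use E.top_E openin_topspace[of "vtop E"] in \<open>simp_all add: E.smult_simps\<close>)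
  then show "carrier (D_c A F U) \<subseteq> topspace (vtop (D_c A F U))" using openin_subset by fastforce
  let ?G = "{S. \<exists>T. lcs ((D_c_space A F U)\<lparr>vtop := T\<rparr>) \<and>
      (\<forall>Y\<in>{D_KR_topology A F U K r | K r. compactin (base A) K \<and> K \<subseteq> U}. continuous_map Y T (\<lambda>x. x)) \<and> openin T S}"
  have v: "vtop (D_c A F U) = topology_generated_by ?G" by (simp add: D_c_def inductive_limit_topology_def)
  show "topspace (vtop (D_c A F U)) \<subseteq> carrier (D_c A F U)"
  proof
    fix x assume "x \<in> topspace (vtop (D_c A F U))"
    then have "x \<in> \<Union>?G" unfolding v topology_generated_by_topspace .
    then obtain S where S: "S \<in> ?G" "x \<in> S" by (rule UnionE)
    from CollectD[OF S(1)] obtain T where x: "openin T S" "lcs ((D_c_space A F U)\<lparr>vtop := T\<rparr>)" by (elim exE conjE)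
    have "topspace T = carrier (D_c_space A F U)" using x(2) by (simp add: lcs_def)
    then show "x \<in> carrier (D_c A F U)" using openin_subset[OF x(1)] S(2) by (auto simp: D_c_simps)
  qed
qed

lemma D_c_tvector_space:
  assumes U: "Op U" and E: "lcspace (E :: 'e tvs)"
  shows "tvector_space (D_c A F U)"
proof -
  have "Module.module complex_ring (D_c A F U)" unfolding D_c_def by (rule module_vtop[OF D_c_module[OF U]])
  then show ?thesis using D_c_top[OF assms] by (simp add: tvector_space_def tvector_space_axioms_def)
qed

lemma limit_continuous:
  assumes U: "Op U" and E: "lcspace E"
    and g: "\<And>x. x \<in> carrier (D_c A F U) \<Longrightarrow> g x \<in> carrier E"
      "\<And>x y. x \<in> carrier (D_c A F U) \<Longrightarrow> y \<in> carrier (D_c A F U) \<Longrightarrow> g (x \<oplus>\<^bsub>D_c A F U\<^esub> y) = g x \<oplus>\<^bsub>E\<^esub> g y"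
      "\<And>c x. x \<in> carrier (D_c A F U) \<Longrightarrow> g (c \<odot>\<^bsub>D_c A F U\<^esub> x) = c \<odot>\<^bsub>E\<^esub> g x"
    and cont: "\<And>K r. compactin (base A) K \<Longrightarrow> K \<subseteq> U \<Longrightarrow>
       continuous_map (Diff_KR_topology A F U K r) (vtop E) (\<lambda>D. g (rho A F U D))"
  shows "continuous_map (vtop (D_c A F U)) (vtop E) g"
  unfolding continuous_map D_c_top[OF U E]
  using limit_openin[OF assms] g(1) lcspace.top_E[OF E] by blast

lemma rho_continuous_step:
  assumes U: "Op U" and K: "compactin (base A) K" "K \<subseteq> U"
    and T: "\<And>K r. compactin (base A) K \<Longrightarrow> K \<subseteq> U \<Longrightarrow> continuous_map (D_KR_topology A F U K r) T (\<lambda>x. x)"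
  shows "continuous_map (Diff_KR_topology A F U K r) T (rho A F U)"
  using continuous_map_compose[OF continuous_map_to_quotient[of "Diff_KR_topology A F U K r" "rho A F U"] T[OF K, of r, unfolded D_KR_topology_def]]
  by (simp add: o_def)

lemma rho_continuous:
  assumes U: "Op U" and E: "lcspace (E :: 'e tvs)" and K: "compactin (base A) K" "K \<subseteq> U"
  shows "continuous_map (Diff_KR_topology A F U K r) (vtop (D_c A F U)) (rho A F U)"
proof -
  let ?G = "{S. \<exists>T. lcs ((D_c_space A F U)\<lparr>vtop := T\<rparr>) \<and>
      (\<forall>Y\<in>{D_KR_topology A F U K r | K r. compactin (base A) K \<and> K \<subseteq> U}. continuous_map Y T (\<lambda>x. x)) \<and> openin T S}"
  have v: "vtop (D_c A F U) = topology_generated_by ?G" by (simp add: D_c_def inductive_limit_topology_def)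
  show ?thesis unfolding v
  proof (rule continuous_on_generated_topo)
    fix S assume "S \<in> ?G"
    then obtain T where T: "\<forall>Y\<in>{D_KR_topology A F U K r | K r. compactin (base A) K \<and> K \<subseteq> U}. continuous_map Y T (\<lambda>x. x)" "openin T S" by blast
    have "continuous_map (Diff_KR_topology A F U K r) T (rho A F U)"
      by (rule rho_continuous_step[OF U K]) (use T(1) in blast)
    from openin_continuous_map_preimage[OF this T(2)]
    show "openin (Diff_KR_topology A F U K r) (rho A F U -` S \<inter> topspace (Diff_KR_topology A F U K r))"
      by (simp add: vimage_def Int_def conj_commute)
  next
    have e: "\<Union>?G = carrier (D_c A F U)" using D_c_top[OF U E] unfolding v topology_generated_by_topspace .
    show "rho A F U ` topspace (Diff_KR_topology A F U K r) \<subseteq> \<Union>?G"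
      unfolding e by (rule image_subsetI) (rule DKR_rho[OF U K])
  qed
qed

lemma extension_add:
  assumes U: "Op U" "Op V" "V \<subseteq> U"
  shows "extension F U V (\<eta> \<oplus>\<^bsub>D_c A F V\<^esub> \<theta>) = extension F U V \<eta> \<oplus>\<^bsub>D_c A F U\<^esub> extension F U V \<theta>"
    and "extension F U V (c \<odot>\<^bsub>D_c A F V\<^esub> \<eta>) = c \<odot>\<^bsub>D_c A F U\<^esub> extension F U V \<eta>"
    and "extension F U V \<zero>\<^bsub>D_c A F V\<^esub> = \<zero>\<^bsub>D_c A F U\<^esub>"
  using FD.resF_closed[OF U] by (auto simp: extension_def D_c_simps intro!: restrict_ext)

text \<open>The target carries a supremum of topologies, so it suffices to treat each competing
  topology \<open>T\<close> as a separate LCS. For it the universal property of the source applies,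
  and on a step the extension is induced by \<open>extop\<close>.\<close>

lemma extension_continuous:
  assumes U: "Op U" "Op V" "V \<subseteq> U" and E: "lcspace (E :: 'e tvs)"
  shows "continuous_map (vtop (D_c A F V)) (vtop (D_c A F U)) (extension F U V)"
proof -
  let ?G = "{S. \<exists>T. lcs ((D_c_space A F U)\<lparr>vtop := T\<rparr>) \<and>
      (\<forall>Y\<in>{D_KR_topology A F U K r | K r. compactin (base A) K \<and> K \<subseteq> U}. continuous_map Y T (\<lambda>x. x)) \<and> openin T S}"
  have v: "vtop (D_c A F U) = topology_generated_by ?G" by (simp add: D_c_def inductive_limit_topology_def)
  show ?thesis unfolding v
  proof (rule continuous_on_generated_topo)
    fix S assume "S \<in> ?G"
    then obtain T where T: "lcs ((D_c_space A F U)\<lparr>vtop := T\<rparr>)"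
      "\<forall>Y\<in>{D_KR_topology A F U K r | K r. compactin (base A) K \<and> K \<subseteq> U}. continuous_map Y T (\<lambda>x. x)" "openin T S" by blast
    let ?E = "(D_c_space A F U)\<lparr>vtop := T\<rparr>"
    have "openin (vtop (D_c A F V)) {x \<in> carrier (D_c A F V). extension F U V x \<in> S}"
    proof (rule limit_openin[OF U(2), where E = ?E])
      show "lcspace ?E" using T(1) by unfold_locales
      show "extension F U V x \<in> carrier ?E" if "x \<in> carrier (D_c A F V)" for x
        using extension_closed[OF U that] by (simp add: D_c_simps)
      show "extension F U V (x \<oplus>\<^bsub>D_c A F V\<^esub> y) = extension F U V x \<oplus>\<^bsub>?E\<^esub> extension F U V y" for x y
        using extension_add(1)[OF U, of x y] by (simp add: D_c_simps)
      show "extension F U V (c \<odot>\<^bsub>D_c A F V\<^esub> x) = c \<odot>\<^bsub>?E\<^esub> extension F U V x" for c x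
        using extension_add(2)[OF U, of c x] by (simp add: D_c_simps)
      show "openin (vtop ?E) S" using T(3) by simp
      fix K r assume K: "compactin (base A) K" "K \<subseteq> V"
      have KU: "K \<subseteq> U" using K U by auto
      have "continuous_map (Diff_KR_topology A F U K r) T (rho A F U)"
        by (rule rho_continuous_step[OF U(1) K(1) KU]) (use T(2) in blast)
      from continuous_map_compose[OF ext_continuous[OF U K] this]
      have "continuous_map (Diff_KR_topology A F V K r) T (\<lambda>D. rho A F U (FD.mk U (FD.extop V K D)))" by (simp add: o_def)
      moreover have "rho A F U (FD.mk U (FD.extop V K D)) = extension F U V (rho A F V D)"
        if "D \<in> topspace (Diff_KR_topology A F V K r)" for D
        using that extension_rho[OF U K] FD.DKR_D[OF hausdorff U(2) K(1)] by (simp add: topspace_Diff_KR[OF U(2) K(1)])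
      ultimately show "continuous_map (Diff_KR_topology A F V K r) (vtop ?E) (\<lambda>D. extension F U V (rho A F V D))"
        by (simp add: continuous_map_eq)
    qed
    then show "openin (vtop (D_c A F V)) (extension F U V -` S \<inter> topspace (vtop (D_c A F V)))"
      unfolding D_c_top[OF U(2) E] by (simp add: vimage_def Int_def conj_commute)
  next
    have e: "\<Union>?G = carrier (D_c A F U)" using D_c_top[OF U(1) E] unfolding v topology_generated_by_topspace .
    show "extension F U V ` topspace (vtop (D_c A F V)) \<subseteq> \<Union>?G"
      unfolding e D_c_top[OF U(2) E] by (rule image_subsetI) (rule extension_closed[OF U])
  qed
qed

end

section \<open>The sheaf of formal generalized functions\<close>

context mfd_module
begin

text \<open>Products of the factors 1 - f j replace a quotient by a sum of bumps. The conclusion is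
  an identity of functionals, stated for every open \<open>W\<close> between \<open>K\<close> and
  \<open>X\<close>: it is used over the whole space and over a single member of the cover.\<close>

lemma partition:
  assumes X: "Op X" and K: "compactin (base A) K" "K \<subseteq> \<Union>\<U>" and \<U>: "\<And>U. U \<in> \<U> \<Longrightarrow> Op U \<and> U \<subseteq> X"
  obtains n V g C where "\<And>j. j < (n :: nat) \<Longrightarrow> V j \<in> \<U> \<and> compactin (base A) (C j) \<and> C j \<subseteq> V j \<and>
      g j \<in> carrier (sect A X) \<and> res A X (X - C j) (g j) = \<zero>\<^bsub>sect A (X - C j)\<^esub>"
    and "\<And>W D v. Op W \<Longrightarrow> W \<subseteq> X \<Longrightarrow> D \<in> FD.DC W \<Longrightarrow> FD.agree (W - K) D FD.hzero \<Longrightarrow> v \<in> carrier (sect F W) \<Longrightarrow> K \<subseteq> W \<Longrightarrow>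
      (\<Sum>j<n. rho A F W D (res A X W (g j) \<odot>\<^bsub>sect F W\<^esub> v)) = rho A F W D v"
proof -
  let ?\<N> = "{N. \<exists>V\<in>\<U>. \<exists>f C. cutoff V N f C \<and> N \<subseteq> C}"
  have "K \<subseteq> \<Union>?\<N>"
  proof
    fix a assume "a \<in> K"
    then obtain V where V: "V \<in> \<U>" "a \<in> V" using K(2) by blast
    have "Op V" using \<U>[OF V(1)] by simp
    from cutoff_point[OF this V(2)] obtain N f C where "cutoff V N f C" "a \<in> N" "N \<subseteq> C" .
    then show "a \<in> \<Union>?\<N>" using V(1) by blast
  qed
  moreover have "\<forall>N\<in>?\<N>. Op N" by (auto simp: cutoff_def)
  ultimately obtain \<F> where \<F>: "finite \<F>" "\<F> \<subseteq> ?\<N>" "K \<subseteq> \<Union>\<F>"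
    using K(1) unfolding compactin_def by meson
  obtain xs where xs: "set xs = \<F>" using finite_list[OF \<F>(1)] by blast
  let ?n = "length xs" and ?N = "\<lambda>j. xs ! j"
  have "\<exists>V f C. V \<in> \<U> \<and> cutoff V (?N j) f C \<and> ?N j \<subseteq> C" if "j < ?n" for j
  proof -
    have "?N j \<in> ?\<N>" using \<F>(2) xs nth_mem[OF that] by auto
    then show ?thesis by blast
  qed
  then obtain V f C where VfC: "\<And>j. j < ?n \<Longrightarrow> V j \<in> \<U> \<and> cutoff (V j) (?N j) (f j) (C j) \<and> ?N j \<subseteq> C j" by metis
  have KN: "K \<subseteq> (\<Union>j<?n. ?N j)" using \<F>(3) xs by (force simp: in_set_conv_nth)
  have XM: "X \<subseteq> M" using openin_subset[OF X] .
  let ?f = "\<lambda>j. res A M X (f j)"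
  interpret r: cring "sect A X" by (rule cringA[OF X])
  have N: "Op (?N j)" "?N j \<subseteq> X" "V j \<in> \<U>" "compactin (base A) (C j)" "C j \<subseteq> V j" "C j \<subseteq> X" if "j < ?n" for j
    using VfC[OF that] \<U>[of "V j"] unfolding cutoff_def by auto
  have f: "?f j \<in> carrier (sect A X)" "res A X (?N j) (?f j) = \<one>\<^bsub>sect A (?N j)\<^esub>"
    "res A X (X - C j) (?f j) = \<zero>\<^bsub>sect A (X - C j)\<^esub>" if j: "j < ?n" for j
  proof -
    have fj: "f j \<in> carrier (sect A M)" "res A M (?N j) (f j) = \<one>\<^bsub>sect A (?N j)\<^esub>" "res A M (M - C j) (f j) = \<zero>\<^bsub>sect A (M - C j)\<^esub>"
      using VfC[OF j] by (auto simp: cutoff_def)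
    have o: "Op (X - C j)" "Op (M - C j)" using openin_Diff_compactin N(4)[OF j] X by auto
    have sub: "X - C j \<subseteq> M - C j" using XM by auto
    show "?f j \<in> carrier (sect A X)" by (rule resA_closed[OF openin_topspace X XM fj(1)])
    show "res A X (?N j) (?f j) = \<one>\<^bsub>sect A (?N j)\<^esub>"
      using resA_trans[OF openin_topspace X N(1)[OF j] XM N(2)[OF j] fj(1)] fj(2) by simp
    have "res A X (X - C j) (?f j) = res A (M - C j) (X - C j) (res A M (M - C j) (f j))"
      using resA_trans[OF openin_topspace X o(1) XM Diff_subset fj(1)] resA_trans[OF openin_topspace o(2,1) Diff_subset sub fj(1)] by simp
    then show "res A X (X - C j) (?f j) = \<zero>\<^bsub>sect A (X - C j)\<^esub>" using fj(3) resA_zero[OF o(2,1) sub] by simp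
  qed
  \<comment> \<open>The partition is the difference sequence of \<open>h\<close>; the sum over it telescopes.\<close>
  define h where "h = rec_nat \<one>\<^bsub>sect A X\<^esub> (\<lambda>j x. x \<otimes>\<^bsub>sect A X\<^esub> (\<one>\<^bsub>sect A X\<^esub> \<ominus>\<^bsub>sect A X\<^esub> ?f j))"
  define g where "g = (\<lambda>j. h j \<otimes>\<^bsub>sect A X\<^esub> ?f j)"
  have h0: "h 0 = \<one>\<^bsub>sect A X\<^esub>" and hS: "h (Suc j) = h j \<otimes>\<^bsub>sect A X\<^esub> (\<one>\<^bsub>sect A X\<^esub> \<ominus>\<^bsub>sect A X\<^esub> ?f j)" for j
    by (simp_all add: h_def)
  have hc: "j \<le> ?n \<Longrightarrow> h j \<in> carrier (sect A X)" for j
  proof (induction j)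
    case (Suc j)
    then show ?case using f(1)[of j] by (simp add: hS)
  qed (simp add: h0)
  have gc: "g j \<in> carrier (sect A X)" if "j < ?n" for j using hc[of j] f(1)[OF that] that by (simp add: g_def)
  have gh: "g j = h j \<ominus>\<^bsub>sect A X\<^esub> h (Suc j)" if j: "j < ?n" for j
  proof -
    have c: "h j \<in> carrier (sect A X)" "?f j \<in> carrier (sect A X)" using hc[of j] f(1)[OF j] j by auto
    then show ?thesis by (simp add: g_def hS a_minus_def r.r_distr r.minus_add r.r_minus r.a_assoc[symmetric] r.r_neg)
  qed
  have g0: "res A X (X - C j) (g j) = \<zero>\<^bsub>sect A (X - C j)\<^esub>" if j: "j < ?n" for j
  proof -
    have o: "Op (X - C j)" using openin_Diff_compactin[OF X N(4)[OF j]] .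
    interpret t: cring "sect A (X - C j)" by (rule cringA[OF o])
    have c: "h j \<in> carrier (sect A X)" using hc[of j] j by simp
    show ?thesis unfolding g_def resA_mult[OF X o Diff_subset c f(1)[OF j]] f(3)[OF j]
      by (rule t.r_null) (rule resA_closed[OF X o Diff_subset c])
  qed
  \<comment> \<open>Beyond index \<open>j\<close> the product contains the factor 1 - f j, which is
    0 on the \<open>j\<close>-th set.\<close>
  have hN: "res A X (?N j) (h m) = \<zero>\<^bsub>sect A (?N j)\<^esub>" if j: "j < ?n" and m: "j < m" "m \<le> ?n" for j m
    using m
  proof (induction m)
    case (Suc m)
    note Nj = N(1,2)[OF j]
    interpret t: cring "sect A (?N j)" by (rule cringA[OF Nj(1)])
    have m: "m < ?n" "m \<le> ?n" using Suc.prems by auto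
    have cc: "\<one>\<^bsub>sect A X\<^esub> \<ominus>\<^bsub>sect A X\<^esub> ?f m \<in> carrier (sect A X)" using f(1)[OF m(1)] by simp
    have e: "res A X (?N j) (h (Suc m)) = res A X (?N j) (h m) \<otimes>\<^bsub>sect A (?N j)\<^esub> (\<one>\<^bsub>sect A (?N j)\<^esub> \<ominus>\<^bsub>sect A (?N j)\<^esub> res A X (?N j) (?f m))"
      unfolding hS resA_mult[OF X Nj hc[OF m(2)] cc] resA_minus[OF X Nj r.one_closed f(1)[OF m(1)]] resA_one[OF X Nj] ..
    have c: "res A X (?N j) (h m) \<in> carrier (sect A (?N j))" "res A X (?N j) (?f m) \<in> carrier (sect A (?N j))"
      using resA_closed[OF X Nj hc[OF m(2)]] resA_closed[OF X Nj f(1)[OF m(1)]] .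
    show ?case
    proof (cases "j = m")
      case True
      have "\<one>\<^bsub>sect A (?N j)\<^esub> \<ominus>\<^bsub>sect A (?N j)\<^esub> res A X (?N j) (?f m) = \<zero>\<^bsub>sect A (?N j)\<^esub>"
        unfolding True[symmetric] f(2)[OF j] by (simp add: a_minus_def t.r_neg)
      then show ?thesis using e c by simp
    next
      case False
      then have "res A X (?N j) (h m) = \<zero>\<^bsub>sect A (?N j)\<^esub>" using Suc m by simp
      then show ?thesis using e c by simp
    qed
  qed simp
  show thesis
  proof (rule that[of ?n V C g])
    show "V j \<in> \<U> \<and> compactin (base A) (C j) \<and> C j \<subseteq> V j \<and> g j \<in> carrier (sect A X) \<and>
        res A X (X - C j) (g j) = \<zero>\<^bsub>sect A (X - C j)\<^esub>" if "j < ?n" for j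
      using N[OF that] gc[OF that] g0[OF that] by simp
    fix W D v assume W: "Op W" "W \<subseteq> X" and D: "D \<in> FD.DC W" "FD.agree (W - K) D FD.hzero" and v: "v \<in> carrier (sect F W)" and KW: "K \<subseteq> W"
    let ?h = "\<lambda>j. res A X W (h j) \<odot>\<^bsub>sect F W\<^esub> v"
    interpret m: module "sect A W" "sect F W" by (rule FD.modF[OF W(1)])
    have hW: "res A X W (h j) \<in> carrier (sect A W)" if "j \<le> ?n" for j using resA_closed[OF X W hc[OF that]] .
    have step: "rho A F W D (res A X W (g j) \<odot>\<^bsub>sect F W\<^esub> v) = rho A F W D (?h j) - rho A F W D (?h (Suc j))" if j: "j < ?n" for j
    proof -
      have j': "j \<le> ?n" "Suc j \<le> ?n" using j by auto
      have "res A X W (g j) = res A X W (h j) \<ominus>\<^bsub>sect A W\<^esub> res A X W (h (Suc j))"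
        unfolding gh[OF j] by (rule resA_minus[OF X W hc[OF j'(1)] hc[OF j'(2)]])
      then have "res A X W (g j) \<odot>\<^bsub>sect F W\<^esub> v = ?h j \<ominus>\<^bsub>sect F W\<^esub> ?h (Suc j)"
        using hW[OF j'(1)] hW[OF j'(2)] v by (simp add: a_minus_def m.smult_l_distr m.smult_l_minus)
      then show ?thesis using rho_minus[OF W(1) D(1), of "?h j" "?h (Suc j)"] hW[OF j'(1)] hW[OF j'(2)] v by simp
    qed
    have lD: "FD.lhom W D" using FD.DC_D[OF hausdorff W(1) D(1)] by metis
    have hn: "?h ?n \<in> carrier (sect F W)" using hW[of ?n] v by simp
    \<comment> \<open>The full product is 0 on each set of the finite cover of \<open>K\<close>, and
      \<open>D\<close> vanishes off \<open>K\<close>. These sets cover \<open>W\<close>, so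
      separation gives 0.\<close>
    have "D W (?h ?n) = \<zero>\<^bsub>sect (densities A) W\<^esub>"
    proof (rule DR.sepF[of "insert (W - K) ((\<lambda>j. ?N j \<inter> W) ` {..<?n})"])
      show "Op T" if "T \<in> insert (W - K) ((\<lambda>j. ?N j \<inter> W) ` {..<?n})" for T
        using that openin_Diff_compactin[OF W(1) K(1)] N(1) W(1) by auto
      show "W = \<Union>(insert (W - K) ((\<lambda>j. ?N j \<inter> W) ` {..<?n}))" using KN by auto
      show "D W (?h ?n) \<in> carrier (sect (densities A) W)" by (rule FD.lhom_closed[OF lD W(1) order_refl hn])
      show "\<zero>\<^bsub>sect (densities A) W\<^esub> \<in> carrier (sect (densities A) W)" by (rule DR.zeroF[OF W(1)])
      fix T assume T: "T \<in> insert (W - K) ((\<lambda>j. ?N j \<inter> W) ` {..<?n})"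
      have oT: "Op T" "T \<subseteq> W" using T openin_Diff_compactin[OF W(1) K(1)] N(1) W(1) by auto
      have "D T (res F W T (?h ?n)) = \<zero>\<^bsub>sect (densities A) T\<^esub>"
      proof (cases "T = W - K")
        case True
        have "T \<subseteq> W - K" using True by simp
        from FD.agreeD[OF D(2) oT(1) this FD.resF_closed[OF W(1) oT hn]] show ?thesis by (simp add: FD.hzero_def)
      next
        case False
        then obtain j where j: "j < ?n" "T = ?N j \<inter> W" using T by auto
        have TN: "T \<subseteq> ?N j" "T \<subseteq> X" using j W by auto
        have "res A W T (res A X W (h ?n)) = res A (?N j) T (res A X (?N j) (h ?n))"
          using resA_trans[OF X W(1) oT(1) W(2) oT(2) hc[OF order_refl]] resA_trans[OF X N(1)[OF j(1)] oT(1) N(2)[OF j(1)] TN(1) hc[OF order_refl]] by simp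
        also have "\<dots> = \<zero>\<^bsub>sect A T\<^esub>" using hN[OF j(1) j(1) order_refl] resA_zero[OF N(1)[OF j(1)] oT(1) TN(1)] by simp
        finally have "res F W T (?h ?n) = \<zero>\<^bsub>sect F T\<^esub>"
          using FD.resF_smult[OF W(1) oT hW[OF order_refl] v] FD.smultF_l_zero[OF oT(1) FD.resF_closed[OF W(1) oT v]] by simp
        then show ?thesis using FD.lhom_zero[OF lD oT] by simp
      qed
      then show "res (densities A) W T (D W (?h ?n)) = res (densities A) W T \<zero>\<^bsub>sect (densities A) W\<^esub>"
        using FD.lhom_res[OF lD W(1) oT(1,2) order_refl hn] DR.resF_zero[OF W(1) oT] by simp
    qed
    then have end0: "rho A F W D (?h ?n) = 0"
    proof -
      assume e: "D W (?h ?n) = \<zero>\<^bsub>sect (densities A) W\<^esub>"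
      have z: "v \<ominus>\<^bsub>sect F W\<^esub> v = \<zero>\<^bsub>sect F W\<^esub>" using FD.minusF_self[OF W(1) v] .
      have "rho A F W D (?h ?n) = rho A F W D \<zero>\<^bsub>sect F W\<^esub>"
        using e FD.lhom_zero[OF lD W(1) order_refl] by (simp add: rho_apply hn FD.zeroF[OF W(1)])
      also have "\<dots> = 0" using rho_minus[OF W(1) D(1) v v] z by simp
      finally show ?thesis .
    qed
    have "(\<Sum>j<?n. rho A F W D (res A X W (g j) \<odot>\<^bsub>sect F W\<^esub> v)) = (\<Sum>j<?n. rho A F W D (?h j) - rho A F W D (?h (Suc j)))"
      using step by simp
    also have "\<dots> = rho A F W D (?h 0) - rho A F W D (?h ?n)" by (rule sum_lessThan_telescope')
    also have "\<dots> = rho A F W D v" using end0 resA_one[OF X W] FD.smultF_one[OF W(1) v] by (simp add: h0)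
    finally show "(\<Sum>j<?n. rho A F W D (res A X W (g j) \<odot>\<^bsub>sect F W\<^esub> v)) = rho A F W D v" .
  qed
qed

end

section \<open>Finite sums in the target space\<close>

lemma (in abelian_monoid) finsum_swap:
  assumes "finite I" "finite J" "\<And>i j. i \<in> I \<Longrightarrow> j \<in> J \<Longrightarrow> x i j \<in> carrier G"
  shows "(\<Oplus>i\<in>I. \<Oplus>j\<in>J. x i j) = (\<Oplus>j\<in>J. \<Oplus>i\<in>I. x i j)"
  using assms(1,3)
proof (induction I)
  case empty
  then show ?case by (simp add: finsum_zero)
next
  case (insert i I)
  have "(\<Oplus>i\<in>insert i I. \<Oplus>j\<in>J. x i j) = (\<Oplus>j\<in>J. x i j) \<oplus> (\<Oplus>i\<in>I. \<Oplus>j\<in>J. x i j)"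
    using insert.hyps insert.prems by (intro finsum_insert) (auto intro!: finsum_closed)
  also have "(\<Oplus>i\<in>I. \<Oplus>j\<in>J. x i j) = (\<Oplus>j\<in>J. \<Oplus>i\<in>I. x i j)" by (rule insert.IH) (use insert.prems in auto)
  also have "(\<Oplus>j\<in>J. x i j) \<oplus> (\<Oplus>j\<in>J. \<Oplus>i\<in>I. x i j) = (\<Oplus>j\<in>J. x i j \<oplus> (\<Oplus>i\<in>I. x i j))"
    using insert.prems by (intro finsum_addf[symmetric]) (auto intro!: finsum_closed)
  also have "\<dots> = (\<Oplus>j\<in>J. \<Oplus>i\<in>insert i I. x i j)"
    using insert.hyps insert.prems by (intro finsum_cong') (auto intro!: finsum_insert[symmetric] finsum_closed)
  finally show ?case .
qed

lemma (in lcspace) continuous_finsum: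
  assumes "finite I" "\<And>i. i \<in> I \<Longrightarrow> continuous_map X (vtop E) (f i)"
  shows "continuous_map X (vtop E) (\<lambda>x. \<Oplus>\<^bsub>E\<^esub>i\<in>I. f i x)"
  using assms
proof (induction I)
  case empty
  then show ?case by (simp add: top_E)
next
  case (insert i I)
  have c: "f k x \<in> carrier E" if "k \<in> insert i I" "x \<in> topspace X" for k x
    using insert.prems[OF that(1)] that(2) top_E by (auto simp: continuous_map_def)
  have "continuous_map X (vtop E) (\<lambda>x. f i x \<oplus>\<^bsub>E\<^esub> (\<Oplus>\<^bsub>E\<^esub>i\<in>I. f i x))"
    using insert by (intro continuous_add) auto
  then show ?case
    by (rule continuous_map_eq) (use insert.hyps c in \<open>auto intro!: M.finsum_insert[symmetric]\<close>)
qed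

section \<open>The presheaf of locally convex spaces\<close>

locale gen_functions = mfd_module A F + lcspace E
  for A :: "('m, 's) ringed_space" and F :: "('m, 's, 'f) module_presheaf" and E :: "'e tvs"
begin

abbreviation "D \<equiv> D_c A F"

lemma lin_maps: "Op U \<Longrightarrow> lin_maps (D U) E"
  using D_c_tvector_space[OF _ lcspace_axioms] lcspace_axioms by (intro lin_maps.intro)

definition restrict_gen :: "'m set \<Rightarrow> 'm set \<Rightarrow> (('f \<Rightarrow> complex) \<Rightarrow> 'e) \<Rightarrow> ('f \<Rightarrow> complex) \<Rightarrow> 'e" where
  "restrict_gen U V u = (\<lambda>\<eta>\<in>carrier (D V). u (extension F U V \<eta>))"

lemma gen_simps:
  "base (generalized_functions A F E) = base A" "sect (generalized_functions A F E) U = Lb (D U) E"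
  "res (generalized_functions A F E) = restrict_gen"
  by (auto simp: generalized_functions_def restrict_gen_def fun_eq_iff)

lemma carrier_Lb: "carrier (Lb V E) = clinear_maps V E"
  by (simp add: Lb_def)

lemma restrict_gen:
  assumes U: "Op U" "Op V" "V \<subseteq> U"
  shows "u \<in> clinear_maps (D U) E \<Longrightarrow> restrict_gen U V u \<in> clinear_maps (D V) E"
    and "restrict (restrict_gen U V) (carrier (Lb (D U) E)) \<in> clinear_maps (Lb (D U) E) (Lb (D V) E)"
proof -
  note g = extension_closed[OF U] extension_add(1)[OF U] extension_add(2)[OF U] extension_add(3)[OF U]
  note L = lin_maps[OF U(2)] lin_maps[OF U(1)] extension_continuous[OF U lcspace_axioms]
  show "u \<in> clinear_maps (D U) E \<Longrightarrow> restrict_gen U V u \<in> clinear_maps (D V) E"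
    unfolding restrict_gen_def by (rule Lb_compose(1)[OF L]) (use g in auto)
  show "restrict (restrict_gen U V) (carrier (Lb (D U) E)) \<in> clinear_maps (Lb (D U) E) (Lb (D V) E)"
    unfolding restrict_gen_def by (rule Lb_compose(2)[OF L]) (use g in auto)
qed

lemma D_ext: "\<eta> \<in> carrier (D U) \<Longrightarrow> (\<lambda>u\<in>carrier (sect F U). \<eta> u) = \<eta>"
  using D_c_ext by (simp add: D_c_simps)

lemma restrict_id:
  assumes U: "Op U" and u: "u \<in> clinear_maps (D U) E"
  shows "restrict_gen U U u = u"
proof -
  interpret lin_maps "D U" E by (rule lin_maps[OF U])
  have "extension F U U \<eta> = \<eta>" if "\<eta> \<in> carrier (D U)" for \<eta>
  proof -
    have "extension F U U \<eta> = (\<lambda>v\<in>carrier (sect F U). \<eta> v)"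
      unfolding extension_def by (rule restrict_ext) (simp add: FD.resF_id[OF U])
    then show ?thesis using D_ext[OF that] by simp
  qed
  then have "restrict_gen U U u = restrict u (carrier (D U))" unfolding restrict_gen_def by (intro restrict_ext) simp
  then show ?thesis using u by (simp add: clinear_maps_iff extensional_restrict)
qed

lemma extension_trans:
  assumes U: "Op U" "Op V" "Op W" "V \<subseteq> U" "W \<subseteq> V"
  shows "extension F U V (extension F V W \<eta>) = extension F U W \<eta>"
  unfolding extension_def
  by (rule restrict_ext) (simp add: FD.resF_closed[OF U(1,2,4)] FD.resF_trans[OF U])

lemma restrict_trans:
  assumes U: "Op U" "Op V" "Op W" "V \<subseteq> U" "W \<subseteq> V"
  shows "restrict_gen V W (restrict_gen U V u) = restrict_gen U W u"
  unfolding restrict_gen_def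
  by (rule restrict_ext) (simp add: extension_closed[OF U(2,3,5)] extension_trans[OF U])

lemma gen_presheaf: "is_presheaf (generalized_functions A F E)"
  unfolding is_presheaf_def gen_simps carrier_Lb
  using restrict_gen(1) restrict_id restrict_trans by auto

lemma gen_presheaf_of_lcs: "presheaf_of_lcs (generalized_functions A F E)"
  unfolding presheaf_of_lcs_def
proof (intro conjI gen_presheaf allI impI; unfold gen_simps)
  show "lcs (Lb (D U) E)" if "Op U" for U using lin_maps.Lb_lcs[OF lin_maps[OF that]] .
  show "restrict (restrict_gen U V) (carrier (Lb (D U) E)) \<in> clinear_maps (Lb (D U) E) (Lb (D V) E)"
    if "Op U \<and> Op V \<and> V \<subseteq> U" for U V using restrict_gen(2) that by blast
qed

text \<open>The pointwise sum is the sum in \<open>D U\<close>. Membership and value are proved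
  together, since each step adds to a partial sum that must already lie in the space.\<close>

lemma clinear_sum:
  assumes U: "Op U" and u: "u \<in> clinear_maps (D U) E"
  shows "(\<And>j. j < (n :: nat) \<Longrightarrow> \<eta> j \<in> carrier (D U)) \<Longrightarrow>
    (\<lambda>v\<in>carrier (sect F U). \<Sum>j<n. \<eta> j v) \<in> carrier (D U) \<and>
    u (\<lambda>v\<in>carrier (sect F U). \<Sum>j<n. \<eta> j v) = (\<Oplus>\<^bsub>E\<^esub>j\<in>{..<n}. u (\<eta> j))"
proof (induction n)
  case 0
  interpret lin_maps "D U" E by (rule lin_maps[OF U])
  have "(\<lambda>v\<in>carrier (sect F U). \<Sum>j<0. \<eta> j v) = \<zero>\<^bsub>D U\<^esub>" unfolding D_c_simps by simp
  then show ?case using clinear_zero[OF u] V.M.zero_closed by simp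
next
  case (Suc n)
  interpret L: lin_maps "D U" E by (rule lin_maps[OF U])
  let ?s = "\<lambda>v\<in>carrier (sect F U). \<Sum>j<n. \<eta> j v"
  have IH: "?s \<in> carrier (D U)" "u ?s = (\<Oplus>\<^bsub>E\<^esub>j\<in>{..<n}. u (\<eta> j))"
    using Suc.IH[OF Suc.prems[OF less_SucI]] by blast+
  have n: "\<eta> n \<in> carrier (D U)" using Suc.prems by simp
  have e: "(\<lambda>v\<in>carrier (sect F U). \<Sum>j<Suc n. \<eta> j v) = \<eta> n \<oplus>\<^bsub>D U\<^esub> ?s"
    unfolding D_c_simps by (rule restrict_ext) (simp add: add.commute)
  have c: "u (\<eta> j) \<in> carrier E" if "j < Suc n" for j using u Suc.prems[OF that] by (simp add: L.clinear_maps_iff)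
  have "u (\<eta> n \<oplus>\<^bsub>D U\<^esub> ?s) = u (\<eta> n) \<oplus>\<^bsub>E\<^esub> u ?s" using u n IH(1) by (simp add: L.clinear_maps_iff)
  also have "\<dots> = (\<Oplus>\<^bsub>E\<^esub>j\<in>{..<Suc n}. u (\<eta> j))"
    unfolding IH(2) lessThan_Suc using c by (intro M.finsum_insert[symmetric]) auto
  finally show ?case unfolding e using L.V.M.add.m_closed[OF n IH(1)] by simp
qed

end

section \<open>Gluing a compatible family of functionals\<close>

locale gluing = gen_functions A F E
  for A :: "('m, 's) ringed_space" and F :: "('m, 's, 'f) module_presheaf" and E :: "'e tvs" +
  fixes \<U> :: "'m set set" and s :: "'m set \<Rightarrow> ('f \<Rightarrow> complex) \<Rightarrow> 'e"
  assumes opU: "U \<in> \<U> \<Longrightarrow> Op U" and s: "U \<in> \<U> \<Longrightarrow> s U \<in> clinear_maps (D U) E"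
    and compat: "U \<in> \<U> \<Longrightarrow> V \<in> \<U> \<Longrightarrow> restrict_gen U (U \<inter> V) (s U) = restrict_gen V (U \<inter> V) (s V)"
begin

abbreviation "X \<equiv> \<Union>\<U>"

lemma opX: "Op X"
  using opU by blast

definition part :: "nat \<Rightarrow> (nat \<Rightarrow> 'm set) \<Rightarrow> (nat \<Rightarrow> 's) \<Rightarrow> (nat \<Rightarrow> 'm set) \<Rightarrow> bool" where
  "part n V g C \<longleftrightarrow> (\<forall>j<n. V j \<in> \<U> \<and> compactin (base A) (C j) \<and> C j \<subseteq> V j \<and>
      g j \<in> carrier (sect A X) \<and> res A X (X - C j) (g j) = \<zero>\<^bsub>sect A (X - C j)\<^esub>)"

text \<open>The sections need to sum to 1 only as seen by \<eta>. This is kept apart from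
  \<open>part\<close> because one family is used for many densities.\<close>

definition valid :: "nat \<Rightarrow> (nat \<Rightarrow> 's) \<Rightarrow> ('f \<Rightarrow> complex) \<Rightarrow> bool" where
  "valid n g \<eta> \<longleftrightarrow> (\<forall>u\<in>carrier (sect F X). (\<Sum>j<n. \<eta> (g j \<odot>\<^bsub>sect F X\<^esub> u)) = \<eta> u)"

definition T :: "nat \<Rightarrow> (nat \<Rightarrow> 'm set) \<Rightarrow> (nat \<Rightarrow> 's) \<Rightarrow> (nat \<Rightarrow> 'm set) \<Rightarrow> ('f \<Rightarrow> complex) \<Rightarrow> 'e" where
  "T n V g C \<eta> = (\<Oplus>\<^bsub>E\<^esub>j\<in>{..<n}. s (V j) (cut X (V j) (g j) (C j) \<eta>))"

lemma partD:
  assumes "part n V g C" "j < n"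
  shows "Op (V j)" "V j \<subseteq> X" "compactin (base A) (C j)" "C j \<subseteq> V j" "g j \<in> carrier (sect A X)"
    "res A X (X - C j) (g j) = \<zero>\<^bsub>sect A (X - C j)\<^esub>" "V j \<in> \<U>"
  using assms opU unfolding part_def by auto

lemma cutD_closed: "part n V g C \<Longrightarrow> j < n \<Longrightarrow> \<eta> \<in> carrier (D X) \<Longrightarrow> cut X (V j) (g j) (C j) \<eta> \<in> carrier (D (V j))"
  by (rule cut_closed[OF opX partD(1-6)])

lemma s_closed: "U \<in> \<U> \<Longrightarrow> \<eta> \<in> carrier (D U) \<Longrightarrow> s U \<eta> \<in> carrier E"
  using s lin_maps.clinear_maps_iff[OF lin_maps[OF opU]] by blast

lemma T_closed: "part n V g C \<Longrightarrow> \<eta> \<in> carrier (D X) \<Longrightarrow> T n V g C \<eta> \<in> carrier E"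
  unfolding T_def by (rule M.finsum_closed) (auto intro!: s_closed partD(7) cutD_closed)

text \<open>The subfamily \<open>\<U>'\<close> is the whole cover when the functional is
  constructed, and a single member when its restriction to that member is computed.\<close>

lemma part_exists:
  assumes K: "compactin (base A) K" "K \<subseteq> \<Union>\<U>'" and U': "\<U>' \<subseteq> \<U>"
  obtains n V g C where "part n V g C" "\<And>j. j < n \<Longrightarrow> V j \<in> \<U>'"
    "\<And>W D' v. Op W \<Longrightarrow> W \<subseteq> X \<Longrightarrow> D' \<in> FD.DC W \<Longrightarrow> FD.agree (W - K) D' FD.hzero \<Longrightarrow> v \<in> carrier (sect F W) \<Longrightarrow> K \<subseteq> W \<Longrightarrow>
      (\<Sum>j<n. rho A F W D' (res A X W (g j) \<odot>\<^bsub>sect F W\<^esub> v)) = rho A F W D' v"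
proof -
  have U: "Op U \<and> U \<subseteq> X" if "U \<in> \<U>'" for U using that U' opU by blast
  obtain n V g C where p: "\<And>j. j < (n :: nat) \<Longrightarrow> V j \<in> \<U>' \<and> compactin (base A) (C j) \<and> C j \<subseteq> V j \<and>
      g j \<in> carrier (sect A X) \<and> res A X (X - C j) (g j) = \<zero>\<^bsub>sect A (X - C j)\<^esub>"
    and v: "\<And>W D' v. Op W \<Longrightarrow> W \<subseteq> X \<Longrightarrow> D' \<in> FD.DC W \<Longrightarrow> FD.agree (W - K) D' FD.hzero \<Longrightarrow> v \<in> carrier (sect F W) \<Longrightarrow> K \<subseteq> W \<Longrightarrow>
      (\<Sum>j<n. rho A F W D' (res A X W (g j) \<odot>\<^bsub>sect F W\<^esub> v)) = rho A F W D' v"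
    by (rule partition[OF opX K U]) auto
  have "part n V g C" unfolding part_def using p U' by blast
  then show thesis using p v by (intro that[of n V g C]) auto
qed

lemma valid_rho:
  assumes g: "\<And>j. j < n \<Longrightarrow> g j \<in> carrier (sect A X)"
    and v: "\<And>W D' v. Op W \<Longrightarrow> W \<subseteq> X \<Longrightarrow> D' \<in> FD.DC W \<Longrightarrow> FD.agree (W - K) D' FD.hzero \<Longrightarrow> v \<in> carrier (sect F W) \<Longrightarrow> K \<subseteq> W \<Longrightarrow>
      (\<Sum>j<n. rho A F W D' (res A X W (g j) \<odot>\<^bsub>sect F W\<^esub> v)) = rho A F W D' v"
    and D': "D' \<in> FD.DC X" "FD.agree (X - K) D' FD.hzero" "K \<subseteq> X"
  shows "valid n g (rho A F X D')"
  unfolding valid_def using v[OF opX order_refl D'(1,2) _ D'(3)] g by (simp add: resA_id[OF opX])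

text \<open>Let w be the extension by zero of g i times v. Validity of the second family gives
  \<eta>(w) as the sum of the \<eta>(f j w), and f j w is the extension by zero from
  \<open>V i \<inter> W j\<close> of the product of both sections with v.\<close>

lemma cut_sum:
  assumes p: "part n V g C" and i: "i < n" and q: "part m W f B" and v: "valid m f \<eta>"
  shows "cut X (V i) (g i) (C i) \<eta> = (\<lambda>v\<in>carrier (sect F (V i)).
     \<Sum>j<m. extension F (V i) (V i \<inter> W j) (cut X (V i \<inter> W j) (g i \<otimes>\<^bsub>sect A X\<^esub> f j) (C i \<inter> B j) \<eta>) v)"
  unfolding cut_def[of X "V i"]
proof (rule restrict_ext)
  fix v assume v': "v \<in> carrier (sect F (V i))"
  note P = partD[OF p i]
  let ?w = "FD.zext (V i) X (C i) (res A X (V i) (g i) \<odot>\<^bsub>sect F (V i)\<^esub> v)"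
  note w = cut_zext[OF opX P(1-6) v']
  have "\<eta> ?w = (\<Sum>j<m. \<eta> (f j \<odot>\<^bsub>sect F X\<^esub> ?w))" using v w(1) by (simp add: valid_def)
  also have "\<dots> = (\<Sum>j<m. extension F (V i) (V i \<inter> W j) (cut X (V i \<inter> W j) (g i \<otimes>\<^bsub>sect A X\<^esub> f j) (C i \<inter> B j) \<eta>) v)"
  proof (rule sum.cong[OF refl])
    fix j assume "j \<in> {..<m}"
    then have j: "j < m" by simp
    note Q = partD[OF q j]
    have VW: "Op (V i \<inter> W j)" "V i \<inter> W j \<subseteq> V i" "V i \<inter> W j \<subseteq> X" "C i \<inter> B j \<subseteq> V i \<inter> W j" using P Q by auto
    have CB: "compactin (base A) (C i \<inter> B j)"
      using compact_Int_closedin[OF P(3)] compactin_imp_closedin[OF hausdorff Q(3)] by blast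
    have o: "Op (X - C i)" "Op (X - B j)" "Op (X - C i \<inter> B j)" using openin_Diff_compactin[OF opX] P(3) Q(3) CB by auto
    interpret r: cring "sect A (V i \<inter> W j)" by (rule cringA[OF VW(1)])
    let ?r = "\<lambda>x. res A X (V i \<inter> W j) x"
    have cl: "?r (g i) \<in> carrier (sect A (V i \<inter> W j))" "?r (f j) \<in> carrier (sect A (V i \<inter> W j))"
      using resA_closed[OF opX VW(1,3)] P(5) Q(5) by auto
    have rv: "res F (V i) (V i \<inter> W j) v \<in> carrier (sect F (V i \<inter> W j))" by (rule FD.resF_closed[OF P(1) VW(1,2) v'])
    have fw: "f j \<odot>\<^bsub>sect F X\<^esub> ?w \<in> carrier (sect F X)" by (rule FD.smultF[OF opX Q(5) w(1)])
    have z: "FD.zext (V i \<inter> W j) X (C i \<inter> B j) (?r (g i \<otimes>\<^bsub>sect A X\<^esub> f j) \<odot>\<^bsub>sect F (V i \<inter> W j)\<^esub> res F (V i) (V i \<inter> W j) v) = f j \<odot>\<^bsub>sect F X\<^esub> ?w"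
    proof (rule FD.zext_eqI[OF VW(1) opX VW(3,4) o(3) fw])
      have "res F X (V i \<inter> W j) (f j \<odot>\<^bsub>sect F X\<^esub> ?w) = ?r (f j) \<odot>\<^bsub>sect F (V i \<inter> W j)\<^esub> res F (V i) (V i \<inter> W j) (res F X (V i) ?w)"
        using FD.resF_smult[OF opX VW(1,3) Q(5) w(1)] FD.resF_trans[OF opX P(1) VW(1) P(2) VW(2) w(1)] by simp
      also have "res F (V i) (V i \<inter> W j) (res F X (V i) ?w) = ?r (g i) \<odot>\<^bsub>sect F (V i \<inter> W j)\<^esub> res F (V i) (V i \<inter> W j) v"
        unfolding w(2) using FD.resF_smult[OF P(1) VW(1,2) resA_closed[OF opX P(1,2,5)] v'] resA_trans[OF opX P(1) VW(1) P(2) VW(2) P(5)] by simp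
      also have "?r (f j) \<odot>\<^bsub>sect F (V i \<inter> W j)\<^esub> (?r (g i) \<odot>\<^bsub>sect F (V i \<inter> W j)\<^esub> res F (V i) (V i \<inter> W j) v) =
          (?r (g i) \<otimes>\<^bsub>sect A (V i \<inter> W j)\<^esub> ?r (f j)) \<odot>\<^bsub>sect F (V i \<inter> W j)\<^esub> res F (V i) (V i \<inter> W j) v"
        using module.smult_assoc1[OF FD.modF[OF VW(1)] cl(2,1) rv] r.m_comm[OF cl] by simp
      also have "?r (g i) \<otimes>\<^bsub>sect A (V i \<inter> W j)\<^esub> ?r (f j) = ?r (g i \<otimes>\<^bsub>sect A X\<^esub> f j)"
        using resA_mult[OF opX VW(1,3) P(5) Q(5)] by simp
      finally show "res F X (V i \<inter> W j) (f j \<odot>\<^bsub>sect F X\<^esub> ?w) = ?r (g i \<otimes>\<^bsub>sect A X\<^esub> f j) \<odot>\<^bsub>sect F (V i \<inter> W j)\<^esub> res F (V i) (V i \<inter> W j) v" .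
      let ?Y = "X - C i \<inter> B j"
      have Y: "?Y = (X - C i) \<union> (X - B j)" "X - C i \<subseteq> ?Y" "X - B j \<subseteq> ?Y" "?Y \<subseteq> X" by auto
      have 1: "res F X (X - C i) (f j \<odot>\<^bsub>sect F X\<^esub> ?w) = \<zero>\<^bsub>sect F (X - C i)\<^esub>"
        using FD.resF_smult[OF opX o(1) Diff_subset Q(5) w(1)] w(3) FD.smultF_zero[OF o(1) resA_closed[OF opX o(1) Diff_subset Q(5)]] by simp
      have 2: "res F X (X - B j) (f j \<odot>\<^bsub>sect F X\<^esub> ?w) = \<zero>\<^bsub>sect F (X - B j)\<^esub>"
        using FD.resF_smult[OF opX o(2) Diff_subset Q(5) w(1)] Q(6) FD.smultF_l_zero[OF o(2) FD.resF_closed[OF opX o(2) Diff_subset w(1)]] by simp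
      show "res F X ?Y (f j \<odot>\<^bsub>sect F X\<^esub> ?w) = \<zero>\<^bsub>sect F ?Y\<^esub>"
      proof (rule FD.sep2F[OF o(1,2) Y(1) FD.resF_closed[OF opX o(3) Y(4) fw] FD.zeroF[OF o(3)]])
        show "res F ?Y (X - C i) (res F X ?Y (f j \<odot>\<^bsub>sect F X\<^esub> ?w)) = res F ?Y (X - C i) \<zero>\<^bsub>sect F ?Y\<^esub>"
          using FD.resF_trans[OF opX o(3,1) Y(4,2) fw] 1 FD.resF_zero[OF o(3,1) Y(2)] by simp
        show "res F ?Y (X - B j) (res F X ?Y (f j \<odot>\<^bsub>sect F X\<^esub> ?w)) = res F ?Y (X - B j) \<zero>\<^bsub>sect F ?Y\<^esub>"
          using FD.resF_trans[OF opX o(3,2) Y(4,3) fw] 2 FD.resF_zero[OF o(3,2) Y(3)] by simp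
      qed
    qed
    show "\<eta> (f j \<odot>\<^bsub>sect F X\<^esub> ?w) = extension F (V i) (V i \<inter> W j) (cut X (V i \<inter> W j) (g i \<otimes>\<^bsub>sect A X\<^esub> f j) (C i \<inter> B j) \<eta>) v"
      using v' rv by (simp add: extension_def cut_def z)
  qed
  finally show "\<eta> ?w = (\<Sum>j<m. extension F (V i) (V i \<inter> W j) (cut X (V i \<inter> W j) (g i \<otimes>\<^bsub>sect A X\<^esub> f j) (C i \<inter> B j) \<eta>) v)" .
qed

lemma cut_Int_closed:
  assumes p: "part n V g C" and i: "i < n" and q: "part m W f B" and j: "j < m" and \<eta>: "\<eta> \<in> carrier (D X)"
  shows "cut X (V i \<inter> W j) (g i \<otimes>\<^bsub>sect A X\<^esub> f j) (C i \<inter> B j) \<eta> \<in> carrier (D (V i \<inter> W j))"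
proof -
  note P = partD[OF p i] and Q = partD[OF q j]
  have VW: "Op (V i \<inter> W j)" "V i \<inter> W j \<subseteq> X" "C i \<inter> B j \<subseteq> V i \<inter> W j" using P Q by auto
  have CB: "compactin (base A) (C i \<inter> B j)"
    using compact_Int_closedin[OF P(3)] compactin_imp_closedin[OF hausdorff Q(3)] by blast
  interpret r: cring "sect A X" by (rule cringA[OF opX])
  have gf: "g i \<otimes>\<^bsub>sect A X\<^esub> f j \<in> carrier (sect A X)" using P(5) Q(5) by simp
  have o: "Op (X - C i)" "Op (X - B j)" "Op (X - C i \<inter> B j)" using openin_Diff_compactin[OF opX] P(3) Q(3) CB by auto
  let ?Y = "X - C i \<inter> B j"
  have Y: "?Y = \<Union>{X - C i, X - B j}" "X - C i \<subseteq> ?Y" "X - B j \<subseteq> ?Y" "?Y \<subseteq> X" by auto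
  \<comment> \<open>The complement of \<open>C i \<inter> B j\<close> is covered by the two
    complements, and on each of them one factor is 0.\<close>
  have "res A X ?Y (g i \<otimes>\<^bsub>sect A X\<^esub> f j) = \<zero>\<^bsub>sect A ?Y\<^esub>"
  proof (rule sepA[OF _ Y(1)])
    show "Op U" if "U \<in> {X - C i, X - B j}" for U using that o by auto
    show "res A X ?Y (g i \<otimes>\<^bsub>sect A X\<^esub> f j) \<in> carrier (sect A ?Y)" by (rule resA_closed[OF opX o(3) Y(4) gf])
    show "\<zero>\<^bsub>sect A ?Y\<^esub> \<in> carrier (sect A ?Y)" using cring.cring_simprules(2)[OF cringA[OF o(3)]] .
    fix U assume "U \<in> {X - C i, X - B j}"
    then consider "U = X - C i" | "U = X - B j" by blast
    then show "res A ?Y U (res A X ?Y (g i \<otimes>\<^bsub>sect A X\<^esub> f j)) = res A ?Y U \<zero>\<^bsub>sect A ?Y\<^esub>"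
    proof cases
      case 1
      interpret t: cring "sect A (X - C i)" by (rule cringA[OF o(1)])
      have "res A X (X - C i) (g i \<otimes>\<^bsub>sect A X\<^esub> f j) = \<zero>\<^bsub>sect A (X - C i)\<^esub>"
        using resA_mult[OF opX o(1) Diff_subset P(5) Q(5)] P(6) resA_closed[OF opX o(1) Diff_subset Q(5)] by simp
      then show ?thesis using 1 resA_trans[OF opX o(3,1) Y(4,2) gf] resA_zero[OF o(3,1) Y(2)] by simp
    next
      case 2
      interpret t: cring "sect A (X - B j)" by (rule cringA[OF o(2)])
      have "res A X (X - B j) (g i \<otimes>\<^bsub>sect A X\<^esub> f j) = \<zero>\<^bsub>sect A (X - B j)\<^esub>"
        using resA_mult[OF opX o(2) Diff_subset P(5) Q(5)] Q(6) resA_closed[OF opX o(2) Diff_subset P(5)] by simp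
      then show ?thesis using 2 resA_trans[OF opX o(3,2) Y(4,3) gf] resA_zero[OF o(3,2) Y(3)] by simp
    qed
  qed
  from cut_closed[OF opX VW(1,2) CB VW(3) gf this \<eta>] show ?thesis .
qed

text \<open>Each local functional sees its cut through the second family, which leaves only values
  of its restrictions to the overlaps. These are the values that \<open>compat\<close> can
  compare.\<close>

lemma T_double:
  assumes p: "part n V g C" and q: "part m W f B" and v: "valid m f \<eta>" and \<eta>: "\<eta> \<in> carrier (D X)"
  shows "T n V g C \<eta> = (\<Oplus>\<^bsub>E\<^esub>i\<in>{..<n}. \<Oplus>\<^bsub>E\<^esub>j\<in>{..<m}.
     restrict_gen (V i) (V i \<inter> W j) (s (V i)) (cut X (V i \<inter> W j) (g i \<otimes>\<^bsub>sect A X\<^esub> f j) (C i \<inter> B j) \<eta>))"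
  unfolding T_def
proof (rule M.finsum_cong'[OF refl])
  let ?c = "\<lambda>i j. cut X (V i \<inter> W j) (g i \<otimes>\<^bsub>sect A X\<^esub> f j) (C i \<inter> B j) \<eta>"
  have e: "s (V i) (cut X (V i) (g i) (C i) \<eta>) = (\<Oplus>\<^bsub>E\<^esub>j\<in>{..<m}. restrict_gen (V i) (V i \<inter> W j) (s (V i)) (?c i j))
      \<and> (\<Oplus>\<^bsub>E\<^esub>j\<in>{..<m}. restrict_gen (V i) (V i \<inter> W j) (s (V i)) (?c i j)) \<in> carrier E" if i: "i < n" for i
  proof -
    note P = partD[OF p i]
    have cl: "extension F (V i) (V i \<inter> W j) (?c i j) \<in> carrier (D (V i))" if j: "j < m" for j
      by (rule extension_closed[OF P(1) _ Int_lower1 cut_Int_closed[OF p i q j \<eta>]]) (use P(1) partD(1)[OF q j] in blast)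
    have "s (V i) (cut X (V i) (g i) (C i) \<eta>) = (\<Oplus>\<^bsub>E\<^esub>j\<in>{..<m}. s (V i) (extension F (V i) (V i \<inter> W j) (?c i j)))"
      unfolding cut_sum[OF p i q v] using clinear_sum[OF P(1) s[OF P(7)], of m "\<lambda>j. extension F (V i) (V i \<inter> W j) (?c i j)"] cl by simp
    also have "\<dots> = (\<Oplus>\<^bsub>E\<^esub>j\<in>{..<m}. restrict_gen (V i) (V i \<inter> W j) (s (V i)) (?c i j))"
      by (rule M.finsum_cong'[OF refl]) (use cl cut_Int_closed[OF p i q _ \<eta>] s_closed[OF P(7)] in \<open>auto simp: restrict_gen_def\<close>)
    finally have 1: "s (V i) (cut X (V i) (g i) (C i) \<eta>) = (\<Oplus>\<^bsub>E\<^esub>j\<in>{..<m}. restrict_gen (V i) (V i \<inter> W j) (s (V i)) (?c i j))" .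
    then show ?thesis using s_closed[OF P(7) cutD_closed[OF p i \<eta>]] by simp
  qed
  then show "s (V i) (cut X (V i) (g i) (C i) \<eta>) = (\<Oplus>\<^bsub>E\<^esub>j\<in>{..<m}. restrict_gen (V i) (V i \<inter> W j) (s (V i)) (?c i j))" if "i \<in> {..<n}" for i
    using that by simp
  show "(\<lambda>i. \<Oplus>\<^bsub>E\<^esub>j\<in>{..<m}. restrict_gen (V i) (V i \<inter> W j) (s (V i)) (?c i j)) \<in> {..<n} \<rightarrow> carrier E" using e by simp
qed

lemma T_unique:
  assumes p: "part n V g C" "valid n g \<eta>" and q: "part m W f B" "valid m f \<eta>" and \<eta>: "\<eta> \<in> carrier (D X)"
  shows "T n V g C \<eta> = T m W f B \<eta>"
proof -
  interpret r: cring "sect A X" by (rule cringA[OF opX])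
  let ?x = "\<lambda>i j. restrict_gen (V i) (V i \<inter> W j) (s (V i)) (cut X (V i \<inter> W j) (g i \<otimes>\<^bsub>sect A X\<^esub> f j) (C i \<inter> B j) \<eta>)"
  let ?y = "\<lambda>j i. restrict_gen (W j) (W j \<inter> V i) (s (W j)) (cut X (W j \<inter> V i) (f j \<otimes>\<^bsub>sect A X\<^esub> g i) (B j \<inter> C i) \<eta>)"
  have xy: "?x i j = ?y j i" if "i < n" "j < m" for i j
  proof -
    note P = partD[OF p(1) that(1)] and Q = partD[OF q(1) that(2)]
    have "W j \<inter> V i = V i \<inter> W j" "B j \<inter> C i = C i \<inter> B j" by auto
    moreover have "f j \<otimes>\<^bsub>sect A X\<^esub> g i = g i \<otimes>\<^bsub>sect A X\<^esub> f j" using r.m_comm[OF Q(5) P(5)] .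
    ultimately show ?thesis using compat[OF P(7) Q(7)] by simp
  qed
  have xc: "?x i j \<in> carrier E" if "i < n" "j < m" for i j
  proof -
    note P = partD[OF p(1) that(1)] and Q = partD[OF q(1) that(2)]
    have o: "Op (V i \<inter> W j)" using P Q by blast
    have "restrict_gen (V i) (V i \<inter> W j) (s (V i)) \<in> clinear_maps (D (V i \<inter> W j)) E"
      by (rule restrict_gen(1)[OF P(1) o Int_lower1 s[OF P(7)]])
    then show ?thesis
      using cut_Int_closed[OF p(1) that(1) q(1) that(2) \<eta>] lin_maps.clinear_maps_iff[OF lin_maps[OF o]] by blast
  qed
  have "T n V g C \<eta> = (\<Oplus>\<^bsub>E\<^esub>i\<in>{..<n}. \<Oplus>\<^bsub>E\<^esub>j\<in>{..<m}. ?x i j)" by (rule T_double[OF p(1) q \<eta>])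
  also have "\<dots> = (\<Oplus>\<^bsub>E\<^esub>j\<in>{..<m}. \<Oplus>\<^bsub>E\<^esub>i\<in>{..<n}. ?x i j)" by (rule M.finsum_swap) (use xc in auto)
  also have "\<dots> = (\<Oplus>\<^bsub>E\<^esub>j\<in>{..<m}. \<Oplus>\<^bsub>E\<^esub>i\<in>{..<n}. ?y j i)"
  proof (rule M.finsum_cong'[OF refl])
    have yc: "?y j i \<in> carrier E" if "j < m" "i < n" for i j using xc[OF that(2,1)] xy[OF that(2,1)] by simp
    then show "(\<lambda>j. \<Oplus>\<^bsub>E\<^esub>i\<in>{..<n}. ?y j i) \<in> {..<m} \<rightarrow> carrier E" by (intro funcsetI M.finsum_closed) auto
    show "(\<Oplus>\<^bsub>E\<^esub>i\<in>{..<n}. ?x i j) = (\<Oplus>\<^bsub>E\<^esub>i\<in>{..<n}. ?y j i)" if j: "j \<in> {..<m}" for j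
      by (rule M.finsum_cong'[OF refl]) (use j yc xy in auto)
  qed
  also have "\<dots> = T m W f B \<eta>" by (rule T_double[OF q(1) p \<eta>, symmetric])
  finally show ?thesis .
qed

text \<open>A common family for two densities, built over the union of their compact supports;
  additivity of the glued functional compares sums over one family.\<close>

lemma DX_part:
  assumes "\<eta> \<in> carrier (D X)" "\<theta> \<in> carrier (D X)"
  obtains n V g C where "part n V g C" "valid n g \<eta>" "valid n g \<theta>"
proof -
  obtain D1 where D1: "D1 \<in> FD.DC X" "\<eta> = rho A F X D1" using assms(1) by (auto simp: D_c_simps)
  obtain D2 where D2: "D2 \<in> FD.DC X" "\<theta> = rho A F X D2" using assms(2) by (auto simp: D_c_simps)
  obtain K where K: "compactin (base A) K" "K \<subseteq> X" "FD.agree (X - K) D1 FD.hzero" using FD.DC_D[OF hausdorff opX D1(1)] by metis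
  obtain L where L: "compactin (base A) L" "L \<subseteq> X" "FD.agree (X - L) D2 FD.hzero" using FD.DC_D[OF hausdorff opX D2(1)] by metis
  have KL: "compactin (base A) (K \<union> L)" "K \<union> L \<subseteq> X" using compactin_Un[OF K(1) L(1)] K L by auto
  obtain n V g C where p: "part n V g C"
    and v: "\<And>W D' v. Op W \<Longrightarrow> W \<subseteq> X \<Longrightarrow> D' \<in> FD.DC W \<Longrightarrow> FD.agree (W - (K \<union> L)) D' FD.hzero \<Longrightarrow> v \<in> carrier (sect F W) \<Longrightarrow> K \<union> L \<subseteq> W \<Longrightarrow>
      (\<Sum>j<n. rho A F W D' (res A X W (g j) \<odot>\<^bsub>sect F W\<^esub> v)) = rho A F W D' v"
    by (rule part_exists[OF KL order_refl]) auto
  have a: "FD.agree (X - (K \<union> L)) D1 FD.hzero" "FD.agree (X - (K \<union> L)) D2 FD.hzero"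
    by (rule FD.agree_subset[OF K(3)], blast) (rule FD.agree_subset[OF L(3)], blast)
  have "valid n g \<eta>" unfolding D1(2) by (rule valid_rho[OF partD(5)[OF p] v D1(1) a(1) KL(2)])
  moreover have "valid n g \<theta>" unfolding D2(2) by (rule valid_rho[OF partD(5)[OF p] v D2(1) a(2) KL(2)])
  ultimately show thesis by (rule that[OF p])
qed

definition glued :: "('f \<Rightarrow> complex) \<Rightarrow> 'e" where
  "glued = (\<lambda>\<eta>\<in>carrier (D X). SOME e. \<exists>n V g C. part n V g C \<and> valid n g \<eta> \<and> e = T n V g C \<eta>)"

lemma glued_eq:
  assumes p: "part n V g C" "valid n g \<eta>" and \<eta>: "\<eta> \<in> carrier (D X)"
  shows "glued \<eta> = T n V g C \<eta>"
proof -
  have "\<exists>m W f B. part m W f B \<and> valid m f \<eta> \<and> (SOME e. \<exists>n V g C. part n V g C \<and> valid n g \<eta> \<and> e = T n V g C \<eta>) = T m W f B \<eta>"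
    by (rule someI[of "\<lambda>e. \<exists>n V g C. part n V g C \<and> valid n g \<eta> \<and> e = T n V g C \<eta>"]) (use p in blast)
  then obtain m W f B where q: "part m W f B" "valid m f \<eta>" "glued \<eta> = T m W f B \<eta>" using \<eta> by (auto simp: glued_def)
  then show ?thesis using T_unique[OF q(1,2) p \<eta>] by simp
qed

lemma cut_linear:
  assumes P: "part n V g C" "j < n"
  shows "cut X (V j) (g j) (C j) (\<eta> \<oplus>\<^bsub>D X\<^esub> \<theta>) = cut X (V j) (g j) (C j) \<eta> \<oplus>\<^bsub>D (V j)\<^esub> cut X (V j) (g j) (C j) \<theta>"
    and "cut X (V j) (g j) (C j) (c \<odot>\<^bsub>D X\<^esub> \<eta>) = c \<odot>\<^bsub>D (V j)\<^esub> cut X (V j) (g j) (C j) \<eta>"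
  using cut_zext(1)[OF opX partD(1-6)[OF P]] by (auto simp: cut_def D_c_simps intro!: restrict_ext)

lemma glued_clinear: "glued \<in> clinear_maps (D X) E"
proof -
  interpret L: lin_maps "D X" E by (rule lin_maps[OF opX])
  have cl: "glued \<eta> \<in> carrier E" if "\<eta> \<in> carrier (D X)" for \<eta>
    using DX_part[OF that that] glued_eq[OF _ _ that] T_closed[OF _ that] by metis
  have sl: "s U (\<eta> \<oplus>\<^bsub>D U\<^esub> \<theta>) = s U \<eta> \<oplus>\<^bsub>E\<^esub> s U \<theta>"
    if "U \<in> \<U>" "\<eta> \<in> carrier (D U)" "\<theta> \<in> carrier (D U)" for U \<eta> \<theta>
    using s[OF that(1)] that(2,3) by (simp add: lin_maps.clinear_maps_iff[OF lin_maps[OF opU[OF that(1)]]])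
  have sl2: "s U (c \<odot>\<^bsub>D U\<^esub> \<eta>) = c \<odot>\<^bsub>E\<^esub> s U \<eta>" if "U \<in> \<U>" "\<eta> \<in> carrier (D U)" for U \<eta> c
    using s[OF that(1)] that(2) by (simp add: lin_maps.clinear_maps_iff[OF lin_maps[OF opU[OF that(1)]]])
  have add: "glued (\<eta> \<oplus>\<^bsub>D X\<^esub> \<theta>) = glued \<eta> \<oplus>\<^bsub>E\<^esub> glued \<theta>" if h: "\<eta> \<in> carrier (D X)" "\<theta> \<in> carrier (D X)" for \<eta> \<theta>
  proof -
    obtain n V g C where p: "part n V g C" "valid n g \<eta>" "valid n g \<theta>" using DX_part[OF h] by metis
    have sm: "g j \<odot>\<^bsub>sect F X\<^esub> u \<in> carrier (sect F X)" if "j < n" "u \<in> carrier (sect F X)" for j u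
      using FD.smultF[OF opX partD(5)[OF p(1) that(1)] that(2)] .
    have "valid n g (\<eta> \<oplus>\<^bsub>D X\<^esub> \<theta>)"
      using p(2,3) sm by (simp add: valid_def D_c_simps sum.distrib)
    then have "glued (\<eta> \<oplus>\<^bsub>D X\<^esub> \<theta>) = T n V g C (\<eta> \<oplus>\<^bsub>D X\<^esub> \<theta>)" using glued_eq[OF p(1)] h by simp
    also have "\<dots> = (\<Oplus>\<^bsub>E\<^esub>j\<in>{..<n}. s (V j) (cut X (V j) (g j) (C j) \<eta>) \<oplus>\<^bsub>E\<^esub> s (V j) (cut X (V j) (g j) (C j) \<theta>))"
      unfolding T_def
      by (rule M.finsum_cong'[OF refl])
         (use cutD_closed[OF p(1)] h s_closed[OF partD(7)[OF p(1)]] in \<open>auto simp: cut_linear[OF p(1)] sl partD(7)[OF p(1)]\<close>)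
    also have "\<dots> = T n V g C \<eta> \<oplus>\<^bsub>E\<^esub> T n V g C \<theta>"
      unfolding T_def by (rule M.finsum_addf) (use cutD_closed[OF p(1)] h s_closed[OF partD(7)[OF p(1)]] in auto)
    finally show ?thesis using glued_eq[OF p(1,2) h(1)] glued_eq[OF p(1,3) h(2)] by simp
  qed
  have smult: "glued (c \<odot>\<^bsub>D X\<^esub> \<eta>) = c \<odot>\<^bsub>E\<^esub> glued \<eta>" if h: "\<eta> \<in> carrier (D X)" for c \<eta>
  proof -
    obtain n V g C where p: "part n V g C" "valid n g \<eta>" using DX_part[OF h h] by metis
    have sm: "g j \<odot>\<^bsub>sect F X\<^esub> u \<in> carrier (sect F X)" if "j < n" "u \<in> carrier (sect F X)" for j u
      using FD.smultF[OF opX partD(5)[OF p(1) that(1)] that(2)] .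
    have "valid n g (c \<odot>\<^bsub>D X\<^esub> \<eta>)"
      using p(2) sm by (simp add: valid_def D_c_simps sum_distrib_left[symmetric])
    then have "glued (c \<odot>\<^bsub>D X\<^esub> \<eta>) = T n V g C (c \<odot>\<^bsub>D X\<^esub> \<eta>)" using glued_eq[OF p(1)] h L.V_smult by simp
    also have "\<dots> = (\<Oplus>\<^bsub>E\<^esub>j\<in>{..<n}. c \<odot>\<^bsub>E\<^esub> s (V j) (cut X (V j) (g j) (C j) \<eta>))"
      unfolding T_def
      by (rule M.finsum_cong'[OF refl])
         (use cutD_closed[OF p(1)] h s_closed[OF partD(7)[OF p(1)]] in \<open>auto simp: cut_linear[OF p(1)] sl2[OF partD(7)[OF p(1)]] smult_simps\<close>)
    also have "\<dots> = c \<odot>\<^bsub>E\<^esub> T n V g C \<eta>"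
      unfolding T_def by (rule finsum_smult_ldistr[symmetric])
        (use cutD_closed[OF p(1)] h s_closed[OF partD(7)[OF p(1)]] in \<open>auto simp: complex_ring_simps\<close>)
    finally show ?thesis using glued_eq[OF p h] by simp
  qed
  have "continuous_map (vtop (D X)) (vtop E) glued"
  proof (rule limit_continuous[OF opX lcspace_axioms cl add smult])
    fix K r assume K: "compactin (base A) K" "K \<subseteq> X"
    obtain n V g C where p: "part n V g C"
      and v: "\<And>W D' v. Op W \<Longrightarrow> W \<subseteq> X \<Longrightarrow> D' \<in> FD.DC W \<Longrightarrow> FD.agree (W - K) D' FD.hzero \<Longrightarrow> v \<in> carrier (sect F W) \<Longrightarrow> K \<subseteq> W \<Longrightarrow>
        (\<Sum>j<n. rho A F W D' (res A X W (g j) \<odot>\<^bsub>sect F W\<^esub> v)) = rho A F W D' v"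
      by (rule part_exists[OF K order_refl]) auto
    let ?T = "Diff_KR_topology A F X K r"
    have "continuous_map ?T (vtop E) (\<lambda>D'. s (V j) (cut X (V j) (g j) (C j) (rho A F X D')))" if j: "j < n" for j
    proof -
      note P = partD[OF p j]
      \<comment> \<open>On one step the cut is induced by precomposition with g j, continuous
        between spaces of operators, followed by the continuous map \<open>rho\<close> into the
        limit over \<open>V j\<close>.\<close>
      have "continuous_map ?T (vtop (D (V j))) (\<lambda>D'. rho A F (V j) (FD.mk (V j) (FD.precomp X (g j) D')))"
        using continuous_map_compose[OF cut_continuous[OF opX P(1-6) K(1)] rho_continuous[OF P(1) lcspace_axioms P(3,4)]] by (simp add: o_def)
      moreover have "continuous_map (vtop (D (V j))) (vtop E) (s (V j))"
        using s[OF P(7)] by (simp add: lin_maps.clinear_maps_iff[OF lin_maps[OF P(1)]])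
      ultimately have "continuous_map ?T (vtop E) (\<lambda>D'. s (V j) (rho A F (V j) (FD.mk (V j) (FD.precomp X (g j) D'))))"
        using continuous_map_compose by (fastforce simp: o_def)
      then show ?thesis
      proof (rule continuous_map_eq)
        fix D' assume "D' \<in> topspace ?T"
        then have "FD.lhom X D'" using FD.DKR_D(1)[OF hausdorff opX K(1)] topspace_Diff_KR[OF opX K(1)] by simp
        from cut_rho[OF opX P(1-6) this]
        show "s (V j) (rho A F (V j) (FD.mk (V j) (FD.precomp X (g j) D'))) = s (V j) (cut X (V j) (g j) (C j) (rho A F X D'))" by simp
      qed
    qed
    then have "continuous_map ?T (vtop E) (\<lambda>D'. T n V g C (rho A F X D'))"
      unfolding T_def by (intro continuous_finsum) auto
    then show "continuous_map ?T (vtop E) (\<lambda>D'. glued (rho A F X D'))"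
    proof (rule continuous_map_eq)
      fix D' assume D': "D' \<in> topspace ?T"
      then have dk: "D' \<in> FD.DKR X K r" using topspace_Diff_KR[OF opX K(1)] by simp
      have "valid n g (rho A F X D')"
        by (rule valid_rho[OF partD(5)[OF p] v]) (use FD.DKR_DC[OF hausdorff opX K dk] FD.DKR_D(4)[OF hausdorff opX K(1) dk] K(2) in auto)
      then show "T n V g C (rho A F X D') = glued (rho A F X D')"
        using glued_eq[OF p] DKR_rho[OF opX K D'] by simp
    qed
  qed
  then show ?thesis using cl add smult by (simp add: L.clinear_maps_iff glued_def restrict_extensional)
qed

text \<open>For a density from \<open>U\<close> the family may be chosen with \<open>U\<close> as
  its only patch. All cuts are then densities on \<open>U\<close>, and they sum to \<eta> before
  \<open>s U\<close> is applied.\<close>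

lemma glued_restrict:
  assumes U: "U \<in> \<U>"
  shows "restrict_gen X U glued = s U"
proof -
  have oU: "Op U" "U \<subseteq> X" using opU U by auto
  interpret L: lin_maps "D U" E by (rule lin_maps[OF oU(1)])
  have "glued (extension F X U \<eta>) = s U \<eta>" if \<eta>: "\<eta> \<in> carrier (D U)" for \<eta>
  proof -
    obtain D' where D': "D' \<in> FD.DC U" "\<eta> = rho A F U D'" using \<eta> by (auto simp: D_c_simps)
    obtain K where K: "FD.lhom U D'" "\<And>a. a \<in> U \<Longrightarrow> \<exists>W r. Op W \<and> a \<in> W \<and> W \<subseteq> U \<and> FD.ordle W r D'"
      "compactin (base A) K" "K \<subseteq> U" "FD.agree (U - K) D' FD.hzero" using FD.DC_D[OF hausdorff oU(1) D'(1)] by metis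
    have KU: "K \<subseteq> \<Union>{U}" "{U} \<subseteq> \<U>" "K \<subseteq> X" using K(4) U by auto
    obtain n V g C where p: "part n V g C" and VU: "\<And>j. j < n \<Longrightarrow> V j \<in> {U}"
      and v: "\<And>W D' v. Op W \<Longrightarrow> W \<subseteq> X \<Longrightarrow> D' \<in> FD.DC W \<Longrightarrow> FD.agree (W - K) D' FD.hzero \<Longrightarrow> v \<in> carrier (sect F W) \<Longrightarrow> K \<subseteq> W \<Longrightarrow>
        (\<Sum>j<n. rho A F W D' (res A X W (g j) \<odot>\<^bsub>sect F W\<^esub> v)) = rho A F W D' v"
      by (rule part_exists[OF K(3) KU(1,2)]) auto
    let ?D = "FD.mk X (FD.extop U K D')"
    have ext: "extension F X U \<eta> = rho A F X ?D" unfolding D'(2) by (rule extension_rho[OF opX oU K(3,4,1,5)])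
    have DX: "?D \<in> FD.DC X" by (rule FD.DC_ext[OF hausdorff opX oU K(3,4,1,5,2)])
    have agr: "FD.agree (X - K) ?D FD.hzero"
      by (rule FD.agree_trans[OF FD.agree_subset[OF FD.mk_agree Diff_subset]
            FD.extop_agree_zero[OF opX oU K(4) openin_Diff_compactin[OF opX K(3)] K(1,5)]])
    have val: "valid n g (extension F X U \<eta>)" unfolding ext by (rule valid_rho[OF partD(5)[OF p] v DX agr KU(3)])
    have eX: "extension F X U \<eta> \<in> carrier (D X)" by (rule extension_closed[OF opX oU \<eta>])
    let ?c = "\<lambda>j. cut X (V j) (g j) (C j) (extension F X U \<eta>)"
    have cc: "?c j \<in> carrier (D U)" if "j < n" for j using cutD_closed[OF p that eX] VU[OF that] by simp
    have "glued (extension F X U \<eta>) = T n V g C (extension F X U \<eta>)" by (rule glued_eq[OF p val eX])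
    also have "\<dots> = (\<Oplus>\<^bsub>E\<^esub>j\<in>{..<n}. s U (?c j))"
      unfolding T_def by (rule M.finsum_cong'[OF refl]) (use VU cc s_closed[OF U] in auto)
    also have "\<dots> = s U (\<lambda>v\<in>carrier (sect F U). \<Sum>j<n. ?c j v)" using clinear_sum[OF oU(1) s[OF U] cc] by simp
    also have "(\<lambda>v\<in>carrier (sect F U). \<Sum>j<n. ?c j v) = (\<lambda>v\<in>carrier (sect F U). \<eta> v)"
    proof (rule restrict_ext)
      fix w assume w: "w \<in> carrier (sect F U)"
      have "?c j w = rho A F U D' (res A X U (g j) \<odot>\<^bsub>sect F U\<^esub> w)" if j: "j < n" for j
      proof -
        have Vj: "V j = U" using VU[OF j] by simp
        note z = cut_zext[OF opX partD(1-6)[OF p j], unfolded Vj, OF w]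
        show ?thesis using w z by (simp add: cut_def Vj extension_def D'(2))
      qed
      then have "(\<Sum>j<n. ?c j w) = (\<Sum>j<n. rho A F U D' (res A X U (g j) \<odot>\<^bsub>sect F U\<^esub> w))" by simp
      also have "\<dots> = \<eta> w" unfolding D'(2) by (rule v[OF oU D'(1) K(5) w K(4)])
      finally show "(\<Sum>j<n. ?c j w) = \<eta> w" .
    qed
    also have "\<dots> = \<eta>" by (rule D_ext[OF \<eta>])
    finally show ?thesis .
  qed
  then have "restrict_gen X U glued = restrict (s U) (carrier (D U))" unfolding restrict_gen_def by (intro restrict_ext) simp
  then show ?thesis using s[OF U] by (simp add: L.clinear_maps_iff extensional_restrict)
qed

lemma glued_unique:
  assumes t: "t \<in> clinear_maps (D X) E" and r: "\<And>U. U \<in> \<U> \<Longrightarrow> restrict_gen X U t = s U"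
  shows "t = glued"
proof -
  interpret L: lin_maps "D X" E by (rule lin_maps[OF opX])
  have "t \<eta> = glued \<eta>" if \<eta>: "\<eta> \<in> carrier (D X)" for \<eta>
  proof -
    obtain n V g C where p: "part n V g C" "valid n g \<eta>" using DX_part[OF \<eta> \<eta>] by metis
    let ?c = "\<lambda>j. extension F X (V j) (cut X (V j) (g j) (C j) \<eta>)"
    have cc: "?c j \<in> carrier (D X)" if "j < n" for j
      by (rule extension_closed[OF opX partD(1,2)[OF p(1) that] cutD_closed[OF p(1) that \<eta>]])
    \<comment> \<open>The extended cuts are the functionals u \<mapsto> \<eta>(g j u), so validity
      of the family says that they sum to \<eta>.\<close>
    have "(\<lambda>u\<in>carrier (sect F X). \<Sum>j<n. ?c j u) = (\<lambda>u\<in>carrier (sect F X). \<eta> u)"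
    proof (rule restrict_ext)
      fix u assume u: "u \<in> carrier (sect F X)"
      have "?c j u = \<eta> (g j \<odot>\<^bsub>sect F X\<^esub> u)" if j: "j < n" for j
        using zext_res_eq[OF opX partD(1-6)[OF p(1) j] u] FD.resF_closed[OF opX partD(1,2)[OF p(1) j] u] u
        by (simp add: extension_def cut_def)
      then show "(\<Sum>j<n. ?c j u) = \<eta> u" using p(2) u by (simp add: valid_def)
    qed
    then have "\<eta> = (\<lambda>u\<in>carrier (sect F X). \<Sum>j<n. ?c j u)" using D_ext[OF \<eta>] by simp
    then have "t \<eta> = (\<Oplus>\<^bsub>E\<^esub>j\<in>{..<n}. t (?c j))"
      using clinear_sum[where \<eta>="?c" and n=n, OF opX t cc] by simp
    also have "\<dots> = T n V g C \<eta>"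
      unfolding T_def
    proof (rule M.finsum_cong'[OF refl])
      show "(\<lambda>j. s (V j) (cut X (V j) (g j) (C j) \<eta>)) \<in> {..<n} \<rightarrow> carrier E"
        using s_closed[OF partD(7)[OF p(1)]] cutD_closed[OF p(1) _ \<eta>] by auto
      fix j assume "j \<in> {..<n}"
      then have j: "j < n" by simp
      show "t (?c j) = s (V j) (cut X (V j) (g j) (C j) \<eta>)"
        unfolding r[OF partD(7)[OF p(1) j], symmetric] restrict_gen_def using cutD_closed[OF p(1) j \<eta>] by simp
    qed
    finally show ?thesis using glued_eq[OF p \<eta>] by simp
  qed
  moreover have "t \<in> extensional (carrier (D X))" "glued \<in> extensional (carrier (D X))"
    using t glued_clinear by (auto simp: L.clinear_maps_iff)
  ultimately show ?thesis by (intro extensionalityI)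
qed

end

section \<open>The sheaf axiom\<close>

lemma (in gen_functions) gen_sheaf: "is_sheaf (generalized_functions A F E)"
  unfolding is_sheaf_def
proof (intro conjI gen_presheaf allI impI; unfold gen_simps carrier_Lb)
  fix \<U> s
  assume a: "(\<forall>U\<in>\<U>. Op U \<and> s U \<in> clinear_maps (D U) E) \<and>
     (\<forall>U\<in>\<U>. \<forall>V\<in>\<U>. restrict_gen U (U \<inter> V) (s U) = restrict_gen V (U \<inter> V) (s V))"
  interpret gluing A F E \<U> s
  proof
    show "Op U" if U: "U \<in> \<U>" for U using conjunct1[OF bspec[OF conjunct1[OF a] U]] .
    show "s U \<in> clinear_maps (D U) E" if U: "U \<in> \<U>" for U using conjunct2[OF bspec[OF conjunct1[OF a] U]] .
    show "restrict_gen U (U \<inter> V) (s U) = restrict_gen V (U \<inter> V) (s V)" if "U \<in> \<U>" "V \<in> \<U>" for U V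
      using bspec[OF bspec[OF conjunct2[OF a] that(1)] that(2)] .
  qed
  show "\<exists>!t. t \<in> clinear_maps (D (\<Union>\<U>)) E \<and> (\<forall>U\<in>\<U>. restrict_gen (\<Union>\<U>) U t = s U)"
  proof (rule ex1I)
    show "glued \<in> clinear_maps (D (\<Union>\<U>)) E \<and> (\<forall>U\<in>\<U>. restrict_gen (\<Union>\<U>) U glued = s U)"
      using glued_clinear glued_restrict by blast
    show "t = glued" if t: "t \<in> clinear_maps (D (\<Union>\<U>)) E \<and> (\<forall>U\<in>\<U>. restrict_gen (\<Union>\<U>) U t = s U)" for t
      by (rule glued_unique[OF conjunct1[OF t] bspec[OF conjunct2[OF t]]])
  qed
qed

theorem lemma3p3:
  fixes A :: "('m, 's) ringed_space"
    and F :: "('m, 's, 'f) module_presheaf"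
    and E :: "'e tvs"
  assumes "formal_manifold A"
    and "sheaf_of_modules A F"
    and "quasi_complete_lcs E"
  shows "presheaf_of_lcs (generalized_functions A F E) \<and> is_sheaf (generalized_functions A F E)"
proof -
  interpret gen_functions A F E
    by unfold_locales (use assms in \<open>simp_all add: quasi_complete_lcs_def\<close>)
  show ?thesis using gen_presheaf_of_lcs gen_sheaf by blast
qed

end
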